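(* Let $E=(E^0,E^1,r,s)$ be a graph, $K$ a field, and $L_K(E)$ the associated Leavitt path algebra. Let $\mathcal{L}_E$ be the lattice of admissible pairs of $E$, and for $(H,S)\in\mathcal{L}_E$ let $I_{(H,S)}$ denote the ideal of $L_K(E)$ generated by $\{v:v\in H\}\cup\{v^H:v\in S\}$. Then: (1) The map $(H,S)\mapsto I_{(H,S)}$ is an isomorphism from the lattice $\mathcal{L}_E$ onto the lattice of graded ideals of $L_K(E)$. (2) For any admissible pair $(H,S)\in\mathcal{L}_E$, $L_K(E)/I_{(H,S)}$ is canonically isomorphic to $L_K(E\setminus(H,S))$, where $E\setminus(H,S)$ is the graph defined by $$(E\setminus(H,S))^0:=(E^0\setminus H)\cup\{v':v\in B_H\setminus S\},$$ $$(E\setminus(H,S))^1:=\{e\in E^1:r(e)\notin H\}\cup\{e':e\in E^1,\ r(e)\in B_H\setminus S\},$$ with $r$ and $s$ extended by $s(e')=s(e)$ and $r(e')=r(e)'$. (3) For any admissible pair $(H,S)\in\mathcal{L}_E$, the ideal $I_{(H,S)}$ and the Leavitt path algebra $L_K(E_{(H,S)})$ are Morita equivalent as rings, where $E_{(H,S)}$ is the graph defined by $$E_{(H,S)}^0:=H\cup S,$$ $$E_{(H,S)}^1:=\{e\in E^1:s(e)\in H\}\cup\{e\in E^1:s(e)\in S\text{ and }r(e)\in H\},$$ with $r$ and $s$ restricted to $E_{(H,S)}^1$. (4) For any hereditary subset $X\subseteq E^0$, if $I_X$ denotes the ideal of $L_K(E)$ generated by $\{v:v\in X\}$, then $I_X=I_{(\overline{X},\emptyset)}$,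 where $\overline{X}$ is the saturation of $X$. Moreover, $I_X$ and $L_K(E_X)$ are Morita equivalent as rings, where $E_X:=E_{(X,\emptyset)}$ is the graph given by the formulas in (3), i.e. $E_X^0=X$ and $E_X^1=\{e\in E^1:s(e)\in X\}$.
   Context: Rings and algebras are not assumed commutative or unital, and ideals are two-sided. A graph $E=(E^0,E^1,r,s)$ is a directed graph with countable vertex set $E^0$, countable edge set $E^1$, and range and source maps $r,s:E^1\to E^0$. A vertex $v$ is an infinite emitter if $|s^{-1}(v)|=\infty$, and regular ($v\in E^0_{\mathrm{reg}}$) if $0<|s^{-1}(v)|<\infty$. A path of length $n\ge1$ is $\alpha=e_1\cdots e_n$ with $r(e_i)=s(e_{i+1})$; $|\alpha|=n$, $s(\alpha)=s(e_1)$, $r(\alpha)=r(e_n)$; vertices are paths of length $0$; $E^*$ is the set of finite paths. $\alpha^*:=e_n^*\cdots e_1^*$ and $v^*:=v$. $L_K(E)$ is the universal $K$-algebra generated by pairwise orthogonal idempotents $\{v:v\in E^0\}$ and elements $\{e,e^*:e\in E^1\}$ satisfying (i) $s(e)e=er(e)=e$; (ii) $r(e)e^*=e^*s(e)=e^*$; (iii) $e^*f=\delta_{e,f}r(e)$ for $e,f\in E^1$; (iv) $v=\sum_{s(e)=v}ee^*$ for $v\in E^0_{\mathrm{reg}}$. It is $\mathbb{Z}$-graded with $L_K(E)_n$ the span of the $\alpha\beta^*$ with $|\alpha|-|\beta|=n$. An ideal $I$ of a $\mathbb{Z}$-graded ring $R$ is graded if $I=\bigoplus_n(I\cap R_n)$.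 Graded ideals are ordered by inclusion. A subset $H\subseteq E^0$ is hereditary if $s(e)\in H$ implies $r(e)\in H$ for all $e\in E^1$. A hereditary set $H$ is saturated if whenever $0<|s^{-1}(v)|<\infty$ and $\{r(e):e\in E^1,s(e)=v\}\subseteq H$, then $v\in H$. The saturation $\overline{H}$ of a hereditary set $H$ is the smallest saturated hereditary set containing $H$. For hereditary $H$, the set of breaking vertices is $$B_H:=\{v\in E^0\setminus H: v\text{ is an infinite emitter and }0<|s^{-1}(v)\cap r^{-1}(E^0\setminus H)|<\infty\},$$ and for $v\in B_H$, $v^H:=v-\sum_{s(e)=v,\ r(e)\notin H}ee^*$. An admissible pair is a pair $(H,S)$ with $H$ a saturated hereditary subset of $E^0$ and $S\subseteq B_H$. The set $\mathcal{L}_E$ of admissible pairs is ordered by $(H,S)\le(H',S')$ if and only if $H\subseteq H'$ and $S\subseteq H'\cup S'$; this ordered set is a lattice. The canonical homomorphism $L_K(E\setminus(H,S))\to L_K(E)/I_{(H,S)}$ in (2) is the one induced by the assignment (modulo $I_{(H,S)}$): $v\mapsto A_v$, where $A_v=v$ if $v\in(E^0\setminus H)\setminus(B_H\setminus S)$, $A_v=\sum_{e\in E^1,\,s(e)=v,\,r(e)\notin H}ee^*$ if $v\in B_H\setminus S$, and $A_{v'}=v^H$ for $v\in B_H\setminus S$; $e\mapsto e$ and $e^*\mapsto e^*$ if $r(e)\notin B_H\setminus S$; $e\mapsto eA_{r(e)}$ and $e^*\mapsto A_{r(e)}e^*$ if $r(e)\in B_H\setminus S$; $e'\mapsto eA_{r(e)'}$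 and $(e')^*\mapsto A_{r(e)'}e^*$. Morita equivalence: a ring $R$ is idempotent if $R^2=R$. A bimodule ${}_RM_S$ is unital if $RM=M$ and $MS=M$. Idempotent rings $R,S$ are Morita equivalent if there is a surjective Morita context: unital bimodules ${}_RM_S$ and ${}_SN_R$, a surjective $R$-bimodule homomorphism $\psi:M\otimes_SN\to R$ and a surjective $S$-bimodule homomorphism $\phi:N\otimes_RM\to S$ with $\phi(n\otimes m)n'=n\psi(m\otimes n')$ and $m'\phi(n\otimes m)=\psi(m'\otimes n)m$ for all $m,m'\in M$, $n,n'\in N$. *)

theory Defs
  imports
    "HOL-Library.Poly_Mapping"
    "HOL-Library.Countable_Set"
    "Graph_Theory.Arc_Walk"
    "HOL-Algebra.QuotRing"
    "HOL-Algebra.Module"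
    "HOL-Algebra.Generated_Groups"
    "HOL-Algebra.Free_Abelian_Groups"
    "HOL-Algebra.Lattice"
begin

section \<open>Rings and algebras without unit\<close>

text \<open>
  Rings are records of HOL-Algebra (type \<open>ring\<close>, or \<open>module\<close> for algebras over a field), so that
  finite sums, additive subgroups and cosets can be reused. The field \<open>one\<close> of these records is
  never used: a ring need not have a unit.
\<close>

locale nu_ring = abelian_group R for R (structure) +
  assumes m_closed: "\<lbrakk>x \<in> carrier R; y \<in> carrier R\<rbrakk> \<Longrightarrow> x \<otimes> y \<in> carrier R"
    and m_assoc: "\<lbrakk>x \<in> carrier R; y \<in> carrier R; z \<in> carrier R\<rbrakk>
      \<Longrightarrow> (x \<otimes> y) \<otimes> z = x \<otimes> (y \<otimes> z)"
    and l_distr: "\<lbrakk>x \<in> carrier R; y \<in> carrier R; z \<in> carrier R\<rbrakk>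
      \<Longrightarrow> (x \<oplus> y) \<otimes> z = x \<otimes> z \<oplus> y \<otimes> z"
    and r_distr: "\<lbrakk>x \<in> carrier R; y \<in> carrier R; z \<in> carrier R\<rbrakk>
      \<Longrightarrow> z \<otimes> (x \<oplus> y) = z \<otimes> x \<oplus> z \<otimes> y"

locale nu_ideal = additive_subgroup I R + nu_ring R for I and R (structure) +
  assumes I_l_closed: "\<lbrakk>a \<in> I; x \<in> carrier R\<rbrakk> \<Longrightarrow> x \<otimes> a \<in> I"
    and I_r_closed: "\<lbrakk>a \<in> I; x \<in> carrier R\<rbrakk> \<Longrightarrow> a \<otimes> x \<in> I"

definition nu_genideal :: "('a, 'm) ring_scheme \<Rightarrow> 'a set \<Rightarrow> 'a set" where
  "nu_genideal R X = \<Inter>{I. nu_ideal I R \<and> X \<subseteq> I}"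

definition alg_ideal :: "'a set \<Rightarrow> ('k, 'a, 'm) module_scheme \<Rightarrow> bool" where
  "alg_ideal I A \<longleftrightarrow> nu_ideal I A \<and> (\<forall>k. \<forall>x\<in>I. k \<odot>\<^bsub>A\<^esub> x \<in> I)"

definition alg_genideal :: "('k, 'a, 'm) module_scheme \<Rightarrow> 'a set \<Rightarrow> 'a set" where
  "alg_genideal A X = \<Inter>{I. alg_ideal I A \<and> X \<subseteq> I}"

definition alg_quot :: "('k, 'a, 'm) module_scheme \<Rightarrow> 'a set \<Rightarrow> ('k, 'a set) module" where
  "alg_quot A I =
     \<lparr>carrier = carrier (A Quot I), mult = mult (A Quot I), one = one (A Quot I),
      ring.zero = \<zero>\<^bsub>A Quot I\<^esub>, add = add (A Quot I),
      smult = (\<lambda>k C. \<Union>x\<in>C. I +>\<^bsub>A\<^esub> (k \<odot>\<^bsub>A\<^esub> x))\<rparr>"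

definition alg_hom :: "('k, 'a, 'm) module_scheme \<Rightarrow> ('k, 'b, 'n) module_scheme \<Rightarrow> ('a \<Rightarrow> 'b) set"
  where
  "alg_hom A B = {h. h \<in> carrier A \<rightarrow> carrier B
     \<and> (\<forall>x\<in>carrier A. \<forall>y\<in>carrier A. h (x \<oplus>\<^bsub>A\<^esub> y) = h x \<oplus>\<^bsub>B\<^esub> h y)
     \<and> (\<forall>x\<in>carrier A. \<forall>y\<in>carrier A. h (x \<otimes>\<^bsub>A\<^esub> y) = h x \<otimes>\<^bsub>B\<^esub> h y)
     \<and> (\<forall>k. \<forall>x\<in>carrier A. h (k \<odot>\<^bsub>A\<^esub> x) = k \<odot>\<^bsub>B\<^esub> h x)}"

definition alg_iso :: "('k, 'a, 'm) module_scheme \<Rightarrow> ('k, 'b, 'n) module_scheme \<Rightarrow> ('a \<Rightarrow> 'b) set"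
  where "alg_iso A B = {h \<in> alg_hom A B. bij_betw h (carrier A) (carrier B)}"

definition internal_direct_sum :: "('a, 'm) ring_scheme \<Rightarrow> 'a set \<Rightarrow> (int \<Rightarrow> 'a set) \<Rightarrow> bool" where
  "internal_direct_sum R I M \<longleftrightarrow>
     (\<forall>n. additive_subgroup (M n) R \<and> M n \<subseteq> I)
     \<and> (\<forall>x\<in>I. \<exists>!c. (\<forall>n. c n \<in> M n) \<and> finite {n. c n \<noteq> \<zero>\<^bsub>R\<^esub>}
            \<and> x = (\<Oplus>\<^bsub>R\<^esub> n\<in>{n. c n \<noteq> \<zero>\<^bsub>R\<^esub>}. c n))"

definition graded_ideal :: "('a, 'm) ring_scheme \<Rightarrow> (int \<Rightarrow> 'a set) \<Rightarrow> 'a set \<Rightarrow> bool" where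
  "graded_ideal R D I \<longleftrightarrow> nu_ideal I R \<and> internal_direct_sum R I (\<lambda>n. I \<inter> D n)"

definition inclusion_order :: "'a set set \<Rightarrow> 'a set gorder" where
  "inclusion_order X = \<lparr>carrier = X, eq = (=), le = (\<subseteq>)\<rparr>"

definition lattice_iso :: "('a, 'm) gorder_scheme \<Rightarrow> ('b, 'n) gorder_scheme \<Rightarrow> ('a \<Rightarrow> 'b) \<Rightarrow> bool" where
  "lattice_iso L M f \<longleftrightarrow> lattice L \<and> lattice M \<and> bij_betw f (carrier L) (carrier M)
     \<and> (\<forall>x\<in>carrier L. \<forall>y\<in>carrier L. x \<sqsubseteq>\<^bsub>L\<^esub> y \<longleftrightarrow> f x \<sqsubseteq>\<^bsub>M\<^esub> f y)
     \<and> join_pres L M f \<and> meet_pres L M f"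


section \<open>Morita equivalence of idempotent rings\<close>

definition idempotent_ring :: "('r, 'm) ring_scheme \<Rightarrow> bool" where
  "idempotent_ring R \<longleftrightarrow> nu_ring R \<and>
     generate (add_monoid R) {x \<otimes>\<^bsub>R\<^esub> y | x y. x \<in> carrier R \<and> y \<in> carrier R} = carrier R"

text \<open>
  The additive group of a bimodule is an HOL-Algebra \<open>comm_group\<close>, i.e. it is written
  multiplicatively, as the free abelian groups and quotient groups of that library are.
\<close>

record ('r, 's, 'm) bimod = "'m monoid" +
  lact :: "'r \<Rightarrow> 'm \<Rightarrow> 'm"
  ract :: "'m \<Rightarrow> 's \<Rightarrow> 'm"

locale bimodule = R: nu_ring R + S: nu_ring S + M: comm_group M
  for R :: "('r, 'x) ring_scheme" and S :: "('s, 'y) ring_scheme"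
    and M :: "('r, 's, 'm, 'z) bimod_scheme" +
  assumes lact_closed: "\<lbrakk>r \<in> carrier R; m \<in> carrier M\<rbrakk> \<Longrightarrow> lact M r m \<in> carrier M"
    and ract_closed: "\<lbrakk>s \<in> carrier S; m \<in> carrier M\<rbrakk> \<Longrightarrow> ract M m s \<in> carrier M"
    and lact_add_r: "\<lbrakk>r \<in> carrier R; m \<in> carrier M; m' \<in> carrier M\<rbrakk>
      \<Longrightarrow> lact M r (m \<otimes>\<^bsub>M\<^esub> m') = lact M r m \<otimes>\<^bsub>M\<^esub> lact M r m'"
    and lact_add_l: "\<lbrakk>r \<in> carrier R; r' \<in> carrier R; m \<in> carrier M\<rbrakk>
      \<Longrightarrow> lact M (r \<oplus>\<^bsub>R\<^esub> r') m = lact M r m \<otimes>\<^bsub>M\<^esub> lact M r' m"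
    and ract_add_l: "\<lbrakk>s \<in> carrier S; m \<in> carrier M; m' \<in> carrier M\<rbrakk>
      \<Longrightarrow> ract M (m \<otimes>\<^bsub>M\<^esub> m') s = ract M m s \<otimes>\<^bsub>M\<^esub> ract M m' s"
    and ract_add_r: "\<lbrakk>s \<in> carrier S; s' \<in> carrier S; m \<in> carrier M\<rbrakk>
      \<Longrightarrow> ract M m (s \<oplus>\<^bsub>S\<^esub> s') = ract M m s \<otimes>\<^bsub>M\<^esub> ract M m s'"
    and lact_assoc: "\<lbrakk>r \<in> carrier R; r' \<in> carrier R; m \<in> carrier M\<rbrakk>
      \<Longrightarrow> lact M (r \<otimes>\<^bsub>R\<^esub> r') m = lact M r (lact M r' m)"
    and ract_assoc: "\<lbrakk>s \<in> carrier S; s' \<in> carrier S; m \<in> carrier M\<rbrakk>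
      \<Longrightarrow> ract M m (s \<otimes>\<^bsub>S\<^esub> s') = ract M (ract M m s) s'"
    and lact_ract: "\<lbrakk>r \<in> carrier R; s \<in> carrier S; m \<in> carrier M\<rbrakk>
      \<Longrightarrow> ract M (lact M r m) s = lact M r (ract M m s)"

definition unital_bimodule ::
  "('r, 'x) ring_scheme \<Rightarrow> ('s, 'y) ring_scheme \<Rightarrow> ('r, 's, 'm, 'z) bimod_scheme \<Rightarrow> bool" where
  "unital_bimodule R S M \<longleftrightarrow> bimodule R S M
     \<and> generate M {lact M r m | r m. r \<in> carrier R \<and> m \<in> carrier M} = carrier M
     \<and> generate M {ract M m s | m s. m \<in> carrier M \<and> s \<in> carrier S} = carrier M"

definition bimodule_hom ::
  "('r, 'x) ring_scheme \<Rightarrow> ('s, 'y) ring_scheme \<Rightarrow> ('r, 's, 'm, 'z) bimod_scheme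
     \<Rightarrow> ('r, 's, 'n, 'w) bimod_scheme \<Rightarrow> ('m \<Rightarrow> 'n) set" where
  "bimodule_hom R S M N = {h \<in> hom M N.
     (\<forall>r\<in>carrier R. \<forall>m\<in>carrier M. h (lact M r m) = lact N r (h m))
     \<and> (\<forall>s\<in>carrier S. \<forall>m\<in>carrier M. h (ract M m s) = ract N (h m) s)}"

definition regular_bimodule :: "('r, 'x) ring_scheme \<Rightarrow> ('r, 'r, 'r) bimod" where
  "regular_bimodule R = \<lparr>carrier = carrier R, mult = add R, one = \<zero>\<^bsub>R\<^esub>,
     lact = mult R, ract = mult R\<rparr>"

text \<open>
  The tensor product over \<open>S\<close>: the free abelian group on pairs modulo the subgroup generated by
  the biadditivity and balancing relations.
\<close>

definition tensor_free ::
  "('r, 's, 'm, 'z) bimod_scheme \<Rightarrow> ('s, 't, 'n, 'w) bimod_scheme \<Rightarrow> ('m \<times> 'n \<Rightarrow>\<^sub>0 int) monoid" where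
  "tensor_free M N = free_Abelian_group (carrier M \<times> carrier N)"

definition tensor_relations ::
  "('s, 'y) ring_scheme \<Rightarrow> ('r, 's, 'm, 'z) bimod_scheme \<Rightarrow> ('s, 't, 'n, 'w) bimod_scheme
     \<Rightarrow> ('m \<times> 'n \<Rightarrow>\<^sub>0 int) set" where
  "tensor_relations S M N =
     {frag_of (m \<otimes>\<^bsub>M\<^esub> m', n) - frag_of (m, n) - frag_of (m', n) | m m' n.
        m \<in> carrier M \<and> m' \<in> carrier M \<and> n \<in> carrier N}
   \<union> {frag_of (m, n \<otimes>\<^bsub>N\<^esub> n') - frag_of (m, n) - frag_of (m, n') | m n n'.
        m \<in> carrier M \<and> n \<in> carrier N \<and> n' \<in> carrier N}
   \<union> {frag_of (ract M m s, n) - frag_of (m, lact N s n) | m s n.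
        m \<in> carrier M \<and> s \<in> carrier S \<and> n \<in> carrier N}"

definition tensor_null ::
  "('s, 'y) ring_scheme \<Rightarrow> ('r, 's, 'm, 'z) bimod_scheme \<Rightarrow> ('s, 't, 'n, 'w) bimod_scheme
     \<Rightarrow> ('m \<times> 'n \<Rightarrow>\<^sub>0 int) set" where
  "tensor_null S M N = generate (tensor_free M N) (tensor_relations S M N)"

definition pure_tensor ::
  "('s, 'y) ring_scheme \<Rightarrow> ('r, 's, 'm, 'z) bimod_scheme \<Rightarrow> ('s, 't, 'n, 'w) bimod_scheme
     \<Rightarrow> 'm \<Rightarrow> 'n \<Rightarrow> ('m \<times> 'n \<Rightarrow>\<^sub>0 int) set" where
  "pure_tensor S M N m n = tensor_null S M N #>\<^bsub>tensor_free M N\<^esub> frag_of (m, n)"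

text \<open>The actions on cosets are the ones with \<open>r (m \<otimes> n) = (r m) \<otimes> n\<close> and \<open>(m \<otimes> n) t = m \<otimes> (n t)\<close>.\<close>

definition tensor_bimodule ::
  "('s, 'y) ring_scheme \<Rightarrow> ('r, 's, 'm, 'z) bimod_scheme \<Rightarrow> ('s, 't, 'n, 'w) bimod_scheme
     \<Rightarrow> ('r, 't, ('m \<times> 'n \<Rightarrow>\<^sub>0 int) set) bimod" where
  "tensor_bimodule S M N =
     (let F = tensor_free M N; Z = tensor_null S M N; Q = F Mod Z in
      \<lparr>carrier = carrier Q, mult = mult Q, one = one Q,
       lact = (\<lambda>r C. \<Union>x\<in>C. Z #>\<^bsub>F\<^esub> frag_extend (\<lambda>(m, n). frag_of (lact M r m, n)) x),
       ract = (\<lambda>C t. \<Union>x\<in>C. Z #>\<^bsub>F\<^esub> frag_extend (\<lambda>(m, n). frag_of (m, ract N n t)) x)\<rparr>)"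

definition surjective_morita_context ::
  "('r, 'x) ring_scheme \<Rightarrow> ('s, 'y) ring_scheme
     \<Rightarrow> ('r, 's, 'm, 'z) bimod_scheme \<Rightarrow> ('s, 'r, 'n, 'w) bimod_scheme
     \<Rightarrow> (('m \<times> 'n \<Rightarrow>\<^sub>0 int) set \<Rightarrow> 'r) \<Rightarrow> (('n \<times> 'm \<Rightarrow>\<^sub>0 int) set \<Rightarrow> 's) \<Rightarrow> bool" where
  "surjective_morita_context R S M N \<psi> \<phi> \<longleftrightarrow>
     unital_bimodule R S M \<and> unital_bimodule S R N
     \<and> \<psi> \<in> bimodule_hom R R (tensor_bimodule S M N) (regular_bimodule R)
     \<and> \<psi> ` carrier (tensor_bimodule S M N) = carrier R
     \<and> \<phi> \<in> bimodule_hom S S (tensor_bimodule R N M) (regular_bimodule S)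
     \<and> \<phi> ` carrier (tensor_bimodule R N M) = carrier S
     \<and> (\<forall>m\<in>carrier M. \<forall>n\<in>carrier N. \<forall>n'\<in>carrier N.
          lact N (\<phi> (pure_tensor R N M n m)) n' = ract N n (\<psi> (pure_tensor S M N m n')))
     \<and> (\<forall>m\<in>carrier M. \<forall>m'\<in>carrier M. \<forall>n\<in>carrier N.
          ract M m' (\<phi> (pure_tensor R N M n m)) = lact M (\<psi> (pure_tensor S M N m' n)) m)"

text \<open>
  A definition cannot quantify over types, so the bimodules are taken inside the type
  \<open>('r + 's) list\<close>. This is no restriction. Given any surjective context \<open>(M, N, \<psi>, \<phi>)\<close>, choose
  finitely many elements of \<open>M\<close> and \<open>N\<close> for each element of \<open>R\<close> and of \<open>S\<close> that witness
  surjectivity, and close up under unitality (\<open>M = RMS\<close>, \<open>N = SNR\<close>) in countably many steps: the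
  sub-bimodules generated again form a surjective context, and their cardinality is at most
  \<open>|R| + |S| + \<aleph>\<^sub>0\<close>, which does not exceed that of \<open>('r + 's) list\<close>.
\<close>

definition morita_equivalent :: "('r, 'x) ring_scheme \<Rightarrow> ('s, 'y) ring_scheme \<Rightarrow> bool" where
  "morita_equivalent R S \<longleftrightarrow> idempotent_ring R \<and> idempotent_ring S \<and>
     (\<exists>(M :: ('r, 's, ('r + 's) list) bimod) (N :: ('s, 'r, ('r + 's) list) bimod) \<psi> \<phi>.
        surjective_morita_context R S M N \<psi> \<phi>)"


section \<open>Free algebras\<close>

text \<open>
  The free (non-unital) algebra on a set of generators is the part of the monoid algebra of the
  free monoid that is supported on non-empty words. Words carry a type of their own because the
  product of \<open>Poly_Mapping\<close> needs the monoid of exponents to be an instance of \<open>monoid_add\<close>.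
\<close>

datatype 'g word = Word (letters: "'g list")

instantiation word :: (type) monoid_add
begin

definition "0 = Word []"
definition "u + w = Word (letters u @ letters w)"

instance
  by standard (simp_all add: zero_word_def plus_word_def)

end

definition free_alg :: "'g set \<Rightarrow> ('k::field, 'g word \<Rightarrow>\<^sub>0 'k) module" where
  "free_alg G =
     \<lparr>carrier = {f. \<forall>w\<in>Poly_Mapping.keys f. letters w \<noteq> [] \<and> set (letters w) \<subseteq> G},
      mult = (*), one = undefined, ring.zero = 0, add = (+),
      smult = (\<lambda>k. Poly_Mapping.map ((*) k))\<rparr>"

abbreviation monomial_word :: "'g list \<Rightarrow> 'g word \<Rightarrow>\<^sub>0 'k::field" where
  "monomial_word ws \<equiv> Poly_Mapping.single (Word ws) 1"


section \<open>Leavitt path algebras\<close>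

text \<open>A graph is a \<open>wf_digraph\<close>; its source map is \<open>tail\<close>, its range map is \<open>head\<close>.\<close>

datatype ('v, 'e) lpa_gen = Vertex 'v | Edge 'e | Ghost 'e

definition lpa_generators :: "('v, 'e) pre_digraph \<Rightarrow> ('v, 'e) lpa_gen set" where
  "lpa_generators E = Vertex ` verts E \<union> Edge ` arcs E \<union> Ghost ` arcs E"

definition regular_vertices :: "('v, 'e) pre_digraph \<Rightarrow> 'v set" where
  "regular_vertices E = {v \<in> verts E. out_arcs E v \<noteq> {} \<and> finite (out_arcs E v)}"

definition infinite_emitters :: "('v, 'e) pre_digraph \<Rightarrow> 'v set" where
  "infinite_emitters E = {v \<in> verts E. infinite (out_arcs E v)}"

definition lpa_relations :: "('v, 'e) pre_digraph \<Rightarrow> (('v, 'e) lpa_gen word \<Rightarrow>\<^sub>0 'k::field) set" where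
  "lpa_relations E =
     (let x = (\<lambda>g. monomial_word [g] :: ('v, 'e) lpa_gen word \<Rightarrow>\<^sub>0 'k) in
      {x (Vertex v) * x (Vertex v) - x (Vertex v) | v. v \<in> verts E}
    \<union> {x (Vertex v) * x (Vertex w) | v w. v \<in> verts E \<and> w \<in> verts E \<and> v \<noteq> w}
    \<union> {x (Vertex (tail E e)) * x (Edge e) - x (Edge e) | e. e \<in> arcs E}
    \<union> {x (Edge e) * x (Vertex (head E e)) - x (Edge e) | e. e \<in> arcs E}
    \<union> {x (Vertex (head E e)) * x (Ghost e) - x (Ghost e) | e. e \<in> arcs E}
    \<union> {x (Ghost e) * x (Vertex (tail E e)) - x (Ghost e) | e. e \<in> arcs E}
    \<union> {x (Ghost e) * x (Edge e) - x (Vertex (head E e)) | e. e \<in> arcs E}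
    \<union> {x (Ghost e) * x (Edge f) | e f. e \<in> arcs E \<and> f \<in> arcs E \<and> e \<noteq> f}
    \<union> {x (Vertex v) - (\<Sum>e\<in>out_arcs E v. x (Edge e) * x (Ghost e)) | v. v \<in> regular_vertices E})"

type_synonym ('k, 'v, 'e) lpa = "(('v, 'e) lpa_gen word \<Rightarrow>\<^sub>0 'k) set"

definition lpa_null :: "'k::field itself \<Rightarrow> ('v, 'e) pre_digraph \<Rightarrow> ('k, 'v, 'e) lpa" where
  "lpa_null _ E = alg_genideal (free_alg (lpa_generators E)) (lpa_relations E)"

text \<open>\<open>LPA TYPE('k) E\<close> is the algebra \<open>L\<^sub>K(E)\<close>, where the field \<open>K\<close> is the type \<open>'k\<close>.\<close>

definition LPA :: "'k::field itself \<Rightarrow> ('v, 'e) pre_digraph \<Rightarrow> ('k, ('k, 'v, 'e) lpa) module" where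
  "LPA K E = alg_quot (free_alg (lpa_generators E)) (lpa_null K E)"

text \<open>The class in \<open>L\<^sub>K(E)\<close> of a (non-empty) product of generators.\<close>

definition lpa_word ::
  "'k::field itself \<Rightarrow> ('v, 'e) pre_digraph \<Rightarrow> ('v, 'e) lpa_gen list \<Rightarrow> ('k, 'v, 'e) lpa" where
  "lpa_word K E ws =
     lpa_null K E +>\<^bsub>free_alg (lpa_generators E) :: ('k, ('v, 'e) lpa_gen word \<Rightarrow>\<^sub>0 'k) module\<^esub>
       monomial_word ws"

abbreviation lpa_vertex ::
  "'k::field itself \<Rightarrow> ('v, 'e) pre_digraph \<Rightarrow> 'v \<Rightarrow> ('k, 'v, 'e) lpa" where
  "lpa_vertex K E v \<equiv> lpa_word K E [Vertex v]"

abbreviation lpa_edge ::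
  "'k::field itself \<Rightarrow> ('v, 'e) pre_digraph \<Rightarrow> 'e \<Rightarrow> ('k, 'v, 'e) lpa" where
  "lpa_edge K E e \<equiv> lpa_word K E [Edge e]"

abbreviation lpa_ghost ::
  "'k::field itself \<Rightarrow> ('v, 'e) pre_digraph \<Rightarrow> 'e \<Rightarrow> ('k, 'v, 'e) lpa" where
  "lpa_ghost K E e \<equiv> lpa_word K E [Ghost e]"

text \<open>
  A path from \<open>u\<close> to \<open>w\<close> is given by \<open>u\<close> and the list \<open>p\<close> of its edges, with
  \<open>pre_digraph.awalk E u p w\<close>; the paths with \<open>p = []\<close> are the vertices.
\<close>

definition lpa_path ::
  "'k::field itself \<Rightarrow> ('v, 'e) pre_digraph \<Rightarrow> 'v \<Rightarrow> 'e list \<Rightarrow> ('k, 'v, 'e) lpa" where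
  "lpa_path K E u p = (if p = [] then lpa_vertex K E u else lpa_word K E (map Edge p))"

definition lpa_path_star ::
  "'k::field itself \<Rightarrow> ('v, 'e) pre_digraph \<Rightarrow> 'v \<Rightarrow> 'e list \<Rightarrow> ('k, 'v, 'e) lpa" where
  "lpa_path_star K E u p = (if p = [] then lpa_vertex K E u else lpa_word K E (map Ghost (rev p)))"

definition lpa_degree ::
  "'k::field itself \<Rightarrow> ('v, 'e) pre_digraph \<Rightarrow> int \<Rightarrow> ('k, 'v, 'e) lpa set" where
  "lpa_degree K E n = generate (add_monoid (LPA K E))
     {k \<odot>\<^bsub>LPA K E\<^esub> (lpa_path K E u p \<otimes>\<^bsub>LPA K E\<^esub> lpa_path_star K E u' p') | k u p w u' p' w'.
        pre_digraph.awalk E u p w \<and> pre_digraph.awalk E u' p' w'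
        \<and> int (length p) - int (length p') = n}"

definition graded_ideal_lattice ::
  "'k::field itself \<Rightarrow> ('v, 'e) pre_digraph \<Rightarrow> ('k, 'v, 'e) lpa set gorder" where
  "graded_ideal_lattice K E = inclusion_order {I. graded_ideal (LPA K E) (lpa_degree K E) I}"


section \<open>Admissible pairs\<close>

definition hereditary :: "('v, 'e) pre_digraph \<Rightarrow> 'v set \<Rightarrow> bool" where
  "hereditary E H \<longleftrightarrow> H \<subseteq> verts E \<and> (\<forall>e\<in>arcs E. tail E e \<in> H \<longrightarrow> head E e \<in> H)"

definition saturated :: "('v, 'e) pre_digraph \<Rightarrow> 'v set \<Rightarrow> bool" where
  "saturated E H \<longleftrightarrow> (\<forall>v\<in>regular_vertices E. head E ` out_arcs E v \<subseteq> H \<longrightarrow> v \<in> H)"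

definition saturation :: "('v, 'e) pre_digraph \<Rightarrow> 'v set \<Rightarrow> 'v set" where
  "saturation E X = \<Inter>{H. hereditary E H \<and> saturated E H \<and> X \<subseteq> H}"

definition out_arcs_avoiding :: "('v, 'e) pre_digraph \<Rightarrow> 'v set \<Rightarrow> 'v \<Rightarrow> 'e set" where
  "out_arcs_avoiding E H v = {e \<in> out_arcs E v. head E e \<notin> H}"

definition breaking_vertices :: "('v, 'e) pre_digraph \<Rightarrow> 'v set \<Rightarrow> 'v set" where
  "breaking_vertices E H = {v \<in> verts E - H. v \<in> infinite_emitters E
     \<and> out_arcs_avoiding E H v \<noteq> {} \<and> finite (out_arcs_avoiding E H v)}"

definition avoiding_sum ::
  "'k::field itself \<Rightarrow> ('v, 'e) pre_digraph \<Rightarrow> 'v set \<Rightarrow> 'v \<Rightarrow> ('k, 'v, 'e) lpa" where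
  "avoiding_sum K E H v =
     (\<Oplus>\<^bsub>LPA K E\<^esub> e\<in>out_arcs_avoiding E H v. lpa_edge K E e \<otimes>\<^bsub>LPA K E\<^esub> lpa_ghost K E e)"

definition gap_vertex ::
  "'k::field itself \<Rightarrow> ('v, 'e) pre_digraph \<Rightarrow> 'v set \<Rightarrow> 'v \<Rightarrow> ('k, 'v, 'e) lpa" where
  "gap_vertex K E H v = lpa_vertex K E v \<ominus>\<^bsub>LPA K E\<^esub> avoiding_sum K E H v"

definition admissible_pairs :: "('v, 'e) pre_digraph \<Rightarrow> ('v set \<times> 'v set) set" where
  "admissible_pairs E = {(H, S). hereditary E H \<and> saturated E H \<and> S \<subseteq> breaking_vertices E H}"

definition admissible_lattice :: "('v, 'e) pre_digraph \<Rightarrow> ('v set \<times> 'v set) gorder" where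
  "admissible_lattice E = \<lparr>carrier = admissible_pairs E, eq = (=),
     le = (\<lambda>(H, S) (H', S'). H \<subseteq> H' \<and> S \<subseteq> H' \<union> S')\<rparr>"

definition admissible_ideal ::
  "'k::field itself \<Rightarrow> ('v, 'e) pre_digraph \<Rightarrow> 'v set \<times> 'v set \<Rightarrow> ('k, 'v, 'e) lpa set" where
  "admissible_ideal K E = (\<lambda>(H, S).
     nu_genideal (LPA K E) (lpa_vertex K E ` H \<union> gap_vertex K E H ` S))"

definition vertex_ideal ::
  "'k::field itself \<Rightarrow> ('v, 'e) pre_digraph \<Rightarrow> 'v set \<Rightarrow> ('k, 'v, 'e) lpa set" where
  "vertex_ideal K E X = nu_genideal (LPA K E) (lpa_vertex K E ` X)"


section \<open>The quotient graph and the graph of an admissible pair\<close>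

text \<open>\<open>Inl\<close> marks the original vertices and edges, \<open>Inr\<close> the primed copies.\<close>

definition quotient_graph ::
  "('v, 'e) pre_digraph \<Rightarrow> 'v set \<Rightarrow> 'v set \<Rightarrow> ('v + 'v, 'e + 'e) pre_digraph" where
  "quotient_graph E H S =
     \<lparr>verts = (verts E - H) <+> (breaking_vertices E H - S),
      arcs = {e \<in> arcs E. head E e \<notin> H} <+> {e \<in> arcs E. head E e \<in> breaking_vertices E H - S},
      tail = case_sum (\<lambda>e. Inl (tail E e)) (\<lambda>e. Inl (tail E e)),
      head = case_sum (\<lambda>e. Inl (head E e)) (\<lambda>e. Inr (head E e))\<rparr>"

definition pair_graph :: "('v, 'e) pre_digraph \<Rightarrow> 'v set \<Rightarrow> 'v set \<Rightarrow> ('v, 'e) pre_digraph" where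
  "pair_graph E H S =
     \<lparr>verts = H \<union> S,
      arcs = {e \<in> arcs E. tail E e \<in> H} \<union> {e \<in> arcs E. tail E e \<in> S \<and> head E e \<in> H},
      tail = tail E, head = head E\<rparr>"

text \<open>Representatives in \<open>L\<^sub>K(E)\<close> of the images of the generators under the canonical map.\<close>

fun canonical_vertex ::
  "'k::field itself \<Rightarrow> ('v, 'e) pre_digraph \<Rightarrow> 'v set \<Rightarrow> 'v set \<Rightarrow> 'v + 'v \<Rightarrow> ('k, 'v, 'e) lpa" where
  "canonical_vertex K E H S (Inl v) =
     (if v \<in> breaking_vertices E H - S then avoiding_sum K E H v else lpa_vertex K E v)"
| "canonical_vertex K E H S (Inr v) = gap_vertex K E H v"

fun canonical_edge ::
  "'k::field itself \<Rightarrow> ('v, 'e) pre_digraph \<Rightarrow> 'v set \<Rightarrow> 'v set \<Rightarrow> 'e + 'e \<Rightarrow> ('k, 'v, 'e) lpa" where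
  "canonical_edge K E H S (Inl e) =
     (if head E e \<in> breaking_vertices E H - S
      then lpa_edge K E e \<otimes>\<^bsub>LPA K E\<^esub> canonical_vertex K E H S (Inl (head E e))
      else lpa_edge K E e)"
| "canonical_edge K E H S (Inr e) =
     lpa_edge K E e \<otimes>\<^bsub>LPA K E\<^esub> canonical_vertex K E H S (Inr (head E e))"

fun canonical_ghost ::
  "'k::field itself \<Rightarrow> ('v, 'e) pre_digraph \<Rightarrow> 'v set \<Rightarrow> 'v set \<Rightarrow> 'e + 'e \<Rightarrow> ('k, 'v, 'e) lpa" where
  "canonical_ghost K E H S (Inl e) =
     (if head E e \<in> breaking_vertices E H - S
      then canonical_vertex K E H S (Inl (head E e)) \<otimes>\<^bsub>LPA K E\<^esub> lpa_ghost K E e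
      else lpa_ghost K E e)"
| "canonical_ghost K E H S (Inr e) =
     canonical_vertex K E H S (Inr (head E e)) \<otimes>\<^bsub>LPA K E\<^esub> lpa_ghost K E e"

text \<open>A homomorphism satisfying this is determined on the carrier, as the generators generate.\<close>

definition is_canonical_map ::
  "'k::field itself \<Rightarrow> ('v, 'e) pre_digraph \<Rightarrow> 'v set \<Rightarrow> 'v set
     \<Rightarrow> (('k, 'v + 'v, 'e + 'e) lpa \<Rightarrow> ('k, 'v, 'e) lpa set) \<Rightarrow> bool" where
  "is_canonical_map K E H S h \<longleftrightarrow>
     (let G = quotient_graph E H S; I = admissible_ideal K E (H, S) in
      h \<in> alg_hom (LPA K G) (alg_quot (LPA K E) I)
      \<and> (\<forall>v\<in>verts G. h (lpa_vertex K G v) = I +>\<^bsub>LPA K E\<^esub> canonical_vertex K E H S v)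
      \<and> (\<forall>e\<in>arcs G. h (lpa_edge K G e) = I +>\<^bsub>LPA K E\<^esub> canonical_edge K E H S e)
      \<and> (\<forall>e\<in>arcs G. h (lpa_ghost K G e) = I +>\<^bsub>LPA K E\<^esub> canonical_ghost K E H S e))"

end

(*
  Ideals of L_K(E) are studied in the free algebra on the generators, as ideals containing the
  relations. If a homogeneous ideal contains a nonzero element, multiplying it by edges and ghost
  edges moves it to a vertex. Hence a graded homomorphism out of a Leavitt path algebra is injective
  as soon as it is nonzero on vertices; vertices themselves are nonzero because the algebra acts on
  functions on E^0 x N.

  For an admissible pair the canonical map out of L_K(E \ (H,S)) has an explicit inverse that splits
  v and e into v + v' and e + e'. So v is in I_(H,S) only for v in H, and v^H only for v in S, which
  makes (H,S) |-> I_(H,S) an order embedding. For a graded ideal I take H to be the vertices in I and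
  S the breaking vertices with v^H in I; then I / I_(H,S) is a graded ideal of L_K(E \ (H,S)) without
  vertices, hence zero.

  The algebra A of the graph E_(H,S) embeds into B = L_K(E) by v |-> v^H for v in S, with image
  satisfying A B A = A and B A B = I_(H,S); the bimodules B A and A B give the Morita context.
*)
theory Submission
  imports Defs "HOL-Library.Function_Algebras"
begin

section \<open>Quotient rings modulo varying ideals\<close>

section \<open>Two-sided ideals and an internal quotient ring\<close>

text \<open>The algebra as defined has no unit and consists of cosets in a carrier, which loads
  every calculation with membership conditions. The calculations are therefore moved to the unital
  ring of all polynomials in words over all generator names: names foreign to \<open>E\<close> are
  put into \<open>lpa_kernel E\<close>, scalars become constant polynomials, and the missing unit is
  accounted for by keeping ideals inside \<open>augmentation_ideal\<close>. Ideals of L_K(E)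
  correspond to the two-sided ideals between these two. Local units (finite sums of vertices) make
  ring ideals closed under scalars, so the correspondence covers all ring ideals. No basis of L_K(E)
  is constructed. The products \<alpha>\<beta>^* only span, with dependencies at regular vertices;
  hence ghost length is measured by a filtration of presentable elements, and nonvanishing is always
  reduced to that of vertices. All comparisons of algebras are substitutions whose values satisfy
  the defining relations modulo some ideal; \<open>leavitt_family\<close> isolates these relations
  in an arbitrary ring.\<close>

definition two_sided :: "'a::ring_1 set \<Rightarrow> bool" where
  "two_sided J \<longleftrightarrow> 0 \<in> J \<and> (\<forall>x\<in>J. \<forall>y\<in>J. x + y \<in> J) \<and> (\<forall>x\<in>J. \<forall>r. r * x \<in> J \<and> x * r \<in> J)"

lemma two_sidedI:
  assumes "0 \<in> J" "\<And>x y. x \<in> J \<Longrightarrow> y \<in> J \<Longrightarrow> x + y \<in> J"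
    "\<And>x r. x \<in> J \<Longrightarrow> r * x \<in> J" "\<And>x r. x \<in> J \<Longrightarrow> x * r \<in> J"
  shows "two_sided J"
  using assms by (auto simp: two_sided_def)

lemma two_sided_closed:
  assumes "two_sided J"
  shows two_sided_zero: "0 \<in> J"
    and two_sided_add: "\<And>x y. x \<in> J \<Longrightarrow> y \<in> J \<Longrightarrow> x + y \<in> J"
    and two_sided_mult_left: "\<And>x r. x \<in> J \<Longrightarrow> r * x \<in> J"
    and two_sided_mult_right: "\<And>x r. x \<in> J \<Longrightarrow> x * r \<in> J"
  using assms by (auto simp: two_sided_def)

lemma two_sided_uminus: "two_sided J \<Longrightarrow> x \<in> J \<Longrightarrow> - x \<in> J"
  using two_sided_mult_left[of J x "-1"] by simp

lemma two_sided_diff: "two_sided J \<Longrightarrow> x \<in> J \<Longrightarrow> y \<in> J \<Longrightarrow> x - y \<in> J"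
  using two_sided_add[of J x "-y"] two_sided_uminus[of J y] by simp

lemma two_sided_sum: "two_sided J \<Longrightarrow> (\<And>i. i \<in> A \<Longrightarrow> f i \<in> J) \<Longrightarrow> sum f A \<in> J"
  by (induction A rule: infinite_finite_induct) (auto simp: two_sided_closed)

lemma two_sided_diff_sym: "two_sided J \<Longrightarrow> x - y \<in> J \<Longrightarrow> y - x \<in> J"
  using two_sided_uminus[of J "x - y"] by simp

lemma two_sided_diff_trans: "two_sided J \<Longrightarrow> x - y \<in> J \<Longrightarrow> y - z \<in> J \<Longrightarrow> x - z \<in> J"
  using two_sided_add[of J "x - y" "y - z"] by simp

lemma two_sided_mem_cong: "two_sided J \<Longrightarrow> x - y \<in> J \<Longrightarrow> x \<in> J \<longleftrightarrow> y \<in> J"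
  using two_sided_add[of J "x - y" y] two_sided_diff[of J x "x - y"] by auto

lemma two_sided_diff_cong:
  assumes "two_sided J" "a - a' \<in> J" "b - b' \<in> J"
  shows "(a - b) - (a' - b') \<in> J"
proof -
  have "(a - b) - (a' - b') = (a - a') - (b - b')"
    by simp
  then show ?thesis
    using assms by (metis two_sided_diff)
qed

lemma two_sided_mult_cong:
  assumes "two_sided J" "a - a' \<in> J" "b - b' \<in> J"
  shows "a * b - a' * b' \<in> J"
proof -
  have "a * b - a' * b' = (a - a') * b + a' * (b - b')"
    by (simp add: algebra_simps)
  then show ?thesis
    using assms by (metis two_sided_add two_sided_mult_left two_sided_mult_right)
qed

lemma two_sided_inter: "two_sided I \<Longrightarrow> two_sided J \<Longrightarrow> two_sided (I \<inter> J)"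
  by (auto simp: two_sided_def)

lemma two_sided_Inter: "(\<And>J. J \<in> \<J> \<Longrightarrow> two_sided J) \<Longrightarrow> two_sided (\<Inter>\<J>)"
  by (auto simp: two_sided_def)

lemma two_sided_plus:
  assumes "two_sided I" "two_sided J"
  shows "two_sided {x + y | x y. x \<in> I \<and> y \<in> J}"
proof (rule two_sidedI)
  show "0 \<in> {x + y | x y. x \<in> I \<and> y \<in> J}"
    using assms[THEN two_sided_zero] by force
next
  fix a b assume "a \<in> {x + y | x y. x \<in> I \<and> y \<in> J}" "b \<in> {x + y | x y. x \<in> I \<and> y \<in> J}"
  then obtain x y x' y' where "a = x + y" "b = x' + y'" "x \<in> I" "x' \<in> I" "y \<in> J" "y' \<in> J"
    by blast
  then have "a + b = (x + x') + (y + y')" "x + x' \<in> I" "y + y' \<in> J"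
    using assms by (auto simp: two_sided_add)
  then show "a + b \<in> {x + y | x y. x \<in> I \<and> y \<in> J}"
    by blast
next
  fix a r assume "a \<in> {x + y | x y. x \<in> I \<and> y \<in> J}"
  then show "r * a \<in> {x + y | x y. x \<in> I \<and> y \<in> J}" "a * r \<in> {x + y | x y. x \<in> I \<and> y \<in> J}"
    using assms by (auto simp: distrib_left distrib_right) (blast intro: two_sided_closed)+
qed

definition ideal_hull :: "'a::ring_1 set \<Rightarrow> 'a set" where
  "ideal_hull X = \<Inter>{J. two_sided J \<and> X \<subseteq> J}"

lemma two_sided_hull: "two_sided (ideal_hull X)"
  unfolding ideal_hull_def by (rule two_sided_Inter) auto

lemma hull_incl: "X \<subseteq> ideal_hull X"
  by (auto simp: ideal_hull_def)

lemma hull_mem: "x \<in> X \<Longrightarrow> x \<in> ideal_hull X"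
  using hull_incl by blast

lemma hull_least: "two_sided J \<Longrightarrow> X \<subseteq> J \<Longrightarrow> ideal_hull X \<subseteq> J"
  by (auto simp: ideal_hull_def)

lemma hull_mono: "X \<subseteq> Y \<Longrightarrow> ideal_hull X \<subseteq> ideal_hull Y"
  by (auto simp: ideal_hull_def)

text \<open>
  A type cannot depend on an ideal. The type below is the product of the quotients of a ring by all
  of its two-sided ideals; \<open>cls J\<close> embeds the quotient by \<open>J\<close> as the factor of index \<open>J\<close>, so that
  equations modulo \<open>J\<close> become equations in a type of class \<open>ring_1\<close>.
\<close>

quotient_type (overloaded) 'a quo = "'a::ring_1 set \<Rightarrow> 'a" / "\<lambda>f g. \<forall>J. two_sided J \<longrightarrow> f J - g J \<in> J"
proof (rule equivpI)
  show "reflp (\<lambda>f g :: 'a set \<Rightarrow> 'a. \<forall>J. two_sided J \<longrightarrow> f J - g J \<in> J)"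
    by (auto simp: reflp_def two_sided_zero)
  show "symp (\<lambda>f g :: 'a set \<Rightarrow> 'a. \<forall>J. two_sided J \<longrightarrow> f J - g J \<in> J)"
    by (auto simp: symp_def intro: two_sided_diff_sym)
  show "transp (\<lambda>f g :: 'a set \<Rightarrow> 'a. \<forall>J. two_sided J \<longrightarrow> f J - g J \<in> J)"
    by (rule transpI) (blast intro: two_sided_diff_trans)
qed

instantiation quo :: (ring_1) ring_1
begin

lift_definition zero_quo :: "'a quo" is "\<lambda>_. 0" .

lift_definition one_quo :: "'a quo" is "\<lambda>_. 1" .

lift_definition plus_quo :: "'a quo \<Rightarrow> 'a quo \<Rightarrow> 'a quo" is "\<lambda>f g J. f J + g J"
  by (simp add: add_diff_add two_sided_add)

lift_definition uminus_quo :: "'a quo \<Rightarrow> 'a quo" is "\<lambda>f J. - f J"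
  by (metis minus_diff_eq minus_diff_minus two_sided_uminus)

lift_definition minus_quo :: "'a quo \<Rightarrow> 'a quo \<Rightarrow> 'a quo" is "\<lambda>f g J. f J - g J"
  by (simp add: two_sided_diff_cong)

lift_definition times_quo :: "'a quo \<Rightarrow> 'a quo \<Rightarrow> 'a quo" is "\<lambda>f g J. f J * g J"
  by (simp add: two_sided_mult_cong)

instance
proof
  fix a b c :: "'a quo"
  note * = two_sided_zero
  show "a + b + c = a + (b + c)" by transfer (simp add: * add.assoc)
  show "a + b = b + a" by transfer (simp add: * add.commute)
  show "0 + a = a" by transfer (simp add: *)
  show "- a + a = 0" by transfer (simp add: *)
  show "a - b = a + - b" by transfer (simp add: *)
  show "a * b * c = a * (b * c)" by transfer (simp add: * mult.assoc)
  show "1 * a = a" "a * 1 = a" by (transfer, simp add: *)+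
  show "(a + b) * c = a * c + b * c" by transfer (simp add: * distrib_right)
  show "a * (b + c) = a * b + a * c" by transfer (simp add: * distrib_left)
  \<comment> \<open>Equal elements agree modulo every ideal, so the zero ideal separates 0 from
    1.\<close>
  have "two_sided {0 :: 'a}"
    by (auto simp: two_sided_def)
  then show "(0 :: 'a quo) \<noteq> 1"
    by transfer force
qed

end

lift_definition cls :: "'a::ring_1 set \<Rightarrow> 'a \<Rightarrow> 'a quo" is "\<lambda>J x J'. if J' = J then x else 0" .

lemma cls_eq_iff: "two_sided J \<Longrightarrow> cls J x = cls J y \<longleftrightarrow> x - y \<in> J"
  by transfer (auto simp: two_sided_zero)

lemma cls_zero [simp]: "cls J 0 = 0"
  by transfer (auto simp: two_sided_zero)

lemma cls_eq_0_iff: "two_sided J \<Longrightarrow> cls J x = 0 \<longleftrightarrow> x \<in> J"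
  using cls_eq_iff[of J x 0] by simp

lemma cls_add: "cls J (x + y) = cls J x + cls J y"
  by transfer (auto simp: two_sided_zero)

lemma cls_mult: "cls J (x * y) = cls J x * cls J y"
  by transfer (auto simp: two_sided_zero)

lemma cls_diff: "cls J (x - y) = cls J x - cls J y"
  by transfer (auto simp: two_sided_zero)

lemma cls_sum: "cls J (sum f A) = (\<Sum>i\<in>A. cls J (f i))"
  by (induction A rule: infinite_finite_induct) (auto simp: cls_add)

text \<open>The unit of the type \<open>'a quo\<close> is 1 in every factor, whereas
  \<open>cls J 1\<close> is 1 in the factor \<open>J\<close> only. It need not be the unit of the
  type and acts as one just on the image of \<open>cls J\<close>.\<close>

lemma cls_one_mult [simp]: "cls J 1 * cls J x = cls J x" "cls J x * cls J 1 = cls J x"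
  by (simp_all flip: cls_mult)

section \<open>Polynomials in words and substitution\<close>

section \<open>The free algebra\<close>

abbreviation gen :: "'g \<Rightarrow> 'g word \<Rightarrow>\<^sub>0 'k::field" where
  "gen g \<equiv> monomial_word [g]"

text \<open>Scalars are polynomials on the empty word. Scalar multiplication thus becomes a ring
  product, and two-sided ideals are closed under it.\<close>

abbreviation cst :: "'k \<Rightarrow> 'g word \<Rightarrow>\<^sub>0 'k::field" where
  "cst k \<equiv> Poly_Mapping.single 0 k"

lemma poly_mapping_sum_monomials:
  "f = (\<Sum>w\<in>Poly_Mapping.keys f. Poly_Mapping.single w (Poly_Mapping.lookup f w))"
proof (rule poly_mapping_eqI)
  fix w
  show "Poly_Mapping.lookup f w = Poly_Mapping.lookup
    (\<Sum>w\<in>Poly_Mapping.keys f. Poly_Mapping.single w (Poly_Mapping.lookup f w)) w"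
    by (cases "w \<in> Poly_Mapping.keys f")
      (auto simp: lookup_sum lookup_single when_def in_keys_iff sum.delta)
qed

text \<open>The monomial case keeps the fact that the word occurs in \<open>f\<close>; this is how
  conditions on the support of \<open>f\<close> (letters, degree, no constant term) reach the single
  words.\<close>

lemma free_induct_on [case_names zero single add]:
  fixes f :: "'g word \<Rightarrow>\<^sub>0 'k::field"
  assumes "P 0"
    and "\<And>ws k. Word ws \<in> Poly_Mapping.keys f \<Longrightarrow> P (Poly_Mapping.single (Word ws) k)"
    and "\<And>f g. P f \<Longrightarrow> P g \<Longrightarrow> P (f + g)"
  shows "P f"
proof -
  have "P (\<Sum>w\<in>A. Poly_Mapping.single w (Poly_Mapping.lookup f w))"
    if "A \<subseteq> Poly_Mapping.keys f" for A
    using finite_subset[OF that finite_keys] that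
  proof (induction A rule: finite_induct)
    case (insert w A)
    then show ?case
      by (cases w) (auto intro!: assms)
  qed (simp add: assms(1))
  then show ?thesis
    using poly_mapping_sum_monomials[of f] by (metis subset_refl)
qed

lemma free_induct [case_names zero single add]:
  fixes f :: "'g word \<Rightarrow>\<^sub>0 'k::field"
  assumes "P 0" and "\<And>ws k. P (Poly_Mapping.single (Word ws) k)"
    and "\<And>f g. P f \<Longrightarrow> P g \<Longrightarrow> P (f + g)"
  shows "P f"
  using assms by (rule free_induct_on)

lemma single_Word_Cons:
  "Poly_Mapping.single (Word (g # ws)) k = gen g * Poly_Mapping.single (Word ws) k"
  by (simp add: mult_single plus_word_def)

lemma single_Word_append:
  "Poly_Mapping.single (Word (us @ ws)) k = monomial_word us * Poly_Mapping.single (Word ws) k"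
  by (simp add: mult_single plus_word_def)

lemma single_Word_Nil: "Poly_Mapping.single (Word []) k = cst k"
  by (simp add: zero_word_def)

lemma single_eq_cst_mult: "Poly_Mapping.single w k = cst k * Poly_Mapping.single w 1"
  by (simp add: mult_single)

lemma cst_commute: "cst k * f = f * cst k"
proof (induction f rule: free_induct)
  case (single ws l)
  then show ?case by (simp add: mult_single zero_word_def plus_word_def mult.commute)
qed (simp_all add: distrib_left distrib_right)

lemma cst_mult: "cst (k * l) = cst k * cst l"
  by (simp add: mult_single)

lemma cst_inverse: "k \<noteq> 0 \<Longrightarrow> cst (inverse k) * (cst k * f) = f"
  by (simp add: mult.assoc[symmetric] mult_single)

subsection \<open>Actions and substitution\<close>

definition word_act :: "('k \<Rightarrow> 'm \<Rightarrow> 'm) \<Rightarrow> ('g \<Rightarrow> 'm \<Rightarrow> 'm) \<Rightarrow> ('g word \<Rightarrow>\<^sub>0 'k::field) \<Rightarrow> 'm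
    \<Rightarrow> 'm::ab_group_add" where
  "word_act s T f m =
     (\<Sum>w\<in>Poly_Mapping.keys f. s (Poly_Mapping.lookup f w) (foldr T (letters w) m))"

text \<open>Linear operators \<open>T g\<close> on a vector space with scalar action
  \<open>s\<close>; \<open>word_act\<close> is the resulting left module over the free algebra, the
  last letter acting first. It is used with the polynomial ring itself, to define substitution, and
  with a space of functions, to see that vertices are nonzero.\<close>

locale word_action =
  fixes s :: "'k::field \<Rightarrow> 'm::ab_group_add \<Rightarrow> 'm" and T :: "'g \<Rightarrow> 'm \<Rightarrow> 'm"
  assumes s_add_left: "s (k + l) m = s k m + s l m"
    and s_add_right: "s k (m + m') = s k m + s k m'"
    and s_mult: "s (k * l) m = s k (s l m)"
    and s_one: "s 1 m = m"
    and T_add: "T g (m + m') = T g m + T g m'"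
    and T_s: "T g (s k m) = s k (T g m)"
begin

lemma s_zero_left: "s 0 m = 0"
  using s_add_left[of 0 0 m] by simp

lemma act_single: "word_act s T (Poly_Mapping.single (Word ws) k) m = s k (foldr T ws m)"
  by (cases "k = 0") (simp_all add: word_act_def s_zero_left)

lemma act_zero: "word_act s T 0 m = 0"
  by (simp add: word_act_def)

lemma act_add: "word_act s T (f + g) m = word_act s T f m + word_act s T g m"
  unfolding word_act_def
  by (rule setsum_keys_plus_distrib) (simp_all add: s_zero_left s_add_left)

lemma foldr_add: "foldr T ws (m + m') = foldr T ws m + foldr T ws m'"
  by (induction ws) (simp_all add: T_add)

lemma foldr_s: "foldr T ws (s k m) = s k (foldr T ws m)"
  by (induction ws) (simp_all add: T_s)

lemma act_add_right: "word_act s T f (m + m') = word_act s T f m + word_act s T f m'"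
  by (simp add: word_act_def foldr_add s_add_right sum.distrib)

lemma act_zero_right: "word_act s T f 0 = 0"
  using act_add_right[of f 0 0] by simp

lemma act_mult: "word_act s T (f * g) m = word_act s T f (word_act s T g m)"
proof (induction f rule: free_induct)
  case (single ws k)
  show ?case
  proof (induction g rule: free_induct)
    case (single us l)
    then show ?case
      by (simp add: mult_single plus_word_def act_single foldr_s s_mult)
  qed (simp_all add: act_zero act_zero_right act_add distrib_left act_add_right)
qed (simp_all add: act_zero act_add distrib_right)

lemma act_uminus: "word_act s T (- f) m = - word_act s T f m"
  using act_add[of f "- f" m] by (simp add: act_zero eq_neg_iff_add_eq_0 add.commute)

lemma act_diff: "word_act s T (f - g) m = word_act s T f m - word_act s T g m"
  using act_add[of f "- g" m] by (simp add: act_uminus)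

lemma act_sum: "word_act s T (sum h B) m = (\<Sum>i\<in>B. word_act s T (h i) m)"
  by (induction B rule: infinite_finite_induct) (simp_all add: act_add act_zero)

lemma act_gen: "word_act s T (gen g) m = T g m"
  by (simp add: act_single s_one)

lemma two_sided_annihilator: "two_sided {f. \<forall>m. word_act s T f m = 0}"
  by (rule two_sidedI) (auto simp: act_zero act_add act_mult act_zero_right)

end

text \<open>Substitution of \<open>\<sigma> g\<close> for each generator \<open>g\<close>. The
  target ring is a module on which \<open>g\<close> acts by left multiplication with
  \<open>\<sigma> g\<close>, and the value at \<open>f\<close> is where \<open>f\<close> sends 1;
  multiplicativity then comes from the module law.\<close>

definition ev :: "('g \<Rightarrow> 'h word \<Rightarrow>\<^sub>0 'k) \<Rightarrow> ('g word \<Rightarrow>\<^sub>0 'k) \<Rightarrow> 'h word \<Rightarrow>\<^sub>0 'k::field" where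
  "ev \<sigma> f = word_act (\<lambda>k y. cst k * y) (\<lambda>g y. \<sigma> g * y) f 1"

context
  fixes \<sigma> :: "'g \<Rightarrow> 'h word \<Rightarrow>\<^sub>0 'k::field"
begin

interpretation word_action "\<lambda>k y. cst k * y" "\<lambda>g y. \<sigma> g * y"
proof
  show "\<sigma> g * (cst k * y) = cst k * (\<sigma> g * y)" for g k y
    by (metis cst_commute mult.assoc)
qed (simp_all add: single_add distrib_left distrib_right cst_mult mult.assoc)

lemma act_eq_ev: "word_act (\<lambda>k y. cst k * y) (\<lambda>g y. \<sigma> g * y) f y = ev \<sigma> f * y"
proof (induction f rule: free_induct)
  case (single ws k)
  have "foldr (\<lambda>g y. \<sigma> g * y) ws y = foldr (\<lambda>g y. \<sigma> g * y) ws 1 * y" for ws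
    by (induction ws) (simp_all add: mult.assoc)
  then show ?case
    by (simp add: ev_def act_single mult.assoc)
qed (simp_all add: ev_def act_zero act_add distrib_right)

lemma ev_zero [simp]: "ev \<sigma> 0 = 0"
  by (simp add: ev_def act_zero)

lemma ev_add: "ev \<sigma> (f + g) = ev \<sigma> f + ev \<sigma> g"
  by (simp add: ev_def act_add)

lemma ev_mult: "ev \<sigma> (f * g) = ev \<sigma> f * ev \<sigma> g"
proof -
  have "ev \<sigma> (f * g) = word_act (\<lambda>k y. cst k * y) (\<lambda>g y. \<sigma> g * y) f (ev \<sigma> g)"
    unfolding ev_def by (rule act_mult)
  then show ?thesis
    by (simp only: act_eq_ev)
qed

lemma ev_single: "ev \<sigma> (Poly_Mapping.single (Word ws) k) = cst k * prod_list (map \<sigma> ws)"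
proof -
  have "foldr (\<lambda>g y. \<sigma> g * y) ws 1 = prod_list (map \<sigma> ws)"
    by (induction ws) simp_all
  then show ?thesis
    by (simp add: ev_def act_single)
qed

end

lemma ev_cst [simp]: "ev \<sigma> (cst k) = cst k"
  using ev_single[of \<sigma> "[]" k] by (simp add: single_Word_Nil)

lemma ev_one [simp]: "ev \<sigma> 1 = 1"
  using ev_cst[of \<sigma> 1] by simp

lemma ev_gen [simp]: "ev \<sigma> (gen g) = \<sigma> g"
  by (simp add: ev_single)

lemma ev_uminus: "ev \<sigma> (- f) = - ev \<sigma> f"
  using ev_add[of \<sigma> f "- f"] by (simp add: eq_neg_iff_add_eq_0 add.commute)

lemma ev_diff: "ev \<sigma> (f - g) = ev \<sigma> f - ev \<sigma> g"
  using ev_add[of \<sigma> f "- g"] by (simp add: ev_uminus)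

lemma ev_sum: "ev \<sigma> (sum f A) = (\<Sum>i\<in>A. ev \<sigma> (f i))"
  by (induction A rule: infinite_finite_induct) (simp_all add: ev_add)

lemmas ev_simps = ev_add ev_diff ev_uminus ev_mult ev_sum

lemma two_sided_vimage_ev: "two_sided J \<Longrightarrow> two_sided {f. ev \<sigma> f \<in> J}"
  by (rule two_sidedI) (auto simp: ev_simps two_sided_closed)

text \<open>Products of congruent factors are congruent, so words reduce to letters. It is applied
  to \<open>proj\<close> and to the two composites between the algebras of \<open>E\<close> and of
  the quotient graph.\<close>

lemma ev_congruent_id:
  fixes f :: "'g word \<Rightarrow>\<^sub>0 'k::field"
  assumes J: "two_sided J" and \<phi>: "\<And>f g. \<phi> (f * g) = \<phi> f * \<phi> g" "\<And>f g. \<phi> (f + g) = \<phi> f + \<phi> g"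
    "\<And>k. \<phi> (cst k) = cst k" and gen: "\<And>g. \<phi> (gen g) - gen g \<in> J"
  shows "\<phi> f - f \<in> J"
proof (induction f rule: free_induct)
  case zero
  then show ?case using \<phi>(3)[of 0] J by (simp add: two_sided_zero)
next
  case (single ws k)
  show ?case
  proof (induction ws)
    case Nil
    then show ?case using \<phi>(3)[of k] J by (simp add: single_Word_Nil two_sided_zero)
  next
    case (Cons g ws)
    show ?case
      unfolding single_Word_Cons[of g ws k] \<phi>(1) by (rule two_sided_mult_cong[OF J gen Cons])
  qed
next
  case (add f g)
  then show ?case
    using two_sided_add[OF J, of "\<phi> f - f" "\<phi> g - g"] by (simp add: \<phi>(2) add_diff_add)
qed

subsection \<open>The augmentation ideal\<close>

text \<open>Kernel of the map that kills all generators. The free algebra in the definition of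
  L_K(E) has no empty word, so the ideals that stand for ideals of L_K(E) are taken inside this
  one.\<close>

definition augmentation_ideal :: "('g word \<Rightarrow>\<^sub>0 'k::field) set" where
  "augmentation_ideal = {f. Poly_Mapping.lookup f 0 = 0}"

lemma word_plus_eq_0_iff: "(u :: 'g word) + w = 0 \<longleftrightarrow> u = 0 \<and> w = 0"
  by (cases u; cases w) (simp add: plus_word_def zero_word_def)

lemma lookup_mult_0:
  "Poly_Mapping.lookup (f * g) 0 = Poly_Mapping.lookup f 0 * Poly_Mapping.lookup (g :: 'g word \<Rightarrow>\<^sub>0 'k::field) 0"
proof (induction f rule: free_induct)
  case (single ws k)
  show ?case
  proof (induction g rule: free_induct)
    case (single us l)
    then show ?case
      by (auto simp: mult_single lookup_single when_def word_plus_eq_0_iff)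
  qed (simp_all add: distrib_left lookup_add)
qed (simp_all add: distrib_right lookup_add)

lemma two_sided_augmentation: "two_sided (augmentation_ideal :: ('g word \<Rightarrow>\<^sub>0 'k::field) set)"
  by (rule two_sidedI) (auto simp: augmentation_ideal_def lookup_add lookup_mult_0)

lemma gen_in_augmentation: "gen g \<in> augmentation_ideal"
  by (simp add: augmentation_ideal_def lookup_single when_def zero_word_def)

lemma lookup_ev_0:
  assumes "\<And>g. \<sigma> g \<in> augmentation_ideal"
  shows "Poly_Mapping.lookup (ev \<sigma> f) 0 = Poly_Mapping.lookup f 0"
proof (induction f rule: free_induct)
  case (single ws k)
  show ?case
  proof (cases ws)
    case Nil
    then show ?thesis by (simp add: ev_single single_Word_Nil)
  next
    case (Cons g us)
    have "Poly_Mapping.lookup (\<sigma> g) 0 = 0"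
      using assms by (simp add: augmentation_ideal_def)
    moreover have "Word ws \<noteq> 0"
      by (simp add: Cons zero_word_def)
    ultimately show ?thesis
      by (simp add: Cons ev_single lookup_mult_0 lookup_single)
  qed
qed (simp_all add: ev_add lookup_add)

text \<open>The extra factor \<open>x\<close> is there because \<open>cls J\<close> need not map the
  empty product 1 to 1.\<close>

lemma cls_mult_prod_list: "cls J (x * prod_list ys) = cls J x * prod_list (map (cls J) ys)"
proof (induction ys arbitrary: x)
  case (Cons y ys)
  have "cls J (x * prod_list (y # ys)) = cls J (x * y * prod_list ys)"
    by (simp add: mult.assoc)
  then show ?case
    unfolding Cons.IH by (simp add: cls_mult mult.assoc)
qed simp

lemma cls_ev_single:
  "cls J (ev \<sigma> (Poly_Mapping.single (Word ws) k)) = cls J (cst k) * prod_list (map (\<lambda>g. cls J (\<sigma> g)) ws)"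
  by (simp add: ev_single cls_mult_prod_list comp_def)

section \<open>Degrees and homogeneous ideals\<close>

section \<open>The grading of the free algebra\<close>

fun gdeg :: "('v, 'e) lpa_gen \<Rightarrow> int" where
  "gdeg (Vertex v) = 0"
| "gdeg (Edge e) = 1"
| "gdeg (Ghost e) = - 1"

definition wdeg :: "('v, 'e) lpa_gen word \<Rightarrow> int" where
  "wdeg w = sum_list (map gdeg (letters w))"

lemma wdeg_plus: "wdeg (u + w) = wdeg u + wdeg w"
  by (simp add: wdeg_def plus_word_def)

lemma wdeg_zero [simp]: "wdeg 0 = 0"
  by (simp add: wdeg_def zero_word_def)

lift_definition hpart ::
  "int \<Rightarrow> (('v, 'e) lpa_gen word \<Rightarrow>\<^sub>0 'k) \<Rightarrow> ('v, 'e) lpa_gen word \<Rightarrow>\<^sub>0 'k::field"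
  is "\<lambda>n f w. if wdeg w = n then f w else 0"
  by (rule finite_subset) auto

lemma hpart_zero [simp]: "hpart n 0 = 0"
  by (rule poly_mapping_eqI) (simp add: hpart.rep_eq)

lemma hpart_add: "hpart n (f + g) = hpart n f + hpart n g"
  by (rule poly_mapping_eqI) (simp add: hpart.rep_eq lookup_add)

lemma hpart_diff: "hpart n (f - g) = hpart n f - hpart n g"
  by (rule poly_mapping_eqI) (simp add: hpart.rep_eq lookup_minus)

lemma hpart_sum: "hpart n (sum f A) = (\<Sum>i\<in>A. hpart n (f i))"
  by (induction A rule: infinite_finite_induct) (simp_all add: hpart_add)

lemma hpart_single:
  "hpart n (Poly_Mapping.single w k) = (if wdeg w = n then Poly_Mapping.single w k else 0)"
  by (rule poly_mapping_eqI) (auto simp: hpart.rep_eq lookup_single when_def)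

lemma keys_hpart: "Poly_Mapping.keys (hpart n f) = {w \<in> Poly_Mapping.keys f. wdeg w = n}"
  by (auto simp: in_keys_iff hpart.rep_eq split: if_splits)

lemma hpart_single_mult:
  "hpart n (Poly_Mapping.single w k * f) = Poly_Mapping.single w k * hpart (n - wdeg w) f"
proof (induction f rule: free_induct)
  case (single ws l)
  have "wdeg (w + Word ws) = n \<longleftrightarrow> wdeg (Word ws) = n - wdeg w"
    by (auto simp: wdeg_plus)
  then show ?case by (simp add: mult_single hpart_single)
qed (simp_all add: distrib_left hpart_add)

lemma hpart_mult_single:
  "hpart n (f * Poly_Mapping.single w k) = hpart (n - wdeg w) f * Poly_Mapping.single w k"
proof (induction f rule: free_induct)
  case (single ws l)
  have "wdeg (Word ws + w) = n \<longleftrightarrow> wdeg (Word ws) = n - wdeg w"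
    by (auto simp: wdeg_plus)
  then show ?case by (simp add: mult_single hpart_single)
qed (simp_all add: distrib_right hpart_add)

lemma hpart_expansion: "f = (\<Sum>n\<in>wdeg ` Poly_Mapping.keys f. hpart n f)"
  by (rule poly_mapping_eqI)
    (auto simp: lookup_sum hpart.rep_eq in_keys_iff sum.delta[OF finite_imageI[OF finite_keys]])

lemma hpart_eq_0: "n \<notin> wdeg ` Poly_Mapping.keys f \<Longrightarrow> hpart n f = 0"
  by (rule poly_mapping_eqI) (auto simp: hpart.rep_eq in_keys_iff)

definition has_deg :: "int \<Rightarrow> (('v, 'e) lpa_gen word \<Rightarrow>\<^sub>0 'k::field) \<Rightarrow> bool" where
  "has_deg n f \<longleftrightarrow> (\<forall>w\<in>Poly_Mapping.keys f. wdeg w = n)"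

lemma hpart_has_deg:
  assumes "has_deg n f"
  shows "hpart m f = (if m = n then f else 0)"
  by (rule poly_mapping_eqI) (use assms in \<open>auto simp: has_deg_def hpart.rep_eq in_keys_iff\<close>)

lemma has_deg_hpart: "has_deg n (hpart n f)"
  by (auto simp: has_deg_def keys_hpart)

lemma has_deg_zero [simp]: "has_deg n 0"
  by (simp add: has_deg_def)

lemma has_deg_add: "has_deg n f \<Longrightarrow> has_deg n g \<Longrightarrow> has_deg n (f + g)"
  using keys_add[of f g] by (auto simp: has_deg_def)

lemma has_deg_diff: "has_deg n f \<Longrightarrow> has_deg n g \<Longrightarrow> has_deg n (f - g)"
  unfolding has_deg_def by (auto simp: in_keys_iff lookup_minus)

lemma has_deg_sum: "(\<And>i. i \<in> A \<Longrightarrow> has_deg n (f i)) \<Longrightarrow> has_deg n (sum f A)"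
  by (induction A rule: infinite_finite_induct) (auto intro: has_deg_add)

lemma has_deg_mult: "has_deg m f \<Longrightarrow> has_deg n g \<Longrightarrow> has_deg (m + n) (f * g)"
  using keys_mult[of f g] by (fastforce simp: has_deg_def wdeg_plus)

lemma has_deg_gen: "has_deg (gdeg g) (gen g)"
  by (simp add: has_deg_def wdeg_def)

lemma has_deg_cst: "has_deg 0 (cst k)"
  by (simp add: has_deg_def)

definition homogeneous :: "(('v, 'e) lpa_gen word \<Rightarrow>\<^sub>0 'k::field) set \<Rightarrow> bool" where
  "homogeneous J \<longleftrightarrow> (\<forall>f\<in>J. \<forall>n. hpart n f \<in> J)"

text \<open>Multiplying by a word only shifts degrees, so the elements all of whose components lie
  in the hull form a two-sided ideal; it contains \<open>X\<close>, hence the hull.\<close>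

lemma homogeneous_hull:
  fixes X :: "(('v, 'e) lpa_gen word \<Rightarrow>\<^sub>0 'k::field) set"
  assumes "\<And>x. x \<in> X \<Longrightarrow> \<exists>n. has_deg n x"
  shows "homogeneous (ideal_hull X)"
proof -
  let ?J = "ideal_hull X" and ?S = "{f. \<forall>n. hpart n f \<in> ideal_hull X}"
  note J = two_sided_hull[of X]
  have "two_sided ?S"
  proof (rule two_sidedI)
    fix x r assume x: "x \<in> ?S"
    show "r * x \<in> ?S"
    proof (induction r rule: free_induct)
      case (single ws k)
      then show ?case using x J by (simp add: hpart_single_mult two_sided_mult_left)
    qed (use J in \<open>simp_all add: distrib_right hpart_add two_sided_closed\<close>)
    show "x * r \<in> ?S"
    proof (induction r rule: free_induct)
      case (single ws k)
      then show ?case using x J by (simp add: hpart_mult_single two_sided_mult_right)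
    qed (use J in \<open>simp_all add: distrib_left hpart_add two_sided_closed\<close>)
  qed (use J in \<open>auto simp: hpart_add two_sided_closed\<close>)
  moreover have "X \<subseteq> ?S"
  proof
    fix x assume "x \<in> X"
    with assms obtain n where "has_deg n x" by blast
    with \<open>x \<in> X\<close> show "x \<in> ?S"
      using J by (auto simp: hpart_has_deg hull_mem two_sided_zero)
  qed
  ultimately have "?J \<subseteq> ?S"
    by (rule hull_least)
  then show ?thesis
    by (auto simp: homogeneous_def)
qed

lemma has_deg_ev_single:
  assumes "\<And>g. has_deg (gdeg g) (\<sigma> g)"
  shows "has_deg (wdeg w) (ev \<sigma> (Poly_Mapping.single w k))"
proof (cases w)
  case (Word ws)
  have "has_deg (sum_list (map gdeg ws)) (prod_list (map \<sigma> ws))"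
  proof (induction ws)
    case Nil
    then show ?case using has_deg_cst[of 1] by simp
  next
    case (Cons g ws)
    then show ?case using has_deg_mult[OF assms[of g] Cons] by simp
  qed
  then show ?thesis
    using has_deg_mult[OF has_deg_cst] by (fastforce simp: Word ev_single wdeg_def)
qed

lemma hpart_ev:
  assumes "\<And>g. has_deg (gdeg g) (\<sigma> g)"
  shows "hpart n (ev \<sigma> f) = ev \<sigma> (hpart n f)"
proof (induction f rule: free_induct)
  case (single ws k)
  show ?case
    using has_deg_ev_single[OF assms, where w = "Word ws" and k = k]
    by (simp add: hpart_has_deg hpart_single)
qed (simp_all add: ev_add hpart_add)

section \<open>The defining relations and their models\<close>

section \<open>Leavitt families\<close>

text \<open>The ideal is taken in the unital ring on all generator names, where names outside
  \<open>E\<close> are set to 0. Its trace on \<open>free_alg\<close> is the ideal in the definition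
  of L_K(E), see \<open>lpa_null_eq\<close>.\<close>

definition lpa_kernel :: "('v, 'e) pre_digraph \<Rightarrow> (('v, 'e) lpa_gen word \<Rightarrow>\<^sub>0 'k::field) set" where
  "lpa_kernel E = ideal_hull (lpa_relations E \<union> gen ` (- lpa_generators E))"

lemma two_sided_kernel: "two_sided (lpa_kernel E)"
  by (simp add: lpa_kernel_def two_sided_hull)

lemma kernel_augmentation: "lpa_kernel E \<subseteq> augmentation_ideal"
  unfolding lpa_kernel_def
  by (rule hull_least[OF two_sided_augmentation])
    (auto simp: lpa_relations_def Let_def gen_in_augmentation
      intro!: two_sided_diff[OF two_sided_augmentation]
        two_sided_mult_left[OF two_sided_augmentation] two_sided_sum[OF two_sided_augmentation])

lemma relations_have_deg:
  fixes x :: "('a, 'b) lpa_gen word \<Rightarrow>\<^sub>0 'c::field"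
  assumes "x \<in> lpa_relations E \<union> gen ` (- lpa_generators E)"
  shows "\<exists>n. has_deg n x"
proof -
  note g = has_deg_gen[of "Vertex v" for v, simplified]
    has_deg_gen[of "Edge e" for e, simplified] has_deg_gen[of "Ghost e" for e, simplified]
  note gg = has_deg_mult[OF g(1) g(1), simplified] has_deg_mult[OF g(1) g(2), simplified]
    has_deg_mult[OF g(1) g(3), simplified] has_deg_mult[OF g(2) g(1), simplified]
    has_deg_mult[OF g(3) g(1), simplified] has_deg_mult[OF g(2) g(3), simplified]
    has_deg_mult[OF g(3) g(2), simplified]
  have D: "\<exists>n. has_deg n (a - b)" if "has_deg n a" "has_deg n b"
    for n and a b :: "('a, 'b) lpa_gen word \<Rightarrow>\<^sub>0 'c"
    using has_deg_diff[OF that] by blast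
  have X: "\<exists>n. has_deg n a" if "has_deg n a" for n and a :: "('a, 'b) lpa_gen word \<Rightarrow>\<^sub>0 'c"
    using that by blast
  show ?thesis
    using assms unfolding lpa_relations_def Let_def
    by (auto intro: D[OF gg(1) g(1)] D[OF gg(2) g(2)] D[OF gg(4) g(2)] D[OF gg(3) g(3)]
      D[OF gg(5) g(3)] D[OF gg(7) g(1)] X[OF gg(1)] X[OF gg(7)] X[OF has_deg_gen]
      D[OF g(1) has_deg_sum[OF gg(6)]])
qed

lemma homogeneous_kernel: "homogeneous (lpa_kernel E)"
  unfolding lpa_kernel_def by (rule homogeneous_hull) (rule relations_have_deg)

text \<open>The defining relations in an arbitrary ring, with scalars \<open>c\<close> that commute
  with the generators. The same calculations then serve modulo any ideal and for derived families.
  The scalar 1 is only asked to fix each \<open>V v\<close>, because \<open>cls J 1\<close> need not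
  be the unit of its type.\<close>

locale leavitt_family = wf_digraph E for E :: "('v, 'e) pre_digraph" +
  fixes c :: "'k::field \<Rightarrow> 'q::ring_1" and V :: "'v \<Rightarrow> 'q" and A G :: "'e \<Rightarrow> 'q"
  assumes V_V: "\<And>v w. v \<in> verts E \<Longrightarrow> w \<in> verts E \<Longrightarrow> V v * V w = (if v = w then V v else 0)"
    and V_A: "\<And>e. e \<in> arcs E \<Longrightarrow> V (tail E e) * A e = A e"
    and A_V: "\<And>e. e \<in> arcs E \<Longrightarrow> A e * V (head E e) = A e"
    and V_G: "\<And>e. e \<in> arcs E \<Longrightarrow> V (head E e) * G e = G e"
    and G_V: "\<And>e. e \<in> arcs E \<Longrightarrow> G e * V (tail E e) = G e"
    and G_A: "\<And>e f. e \<in> arcs E \<Longrightarrow> f \<in> arcs E \<Longrightarrow> G e * A f = (if e = f then V (head E e) else 0)"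
    and CK: "\<And>v. v \<in> regular_vertices E \<Longrightarrow> V v = (\<Sum>e\<in>out_arcs E v. A e * G e)"
    and c_add: "\<And>k l. c (k + l) = c k + c l"
    and c_mult: "\<And>k l. c (k * l) = c k * c l"
    and c_one: "\<And>v. c 1 * V v = V v"
    and c_V: "\<And>k v. c k * V v = V v * c k"
    and c_A: "\<And>k e. c k * A e = A e * c k"
    and c_G: "\<And>k e. c k * G e = G e * c k"

definition family_of :: "('v, 'e) pre_digraph \<Rightarrow> (('v, 'e) lpa_gen \<Rightarrow> 'h word \<Rightarrow>\<^sub>0 'k::field)
    \<Rightarrow> ('h word \<Rightarrow>\<^sub>0 'k) set \<Rightarrow> bool" where
  "family_of E \<sigma> J \<longleftrightarrow> leavitt_family E (\<lambda>k. cls J (cst k)) (\<lambda>v. cls J (\<sigma> (Vertex v)))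
     (\<lambda>e. cls J (\<sigma> (Edge e))) (\<lambda>e. cls J (\<sigma> (Ghost e)))"

lemma family_ofI:
  assumes "wf_digraph E"
    "\<And>v w. v \<in> verts E \<Longrightarrow> w \<in> verts E \<Longrightarrow>
      cls J (\<sigma> (Vertex v)) * cls J (\<sigma> (Vertex w)) = (if v = w then cls J (\<sigma> (Vertex v)) else 0)"
    "\<And>e. e \<in> arcs E \<Longrightarrow> cls J (\<sigma> (Vertex (tail E e))) * cls J (\<sigma> (Edge e)) = cls J (\<sigma> (Edge e))"
    "\<And>e. e \<in> arcs E \<Longrightarrow> cls J (\<sigma> (Edge e)) * cls J (\<sigma> (Vertex (head E e))) = cls J (\<sigma> (Edge e))"
    "\<And>e. e \<in> arcs E \<Longrightarrow> cls J (\<sigma> (Vertex (head E e))) * cls J (\<sigma> (Ghost e)) = cls J (\<sigma> (Ghost e))"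
    "\<And>e. e \<in> arcs E \<Longrightarrow> cls J (\<sigma> (Ghost e)) * cls J (\<sigma> (Vertex (tail E e))) = cls J (\<sigma> (Ghost e))"
    "\<And>e f. e \<in> arcs E \<Longrightarrow> f \<in> arcs E \<Longrightarrow> cls J (\<sigma> (Ghost e)) * cls J (\<sigma> (Edge f)) =
      (if e = f then cls J (\<sigma> (Vertex (head E e))) else 0)"
    "\<And>v. v \<in> regular_vertices E \<Longrightarrow>
      cls J (\<sigma> (Vertex v)) = (\<Sum>e\<in>out_arcs E v. cls J (\<sigma> (Edge e)) * cls J (\<sigma> (Ghost e)))"
  shows "family_of E \<sigma> J"
proof -
  have comm: "cls J (cst k) * cls J x = cls J x * cls J (cst k)" for k x
    by (simp flip: cls_mult add: cst_commute)
  show ?thesis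
    unfolding family_of_def
    by (rule leavitt_family.intro[OF assms(1) leavitt_family_axioms.intro])
      ((rule assms(2-) comm, assumption?, assumption?) |
        (simp add: single_add cls_add cst_mult cls_mult; fail))+
qed

lemma lpa_relations_mem:
  "v \<in> verts E \<Longrightarrow> gen (Vertex v) * gen (Vertex v) - gen (Vertex v) \<in> lpa_relations E"
  "v \<in> verts E \<Longrightarrow> w \<in> verts E \<Longrightarrow> v \<noteq> w \<Longrightarrow> gen (Vertex v) * gen (Vertex w) \<in> lpa_relations E"
  "e \<in> arcs E \<Longrightarrow> gen (Vertex (tail E e)) * gen (Edge e) - gen (Edge e) \<in> lpa_relations E"
  "e \<in> arcs E \<Longrightarrow> gen (Edge e) * gen (Vertex (head E e)) - gen (Edge e) \<in> lpa_relations E"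
  "e \<in> arcs E \<Longrightarrow> gen (Vertex (head E e)) * gen (Ghost e) - gen (Ghost e) \<in> lpa_relations E"
  "e \<in> arcs E \<Longrightarrow> gen (Ghost e) * gen (Vertex (tail E e)) - gen (Ghost e) \<in> lpa_relations E"
  "e \<in> arcs E \<Longrightarrow> gen (Ghost e) * gen (Edge e) - gen (Vertex (head E e)) \<in> lpa_relations E"
  "e \<in> arcs E \<Longrightarrow> f \<in> arcs E \<Longrightarrow> e \<noteq> f \<Longrightarrow> gen (Ghost e) * gen (Edge f) \<in> lpa_relations E"
  "u \<in> regular_vertices E \<Longrightarrow>
    gen (Vertex u) - (\<Sum>e\<in>out_arcs E u. gen (Edge e) * gen (Ghost e)) \<in> lpa_relations E"
  unfolding lpa_relations_def Let_def
  subgoal by (rule UnI1, rule UnI1, rule UnI1, rule UnI1, rule UnI1, rule UnI1, rule UnI1, rule UnI1, intro CollectI exI conjI, rule refl, assumption+)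
  subgoal by (rule UnI1, rule UnI1, rule UnI1, rule UnI1, rule UnI1, rule UnI1, rule UnI1, rule UnI2, intro CollectI exI conjI, rule refl, assumption+)
  subgoal by (rule UnI1, rule UnI1, rule UnI1, rule UnI1, rule UnI1, rule UnI1, rule UnI2, intro CollectI exI conjI, rule refl, assumption+)
  subgoal by (rule UnI1, rule UnI1, rule UnI1, rule UnI1, rule UnI1, rule UnI2, intro CollectI exI conjI, rule refl, assumption+)
  subgoal by (rule UnI1, rule UnI1, rule UnI1, rule UnI1, rule UnI2, intro CollectI exI conjI, rule refl, assumption+)
  subgoal by (rule UnI1, rule UnI1, rule UnI1, rule UnI2, intro CollectI exI conjI, rule refl, assumption+)
  subgoal by (rule UnI1, rule UnI1, rule UnI2, intro CollectI exI conjI, rule refl, assumption+)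
  subgoal by (rule UnI1, rule UnI2, intro CollectI exI conjI, rule refl, assumption+)
  subgoal by (rule UnI2, intro CollectI exI conjI, rule refl, assumption+)
  done

lemma family_of_gen:
  assumes "wf_digraph E" "two_sided J" "lpa_kernel E \<subseteq> J"
  shows "family_of E gen J"
proof -
  have "lpa_relations E \<subseteq> J"
    using assms(3) hull_incl[of "lpa_relations E \<union> gen ` (- lpa_generators E)"]
    unfolding lpa_kernel_def by blast
  then have *: "\<And>x. x \<in> lpa_relations E \<Longrightarrow> cls J x = 0"
    using cls_eq_0_iff[OF assms(2)] by blast
  show ?thesis
    by (rule family_ofI[OF assms(1)])
      (use lpa_relations_mem[THEN *] in \<open>simp_all add: cls_diff cls_mult cls_sum\<close>)
qed

text \<open>This is the universal property of L_K(E) for representatives; the maps between Leavitt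
  path algebras below are well defined because of it.\<close>

lemma ev_kernel:
  assumes J: "two_sided J" and fam: "family_of E \<sigma> J"
    and bad: "\<And>g. g \<notin> lpa_generators E \<Longrightarrow> \<sigma> g \<in> J" and f: "f \<in> lpa_kernel E"
  shows "ev \<sigma> f \<in> J"
proof -
  interpret leavitt_family E "\<lambda>k. cls J (cst k)" "\<lambda>v. cls J (\<sigma> (Vertex v))"
     "\<lambda>e. cls J (\<sigma> (Edge e))" "\<lambda>e. cls J (\<sigma> (Ghost e))"
    using fam by (simp add: family_of_def)
  have "ev \<sigma> x \<in> J" if "x \<in> lpa_relations E" for x
  proof -
    have "cls J (ev \<sigma> x) = 0"
      using that unfolding lpa_relations_def Let_def
      by (auto simp: ev_simps cls_diff cls_mult cls_sum V_V V_A A_V V_G G_V G_A simp flip: CK)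
    then show ?thesis
      using cls_eq_0_iff[OF J] by simp
  qed
  then have "lpa_relations E \<subseteq> {f. ev \<sigma> f \<in> J}"
    by blast
  then have "lpa_kernel E \<subseteq> {f. ev \<sigma> f \<in> J}"
    unfolding lpa_kernel_def using bad
    by (intro hull_least two_sided_vimage_ev[OF J]) auto
  then show ?thesis
    using f by blast
qed

subsection \<open>Vertices do not vanish\<close>

text \<open>
  The algebra acts on functions on \<open>verts E \<times> \<nat>\<close>: since the set of arcs is countable, for every
  vertex \<open>v\<close> that is not a sink the countable set \<open>out_arcs E v \<times> \<nat>\<close> can be identified with \<open>\<nat>\<close>.
\<close>

lemma sum_apply: "(\<Sum>i\<in>I. f i) x = (\<Sum>i\<in>I. f i x)" for f :: "'i \<Rightarrow> 'a \<Rightarrow> 'b::comm_monoid_add"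
  by (induction I rule: infinite_finite_induct) simp_all

lemma vertex_notin_kernel:
  assumes "wf_digraph E" and "countable (arcs E)" and v: "v \<in> verts E"
  shows "gen (Vertex v) \<notin> (lpa_kernel E :: (('v, 'e) lpa_gen word \<Rightarrow>\<^sub>0 'k::field) set)"
proof
  assume asm: "gen (Vertex v) \<in> (lpa_kernel E :: (('v, 'e) lpa_gen word \<Rightarrow>\<^sub>0 'k::field) set)"
  \<comment> \<open>For the arcs \<open>e\<close> leaving one vertex, the maps \<open>b e\<close>
    are injective and their images partition the natural numbers. The factor \<open>UNIV\<close>
    makes the coded set infinite even when only finitely many arcs leave the vertex.\<close>
  define b where "b e n = to_nat_on (out_arcs E (tail E e) \<times> (UNIV :: nat set)) (e, n)" for e n
  have bij: "bij_betw (to_nat_on (out_arcs E u \<times> (UNIV :: nat set))) (out_arcs E u \<times> UNIV) UNIV"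
    if "out_arcs E u \<noteq> {}" for u
  proof (rule to_nat_on_infinite)
    have "countable (out_arcs E u)"
      by (rule countable_subset[OF _ assms(2)]) auto
    then show "countable (out_arcs E u \<times> (UNIV :: nat set))"
      by blast
    show "infinite (out_arcs E u \<times> (UNIV :: nat set))"
      using that by (simp add: finite_cartesian_product_iff)
  qed
  have b_inj: "b e n = b f m \<longleftrightarrow> e = f \<and> n = m"
    if "e \<in> arcs E" "f \<in> arcs E" "tail E e = tail E f" for e f n m
  proof -
    let ?S = "out_arcs E (tail E e) \<times> (UNIV :: nat set)"
    have *: "e \<in> out_arcs E (tail E e)" "f \<in> out_arcs E (tail E e)"
      using that by auto
    then have "inj_on (to_nat_on ?S) ?S"
      using bij_betw_imp_inj_on[OF bij] by blast
    then have "to_nat_on ?S (e, n) = to_nat_on ?S (f, m) \<longleftrightarrow> (e, n) = (f, m)"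
      by (rule inj_on_eq_iff) (use * in auto)
    then show ?thesis
      using that(3) by (simp add: b_def)
  qed
  have b_surj: "\<exists>e\<in>out_arcs E u. \<exists>n. b e n = m" if "out_arcs E u \<noteq> {}" for u m
  proof -
    have "m \<in> to_nat_on (out_arcs E u \<times> (UNIV :: nat set)) ` (out_arcs E u \<times> UNIV)"
      using bij_betw_imp_surj_on[OF bij[OF that]] by simp
    then obtain e n where "e \<in> out_arcs E u" "m = to_nat_on (out_arcs E u \<times> (UNIV :: nat set)) (e, n)"
      by auto
    then show ?thesis
      by (auto simp: b_def intro!: bexI[of _ e])
  qed
  define s :: "'k \<Rightarrow> ('v \<times> nat \<Rightarrow> 'k) \<Rightarrow> 'v \<times> nat \<Rightarrow> 'k" where "s k \<phi> = (\<lambda>x. k * \<phi> x)" for k \<phi>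
  \<comment> \<open>An edge copies the values at \<open>head E e\<close> onto the image of
    \<open>b e\<close> at \<open>tail E e\<close> and is 0 elsewhere; the ghost edge reads them
    back. Disjoint images give e^* f = 0 for distinct edges, and exhausting images give the sum
    relation at regular vertices.\<close>
  define T :: "('v, 'e) lpa_gen \<Rightarrow> ('v \<times> nat \<Rightarrow> 'k) \<Rightarrow> 'v \<times> nat \<Rightarrow> 'k" where
    "T g \<phi> = (\<lambda>(w, m). case g of
        Vertex u \<Rightarrow> if u \<in> verts E \<and> w = u then \<phi> (w, m) else 0
      | Edge e \<Rightarrow> if e \<in> arcs E \<and> w = tail E e \<and> (\<exists>n. b e n = m)
          then \<phi> (head E e, THE n. b e n = m) else 0
      | Ghost e \<Rightarrow> if e \<in> arcs E \<and> w = head E e then \<phi> (tail E e, b e m) else 0)" for g \<phi>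
  interpret word_action s T
    by standard (auto simp: s_def T_def fun_eq_iff algebra_simps split: lpa_gen.split)
  interpret wf_digraph E by fact
  have the_b: "(THE n. b e n = b e m) = m" if "e \<in> arcs E" for e m
    using b_inj[OF that that] by auto
  have V: "T (Vertex u) \<phi> (w, m) = (if u \<in> verts E \<and> w = u then \<phi> (w, m) else 0)"
    and A: "e \<in> arcs E \<Longrightarrow> T (Edge e) \<phi> (w, m) =
      (if w = tail E e \<and> (\<exists>n. b e n = m) then \<phi> (head E e, THE n. b e n = m) else 0)"
    and G: "e \<in> arcs E \<Longrightarrow> T (Ghost e) \<phi> (w, m) = (if w = head E e then \<phi> (tail E e, b e m) else 0)"
    for u e \<phi> w m
    by (simp_all add: T_def)
  have GA: "T (Ghost e) (T (Edge f) \<phi>) x = (if e = f then T (Vertex (head E e)) \<phi> x else 0)"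
    if "e \<in> arcs E" "f \<in> arcs E" for e f \<phi> x
  proof -
    obtain w m where x: "x = (w, m)" by fastforce
    consider "w \<noteq> head E e" | "w = head E e" "e = f" | "w = head E e" "e \<noteq> f" by blast
    then show ?thesis
    proof cases
      case 1
      then show ?thesis using that by (auto simp: x G V)
    next
      case 2
      then have "\<exists>n. b f n = b e m" by blast
      then show ?thesis
        using that 2 by (simp add: x G A V the_b)
    next
      case 3
      then have "\<not> (tail E e = tail E f \<and> (\<exists>n. b f n = b e m))"
        using b_inj[OF that] by metis
      then have "T (Edge f) \<phi> (tail E e, b e m) = 0"
        by (subst A[OF that(2)]) (rule if_not_P)
      then show ?thesis
        using that 3 by (simp add: x G)
    qed
  qed
  have CK: "(\<Sum>e\<in>out_arcs E u. T (Edge e) (T (Ghost e) \<phi>) x) = T (Vertex u) \<phi> x"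
    if u: "u \<in> regular_vertices E" for u \<phi> x
  proof -
    obtain w m where x: "x = (w, m)" by fastforce
    have "out_arcs E u \<noteq> {}" "finite (out_arcs E u)" "u \<in> verts E"
      using u by (auto simp: regular_vertices_def)
    \<comment> \<open>Exactly one arc leaving \<open>u\<close> has \<open>m\<close> in the image of
      its embedding; only its summand survives.\<close>
    then obtain f n where f: "f \<in> out_arcs E u" "b f n = m"
      using b_surj by blast
    have "T (Edge e) (T (Ghost e) \<phi>) x = (if e = f then (if w = u then \<phi> x else 0) else 0)"
      if "e \<in> out_arcs E u" for e
    proof (cases "e = f")
      case True
      have "\<exists>k. b f k = m" "(THE k. b f k = m) = n" "f \<in> arcs E" "tail E f = u"
        using f the_b[of f n] by auto
      then show ?thesis
        using f(2) by (auto simp: True x A G)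
    next
      case False
      have ef: "e \<in> arcs E" "f \<in> arcs E" "tail E e = tail E f"
        using that f by auto
      have "\<not> (w = tail E e \<and> (\<exists>k. b e k = m))"
        using b_inj[OF ef] f(2) False by metis
      then have "T (Edge e) (T (Ghost e) \<phi>) (w, m) = 0"
        by (subst A[OF ef(1)]) (rule if_not_P)
      then show ?thesis
        using False by (simp add: x)
    qed
    then have "(\<Sum>e\<in>out_arcs E u. T (Edge e) (T (Ghost e) \<phi>) x) =
      (\<Sum>e\<in>out_arcs E u. if e = f then (if w = u then \<phi> x else 0) else 0)"
      by (rule sum.cong[OF refl])
    also have "\<dots> = T (Vertex u) \<phi> x"
      using f \<open>finite _\<close> \<open>u \<in> verts E\<close> by (simp add: sum.delta' sum.delta V x)
    finally show ?thesis .
  qed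
  \<comment> \<open>The annihilator of the module is a two-sided ideal. Once it contains the
    relations and the foreign names it contains the kernel, but \<open>v\<close> does not annihilate
    the constant function 1.\<close>
  let ?J = "{f :: ('v, 'e) lpa_gen word \<Rightarrow>\<^sub>0 'k. \<forall>m. word_act s T f m = 0}"
  have "T g \<phi> x = 0" if "g \<notin> lpa_generators E" for g \<phi> x
    using that by (cases g; cases x) (auto simp: T_def lpa_generators_def)
  then have "gen ` (- lpa_generators E) \<subseteq> ?J"
    by (auto simp: act_gen fun_eq_iff)
  moreover have "lpa_relations E \<subseteq> ?J"
    unfolding lpa_relations_def Let_def
    by (auto simp: act_gen act_diff act_mult act_sum fun_eq_iff GA CK sum_apply)
      (auto simp: V A G fun_eq_iff)
  ultimately have "lpa_kernel E \<subseteq> ?J"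
    unfolding lpa_kernel_def by (intro hull_least two_sided_annihilator) auto
  with asm have "T (Vertex v) (\<lambda>_. 1) = 0"
    by (auto simp: act_gen)
  then have "T (Vertex v) (\<lambda>_. 1) (v, 0) = 0"
    by simp
  then show False
    using v by (simp add: V)
qed

section \<open>Paths times ghost paths, and the graded uniqueness theorem\<close>

section \<open>Spanning monomials and the reduction argument\<close>

context leavitt_family
begin

lemma c_zero: "c 0 = 0"
  using c_add[of 0 0] by simp

lemma A_V_if: "e \<in> arcs E \<Longrightarrow> v \<in> verts E \<Longrightarrow> A e * V v = (if v = head E e then A e else 0)"
  using A_V[of e] V_V[of "head E e" v] by (metis head_in_verts mult.assoc mult_zero_right)

lemma G_V_if: "e \<in> arcs E \<Longrightarrow> v \<in> verts E \<Longrightarrow> G e * V v = (if v = tail E e then G e else 0)"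
  using G_V[of e] V_V[of "tail E e" v] by (metis tail_in_verts mult.assoc mult_zero_right)

lemma V_A_if: "e \<in> arcs E \<Longrightarrow> v \<in> verts E \<Longrightarrow> V v * A e = (if v = tail E e then A e else 0)"
  using V_A[of e] V_V[of v "tail E e"] by (metis tail_in_verts mult.assoc mult_zero_left)

lemma V_G_if: "e \<in> arcs E \<Longrightarrow> v \<in> verts E \<Longrightarrow> V v * G e = (if v = head E e then G e else 0)"
  using V_G[of e] V_V[of v "head E e"] by (metis head_in_verts mult.assoc mult_zero_left)

text \<open>\<open>Pa u p\<close> stands for the path \<open>p\<close> from \<open>u\<close>, and
  \<open>Pg u p\<close> for its ghost path. The factor \<open>V u\<close> makes the empty list
  denote the vertex \<open>u\<close> instead of the unit of the ring; for other walks it is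
  absorbed.\<close>

definition Pa :: "'v \<Rightarrow> 'e list \<Rightarrow> 'q" where
  "Pa u p = V u * prod_list (map A p)"

definition Pg :: "'v \<Rightarrow> 'e list \<Rightarrow> 'q" where
  "Pg u p = prod_list (map G (rev p)) * V u"

lemma Pa_Nil: "Pa u [] = V u" and Pg_Nil: "Pg u [] = V u"
  by (simp_all add: Pa_def Pg_def)

lemma Pa_Cons: "e \<in> arcs E \<Longrightarrow> Pa (tail E e) (e # p) = A e * Pa (head E e) p"
  by (simp add: Pa_def mult.assoc[symmetric] V_A A_V)

lemma Pg_Cons: "e \<in> arcs E \<Longrightarrow> Pg (tail E e) (e # p) = Pg (head E e) p * G e"
  by (simp add: Pg_def mult.assoc V_G G_V)

lemma V_Pa: "awalk u p w \<Longrightarrow> v \<in> verts E \<Longrightarrow> V v * Pa u p = (if v = u then Pa u p else 0)"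
  by (simp add: Pa_def mult.assoc[symmetric] V_V awalk_hd_in_verts)

lemma Pa_V: "awalk u p w \<Longrightarrow> v \<in> verts E \<Longrightarrow> Pa u p * V v = (if v = w then Pa u p else 0)"
proof (induction p arbitrary: u)
  case Nil
  then show ?case by (auto simp: Pa_Nil V_V awalk_simps)
next
  case (Cons e p)
  then show ?case by (auto simp: Pa_Cons awalk_simps mult.assoc)
qed

lemma Pa_snoc: "awalk u p (tail E e) \<Longrightarrow> e \<in> arcs E \<Longrightarrow> Pa u p * A e = Pa u (p @ [e])"
  by (simp add: Pa_def mult.assoc)

lemma Pg_snoc: "G e * Pg u p = Pg u (p @ [e])"
  by (simp add: Pg_def mult.assoc)

lemma awalk_snoc: "awalk u p (tail E e) \<Longrightarrow> e \<in> arcs E \<Longrightarrow> awalk u (p @ [e]) (head E e)"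
  by (rule awalk_appendI[OF _ arc_implies_awalk]) (simp_all add: head_in_verts)

lemma Pa_A: "awalk u p w \<Longrightarrow> e \<in> arcs E \<Longrightarrow> Pa u p * A e = (if w = tail E e then Pa u (p @ [e]) else 0)"
  using Pa_V[of u p w "tail E e"] V_A[of e] Pa_snoc[of u p e]
  by (metis tail_in_verts mult.assoc mult_zero_left)

text \<open>Cancel the first edges by the relation for e^* f and recurse. With equal lengths neither
  path is a proper prefix of the other, so nothing but 0 and a vertex can remain.\<close>

lemma Pg_Pa:
  "awalk u p w \<Longrightarrow> awalk u' p' w' \<Longrightarrow> length p = length p' \<Longrightarrow>
    Pg u p * Pa u' p' = (if u = u' \<and> p = p' then V w else 0)"
proof (induction p arbitrary: u u' p')
  case Nil
  then show ?case by (auto simp: Pa_Nil Pg_Nil V_V awalk_simps)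
next
  case (Cons e p)
  then obtain f q where p': "p' = f # q" by (cases p') auto
  have e: "e \<in> arcs E" "u = tail E e" "awalk (head E e) p w"
    and f: "f \<in> arcs E" "u' = tail E f" "awalk (head E f) q w'"
    using Cons.prems by (auto simp: p' awalk_simps)
  have "Pg u (e # p) * Pa u' (f # q) = Pg (head E e) p * (G e * A f) * Pa (head E f) q"
    by (simp add: e f Pg_Cons Pa_Cons mult.assoc)
  also have "\<dots> = (if e = f then Pg (head E e) p * Pa (head E e) q else 0)"
    using V_Pa[OF f(3)] by (auto simp: G_A e f mult.assoc)
  also have "\<dots> = (if u = u' \<and> e # p = f # q then V w else 0)"
    using Cons.IH[of "head E e" "head E e" q] Cons.prems(3) e f by (auto simp: p')
  finally show ?case by (simp add: p')
qed

fun L :: "('v, 'e) lpa_gen \<Rightarrow> 'q" where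
  "L (Vertex v) = V v"
| "L (Edge e) = A e"
| "L (Ghost e) = G e"

definition monomials :: "int \<Rightarrow> 'q set" where
  "monomials n = {Pa u p * Pg u' p' | u p w u' p'. awalk u p w \<and> awalk u' p' w
     \<and> int (length p) - int (length p') = n}"

lemma monomialsI:
  "awalk u p w \<Longrightarrow> awalk u' p' w \<Longrightarrow> int (length p) - int (length p') = n \<Longrightarrow> Pa u p * Pg u' p' \<in> monomials n"
  unfolding monomials_def by blast

text \<open>The case with content is a ghost edge. It meets the first edge of the path part, with
  which it cancels or gives 0; if the path part is a vertex, a matching ghost edge is absorbed into
  the ghost part, since e^* \<beta>^* is the ghost of the longer path \<beta>e.\<close>

lemma L_mult_mono:
  assumes g: "g \<in> lpa_generators E" and x: "x \<in> monomials n"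
  shows "L g * x \<in> insert 0 (monomials (gdeg g + n))"
proof -
  obtain u p w u' p' where x: "x = Pa u p * Pg u' p'" "awalk u p w" "awalk u' p' w"
    "int (length p) - int (length p') = n"
    using x by (auto simp: monomials_def)
  show ?thesis
  proof (cases g)
    case (Vertex v)
    then have "v \<in> verts E" using g by (auto simp: lpa_generators_def)
    then show ?thesis
      using x by (auto simp: Vertex mult.assoc[symmetric] V_Pa intro: monomialsI)
  next
    case (Edge e)
    then have e: "e \<in> arcs E" using g by (auto simp: lpa_generators_def)
    have "A e * Pa u p = (if head E e = u then Pa (tail E e) (e # p) else 0)"
      using V_Pa[OF x(2), of "head E e"] e by (auto simp: Pa_Cons)
        (metis A_V mult.assoc mult_zero_right)
    moreover have "awalk (tail E e) (e # p) w" if "head E e = u"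
      using that e x by (simp add: awalk_simps)
    ultimately show ?thesis
      using x by (auto simp: Edge mult.assoc[symmetric] intro!: monomialsI)
  next
    case (Ghost e)
    then have e: "e \<in> arcs E" using g by (auto simp: lpa_generators_def)
    show ?thesis
    proof (cases p)
      case Nil
      then have u: "u = w" "u \<in> verts E" using x by (auto simp: awalk_simps)
      have "G e * x = (if u = tail E e then V (head E e) * Pg u' (p' @ [e]) else 0)"
        using G_V_if[OF e u(2)] V_G[OF e] Pg_snoc[of e u' p', symmetric]
        by (auto simp: x Nil Pa_Nil mult.assoc[symmetric])
      moreover have "V (head E e) * Pg u' (p' @ [e]) \<in> monomials (n - 1)" if "u = tail E e"
        using monomialsI[of "head E e" "[]" "head E e" u' "p' @ [e]" "n - 1"] awalk_snoc[of u' p' e] x e that u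
        by (simp add: Pa_Nil awalk_simps Nil)
      ultimately show ?thesis by (auto simp: Ghost)
    next
      case (Cons f q)
      then have f: "f \<in> arcs E" "u = tail E f" "awalk (head E f) q w"
        using x by (auto simp: awalk_simps)
      have "G e * x = (G e * A f) * Pa (head E f) q * Pg u' p'"
        by (simp add: x Cons f Pa_Cons mult.assoc)
      also have "\<dots> = (if e = f then Pa (head E f) q * Pg u' p' else 0)"
        using V_Pa[OF f(3)] by (simp add: G_A e f)
      finally show ?thesis
        using monomialsI[OF f(3) x(3), of "n - 1"] x(4) by (auto simp: Ghost Cons)
    qed
  qed
qed

lemma L_mono:
  assumes "g \<in> lpa_generators E"
  shows "L g \<in> monomials (gdeg g)"
proof (cases g)
  case (Vertex v)
  then have v: "awalk v [] v" using assms by (auto simp: awalk_simps lpa_generators_def)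
  then show ?thesis using monomialsI[OF v v, of 0] by (simp add: Vertex Pa_Nil Pg_Nil V_V awalk_simps)
next
  case (Edge e)
  then have e: "e \<in> arcs E" using assms by (auto simp: lpa_generators_def)
  then have "awalk (tail E e) [e] (head E e)" "awalk (head E e) [] (head E e)"
    by (auto simp: awalk_simps)
  from monomialsI[OF this, of 1] show ?thesis
    by (simp add: Edge Pa_Cons e Pa_Nil Pg_Nil A_V)
next
  case (Ghost e)
  then have e: "e \<in> arcs E" using assms by (auto simp: lpa_generators_def)
  then have "awalk (head E e) [] (head E e)" "awalk (tail E e) [e] (head E e)"
    by (auto simp: awalk_simps)
  from monomialsI[OF this, of "- 1"] show ?thesis
    using e by (simp add: Ghost Pg_Cons Pa_Nil Pg_Nil V_G mult.assoc[symmetric] V_V)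
qed

lemma word_mono:
  "ws \<noteq> [] \<Longrightarrow> set ws \<subseteq> lpa_generators E \<Longrightarrow>
    prod_list (map L ws) \<in> insert 0 (monomials (sum_list (map gdeg ws)))"
proof (induction ws rule: list_nonempty_induct)
  case (single g)
  then show ?case using L_mono by simp
next
  case (cons g ws)
  then have "prod_list (map L ws) \<in> insert 0 (monomials (sum_list (map gdeg ws)))"
    "g \<in> lpa_generators E"
    by auto
  then show ?case
    using L_mult_mono[of g "prod_list (map L ws)"] by auto
qed

subsection \<open>A filtration by the length of the ghost part\<close>

text \<open>Each path enters once, with one coefficient, so that a single coefficient can be
  isolated in \<open>path_span_nonzero\<close>. The length is compared with an integer because it is
  the degree; for negative \<open>n\<close> only 0 is left.\<close>

definition path_span :: "int \<Rightarrow> 'q set" where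
  "path_span n = {\<Sum>x\<in>F. c (\<kappa> x) * Pa (fst x) (snd x) | F \<kappa>. finite F
     \<and> (\<forall>x\<in>F. \<exists>w. awalk (fst x) (snd x) w \<and> int (length (snd x)) = n)}"

lemma path_span_zero: "0 \<in> path_span n"
  unfolding path_span_def by (rule CollectI, rule exI[of _ "{}"]) simp

lemma path_span_single:
  assumes "awalk u p w" "int (length p) = n"
  shows "c k * Pa u p \<in> path_span n"
  unfolding path_span_def using assms
  by (intro CollectI exI[of _ "{(u, p)}"] exI[of _ "\<lambda>_. k"]) auto

lemma path_span_add:
  assumes "a \<in> path_span n" "b \<in> path_span n"
  shows "a + b \<in> path_span n"
proof -
  obtain F \<kappa> where F: "a = (\<Sum>x\<in>F. c (\<kappa> x) * Pa (fst x) (snd x))" "finite F"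
    "\<forall>x\<in>F. \<exists>w. awalk (fst x) (snd x) w \<and> int (length (snd x)) = n"
    using assms(1) by (auto simp: path_span_def)
  obtain F' \<kappa>' where F': "b = (\<Sum>x\<in>F'. c (\<kappa>' x) * Pa (fst x) (snd x))" "finite F'"
    "\<forall>x\<in>F'. \<exists>w. awalk (fst x) (snd x) w \<and> int (length (snd x)) = n"
    using assms(2) by (auto simp: path_span_def)
  \<comment> \<open>Coefficients are extended by 0 to the union of the index sets, so that a path
    occurring in both sums still occurs once.\<close>
  let ?k = "\<lambda>x. if x \<in> F then \<kappa> x else 0" and ?k' = "\<lambda>x. if x \<in> F' then \<kappa>' x else 0"
  have "a = (\<Sum>x\<in>F \<union> F'. c (?k x) * Pa (fst x) (snd x))"
    unfolding F(1) using F(2) F'(2) by (intro sum.mono_neutral_cong_left) (auto simp: c_zero)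
  moreover have "b = (\<Sum>x\<in>F \<union> F'. c (?k' x) * Pa (fst x) (snd x))"
    unfolding F'(1) using F(2) F'(2) by (intro sum.mono_neutral_cong_left) (auto simp: c_zero)
  ultimately have "a + b = (\<Sum>x\<in>F \<union> F'. c (?k x + ?k' x) * Pa (fst x) (snd x))"
    by (simp add: sum.distrib c_add distrib_right)
  then show ?thesis
    unfolding path_span_def using F F'
    by (intro CollectI exI[of _ "F \<union> F'"] exI[of _ "\<lambda>x. ?k x + ?k' x"]) auto
qed

lemma path_span_induct [consumes 1, case_names zero add]:
  assumes "a \<in> path_span n" and "P 0"
    and "\<And>k u p w b. awalk u p w \<Longrightarrow> int (length p) = n \<Longrightarrow> b \<in> path_span n \<Longrightarrow> P b
      \<Longrightarrow> P (c k * Pa u p + b)"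
  shows "P a"
proof -
  obtain F \<kappa> where F: "a = (\<Sum>x\<in>F. c (\<kappa> x) * Pa (fst x) (snd x))" "finite F"
    "\<forall>x\<in>F. \<exists>w. awalk (fst x) (snd x) w \<and> int (length (snd x)) = n"
    using assms(1) by (auto simp: path_span_def)
  from F(2,3) have "P (\<Sum>x\<in>F. c (\<kappa> x) * Pa (fst x) (snd x))
    \<and> (\<Sum>x\<in>F. c (\<kappa> x) * Pa (fst x) (snd x)) \<in> path_span n"
  proof (induction F rule: finite_induct)
    case empty
    then show ?case using assms(2) path_span_zero by simp
  next
    case (insert x F)
    then obtain w where "awalk (fst x) (snd x) w" "int (length (snd x)) = n"
      by auto
    with insert show ?case
      using assms(3) path_span_single path_span_add by simp
  qed
  then show ?thesis by (simp add: F(1))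
qed

lemma path_span_mult_V: "a \<in> path_span n \<Longrightarrow> v \<in> verts E \<Longrightarrow> a * V v \<in> path_span n"
proof (induction rule: path_span_induct)
  case (add l u p w b)
  then show ?case
    using path_span_add[OF path_span_single[of u p w n l], of "b * V v"]
    by (auto simp: distrib_right mult.assoc Pa_V)
qed (simp add: path_span_zero)

lemma path_span_mult_A: "a \<in> path_span n \<Longrightarrow> e \<in> arcs E \<Longrightarrow> a * A e \<in> path_span (n + 1)"
proof (induction rule: path_span_induct)
  case (add l u p w b)
  then show ?case
    using path_span_add[OF path_span_single[of u "p @ [e]" "head E e" "n + 1" l], of "b * A e"]
      awalk_snoc[of u p e]
    by (auto simp: distrib_right mult.assoc Pa_A)
qed (simp add: path_span_zero)

text \<open>All paths in \<open>a\<close> have the same length, so multiplying on the left by the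
  ghost of one of them kills the others. The path \<open>p\<close> is taken from a nonzero
  summand.\<close>

lemma path_span_nonzero:
  assumes "a \<in> path_span n" "a \<noteq> 0"
  obtains u p w k where "awalk u p w" "k \<noteq> 0" "c k * V w \<noteq> 0" "Pg u p * a = c k * V w"
proof -
  obtain F \<kappa> where F: "a = (\<Sum>x\<in>F. c (\<kappa> x) * Pa (fst x) (snd x))" "finite F"
    "\<forall>x\<in>F. \<exists>w. awalk (fst x) (snd x) w \<and> int (length (snd x)) = n"
    using assms(1) by (auto simp: path_span_def)
  obtain y where y: "y \<in> F" "c (\<kappa> y) * Pa (fst y) (snd y) \<noteq> 0"
    using sum.not_neutral_contains_not_neutral assms(2) F(1) by blast
  obtain u p where up: "y = (u, p)" by fastforce
  obtain w where w: "awalk u p w" "int (length p) = n"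
    using F(3) y up by force
  have c_Pg: "Pg u' p' * c k = c k * Pg u' p'" for u' p' k
  proof -
    have "prod_list (map G q) * c k = c k * prod_list (map G q)" for q
      by (induction q) (simp_all add: mult.assoc[symmetric] c_G, simp add: mult.assoc)
    then show ?thesis
      by (simp add: Pg_def mult.assoc flip: c_V) (simp add: mult.assoc[symmetric])
  qed
  have "Pg u p * a = (\<Sum>x\<in>F. c (\<kappa> x) * (Pg u p * Pa (fst x) (snd x)))"
    by (simp add: F(1) sum_distrib_left mult.assoc[symmetric] c_Pg)
  also have "\<dots> = (\<Sum>x\<in>F. if x = y then c (\<kappa> y) * V w else 0)"
  proof (rule sum.cong[OF refl])
    fix x assume "x \<in> F"
    then obtain w' where "awalk (fst x) (snd x) w'" "int (length (snd x)) = n"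
      using F(3) by blast
    then show "c (\<kappa> x) * (Pg u p * Pa (fst x) (snd x)) = (if x = y then c (\<kappa> y) * V w else 0)"
      using Pg_Pa[OF w(1), of "fst x" "snd x" w'] w(2) by (cases x) (auto simp: up)
  qed
  also have "\<dots> = c (\<kappa> y) * V w"
    using y F(2) by simp
  finally have 1: "Pg u p * a = c (\<kappa> y) * V w" .
  \<comment> \<open>Multiplying back by \<open>Pa u p\<close> would otherwise make the chosen
    summand 0.\<close>
  have 2: "c (\<kappa> y) * V w \<noteq> 0"
  proof
    assume "c (\<kappa> y) * V w = 0"
    moreover have "c (\<kappa> y) * Pa u p = Pa u p * (c (\<kappa> y) * V w)"
    proof -
      have "prod_list (map A q) * c k = c k * prod_list (map A q)" for q k
        by (induction q) (simp_all add: mult.assoc[symmetric] c_A, simp add: mult.assoc)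
      then have "Pa u p * c k = c k * Pa u p" for k
        by (simp add: Pa_def mult.assoc) (simp add: mult.assoc[symmetric] c_V)
      then show ?thesis
        using Pa_V[OF w(1), of w] awalk_last_in_verts[OF w(1)] by (metis mult.assoc)
    qed
    ultimately show False using y(2) up by simp
  qed
  have "\<kappa> y \<noteq> 0"
    using 2 c_zero by auto
  show thesis by (rule that[OF w(1) \<open>\<kappa> y \<noteq> 0\<close> 2 1])
qed

text \<open>Elements of degree \<open>n\<close> that admit a presentation with ghost parts of length
  at most \<open>m\<close>. The rightmost ghost edge is split off, because \<open>reduction\<close>
  multiplies by edges from the right; its coefficient \<open>h e\<close> has degree
  \<open>n + 1\<close> since a ghost edge has degree -1. The definition goes by presentations
  because the spanning products may be dependent.\<close>

primrec filt :: "nat \<Rightarrow> int \<Rightarrow> 'q set" where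
  "filt 0 n = path_span n"
| "filt (Suc m) n = {b + (\<Sum>e\<in>D. h e * G e) | b D h. b \<in> path_span n \<and> finite D \<and> D \<subseteq> arcs E
     \<and> (\<forall>e\<in>D. h e \<in> filt m (n + 1))}"

declare filt.simps(2) [simp del]

lemma filt_SucE:
  assumes "a \<in> filt (Suc m) n"
  obtains b D h where "a = b + (\<Sum>e\<in>D. h e * G e)" "b \<in> path_span n" "finite D"
    "D \<subseteq> arcs E" "\<forall>e\<in>D. h e \<in> filt m (n + 1)"
  using assms unfolding filt.simps by blast

lemma filt_SucI:
  "b \<in> path_span n \<Longrightarrow> finite D \<Longrightarrow> D \<subseteq> arcs E \<Longrightarrow> (\<And>e. e \<in> D \<Longrightarrow> h e \<in> filt m (n + 1)) \<Longrightarrow>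
    b + (\<Sum>e\<in>D. h e * G e) \<in> filt (Suc m) n"
  unfolding filt.simps by (intro CollectI exI[of _ b] exI[of _ D] exI[of _ h]) auto

lemma path_span_filt: "a \<in> path_span n \<Longrightarrow> a \<in> filt m n"
  using filt_SucI[of a n "{}"] by (cases m) simp_all

lemma filt_zero: "0 \<in> filt m n"
  by (rule path_span_filt[OF path_span_zero])

lemma filt_add: "a \<in> filt m n \<Longrightarrow> b \<in> filt m n \<Longrightarrow> a + b \<in> filt m n"
proof (induction m arbitrary: a b n)
  case 0
  then show ?case by (simp add: path_span_add)
next
  case (Suc m)
  obtain a0 D h where a: "a = a0 + (\<Sum>e\<in>D. h e * G e)" "a0 \<in> path_span n" "finite D"
    "D \<subseteq> arcs E" "\<forall>e\<in>D. h e \<in> filt m (n + 1)"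
    using Suc.prems(1) by (rule filt_SucE)
  obtain b0 D' h' where b: "b = b0 + (\<Sum>e\<in>D'. h' e * G e)" "b0 \<in> path_span n" "finite D'"
    "D' \<subseteq> arcs E" "\<forall>e\<in>D'. h' e \<in> filt m (n + 1)"
    using Suc.prems(2) by (rule filt_SucE)
  let ?h = "\<lambda>x. if x \<in> D then h x else 0" and ?h' = "\<lambda>x. if x \<in> D' then h' x else 0"
  have "(\<Sum>e\<in>D. h e * G e) = (\<Sum>e\<in>D \<union> D'. ?h e * G e)"
    using a b by (intro sum.mono_neutral_cong_left) auto
  moreover have "(\<Sum>e\<in>D'. h' e * G e) = (\<Sum>e\<in>D \<union> D'. ?h' e * G e)"
    using a b by (intro sum.mono_neutral_cong_left) auto
  ultimately have ab: "a + b = (a0 + b0) + (\<Sum>e\<in>D \<union> D'. (?h e + ?h' e) * G e)"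
    by (simp add: a(1) b(1) sum.distrib distrib_right)
  have "?h e + ?h' e \<in> filt m (n + 1)" if "e \<in> D \<union> D'" for e
    using that a b Suc.IH[of "h e" "n + 1" "h' e"] by auto
  then show ?case
    unfolding ab using a b by (intro filt_SucI path_span_add) auto
qed

lemma filt_Suc: "a \<in> filt m n \<Longrightarrow> a \<in> filt (Suc m) n"
proof (induction m arbitrary: a n)
  case 0
  then show ?case by (simp add: path_span_filt)
next
  case (Suc m)
  obtain a0 D h where a: "a = a0 + (\<Sum>e\<in>D. h e * G e)" "a0 \<in> path_span n" "finite D"
    "D \<subseteq> arcs E" "\<forall>e\<in>D. h e \<in> filt m (n + 1)"
    using Suc.prems by (rule filt_SucE)
  have "h e \<in> filt (Suc m) (n + 1)" if "e \<in> D" for e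
    using Suc.IH a(5) that by blast
  then show ?case
    unfolding a(1) by (intro filt_SucI a(2-4))
qed

lemma filt_mono: "a \<in> filt m n \<Longrightarrow> m \<le> m' \<Longrightarrow> a \<in> filt m' n"
  by (induction m' rule: nat_induct) (auto simp: le_Suc_eq intro: filt_Suc)

lemma filt_mult_V: "a \<in> filt m n \<Longrightarrow> v \<in> verts E \<Longrightarrow> a * V v \<in> filt m n"
proof (cases m)
  case (Suc m')
  assume am: "a \<in> filt m n" and v: "v \<in> verts E"
  obtain a0 D h where a: "a = a0 + (\<Sum>e\<in>D. h e * G e)" "a0 \<in> path_span n" "finite D"
    "D \<subseteq> arcs E" "\<forall>e\<in>D. h e \<in> filt m' (n + 1)"
    using am unfolding Suc by (rule filt_SucE)
  have "(\<Sum>e\<in>D. h e * G e) * V v = (\<Sum>e\<in>D. (if v = tail E e then h e else 0) * G e)"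
    unfolding sum_distrib_right
    using a(4) v by (intro sum.cong) (auto simp: mult.assoc G_V_if)
  then have "a * V v = a0 * V v + (\<Sum>e\<in>D. (if v = tail E e then h e else 0) * G e)"
    by (simp add: a(1) distrib_right)
  then show ?thesis
    unfolding Suc using a v by (auto intro!: filt_SucI path_span_mult_V filt_zero)
qed (simp add: path_span_mult_V)

text \<open>The edge lengthens the paths without ghost part and, among the other summands, leaves
  only the one for \<open>e\<close>, from which it removes the ghost edge.\<close>

lemma filt_mult_A:
  assumes "a \<in> filt (Suc m) n" "e \<in> arcs E"
  shows "a * A e \<in> filt m (n + 1)"
proof -
  obtain a0 D h where a: "a = a0 + (\<Sum>f\<in>D. h f * G f)" "a0 \<in> path_span n" "finite D"
    "D \<subseteq> arcs E" "\<forall>f\<in>D. h f \<in> filt m (n + 1)"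
    using assms(1) by (rule filt_SucE)
  have "(\<Sum>f\<in>D. h f * G f) * A e = (\<Sum>f\<in>D. if f = e then h e * V (head E e) else 0)"
    unfolding sum_distrib_right
    using a(4) assms(2) by (intro sum.cong) (auto simp: mult.assoc G_A)
  then have "a * A e = a0 * A e + (if e \<in> D then h e * V (head E e) else 0)"
    using a(3) by (simp add: a(1) distrib_right)
  then show ?thesis
    using a(2-5) assms(2)
    by (auto intro!: filt_add path_span_filt[OF path_span_mult_A] filt_mult_V)
qed

lemma mono_filt:
  "awalk u p w \<Longrightarrow> awalk u' p' w \<Longrightarrow> int (length p) - int (length p') = n \<Longrightarrow>
    c k * (Pa u p * Pg u' p') \<in> filt (length p') n"
proof (induction p' arbitrary: u' n)
  case Nil
  then show ?case
    using path_span_single[of u p w n k] Pa_V[of u p w w]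
    by (auto simp: Pg_Nil awalk_simps dest: awalk_last_in_verts)
next
  case (Cons e p')
  then have e: "e \<in> arcs E" "u' = tail E e" "awalk (head E e) p' w"
    by (auto simp: awalk_simps)
  have "c k * (Pa u p * Pg u' (e # p')) = 0 + (\<Sum>f\<in>{e}. c k * (Pa u p * Pg (head E e) p') * G f)"
    by (simp add: e Pg_Cons mult.assoc)
  moreover have "c k * (Pa u p * Pg (head E e) p') \<in> filt (length p') (n + 1)"
    using Cons.IH[OF Cons.prems(1) e(3), of "n + 1"] Cons.prems(3) by simp
  ultimately show ?case
    using filt_SucI[OF path_span_zero, of "{e}" "\<lambda>_. c k * (Pa u p * Pg (head E e) p')" "length p'" n] e
    by simp
qed

text \<open>The vertices at which the summands end act on \<open>a\<close> as a right unit;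
  \<open>reduction\<close> uses this to find a vertex that does not annihilate \<open>a\<close> from
  the right.\<close>

lemma filt_right_unit:
  assumes "a \<in> filt m n"
  shows "\<exists>W. finite W \<and> W \<subseteq> verts E \<and> a = (\<Sum>v\<in>W. a * V v)"
proof -
  define U where "U W a \<longleftrightarrow> a * sum V W = a" for W a
  have VU: "V v * sum V W = V v" if "v \<in> W" "finite W" "W \<subseteq> verts E" for v W
  proof -
    have "V v * sum V W = (\<Sum>w\<in>W. if w = v then V v else 0)"
      unfolding sum_distrib_left using that by (intro sum.cong) (auto simp: V_V subset_iff)
    then show ?thesis using that by simp
  qed
  \<comment> \<open>Stated for all larger finite vertex sets, so that the sets of the summands can
    be united.\<close>
  have ps: "\<exists>W. finite W \<and> W \<subseteq> verts E \<and> (\<forall>W'. finite W' \<longrightarrow> W \<subseteq> W' \<longrightarrow> W' \<subseteq> verts E \<longrightarrow> U W' b)"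
    if "b \<in> path_span n" for b
    using that
  proof (induction rule: path_span_induct)
    case zero
    then show ?case by (auto simp: U_def intro!: exI[of _ "{}"])
  next
    case (add k u p w b)
    then obtain W where W: "finite W" "W \<subseteq> verts E"
      "\<forall>W'. finite W' \<longrightarrow> W \<subseteq> W' \<longrightarrow> W' \<subseteq> verts E \<longrightarrow> U W' b"
      by blast
    have w: "w \<in> verts E" using add awalk_last_in_verts by blast
    have "U W' (c k * Pa u p + b)" if "finite W'" "insert w W \<subseteq> W'" "W' \<subseteq> verts E" for W'
    proof -
      have "Pa u p * sum V W' = Pa u p * (V w * sum V W')"
        using Pa_V[OF add(1) w] by (simp add: mult.assoc[symmetric])
      also have "\<dots> = Pa u p"
        using VU[of w W'] that Pa_V[OF add(1) w] by simp
      finally show ?thesis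
        using W(3) that by (simp add: U_def distrib_right mult.assoc)
    qed
    then show ?case
      using W w by (intro exI[of _ "insert w W"]) auto
  qed
  have "\<exists>W. finite W \<and> W \<subseteq> verts E \<and> U W a"
  proof (cases m)
    case 0
    then show ?thesis using ps[of a] assms by simp blast
  next
    case (Suc m')
    then obtain a0 D h where a: "a = a0 + (\<Sum>e\<in>D. h e * G e)" "a0 \<in> path_span n" "finite D"
      "D \<subseteq> arcs E"
      using assms filt_SucE[of a m' n] by metis
    obtain W where W: "finite W" "W \<subseteq> verts E"
      "\<forall>W'. finite W' \<longrightarrow> W \<subseteq> W' \<longrightarrow> W' \<subseteq> verts E \<longrightarrow> U W' a0"
      using ps[OF a(2)] by blast
    let ?W = "W \<union> tail E ` D"
    have sub: "finite ?W" "?W \<subseteq> verts E"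
      using W a by (auto intro: tail_in_verts)
    have "h e * G e * sum V ?W = h e * G e" if "e \<in> D" for e
    proof -
      have "G e * sum V ?W = G e * (V (tail E e) * sum V ?W)"
        using that a G_V[of e] by (metis mult.assoc subsetD)
      then show ?thesis
        using VU[of "tail E e" ?W] that sub a(4) G_V[of e] by (auto simp: mult.assoc)
    qed
    then have "U ?W a"
      using W(3) sub by (simp add: U_def a(1) distrib_right sum_distrib_right)
    then show ?thesis
      using sub by blast
  qed
  then show ?thesis
    by (auto simp: U_def sum_distrib_left)
qed

text \<open>Products of generators. With multipliers of this kind in \<open>reduction\<close>, every
  multiplication has a representative in the free algebra and can be carried out inside an ideal
  there.\<close>

inductive_set wds :: "'q set" where
  "g \<in> lpa_generators E \<Longrightarrow> L g \<in> wds"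
| "x \<in> wds \<Longrightarrow> y \<in> wds \<Longrightarrow> x * y \<in> wds"

lemma wds_gens: "v \<in> verts E \<Longrightarrow> V v \<in> wds" "e \<in> arcs E \<Longrightarrow> A e \<in> wds" "e \<in> arcs E \<Longrightarrow> G e \<in> wds"
  using wds.intros(1)[of "Vertex v"] wds.intros(1)[of "Edge e"] wds.intros(1)[of "Ghost e"]
  by (auto simp: lpa_generators_def)

lemma Pg_wds: "awalk u p w \<Longrightarrow> Pg u p \<in> wds"
proof (induction p arbitrary: u)
  case Nil
  then show ?case by (auto simp: Pg_Nil awalk_simps intro: wds_gens)
next
  case (Cons e p)
  then show ?case by (auto simp: Pg_Cons awalk_simps intro!: wds.intros(2) wds_gens)
qed

text \<open>
  A nonzero homogeneous element is moved to a nonzero multiple of a vertex: multiplying by an edge on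
  the right shortens the ghost parts, until the paths without ghost part can be separated, which works
  because by homogeneity they all have the same length.
\<close>

theorem reduction:
  "a \<in> filt m n \<Longrightarrow> a \<noteq> 0 \<Longrightarrow> \<exists>x\<in>wds. \<exists>y\<in>wds. \<exists>k v. k \<noteq> 0 \<and> v \<in> verts E \<and> x * a * y = c k * V v"
proof (induction m arbitrary: a n)
  case 0
  then have "a \<in> path_span n" by simp
  then obtain u p w k where *: "awalk u p w" "k \<noteq> 0" "c k * V w \<noteq> 0" "Pg u p * a = c k * V w"
    using 0(2) by (rule path_span_nonzero)
  then have w: "w \<in> verts E" using awalk_last_in_verts by blast
  have "Pg u p * a * V w = c k * V w"
    using w by (simp add: * mult.assoc V_V)
  then show ?case
    using * w Pg_wds wds_gens by blast
next
  case (Suc m)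
  obtain W where W: "finite W" "W \<subseteq> verts E" "a = (\<Sum>v\<in>W. a * V v)"
    using filt_right_unit[OF Suc.prems(1)] by blast
  have "\<exists>w0\<in>W. a * V w0 \<noteq> 0"
  proof (rule ccontr)
    assume "\<not> ?thesis"
    then have "(\<Sum>v\<in>W. a * V v) = 0"
      by (intro sum.neutral) blast
    then show False
      using W(3) Suc.prems(2) by (metis (no_types))
  qed
  \<comment> \<open>Cutting down to one vertex \<open>w0\<close> keeps only ghost edges of edges
    that leave \<open>w0\<close>; from here on it matters which edges leave
    \<open>w0\<close>.\<close>
  then obtain w0 where w0: "w0 \<in> verts E" "a * V w0 \<noteq> 0"
    using W(2) by blast
  obtain b D h where a: "a = b + (\<Sum>e\<in>D. h e * G e)" "b \<in> path_span n" "finite D"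
    "D \<subseteq> arcs E" "\<forall>e\<in>D. h e \<in> filt m (n + 1)"
    using Suc.prems(1) by (rule filt_SucE)
  define D0 where "D0 = {e \<in> D. tail E e = w0}"
  have D0: "finite D0" "D0 \<subseteq> out_arcs E w0"
    using a by (auto simp: D0_def)
  have "(\<Sum>e\<in>D. h e * G e) * V w0 = (\<Sum>e\<in>D0. h e * G e)"
    unfolding sum_distrib_right D0_def using a(3,4) w0(1)
    by (intro sum.mono_neutral_cong_right) (auto simp: mult.assoc G_V_if subset_iff)
  then have aV: "a * V w0 = b * V w0 + (\<Sum>e\<in>D0. h e * G e)"
    by (simp add: a(1) distrib_right)
  \<comment> \<open>An edge \<open>e\<close> with \<open>a * A e\<close> nonzero suffices, as right
    multiplication by \<open>A e\<close> lowers the ghost length.\<close>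
  have IH: ?case if e: "e \<in> out_arcs E w0" "a * A e \<noteq> 0" for e
  proof -
    have e': "e \<in> arcs E" using e by auto
    obtain x y k v where "x \<in> wds" "y \<in> wds" "k \<noteq> 0" "v \<in> verts E" "x * (a * A e) * y = c k * V v"
      using Suc.IH[OF filt_mult_A[OF Suc.prems(1) e'] e(2)] by blast
    then show ?thesis
      using wds.intros(2)[OF wds_gens(2)[OF e'], of y] by (auto simp: mult.assoc)
  qed
  have pre: "a * V w0 * A e = a * A e" if "e \<in> out_arcs E w0" for e
    using that V_A[of e] by (auto simp: mult.assoc)
  show ?case
  \<comment> \<open>Without a path part at \<open>w0\<close> some \<open>h e * G e\<close> is
    nonzero. It equals \<open>a * A e * G e\<close>, so \<open>a * A e\<close> is nonzero.\<close>
  proof (cases "b * V w0 = 0")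
    case True
    then have "\<exists>e\<in>D0. h e * G e \<noteq> 0"
      using w0(2) unfolding aV by (metis (no_types, lifting) add_0 sum.neutral)
    then obtain e where e: "e \<in> D0" "h e * G e \<noteq> 0"
      by blast
    have "a * A e = (\<Sum>f\<in>D0. h f * G f * A e)"
      using pre[of e] D0 e by (auto simp: aV True sum_distrib_right)
    also have "\<dots> = (\<Sum>f\<in>D0. if f = e then h e * V (head E e) else 0)"
      using D0 e by (intro sum.cong) (auto simp: mult.assoc G_A subset_iff)
    also have "\<dots> = h e * V (head E e)"
      using D0 e by simp
    finally have "a * A e * G e = h e * G e"
      using V_G[of e] e D0 by (auto simp: mult.assoc subset_iff)
    then have "a * A e \<noteq> 0"
      using e by auto
    then show ?thesis
      using IH e D0 by blast
  next
    case False
    obtain u p w k where *: "awalk u p w" "k \<noteq> 0" "c k * V w \<noteq> 0" "Pg u p * (b * V w0) = c k * V w"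
      by (rule path_span_nonzero[OF path_span_mult_V[OF a(2) w0(1)] False])
    have w: "w \<in> verts E" using * awalk_last_in_verts by blast
    have "c k * V w * V w0 = Pg u p * (b * (V w0 * V w0))"
      unfolding *(4)[symmetric] by (simp add: mult.assoc)
    also have "\<dots> = c k * V w"
      using * w0 by (simp add: V_V)
    finally have [simp]: "w = w0"
      using *(3) V_V[OF w w0(1)] by (auto simp: mult.assoc split: if_splits)
    show ?thesis
    \<comment> \<open>An edge \<open>f\<close> that leaves \<open>w0\<close> and lies outside
      \<open>D0\<close> kills all ghost summands and keeps the path part, which the ghosts of
      \<open>p\<close> and \<open>f\<close> then turn into a multiple of a vertex. Otherwise only
      finitely many edges leave \<open>w0\<close>.\<close>
    proof (cases "out_arcs E w0 \<subseteq> D0")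
      case False
      then obtain f where "f \<in> out_arcs E w0" "f \<notin> D0" by blast
      then have f: "f \<in> arcs E" "tail E f = w0" "f \<notin> D0" by auto
      have "(\<Sum>e\<in>D0. h e * G e) * A f = 0"
        unfolding sum_distrib_right using f D0
        by (intro sum.neutral) (auto simp: mult.assoc G_A subset_iff)
      then have "a * A f = b * V w0 * A f"
        using pre[of f] f by (simp add: aV distrib_right)
      then have "(G f * Pg u p) * a * A f = G f * (Pg u p * (b * V w0)) * A f"
        by (simp add: mult.assoc)
      also have "\<dots> = G f * c k * (V (tail E f) * A f)"
        by (simp add: * f mult.assoc)
      also have "\<dots> = c k * V (head E f)"
        using V_A[OF f(1)] G_A[OF f(1,1)] by (simp add: c_G[symmetric] mult.assoc)
      finally show ?thesis
        using *(2) wds.intros(2)[OF wds_gens(3)[OF f(1)] Pg_wds[OF *(1)]] wds_gens(2)[OF f(1)]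
          head_in_verts[OF f(1)] by blast
    next
      case True
      show ?thesis
      \<comment> \<open>At a sink there is no ghost summand. At a regular \<open>w0\<close> the
        relation \<open>CK\<close> expands \<open>a * V w0\<close> over the edges \<open>e\<close>
        leaving \<open>w0\<close>, so some \<open>a * A e\<close> is nonzero.\<close>
      proof (cases "out_arcs E w0 = {}")
        case True
        then have "a * V w0 = b * V w0"
          using D0 aV by auto
        then have "Pg u p * a * V w0 = c k * V w0"
          using * by (simp add: mult.assoc)
        then show ?thesis
          using *(2) w0(1) Pg_wds[OF *(1)] wds_gens(1)[OF w0(1)] by blast
      next
        case False
        then have "w0 \<in> regular_vertices E"
          using True D0 w0 finite_subset by (auto simp: regular_vertices_def)
        then have "a * V w0 = (\<Sum>e\<in>out_arcs E w0. a * A e * G e)"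
          by (simp add: CK sum_distrib_left mult.assoc)
        then have "\<exists>e\<in>out_arcs E w0. a * A e * G e \<noteq> 0"
          using w0(2) by (metis (no_types, lifting) sum.neutral)
        then obtain e where "e \<in> out_arcs E w0" "a * A e * G e \<noteq> 0"
          by blast
        then have "a * A e \<noteq> 0"
          by auto
        with \<open>e \<in> out_arcs E w0\<close> show ?thesis
          by (rule IH)
      qed
    qed
  qed
qed

end

subsection \<open>Graded ideals contain vertices\<close>

lemma cls_single:
  "cls J (Poly_Mapping.single (Word ws) k) = cls J (cst k) * prod_list (map (\<lambda>g. cls J (gen g)) ws)"
proof (induction ws)
  case Nil
  then show ?case by (simp add: single_Word_Nil)
next
  case (Cons g ws)
  have "cls J (gen g) * cls J (cst k) = cls J (cst k) * cls J (gen g)"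
    by (simp flip: cls_mult add: cst_commute)
  then show ?case
    by (simp add: single_Word_Cons[of g ws k] cls_mult Cons mult.assoc[symmetric])
qed

lemma cst_in_ideal: "two_sided J \<Longrightarrow> k \<noteq> 0 \<Longrightarrow> cst k * f \<in> J \<Longrightarrow> f \<in> J"
  using two_sided_mult_left[of J "cst k * f" "cst (inverse k)"] by (simp add: cst_inverse)

lemma family_L_cls:
  assumes "leavitt_family E c (\<lambda>v. cls J (gen (Vertex v))) (\<lambda>e. cls J (gen (Edge e)))
    (\<lambda>e. cls J (gen (Ghost e)))"
  shows "leavitt_family.L (\<lambda>v. cls J (gen (Vertex v))) (\<lambda>e. cls J (gen (Edge e)))
    (\<lambda>e. cls J (gen (Ghost e))) = (\<lambda>g. cls J (gen g))"
proof
  interpret leavitt_family E c "\<lambda>v. cls J (gen (Vertex v))" "\<lambda>e. cls J (gen (Edge e))"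
    "\<lambda>e. cls J (gen (Ghost e))"
    by fact
  show "L g = cls J (gen g)" for g
    by (cases g) simp_all
qed

text \<open>Carries \<open>word_mono\<close> over to the free algebra; a word with a foreign letter
  is 0 modulo the kernel.\<close>

lemma word_in_monomials:
  assumes fam: "family_of E gen J" and J: "two_sided J" "lpa_kernel E \<subseteq> J" and ws: "ws \<noteq> []"
  shows "cls J (Poly_Mapping.single (Word ws) k) \<in> insert 0 ((*) (cls J (cst k)) `
    leavitt_family.monomials E (\<lambda>v. cls J (gen (Vertex v))) (\<lambda>e. cls J (gen (Edge e)))
      (\<lambda>e. cls J (gen (Ghost e))) (wdeg (Word ws)))"
proof -
  interpret leavitt_family E "\<lambda>k. cls J (cst k)" "\<lambda>v. cls J (gen (Vertex v))"
    "\<lambda>e. cls J (gen (Edge e))" "\<lambda>e. cls J (gen (Ghost e))"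
    using fam by (simp add: family_of_def)
  have L: "L = (\<lambda>g. cls J (gen g))"
    by (rule family_L_cls) (use fam in \<open>simp add: family_of_def\<close>)
  show ?thesis
  proof (cases "set ws \<subseteq> lpa_generators E")
    case True
    then show ?thesis
      using word_mono[OF ws True] by (auto simp: cls_single[of J ws k] L wdeg_def)
  next
    case False
    then obtain g where g: "g \<in> set ws" "g \<notin> lpa_generators E" by blast
    then have "gen g \<in> lpa_kernel E"
      by (auto simp: lpa_kernel_def intro: hull_mem)
    then have "cls J (gen g) = 0"
      using J cls_eq_0_iff by blast
    then have "0 \<in> set (map (\<lambda>g. cls J (gen g)) ws)"
      using g(1) by force
    moreover have "prod_list xs = 0" if "0 \<in> set xs" for xs :: "(('a, 'b) lpa_gen word \<Rightarrow>\<^sub>0 'c) quo list"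
      using that by (induction xs) auto
    ultimately show ?thesis
      by (simp add: cls_single[of J ws k])
  qed
qed

text \<open>Some component of \<open>f\<close> is nonzero modulo the kernel, and the multiplications
  that move it to a vertex stay inside \<open>J\<close>. Applied to preimages under substitutions,
  this shows that a graded map whose kernel contains no vertex is injective.\<close>

theorem graded_ideal_contains_vertex:
  assumes wf: "wf_digraph E" and J: "two_sided J" "lpa_kernel E \<subseteq> J" "J \<subseteq> augmentation_ideal"
    "homogeneous J" and f: "f \<in> J" "f \<notin> lpa_kernel E"
  shows "\<exists>v\<in>verts E. gen (Vertex v) \<in> J"
proof -
  let ?N = "lpa_kernel E"
  have fam: "family_of E gen ?N"
    by (rule family_of_gen[OF wf two_sided_kernel]) simp
  interpret leavitt_family E "\<lambda>k. cls ?N (cst k)" "\<lambda>v. cls ?N (gen (Vertex v))"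
    "\<lambda>e. cls ?N (gen (Edge e))" "\<lambda>e. cls ?N (gen (Ghost e))"
    using fam by (simp add: family_of_def)
  have L: "L = (\<lambda>g. cls ?N (gen g))"
    by (rule family_L_cls) (use fam in \<open>simp add: family_of_def\<close>)
  obtain n where n: "hpart n f \<notin> ?N"
    using f(2) two_sided_sum[OF two_sided_kernel] hpart_expansion[of f] by metis
  define g where "g = hpart n f"
  have g: "g \<in> J" "g \<notin> ?N"
    using J(4) f(1) n by (auto simp: homogeneous_def g_def)
  have "\<exists>m. cls ?N g \<in> filt m n"
  proof (induction g rule: free_induct_on)
    case zero
    then show ?case using filt_zero by auto
  next
    case (single ws k)
    \<comment> \<open>\<open>J\<close> contains no constant terms, so the words that occur are
      nonempty.\<close>
    then have "wdeg (Word ws) = n" "Word ws \<noteq> 0"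
      using g(1) J(3) by (auto simp: g_def keys_hpart augmentation_ideal_def in_keys_iff hpart.rep_eq split: if_splits)
    then have "cls ?N (Poly_Mapping.single (Word ws) k) \<in> insert 0 ((*) (cls ?N (cst k)) ` monomials n)"
      using word_in_monomials[OF fam two_sided_kernel order_refl, of ws k] by (auto simp: zero_word_def)
    then show ?case
      unfolding monomials_def
      by (elim insertE imageE CollectE exE conjE) (auto intro: filt_zero mono_filt)
  next
    case (add f g)
    then obtain m m' where "cls ?N f \<in> filt m n" "cls ?N g \<in> filt m' n" by blast
    then have "cls ?N f \<in> filt (max m m') n" "cls ?N g \<in> filt (max m m') n"
      by (auto intro: filt_mono)
    then show ?case
      using filt_add[of "cls ?N f"] unfolding cls_add by blast
  qed
  moreover have "cls ?N g \<noteq> 0"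
    using g(2) cls_eq_0_iff[OF two_sided_kernel] by blast
  ultimately obtain x y k v where *: "x \<in> wds" "y \<in> wds" "k \<noteq> 0" "v \<in> verts E"
    "x * cls ?N g * y = cls ?N (cst k) * cls ?N (gen (Vertex v))"
    using reduction by blast
  \<comment> \<open>The multipliers lift to polynomials, so the equation modulo the kernel becomes
    one modulo \<open>J\<close>.\<close>
  have "\<exists>x'. x = cls ?N x'" if "x \<in> wds" for x
    using that
  proof induction
    case (2 x y)
    then show ?case by (metis cls_mult)
  qed (auto simp: L)
  then obtain x' y' where "x = cls ?N x'" "y = cls ?N y'"
    using *(1,2) by blast
  then have "cls ?N (x' * g * y') = cls ?N (cst k * gen (Vertex v))"
    using *(5) by (simp add: cls_mult)
  then have "x' * g * y' - cst k * gen (Vertex v) \<in> J"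
    using cls_eq_iff[OF two_sided_kernel] J(2) by blast
  moreover have "x' * g * y' \<in> J"
    using g(1) J(1) by (simp add: two_sided_closed)
  ultimately have "cst k * gen (Vertex v) \<in> J"
    using two_sided_mem_cong[OF J(1)] by blast
  then show ?thesis
    using *(3,4) cst_in_ideal[OF J(1)] by blast
qed

section \<open>The quotient graph and both directions of the canonical map\<close>

section \<open>The quotient graph\<close>

lemma family_of_restrict:
  assumes "leavitt_family E (\<lambda>k. cls J (cst k)) V A G"
    and V: "\<And>v. v \<in> verts E \<Longrightarrow> cls J (\<sigma> (Vertex v)) = V v"
    and A: "\<And>e. e \<in> arcs E \<Longrightarrow> cls J (\<sigma> (Edge e)) = A e"
    and G: "\<And>e. e \<in> arcs E \<Longrightarrow> cls J (\<sigma> (Ghost e)) = G e"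
  shows "family_of E \<sigma> J"
proof -
  interpret leavitt_family E "\<lambda>k. cls J (cst k)" V A G by fact
  show ?thesis
  proof (rule family_ofI)
    fix v assume v: "v \<in> regular_vertices E"
    have "(\<Sum>e\<in>out_arcs E v. cls J (\<sigma> (Edge e)) * cls J (\<sigma> (Ghost e))) = (\<Sum>e\<in>out_arcs E v. A e * G e)"
      by (rule sum.cong) (auto simp: A G)
    then show "cls J (\<sigma> (Vertex v)) = (\<Sum>e\<in>out_arcs E v. cls J (\<sigma> (Edge e)) * cls J (\<sigma> (Ghost e)))"
      using v CK[OF v] by (simp add: V regular_vertices_def)
  qed (auto simp: V A G V_V V_A A_V V_G G_V G_A tail_in_verts head_in_verts wf_digraph_axioms)
qed

context leavitt_family
begin

text \<open>This is v - v^H. When finitely many edges from \<open>v\<close> avoid \<open>H\<close>,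
  it is an idempotent below \<open>v\<close> that fixes these edges and kills all others.\<close>

definition av :: "'v set \<Rightarrow> 'v \<Rightarrow> 'q" where
  "av H v = (\<Sum>e\<in>out_arcs_avoiding E H v. A e * G e)"

lemma V_av: "v \<in> verts E \<Longrightarrow> w \<in> verts E \<Longrightarrow> V w * av H v = (if w = v then av H v else 0)"
  unfolding av_def sum_distrib_left
  by (auto simp: out_arcs_avoiding_def mult.assoc[symmetric] V_A_if intro!: sum.cong sum.neutral)

lemma av_V: "v \<in> verts E \<Longrightarrow> w \<in> verts E \<Longrightarrow> av H v * V w = (if w = v then av H v else 0)"
  unfolding av_def sum_distrib_right
  by (auto simp: out_arcs_avoiding_def mult.assoc G_V_if intro!: sum.cong sum.neutral)

lemma av_A:
  assumes "e \<in> arcs E" "finite (out_arcs_avoiding E H v)"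
  shows "av H v * A e = (if e \<in> out_arcs_avoiding E H v then A e else 0)"
proof -
  have "av H v * A e = (\<Sum>f\<in>out_arcs_avoiding E H v. if f = e then A e else 0)"
    unfolding av_def sum_distrib_right using assms(1)
    by (intro sum.cong) (auto simp: out_arcs_avoiding_def mult.assoc G_A A_V)
  then show ?thesis using assms(2) by simp
qed

lemma G_av:
  assumes "e \<in> arcs E" "finite (out_arcs_avoiding E H v)"
  shows "G e * av H v = (if e \<in> out_arcs_avoiding E H v then G e else 0)"
proof -
  have "G e * av H v = (\<Sum>f\<in>out_arcs_avoiding E H v. if f = e then G e else 0)"
    unfolding av_def sum_distrib_left using assms(1)
    by (intro sum.cong) (auto simp: out_arcs_avoiding_def mult.assoc[symmetric] G_A V_G)
  then show ?thesis using assms(2) by simp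
qed

lemma av_av:
  assumes "finite (out_arcs_avoiding E H v)"
  shows "av H v * av H v = av H v"
proof -
  have "av H v * av H v = (\<Sum>e\<in>out_arcs_avoiding E H v. (av H v * A e) * G e)"
    by (subst (2) av_def) (simp add: sum_distrib_left mult.assoc)
  also have "\<dots> = av H v"
    unfolding av_def[of H v, symmetric]
    by (subst (2) av_def) (use assms in \<open>auto simp: av_A out_arcs_avoiding_def intro!: sum.cong\<close>)
  finally show ?thesis .
qed

lemma av_orth:
  assumes "v \<in> verts E" "w \<in> verts E" "v \<noteq> w"
  shows "av H v * av H w = 0"
proof -
  have "av H v * (V v * av H w) = 0"
    using assms by (simp add: V_av)
  then show ?thesis
    using av_V[OF assms(1,1)] assms by (simp add: mult.assoc[symmetric])
qed

lemma c_av: "c k * av H v = av H v * c k"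
  unfolding av_def sum_distrib_left sum_distrib_right
  by (rule sum.cong) (simp_all add: mult.assoc[symmetric] c_A, simp add: mult.assoc c_G)

lemma c_one_A: "e \<in> arcs E \<Longrightarrow> c 1 * A e = A e"
  by (metis V_A c_one mult.assoc)

lemma c_one_av: "c 1 * av H v = av H v"
  unfolding av_def sum_distrib_left
  by (rule sum.cong) (auto simp: out_arcs_avoiding_def mult.assoc[symmetric] c_one_A)

end

fun und :: "'e + 'e \<Rightarrow> 'e" where
  "und (Inl e) = e"
| "und (Inr e) = e"

lemma quotient_graph_mem [simp]:
  "Inl v \<in> verts (quotient_graph E H S) \<longleftrightarrow> v \<in> verts E \<and> v \<notin> H"
  "Inr v \<in> verts (quotient_graph E H S) \<longleftrightarrow> v \<in> breaking_vertices E H \<and> v \<notin> S"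
  "Inl e \<in> arcs (quotient_graph E H S) \<longleftrightarrow> e \<in> arcs E \<and> head E e \<notin> H"
  "Inr e \<in> arcs (quotient_graph E H S) \<longleftrightarrow> e \<in> arcs E \<and> head E e \<in> breaking_vertices E H \<and> head E e \<notin> S"
  "tail (quotient_graph E H S) (Inl e) = Inl (tail E e)"
  "tail (quotient_graph E H S) (Inr e) = Inl (tail E e)"
  "head (quotient_graph E H S) (Inl e) = Inl (head E e)"
  "head (quotient_graph E H S) (Inr e) = Inr (head E e)"
  by (auto simp: quotient_graph_def)

lemma breaking_verticesD:
  assumes "v \<in> breaking_vertices E H"
  shows "v \<in> verts E" "v \<notin> H" "infinite (out_arcs E v)" "out_arcs_avoiding E H v \<noteq> {}"
    "finite (out_arcs_avoiding E H v)"
  using assms by (auto simp: breaking_vertices_def infinite_emitters_def)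

lemma wf_quotient_graph:
  assumes "wf_digraph E" "hereditary E H"
  shows "wf_digraph (quotient_graph E H S)"
proof
  fix e :: "'b + 'b" assume "e \<in> arcs (quotient_graph E H S)"
  then show "tail (quotient_graph E H S) e \<in> verts (quotient_graph E H S)"
    "head (quotient_graph E H S) e \<in> verts (quotient_graph E H S)"
    using assms by (cases e; auto simp: hereditary_def wf_digraph_def dest: breaking_verticesD)+
qed

lemma out_arcs_quotient:
  "out_arcs (quotient_graph E H S) (Inl v) = Inl ` out_arcs_avoiding E H v
    \<union> Inr ` {e \<in> out_arcs_avoiding E H v. head E e \<in> breaking_vertices E H \<and> head E e \<notin> S}"
  "out_arcs (quotient_graph E H S) (Inr v) = {}"
proof -
  have "x \<in> out_arcs (quotient_graph E H S) (Inl v) \<longleftrightarrow> x \<in> Inl ` out_arcs_avoiding E H v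
    \<union> Inr ` {e \<in> out_arcs_avoiding E H v. head E e \<in> breaking_vertices E H \<and> head E e \<notin> S}" for x
    by (cases x) (auto simp: out_arcs_avoiding_def out_arcs_def dest: breaking_verticesD)
  then show "out_arcs (quotient_graph E H S) (Inl v) = Inl ` out_arcs_avoiding E H v
    \<union> Inr ` {e \<in> out_arcs_avoiding E H v. head E e \<in> breaking_vertices E H \<and> head E e \<notin> S}"
    by blast
  have "x \<notin> out_arcs (quotient_graph E H S) (Inr v)" for x
    by (cases x) (auto simp: out_arcs_def)
  then show "out_arcs (quotient_graph E H S) (Inr v) = {}"
    by blast
qed

text \<open>Primed vertices are sinks, and an edge avoiding \<open>H\<close> has at most two copies,
  so the edges avoiding \<open>H\<close> decide. Breaking vertices thus become regular; the vertex
  \<open>v'\<close> makes room for v^H, which the sum relation at \<open>v\<close> alone would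
  kill.\<close>

lemma regular_quotient:
  "x \<in> regular_vertices (quotient_graph E H S) \<longleftrightarrow> (\<exists>v. x = Inl v \<and> v \<in> verts E \<and> v \<notin> H
     \<and> finite (out_arcs_avoiding E H v) \<and> out_arcs_avoiding E H v \<noteq> {})"
  by (cases x) (auto simp: regular_vertices_def out_arcs_quotient finite_image_iff)

lemma sum_out_arcs_quotient:
  assumes "finite (out_arcs_avoiding E H v)"
  shows "sum f (out_arcs (quotient_graph E H S) (Inl v)) =
    (\<Sum>e\<in>out_arcs_avoiding E H v. f (Inl e)
      + (if head E e \<in> breaking_vertices E H \<and> head E e \<notin> S then f (Inr e) else 0))"
proof -
  have "sum f (out_arcs (quotient_graph E H S) (Inl v)) = sum f (Inl ` out_arcs_avoiding E H v)
    + sum f (Inr ` {e \<in> out_arcs_avoiding E H v. head E e \<in> breaking_vertices E H \<and> head E e \<notin> S})"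
    unfolding out_arcs_quotient using assms by (intro sum.union_disjoint) auto
  also have "\<dots> = (\<Sum>e\<in>out_arcs_avoiding E H v. f (Inl e)) + (\<Sum>e\<in>out_arcs_avoiding E H v.
      if head E e \<in> breaking_vertices E H \<and> head E e \<notin> S then f (Inr e) else 0)"
    using assms by (simp add: sum.reindex sum.inter_filter)
  finally show ?thesis by (simp add: sum.distrib)
qed

lemma avoiding_nonempty:
  assumes "saturated E H" "v \<in> regular_vertices E" "v \<notin> H"
  shows "out_arcs_avoiding E H v \<noteq> {}" "finite (out_arcs_avoiding E H v)"
proof -
  show "out_arcs_avoiding E H v \<noteq> {}"
    using assms by (auto simp: saturated_def out_arcs_avoiding_def)
  have "out_arcs_avoiding E H v \<subseteq> out_arcs E v"
    by (auto simp: out_arcs_avoiding_def)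
  then show "finite (out_arcs_avoiding E H v)"
    using assms(2) finite_subset by (auto simp: regular_vertices_def)
qed

context leavitt_family
begin

fun qV :: "'v set \<Rightarrow> 'v set \<Rightarrow> 'v + 'v \<Rightarrow> 'q" where
  "qV H S (Inl v) = (if v \<in> breaking_vertices E H \<and> v \<notin> S then av H v else V v)"
| "qV H S (Inr v) = V v - av H v"

text \<open>The factor \<open>qV\<close> at the range is present for every edge. Where the range is
  not split it is the range vertex itself and is absorbed, so this agrees with the case distinction
  in the canonical map.\<close>

definition qA :: "'v set \<Rightarrow> 'v set \<Rightarrow> 'e + 'e \<Rightarrow> 'q" where
  "qA H S x = A (und x) * qV H S (head (quotient_graph E H S) x)"

definition qG :: "'v set \<Rightarrow> 'v set \<Rightarrow> 'e + 'e \<Rightarrow> 'q" where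
  "qG H S x = qV H S (head (quotient_graph E H S) x) * G (und x)"

text \<open>\<open>VH\<close> and \<open>VS\<close> hold modulo I_(H,S), so this makes the canonical
  map well defined. Split vertices give orthogonal idempotents v - v^H and v^H, and the sum relation
  reduces to a sum over the edges avoiding \<open>H\<close>.\<close>

lemma quotient_family:
  assumes H: "hereditary E H" "saturated E H" and S: "S \<subseteq> breaking_vertices E H"
    and VH: "\<And>v. v \<in> H \<Longrightarrow> V v = 0" and VS: "\<And>v. v \<in> S \<Longrightarrow> V v = av H v"
  shows "leavitt_family (quotient_graph E H S) c (qV H S) (qA H S) (qG H S)"
proof -
  let ?Q = "quotient_graph E H S"
  have q_idem: "qV H S x * qV H S y = (if x = y then qV H S x else 0)"
    if "x \<in> verts ?Q" "y \<in> verts ?Q" for x y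
    using that
    by (cases x; cases y)
      (auto simp: V_V V_av av_V av_av av_orth left_diff_distrib right_diff_distrib breaking_verticesD(1,5))
  define o1 where "o1 x = (case x of Inl v \<Rightarrow> v | Inr v \<Rightarrow> v)" for x :: "'v + 'v"
  have Vq: "V (o1 x) * qV H S x = qV H S x" "qV H S x * V (o1 x) = qV H S x" if "x \<in> verts ?Q" for x
    using that by (cases x; auto simp: o1_def V_V V_av av_V left_diff_distrib right_diff_distrib
      breaking_verticesD(1))+
  have o1_head: "o1 (head ?Q x) = head E (und x)" for x
    by (cases x) (auto simp: o1_def)
  have hd: "head ?Q x \<in> verts ?Q" and und: "und x \<in> arcs E" "und x \<in> out_arcs_avoiding E H (tail E (und x))"
    and tl: "tail ?Q x = Inl (tail E (und x))"
    if "x \<in> arcs ?Q" for x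
    using that wf_quotient_graph[OF wf_digraph_axioms H(1), of S]
    by (auto simp: wf_digraph_def) (cases x; auto simp: out_arcs_avoiding_def dest: breaking_verticesD)+
  have und_inj: "x = y" if "x \<in> arcs ?Q" "y \<in> arcs ?Q" "und x = und y" "head ?Q x = head ?Q y" for x y
    using that by (cases x; cases y) auto
  have q_tail_A: "qV H S (Inl v) * A e = A e" and q_tail_G: "G e * qV H S (Inl v) = G e"
    if "e \<in> out_arcs_avoiding E H v" for e v
    using that
    by (auto simp: av_A G_av V_A G_V out_arcs_avoiding_def dest: breaking_verticesD(5))
  \<comment> \<open>The copies of a vertex add up to the vertex. Hence the copies of an edge e that
    avoids \<open>H\<close> together contribute e e^* to a sum relation.\<close>
  have qVH: "qV H S (Inl v) + (if v \<in> breaking_vertices E H \<and> v \<notin> S then qV H S (Inr v) else 0) = V v" for v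
    by auto
  show ?thesis
  proof (rule leavitt_family.intro[OF wf_quotient_graph[OF wf_digraph_axioms H(1)]], unfold_locales)
    fix x y assume "x \<in> verts ?Q" "y \<in> verts ?Q"
    then show "qV H S x * qV H S y = (if x = y then qV H S x else 0)"
      by (rule q_idem)
  next
    fix x assume x: "x \<in> arcs ?Q"
    show "qV H S (tail ?Q x) * qA H S x = qA H S x"
      using q_tail_A[OF und(2)[OF x]] by (simp add: qA_def tl[OF x] mult.assoc[symmetric] del: qV.simps)
    show "qA H S x * qV H S (head ?Q x) = qA H S x"
      using q_idem[OF hd hd, OF x x] by (simp add: qA_def mult.assoc)
    show "qV H S (head ?Q x) * qG H S x = qG H S x"
      using q_idem[OF hd hd, OF x x] by (simp add: qG_def mult.assoc[symmetric])
    show "qG H S x * qV H S (tail ?Q x) = qG H S x"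
      using q_tail_G[OF und(2)[OF x]] by (simp add: qG_def tl[OF x] mult.assoc del: qV.simps)
    fix y assume y: "y \<in> arcs ?Q"
    have "qG H S x * qA H S y = qV H S (head ?Q x) * (G (und x) * A (und y)) * qV H S (head ?Q y)"
      by (simp add: qG_def qA_def mult.assoc)
    also have "\<dots> = (if x = y then qV H S (head ?Q x) else 0)"
    proof (cases "und x = und y")
      case True
      have "qV H S (head ?Q x) * V (head E (und x)) = qV H S (head ?Q x)"
        using Vq(2)[OF hd[OF x]] by (simp add: o1_head)
      then show ?thesis
        using True q_idem[OF hd hd, OF x y] und_inj[OF x y] und(1)[OF y] by (auto simp: G_A)
    next
      case False
      then show ?thesis
        using und(1) x y by (auto simp: G_A)
    qed
    finally show "qG H S x * qA H S y = (if x = y then qV H S (head ?Q x) else 0)" .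
  next
    fix x assume "x \<in> regular_vertices ?Q"
    then obtain v where v: "x = Inl v" "v \<in> verts E" "v \<notin> H" "finite (out_arcs_avoiding E H v)"
      "out_arcs_avoiding E H v \<noteq> {}"
      by (auto simp: regular_quotient)
    let ?B = "\<lambda>v. v \<in> breaking_vertices E H \<and> v \<notin> S"
    have "(\<Sum>y\<in>out_arcs ?Q x. qA H S y * qG H S y) = (\<Sum>e\<in>out_arcs_avoiding E H v.
      qA H S (Inl e) * qG H S (Inl e) + (if ?B (head E e) then qA H S (Inr e) * qG H S (Inr e) else 0))"
      unfolding v(1) by (rule sum_out_arcs_quotient[OF v(4)])
    also have "\<dots> = av H v"
      unfolding av_def
    proof (rule sum.cong[OF refl])
      fix e assume "e \<in> out_arcs_avoiding E H v"
      then have e: "e \<in> arcs E" "head E e \<notin> H" "head E e \<in> verts E"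
        by (auto simp: out_arcs_avoiding_def head_in_verts)
      have 1: "qA H S (Inl e) * qG H S (Inl e) = A e * qV H S (Inl (head E e)) * G e"
        using q_idem[of "Inl (head E e)" "Inl (head E e)"] e
        by (simp add: qA_def qG_def mult.assoc del: qV.simps) (simp add: mult.assoc[symmetric] del: qV.simps)
      have 2: "qA H S (Inr e) * qG H S (Inr e) = A e * qV H S (Inr (head E e)) * G e" if "?B (head E e)"
        using q_idem[of "Inr (head E e)" "Inr (head E e)"] that
        by (simp add: qA_def qG_def mult.assoc del: qV.simps) (simp add: mult.assoc[symmetric] del: qV.simps)
      have "qA H S (Inl e) * qG H S (Inl e) + (if ?B (head E e) then qA H S (Inr e) * qG H S (Inr e) else 0)
        = A e * (qV H S (Inl (head E e)) + (if ?B (head E e) then qV H S (Inr (head E e)) else 0)) * G e"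
        using 1 2 by (simp add: distrib_left distrib_right del: qV.simps)
      also have "\<dots> = A e * G e"
        unfolding qVH using A_V[OF e(1)] by simp
      finally show "qA H S (Inl e) * qG H S (Inl e)
        + (if ?B (head E e) then qA H S (Inr e) * qG H S (Inr e) else 0) = A e * G e" .
    qed
    also have "\<dots> = qV H S x"
    \<comment> \<open>For a breaking vertex outside \<open>S\<close> the sum is \<open>qV\<close> by
      definition, and for \<open>v\<close> in \<open>S\<close> by \<open>VS\<close>. Any other
      \<open>v\<close> is regular in \<open>E\<close>, and the edges missing from the sum lead into
      \<open>H\<close> and are 0.\<close>
    proof (cases "v \<in> breaking_vertices E H")
      case True
      then show ?thesis using VS by (auto simp: v(1))
    next
      case False
      have out: "out_arcs_avoiding E H v \<subseteq> out_arcs E v"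
        by (auto simp: out_arcs_avoiding_def)
      then have reg: "v \<in> regular_vertices E"
        using False v by (auto simp: breaking_vertices_def infinite_emitters_def regular_vertices_def)
      then have "finite (out_arcs E v)"
        by (simp add: regular_vertices_def)
      moreover have "A e = 0" if "e \<in> out_arcs E v - out_arcs_avoiding E H v" for e
        using that A_V[of e] VH[of "head E e"] by (auto simp: out_arcs_avoiding_def)
      ultimately have "av H v = (\<Sum>e\<in>out_arcs E v. A e * G e)"
        unfolding av_def by (intro sum.mono_neutral_left out) auto
      then show ?thesis
        using CK[OF reg] False by (simp add: v(1))
    qed
    finally show "qV H S x = (\<Sum>y\<in>out_arcs ?Q x. qA H S y * qG H S y)" ..
  next
    have c_q: "c k * qV H S x = qV H S x * c k" for k x
      by (cases x) (auto simp: c_V c_av left_diff_distrib right_diff_distrib)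
    show "c k * qV H S x = qV H S x * c k" for k x
      by (rule c_q)
    show "c k * qA H S x = qA H S x * c k" for k x
      unfolding qA_def by (metis c_A c_q mult.assoc)
    show "c k * qG H S x = qG H S x * c k" for k x
      unfolding qG_def by (metis c_G c_q mult.assoc)
    show "c 1 * qV H S x = qV H S x" for x
      by (cases x) (auto simp: c_one c_one_av right_diff_distrib)
  qed (simp_all add: c_add c_mult)
qed

end

text \<open>The image of \<open>v\<close> under the inverse of the canonical map. A copy that the
  quotient graph lacks contributes 0, so vertices of \<open>H\<close> and foreign names are sent to
  0.\<close>

definition vertex_split :: "('v, 'e) pre_digraph \<Rightarrow> 'v set \<Rightarrow> 'v set \<Rightarrow> ('v + 'v \<Rightarrow> 'q::ring_1) \<Rightarrow> 'v \<Rightarrow> 'q"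
  where "vertex_split E H S V v = (if v \<in> verts E \<and> v \<notin> H then V (Inl v) else 0)
    + (if v \<in> breaking_vertices E H \<and> v \<notin> S then V (Inr v) else 0)"

definition arc_split :: "('v, 'e) pre_digraph \<Rightarrow> 'v set \<Rightarrow> 'v set \<Rightarrow> ('e + 'e \<Rightarrow> 'q::ring_1) \<Rightarrow> 'e \<Rightarrow> 'q"
  where "arc_split E H S A e = (if e \<in> arcs E \<and> head E e \<notin> H then A (Inl e) else 0)
    + (if e \<in> arcs E \<and> head E e \<in> breaking_vertices E H \<and> head E e \<notin> S then A (Inr e) else 0)"

context
  fixes E :: "('v, 'e) pre_digraph" and H S :: "'v set"
    and c :: "'k::field \<Rightarrow> 'q::ring_1" and V :: "'v + 'v \<Rightarrow> 'q" and A G :: "'e + 'e \<Rightarrow> 'q"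
  assumes wf: "wf_digraph E" and H: "hereditary E H" "saturated E H"
    and S: "S \<subseteq> breaking_vertices E H"
    and Q: "leavitt_family (quotient_graph E H S) c V A G"
begin

interpretation wf_digraph E by (rule wf)

interpretation Q: leavitt_family "quotient_graph E H S" c V A G by (rule Q)

text \<open>The mixed products vanish because e and e' have different ranges.\<close>

lemma arc_split_mult:
  assumes "e \<in> arcs E" "head E e \<notin> H"
  shows "arc_split E H S A e * arc_split E H S G e = A (Inl e) * G (Inl e)
    + (if head E e \<in> breaking_vertices E H \<and> head E e \<notin> S then A (Inr e) * G (Inr e) else 0)"
proof -
  let ?B = "head E e \<in> breaking_vertices E H \<and> head E e \<notin> S"
  have e: "Inl e \<in> arcs (quotient_graph E H S)" "Inl (head E e) \<in> verts (quotient_graph E H S)"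
    using assms by (simp_all add: head_in_verts)
  have 1: "A (Inl e) * G (Inr e) = 0" "A (Inr e) * G (Inl e) = 0" if ?B
  proof -
    have f: "Inr e \<in> arcs (quotient_graph E H S)" "Inr (head E e) \<in> verts (quotient_graph E H S)"
      using that assms by simp_all
    have "A (Inl e) * V (Inl (head E e)) * G (Inr e) = 0"
      using Q.V_G_if[OF f(1) e(2)] by (simp add: mult.assoc)
    then show "A (Inl e) * G (Inr e) = 0"
      using Q.A_V[OF e(1)] by simp
    have "A (Inr e) * V (Inr (head E e)) * G (Inl e) = 0"
      using Q.V_G_if[OF e(1) f(2)] by (simp add: mult.assoc)
    then show "A (Inr e) * G (Inl e) = 0"
      using Q.A_V[OF f(1)] by simp
  qed
  show ?thesis
    using assms 1 by (auto simp: arc_split_def algebra_simps)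
qed

text \<open>This is the sum relation of the quotient graph at \<open>v\<close>, with e and e'
  collected into one factor. It yields \<open>V (Inl v)\<close> alone, so for a breaking
  \<open>v\<close> the inverse map sends v^H to \<open>V (Inr v)\<close>, or to 0 when
  \<open>v\<close> lies in \<open>S\<close>.\<close>

lemma sum_arc_split:
  assumes v: "v \<in> verts E" "v \<notin> H" "finite (out_arcs_avoiding E H v)" "out_arcs_avoiding E H v \<noteq> {}"
  shows "(\<Sum>e\<in>out_arcs_avoiding E H v. arc_split E H S A e * arc_split E H S G e) = V (Inl v)"
proof -
  have "Inl v \<in> regular_vertices (quotient_graph E H S)"
    using v by (simp add: regular_quotient)
  then have "V (Inl v) = (\<Sum>x\<in>out_arcs (quotient_graph E H S) (Inl v). A x * G x)"
    by (rule Q.CK)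
  also have "\<dots> = (\<Sum>e\<in>out_arcs_avoiding E H v. arc_split E H S A e * arc_split E H S G e)"
    unfolding sum_out_arcs_quotient[OF v(3)]
    by (rule sum.cong) (auto simp: out_arcs_avoiding_def arc_split_mult)
  finally show ?thesis ..
qed

lemma split_family:
  "leavitt_family E c (vertex_split E H S V) (arc_split E H S A) (arc_split E H S G)"
proof (rule leavitt_family.intro[OF wf leavitt_family_axioms.intro])
  let ?Q = "quotient_graph E H S" and ?B = "\<lambda>v. v \<in> breaking_vertices E H \<and> v \<notin> S"
  have B: "v \<in> verts E" "v \<notin> H" if "?B v" for v
    using breaking_verticesD(1,2)[of v E H] that by simp_all
  have vs: "vertex_split E H S V v = (if v \<in> H then 0 else if ?B v then V (Inl v) + V (Inr v) else V (Inl v))"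
    if "v \<in> verts E" for v
    using that B by (simp add: vertex_split_def)
  have as: "arc_split E H S f e = (if head E e \<in> H then 0 else if ?B (head E e)
      then f (Inl e) + f (Inr e) else f (Inl e))" if "e \<in> arcs E" for e and f :: "'e + 'e \<Rightarrow> 'q"
    using that B by (simp add: arc_split_def)
  {
    fix v w assume vw: "v \<in> verts E" "w \<in> verts E"
    have *: "V x * V y = (if x = y then V x else 0)" if "x \<in> verts ?Q" "y \<in> verts ?Q" for x y
      using Q.V_V that .
    show "vertex_split E H S V v * vertex_split E H S V w = (if v = w then vertex_split E H S V v else 0)"
    proof (cases "v \<in> H \<or> w \<in> H")
      case False
      then show ?thesis
        by (cases "v = w"; cases "?B v"; cases "?B w")
          (auto simp: vs vw distrib_left distrib_right *)
    qed (auto simp: vs vw)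
  }
  fix e assume e: "e \<in> arcs E"
  have he: "head E e \<in> verts E" "tail E e \<in> verts E"
    using e by (simp_all add: head_in_verts tail_in_verts)
  have her: "tail E e \<in> H \<Longrightarrow> head E e \<in> H"
    using H(1) e by (auto simp: hereditary_def)
  note split = vs[OF he(1)] vs[OF he(2)] as[OF e] distrib_left distrib_right
    Q.V_A_if Q.A_V_if Q.V_G_if Q.G_V_if
  show "vertex_split E H S V (tail E e) * arc_split E H S A e = arc_split E H S A e"
  proof (cases "head E e \<in> H")
    case False
    then show ?thesis
      using her he e by (cases "?B (head E e)"; cases "?B (tail E e)") (auto simp: split)
  qed (simp add: as[OF e])
  show "arc_split E H S A e * vertex_split E H S V (head E e) = arc_split E H S A e"
  proof (cases "head E e \<in> H")
    case False
    then show ?thesis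
      using her he e by (cases "?B (head E e)"; cases "?B (tail E e)") (auto simp: split)
  qed (simp add: as[OF e])
  show "vertex_split E H S V (head E e) * arc_split E H S G e = arc_split E H S G e"
  proof (cases "head E e \<in> H")
    case False
    then show ?thesis
      using her he e by (cases "?B (head E e)"; cases "?B (tail E e)") (auto simp: split)
  qed (simp add: as[OF e])
  show "arc_split E H S G e * vertex_split E H S V (tail E e) = arc_split E H S G e"
  proof (cases "head E e \<in> H")
    case False
    then show ?thesis
      using her he e by (cases "?B (head E e)"; cases "?B (tail E e)") (auto simp: split)
  qed (simp add: as[OF e])
  fix f assume f: "f \<in> arcs E"
  show "arc_split E H S G e * arc_split E H S A f = (if e = f then vertex_split E H S V (head E e) else 0)"
  proof (cases "head E e \<in> H \<or> head E f \<in> H")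
    case False
    then show ?thesis
      using e f by (cases "e = f"; cases "?B (head E e)"; cases "?B (head E f)")
        (auto simp: as[OF e] as[OF f] vs head_in_verts distrib_left distrib_right Q.G_A)
  qed (use e f in \<open>auto simp: as vs head_in_verts\<close>)
next
  fix v assume v: "v \<in> regular_vertices E"
  then have v': "v \<in> verts E" "finite (out_arcs E v)" "v \<notin> breaking_vertices E H"
    by (auto simp: regular_vertices_def breaking_vertices_def infinite_emitters_def)
  show "vertex_split E H S V v = (\<Sum>e\<in>out_arcs E v. arc_split E H S A e * arc_split E H S G e)"
  \<comment> \<open>Edges leaving \<open>H\<close> end in \<open>H\<close> and are sent to 0. A
    regular \<open>v\<close> outside \<open>H\<close> is not a breaking vertex, so its image is
    \<open>V (Inl v)\<close> alone.\<close>
  proof (cases "v \<in> H")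
    case True
    then have "arc_split E H S A e = 0" if "e \<in> out_arcs E v" for e
      using that H(1) by (auto simp: arc_split_def hereditary_def dest: breaking_verticesD(2))
    then show ?thesis
      using True v' by (simp add: vertex_split_def)
  next
    case False
    note av = avoiding_nonempty[OF H(2) v False]
    have "(\<Sum>e\<in>out_arcs E v. arc_split E H S A e * arc_split E H S G e) =
      (\<Sum>e\<in>out_arcs_avoiding E H v. arc_split E H S A e * arc_split E H S G e)"
      using v'(2) by (intro sum.mono_neutral_right)
        (auto simp: out_arcs_avoiding_def arc_split_def dest: breaking_verticesD(2))
    then show ?thesis
      using sum_arc_split[OF v'(1) False av(2,1)] False v' by (simp add: vertex_split_def)
  qed
next
  show "c k * vertex_split E H S V v = vertex_split E H S V v * c k" for k v
    by (simp add: vertex_split_def distrib_left distrib_right Q.c_V)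
  show "c k * arc_split E H S A e = arc_split E H S A e * c k" for k e
    by (simp add: arc_split_def distrib_left distrib_right Q.c_A)
  show "c k * arc_split E H S G e = arc_split E H S G e * c k" for k e
    by (simp add: arc_split_def distrib_left distrib_right Q.c_G)
  show "c 1 * vertex_split E H S V v = vertex_split E H S V v" for v
    by (simp add: vertex_split_def distrib_left Q.c_one)
qed (simp_all add: Q.c_add Q.c_mult)

end

section \<open>Homogeneous ideals and admissible pairs\<close>

section \<open>The ideal of an admissible pair in the free algebra\<close>

definition avoiding_rep :: "('v, 'e) pre_digraph \<Rightarrow> 'v set \<Rightarrow> 'v \<Rightarrow> ('v, 'e) lpa_gen word \<Rightarrow>\<^sub>0 'k::field" where
  "avoiding_rep E H v = (\<Sum>e\<in>out_arcs_avoiding E H v. gen (Edge e) * gen (Ghost e))"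

definition gap_rep :: "('v, 'e) pre_digraph \<Rightarrow> 'v set \<Rightarrow> 'v \<Rightarrow> ('v, 'e) lpa_gen word \<Rightarrow>\<^sub>0 'k::field" where
  "gap_rep E H v = gen (Vertex v) - avoiding_rep E H v"

text \<open>Represents I_(H,S) in the polynomial ring, see \<open>admissible_ideal_image\<close>.
  With \<open>S\<close> empty and \<open>H\<close> merely hereditary it also represents I_X.\<close>

definition pair_ideal :: "('v, 'e) pre_digraph \<Rightarrow> 'v set \<Rightarrow> 'v set
    \<Rightarrow> (('v, 'e) lpa_gen word \<Rightarrow>\<^sub>0 'k::field) set" where
  "pair_ideal E H S = ideal_hull (lpa_kernel E \<union> (\<lambda>v. gen (Vertex v)) ` H \<union> gap_rep E H ` S)"

lemma two_sided_pair_ideal: "two_sided (pair_ideal E H S)"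
  by (simp add: pair_ideal_def two_sided_hull)

lemma pair_ideal_mem:
  shows kernel_pair_ideal: "lpa_kernel E \<subseteq> pair_ideal E H S"
    and "v \<in> H \<Longrightarrow> gen (Vertex v) \<in> pair_ideal E H S"
    and "v \<in> S \<Longrightarrow> gap_rep E H v \<in> pair_ideal E H S"
  using hull_incl[of "lpa_kernel E \<union> (\<lambda>v. gen (Vertex v)) ` H \<union> gap_rep E H ` S"]
  unfolding pair_ideal_def by blast+

lemma has_deg_0_vertex: "has_deg 0 (gen (Vertex v))"
  using has_deg_gen[of "Vertex v"] by simp

lemma has_deg_0_avoiding: "has_deg 0 (avoiding_rep E H v)"
  unfolding avoiding_rep_def
proof (rule has_deg_sum)
  show "has_deg 0 (gen (Edge e) * gen (Ghost e))" for e
    using has_deg_mult[OF has_deg_gen[of "Edge e"] has_deg_gen[of "Ghost e"]] by simp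
qed

lemma has_deg_0_gap: "has_deg 0 (gap_rep E H v)"
  unfolding gap_rep_def by (intro has_deg_diff has_deg_0_vertex has_deg_0_avoiding)

lemma augmentation_avoiding: "avoiding_rep E H v \<in> augmentation_ideal"
  unfolding avoiding_rep_def
  by (intro two_sided_sum[OF two_sided_augmentation] two_sided_mult_left[OF two_sided_augmentation]
    gen_in_augmentation)

lemma augmentation_gap: "gap_rep E H v \<in> augmentation_ideal"
  unfolding gap_rep_def
  by (intro two_sided_diff[OF two_sided_augmentation] augmentation_avoiding gen_in_augmentation)

lemma pair_ideal_augmentation: "pair_ideal E H S \<subseteq> augmentation_ideal"
  unfolding pair_ideal_def
  by (rule hull_least[OF two_sided_augmentation])
    (use kernel_augmentation in \<open>auto simp: gen_in_augmentation augmentation_gap\<close>)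

text \<open>\<open>homogeneous_hull\<close> asks for generators that have a degree, so the kernel is
  replaced by the relations and foreign names that generate it.\<close>

lemma homogeneous_pair_ideal:
  "homogeneous (pair_ideal E H S :: (('v, 'e) lpa_gen word \<Rightarrow>\<^sub>0 'k::field) set)"
proof -
  let ?P = "pair_ideal E H S :: (('v, 'e) lpa_gen word \<Rightarrow>\<^sub>0 'k) set"
  let ?R = "lpa_relations E \<union> gen ` (- lpa_generators E) :: (('v, 'e) lpa_gen word \<Rightarrow>\<^sub>0 'k) set"
    and ?Y = "(\<lambda>v. gen (Vertex v)) ` H \<union> gap_rep E H ` S"
  have P: "?P = ideal_hull (lpa_kernel E \<union> ?Y)"
    by (simp add: pair_ideal_def Un_assoc)
  have "?P = ideal_hull (?R \<union> ?Y)"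
  proof
    have "lpa_kernel E \<subseteq> ideal_hull (?R \<union> ?Y)"
      unfolding lpa_kernel_def by (rule hull_mono) blast
    moreover have "?Y \<subseteq> ideal_hull (?R \<union> ?Y)"
      using hull_incl by (rule subset_trans[rotated]) blast
    ultimately show "?P \<subseteq> ideal_hull (?R \<union> ?Y)"
      unfolding P by (rule hull_least[OF two_sided_hull Un_least])
    have "?R \<subseteq> lpa_kernel E"
      unfolding lpa_kernel_def by (rule hull_incl)
    then show "ideal_hull (?R \<union> ?Y) \<subseteq> ?P"
      unfolding P by (rule hull_mono[OF Un_mono[OF _ order_refl]])
  qed
  moreover have "homogeneous (ideal_hull (?R \<union> ?Y))"
  proof (rule homogeneous_hull)
    fix x assume "x \<in> ?R \<union> ?Y"
    then consider "x \<in> ?R" | "x \<in> ?Y" by blast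
    then show "\<exists>n. has_deg n x"
    proof cases
      case 1
      then show ?thesis by (rule relations_have_deg)
    next
      case 2
      then have "has_deg 0 x"
        using has_deg_0_vertex has_deg_0_gap by auto
      then show ?thesis ..
    qed
  qed
  ultimately show ?thesis by simp
qed

fun canon_vertex :: "('v, 'e) pre_digraph \<Rightarrow> 'v set \<Rightarrow> 'v set \<Rightarrow> 'v + 'v
    \<Rightarrow> ('v, 'e) lpa_gen word \<Rightarrow>\<^sub>0 'k::field" where
  "canon_vertex E H S (Inl v) =
     (if v \<in> breaking_vertices E H - S then avoiding_rep E H v else gen (Vertex v))"
| "canon_vertex E H S (Inr v) = gap_rep E H v"

fun canon_edge :: "('v, 'e) pre_digraph \<Rightarrow> 'v set \<Rightarrow> 'v set \<Rightarrow> 'e + 'e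
    \<Rightarrow> ('v, 'e) lpa_gen word \<Rightarrow>\<^sub>0 'k::field" where
  "canon_edge E H S (Inl e) = (if head E e \<in> breaking_vertices E H - S
     then gen (Edge e) * canon_vertex E H S (Inl (head E e)) else gen (Edge e))"
| "canon_edge E H S (Inr e) = gen (Edge e) * canon_vertex E H S (Inr (head E e))"

fun canon_ghost :: "('v, 'e) pre_digraph \<Rightarrow> 'v set \<Rightarrow> 'v set \<Rightarrow> 'e + 'e
    \<Rightarrow> ('v, 'e) lpa_gen word \<Rightarrow>\<^sub>0 'k::field" where
  "canon_ghost E H S (Inl e) = (if head E e \<in> breaking_vertices E H - S
     then canon_vertex E H S (Inl (head E e)) * gen (Ghost e) else gen (Ghost e))"
| "canon_ghost E H S (Inr e) = canon_vertex E H S (Inr (head E e)) * gen (Ghost e)"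

definition from_quotient :: "('v, 'e) pre_digraph \<Rightarrow> 'v set \<Rightarrow> 'v set \<Rightarrow> ('v + 'v, 'e + 'e) lpa_gen
    \<Rightarrow> ('v, 'e) lpa_gen word \<Rightarrow>\<^sub>0 'k::field" where
  "from_quotient E H S g = (if g \<in> lpa_generators (quotient_graph E H S) then
     (case g of Vertex x \<Rightarrow> canon_vertex E H S x | Edge x \<Rightarrow> canon_edge E H S x
      | Ghost x \<Rightarrow> canon_ghost E H S x) else 0)"

definition to_quotient :: "('v, 'e) pre_digraph \<Rightarrow> 'v set \<Rightarrow> 'v set \<Rightarrow> ('v, 'e) lpa_gen
    \<Rightarrow> ('v + 'v, 'e + 'e) lpa_gen word \<Rightarrow>\<^sub>0 'k::field" where
  "to_quotient E H S g = (case g of Vertex v \<Rightarrow> vertex_split E H S (\<lambda>x. gen (Vertex x)) v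
     | Edge e \<Rightarrow> arc_split E H S (\<lambda>x. gen (Edge x)) e
     | Ghost e \<Rightarrow> arc_split E H S (\<lambda>x. gen (Ghost x)) e)"

lemma lpa_generators_mem [simp]:
  "Vertex v \<in> lpa_generators E \<longleftrightarrow> v \<in> verts E"
  "Edge e \<in> lpa_generators E \<longleftrightarrow> e \<in> arcs E"
  "Ghost e \<in> lpa_generators E \<longleftrightarrow> e \<in> arcs E"
  by (auto simp: lpa_generators_def)

lemma gen_in_kernel: "g \<notin> lpa_generators E \<Longrightarrow> gen g \<in> lpa_kernel E"
  by (auto simp: lpa_kernel_def intro: hull_mem)

lemma from_quotient_bad: "g \<notin> lpa_generators (quotient_graph E H S) \<Longrightarrow> from_quotient E H S g = 0"
  by (simp add: from_quotient_def)

lemma to_quotient_bad: "g \<notin> lpa_generators E \<Longrightarrow> to_quotient E H S g = 0"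
  by (cases g) (auto simp: to_quotient_def vertex_split_def arc_split_def dest: breaking_verticesD(1))

lemma cls_vertex_split: "cls J (vertex_split E H S f v) = vertex_split E H S (\<lambda>x. cls J (f x)) v"
  by (simp add: vertex_split_def cls_add)

lemma cls_arc_split: "cls J (arc_split E H S f e) = arc_split E H S (\<lambda>x. cls J (f x)) e"
  by (simp add: arc_split_def cls_add)

text \<open>On representatives, \<open>\<sigma>\<close> is the canonical map and
  \<open>\<tau>\<close> its inverse. Countability of the arcs passes to the quotient graph and
  guarantees that its vertices are nonzero.\<close>

locale admissible = wf_digraph E for E :: "('v, 'e) pre_digraph" +
  fixes K :: "'k::field itself" and H S :: "'v set"
  assumes hereditary: "hereditary E H" and saturated: "saturated E H"
    and S_sub: "S \<subseteq> breaking_vertices E H" and countable_arcs: "countable (arcs E)"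
begin

abbreviation Q where "Q \<equiv> quotient_graph E H S"
abbreviation J :: "(('v, 'e) lpa_gen word \<Rightarrow>\<^sub>0 'k) set" where "J \<equiv> pair_ideal E H S"
abbreviation N :: "(('v + 'v, 'e + 'e) lpa_gen word \<Rightarrow>\<^sub>0 'k) set" where "N \<equiv> lpa_kernel Q"
abbreviation \<sigma> :: "('v + 'v, 'e + 'e) lpa_gen \<Rightarrow> ('v, 'e) lpa_gen word \<Rightarrow>\<^sub>0 'k"
  where "\<sigma> \<equiv> from_quotient E H S"
abbreviation \<tau> :: "('v, 'e) lpa_gen \<Rightarrow> ('v + 'v, 'e + 'e) lpa_gen word \<Rightarrow>\<^sub>0 'k"
  where "\<tau> \<equiv> to_quotient E H S"

lemma wf_Q: "wf_digraph Q"
  by (rule wf_quotient_graph[OF wf_digraph_axioms hereditary])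

interpretation EJ: leavitt_family E "\<lambda>k. cls J (cst k)" "\<lambda>v. cls J (gen (Vertex v))"
    "\<lambda>e. cls J (gen (Edge e))" "\<lambda>e. cls J (gen (Ghost e))"
  using family_of_gen[OF wf_digraph_axioms two_sided_pair_ideal kernel_pair_ideal]
  by (simp add: family_of_def)

interpretation QN: leavitt_family Q "\<lambda>k. cls N (cst k)" "\<lambda>v. cls N (gen (Vertex v))"
    "\<lambda>e. cls N (gen (Edge e))" "\<lambda>e. cls N (gen (Ghost e))"
  using family_of_gen[OF wf_Q two_sided_kernel order_refl] by (simp add: family_of_def)

lemma J0: "cls J x = 0 \<longleftrightarrow> x \<in> J"
  by (rule cls_eq_0_iff[OF two_sided_pair_ideal])

lemma N0: "cls N x = 0 \<longleftrightarrow> x \<in> N"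
  by (rule cls_eq_0_iff[OF two_sided_kernel])

lemma cls_avoiding: "cls J (avoiding_rep E H v) = EJ.av H v"
  by (simp add: avoiding_rep_def EJ.av_def cls_sum cls_mult)

lemma J_vertex: "v \<in> H \<Longrightarrow> cls J (gen (Vertex v)) = 0"
  by (simp add: J0 pair_ideal_mem(2))

lemma J_gap: "v \<in> S \<Longrightarrow> cls J (gen (Vertex v)) = EJ.av H v"
proof -
  assume "v \<in> S"
  then have "cls J (gap_rep E H v) = 0"
    by (simp add: J0 pair_ideal_mem(3))
  then show ?thesis
    by (simp add: gap_rep_def cls_diff cls_avoiding)
qed

lemma cls_canon_vertex: "cls J (canon_vertex E H S x) = EJ.qV H S x"
  by (cases x) (auto simp: cls_avoiding gap_rep_def cls_diff)

lemma cls_canon_edge: "x \<in> arcs Q \<Longrightarrow> cls J (canon_edge E H S x) = EJ.qA H S x"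
  by (cases x) (auto simp: EJ.qA_def cls_mult cls_canon_vertex EJ.A_V simp del: canon_vertex.simps)

lemma cls_canon_ghost: "x \<in> arcs Q \<Longrightarrow> cls J (canon_ghost E H S x) = EJ.qG H S x"
  by (cases x) (auto simp: EJ.qG_def cls_mult cls_canon_vertex EJ.V_G simp del: canon_vertex.simps)

lemma ev_\<sigma>_kernel: "f \<in> N \<Longrightarrow> ev \<sigma> f \<in> J"
proof (rule ev_kernel[OF two_sided_pair_ideal])
  show "family_of Q \<sigma> J"
    by (rule family_of_restrict[OF EJ.quotient_family[OF hereditary saturated S_sub J_vertex J_gap]])
      (simp_all add: from_quotient_def cls_canon_vertex cls_canon_edge cls_canon_ghost)
  show "\<sigma> g \<in> J" if "g \<notin> lpa_generators Q" for g
    using that by (simp add: from_quotient_bad two_sided_zero[OF two_sided_pair_ideal])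
qed

abbreviation tV where "tV \<equiv> vertex_split E H S (\<lambda>v. cls N (gen (Vertex v)))"
abbreviation tA where "tA \<equiv> arc_split E H S (\<lambda>e. cls N (gen (Edge e)))"
abbreviation tG where "tG \<equiv> arc_split E H S (\<lambda>e. cls N (gen (Ghost e)))"

lemma cls_\<tau>:
  "cls N (\<tau> (Vertex v)) = tV v" "cls N (\<tau> (Edge e)) = tA e" "cls N (\<tau> (Ghost e)) = tG e"
  by (simp_all add: to_quotient_def cls_vertex_split cls_arc_split)

lemma cls_\<tau>_avoiding:
  assumes "v \<in> verts E" "v \<notin> H" "finite (out_arcs_avoiding E H v)" "out_arcs_avoiding E H v \<noteq> {}"
  shows "cls N (ev \<tau> (avoiding_rep E H v)) = cls N (gen (Vertex (Inl v)))"
  using sum_arc_split[OF wf_digraph_axioms hereditary saturated S_sub QN.leavitt_family_axioms assms]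
  by (simp add: avoiding_rep_def ev_simps cls_sum cls_mult cls_\<tau>)

lemma cls_\<tau>_gap:
  assumes "v \<in> breaking_vertices E H"
  shows "cls N (ev \<tau> (gap_rep E H v)) = (if v \<in> S then 0 else cls N (gen (Vertex (Inr v))))"
  using cls_\<tau>_avoiding[of v] breaking_verticesD[OF assms] assms
  by (simp add: gap_rep_def ev_diff cls_diff cls_\<tau> vertex_split_def)

lemma ev_\<tau>_ideal:
  assumes "f \<in> J"
  shows "ev \<tau> f \<in> N"
proof -
  have "family_of E \<tau> N"
    by (rule family_of_restrict[OF split_family[OF wf_digraph_axioms hereditary saturated S_sub
      QN.leavitt_family_axioms]]) (simp_all add: cls_\<tau>)
  then have "ev \<tau> f \<in> N" if "f \<in> lpa_kernel E" for f
    by (rule ev_kernel[OF two_sided_kernel _ _ that])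
      (simp add: to_quotient_bad two_sided_zero[OF two_sided_kernel])
  moreover have "\<tau> (Vertex v) \<in> N" if "v \<in> H" for v
    using that by (auto simp: N0[symmetric] cls_\<tau> vertex_split_def dest: breaking_verticesD(2))
  moreover have "ev \<tau> (gap_rep E H v) \<in> N" if "v \<in> S" for v
    using cls_\<tau>_gap[of v] that S_sub by (auto simp: N0[symmetric])
  ultimately have "J \<subseteq> {f. ev \<tau> f \<in> N}"
    unfolding pair_ideal_def by (intro hull_least two_sided_vimage_ev[OF two_sided_kernel]) auto
  then show ?thesis
    using assms by blast
qed

lemma \<tau>_\<sigma>: "ev \<tau> (ev \<sigma> f) - f \<in> N"
proof (rule ev_congruent_id[OF two_sided_kernel])
  fix g
  \<comment> \<open>At a breaking vertex outside \<open>S\<close> the canonical map gives the sum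
    over the edges avoiding \<open>H\<close>, which \<open>\<tau>\<close> sends to the unprimed
    vertex; any other vertex has no primed copy.\<close>
  have nonB: "cls N (ev \<tau> (canon_vertex E H S (Inl v))) = cls N (gen (Vertex (Inl v)))"
    if "v \<in> verts E" "v \<notin> H" for v
    using that cls_\<tau>_avoiding[of v] breaking_verticesD[of v E H] by (auto simp: cls_\<tau> vertex_split_def)
  have B: "cls N (ev \<tau> (canon_vertex E H S (Inr v))) = cls N (gen (Vertex (Inr v)))"
    if "v \<in> breaking_vertices E H" "v \<notin> S" for v
    using that cls_\<tau>_gap[of v] by simp
  have "cls N (ev \<tau> (\<sigma> g)) = cls N (gen g)"
  proof (cases "g \<in> lpa_generators Q")
    case False
    then show ?thesis
      by (simp add: from_quotient_bad N0 gen_in_kernel)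
  next
    case True
    note simps = ev_mult cls_mult cls_\<tau> nonB B arc_split_def distrib_left distrib_right QN.A_V_if
      QN.V_G_if head_in_verts breaking_verticesD(1,2)
    show ?thesis
    proof (cases g)
      case (Vertex x)
      then show ?thesis
        using True nonB B by (cases x) (auto simp: from_quotient_def simp del: canon_vertex.simps)
    next
      case (Edge x)
      then show ?thesis
        using True by (cases x) (auto simp: from_quotient_def simps simp del: canon_vertex.simps)
    next
      case (Ghost x)
      then show ?thesis
        using True by (cases x) (auto simp: from_quotient_def simps simp del: canon_vertex.simps)
    qed
  qed
  then show "ev \<tau> (ev \<sigma> (gen g)) - gen g \<in> N"
    by (simp add: cls_eq_iff[OF two_sided_kernel])
qed (simp_all add: ev_simps)

lemma \<sigma>_\<tau>: "ev \<sigma> (ev \<tau> f) - f \<in> J"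
proof (rule ev_congruent_id[OF two_sided_pair_ideal])
  fix g
  let ?B = "\<lambda>v. v \<in> breaking_vertices E H \<and> v \<notin> S"
  have qV: "EJ.qV H S (Inl v) + (if ?B v then EJ.qV H S (Inr v) else 0) = cls J (gen (Vertex v))" for v
    by auto
  have \<sigma>: "x \<in> verts Q \<Longrightarrow> cls J (\<sigma> (Vertex x)) = EJ.qV H S x"
    "y \<in> arcs Q \<Longrightarrow> cls J (\<sigma> (Edge y)) = EJ.qA H S y"
    "y \<in> arcs Q \<Longrightarrow> cls J (\<sigma> (Ghost y)) = EJ.qG H S y" for x y
    by (simp_all add: from_quotient_def cls_canon_vertex cls_canon_edge cls_canon_ghost)
  have "cls J (ev \<sigma> (\<tau> g)) = cls J (gen g)"
  proof (cases "g \<in> lpa_generators E")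
    case False
    then show ?thesis
      by (simp add: to_quotient_bad J0 subsetD[OF kernel_pair_ideal] gen_in_kernel)
  next
    case True
    show ?thesis
    proof (cases g)
      case (Vertex v)
      then show ?thesis
        using True J_vertex[of v] qV[of v]
        by (auto simp: to_quotient_def vertex_split_def ev_add cls_add \<sigma>
          simp del: EJ.qV.simps dest: breaking_verticesD(2))
    next
      case (Edge e)
      have e: "e \<in> arcs E" using True Edge by simp
      show ?thesis
      proof (cases "head E e \<in> H")
        case True
        then have "cls J (gen (Edge e)) = 0"
          using EJ.A_V[OF e] J_vertex[OF True] by simp
        then show ?thesis
          using True by (auto simp: Edge to_quotient_def arc_split_def ev_add cls_add
            dest: breaking_verticesD(2))
      next
        case False
        have "cls J (ev \<sigma> (\<tau> g)) = cls J (gen (Edge e)) *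
          (EJ.qV H S (Inl (head E e)) + (if ?B (head E e) then EJ.qV H S (Inr (head E e)) else 0))"
          using False e by (simp add: Edge to_quotient_def arc_split_def ev_add cls_add \<sigma>
            EJ.qA_def distrib_left del: EJ.qV.simps)
        then show ?thesis
          unfolding qV using EJ.A_V[OF e] by (simp add: Edge)
      qed
    next
      case (Ghost e)
      have e: "e \<in> arcs E" using True Ghost by simp
      show ?thesis
      proof (cases "head E e \<in> H")
        case True
        then have "cls J (gen (Ghost e)) = 0"
          using EJ.V_G[OF e] J_vertex[OF True] by simp
        then show ?thesis
          using True by (auto simp: Ghost to_quotient_def arc_split_def ev_add cls_add
            dest: breaking_verticesD(2))
      next
        case False
        have "cls J (ev \<sigma> (\<tau> g)) = (EJ.qV H S (Inl (head E e))
          + (if ?B (head E e) then EJ.qV H S (Inr (head E e)) else 0)) * cls J (gen (Ghost e))"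
          using False e by (simp add: Ghost to_quotient_def arc_split_def ev_add cls_add \<sigma>
            EJ.qG_def distrib_right del: EJ.qV.simps)
        then show ?thesis
          unfolding qV using EJ.V_G[OF e] by (simp add: Ghost)
      qed
    qed
  qed
  then show "ev \<sigma> (ev \<tau> (gen g)) - gen g \<in> J"
    by (simp add: cls_eq_iff[OF two_sided_pair_ideal])
qed (simp_all add: ev_simps)

text \<open>Both substitutions respect the ideals and their composites are congruent to the
  identity, so membership is also reflected. This is the injectivity of the canonical map.\<close>

lemma ev_\<sigma>_mem_iff: "ev \<sigma> f \<in> J \<longleftrightarrow> f \<in> N"
  using ev_\<tau>_ideal[of "ev \<sigma> f"] ev_\<sigma>_kernel[of f] two_sided_mem_cong[OF two_sided_kernel \<tau>_\<sigma>, of f]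
  by blast

lemma ev_\<tau>_mem_iff: "ev \<tau> f \<in> N \<longleftrightarrow> f \<in> J"
  using ev_\<sigma>_kernel[of "ev \<tau> f"] ev_\<tau>_ideal[of f] two_sided_mem_cong[OF two_sided_pair_ideal \<sigma>_\<tau>, of f]
  by blast

lemma Q_vertex: "x \<in> verts Q \<Longrightarrow> cls N (gen (Vertex x)) \<noteq> 0"
proof -
  have "arcs Q \<subseteq> Inl ` arcs E \<union> Inr ` arcs E"
    by (auto simp: quotient_graph_def)
  then have "countable (arcs Q)"
    by (rule countable_subset) (use countable_arcs in auto)
  then show "x \<in> verts Q \<Longrightarrow> cls N (gen (Vertex x)) \<noteq> 0"
    using vertex_notin_kernel[OF wf_Q, of x] by (simp add: N0)
qed

text \<open>For \<open>v\<close> outside \<open>H\<close> the image under \<open>\<tau>\<close> has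
  the component \<open>Inl v\<close>, which multiplication by that nonzero vertex isolates.\<close>

lemma vertex_mem_iff:
  assumes "v \<in> verts E"
  shows "gen (Vertex v) \<in> J \<longleftrightarrow> v \<in> H"
proof
  assume "gen (Vertex v) \<in> J"
  then have *: "tV v = 0"
    using ev_\<tau>_ideal[of "gen (Vertex v)"] by (simp add: N0 flip: cls_\<tau>(1))
  show "v \<in> H"
  proof (rule ccontr)
    assume v: "v \<notin> H"
    then have "cls N (gen (Vertex (Inl v))) * tV v = cls N (gen (Vertex (Inl v)))"
      using assms by (auto simp: vertex_split_def distrib_left QN.V_V)
    then show False
      using Q_vertex[of "Inl v"] assms v * by simp
  qed
qed (rule pair_ideal_mem(2))

text \<open>For \<open>v\<close> outside \<open>S\<close> the image of v^H is the vertex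
  \<open>Inr v\<close> of the quotient graph, which is nonzero; this is the purpose of the primed
  vertices.\<close>

lemma gap_mem_iff:
  assumes "v \<in> breaking_vertices E H"
  shows "gap_rep E H v \<in> J \<longleftrightarrow> v \<in> S"
proof
  assume "gap_rep E H v \<in> J"
  then have "cls N (ev \<tau> (gap_rep E H v)) = 0"
    using ev_\<tau>_ideal by (simp add: N0)
  then show "v \<in> S"
    using cls_\<tau>_gap[OF assms] Q_vertex[of "Inr v"] assms by (auto split: if_splits)
qed (rule pair_ideal_mem(3))

end

text \<open>Passing from \<open>H\<close> to \<open>H'\<close> drops the terms e e^* with range in
  \<open>H'\<close>, and these edges are 0 modulo \<open>J\<close>. This allows gap elements for
  different hereditary sets to be compared.\<close>

lemma gap_rep_diff:
  assumes wf: "wf_digraph E" and J: "two_sided J" "lpa_kernel E \<subseteq> J"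
    and H': "\<And>w. w \<in> H' \<Longrightarrow> gen (Vertex w) \<in> J" and sub: "H \<subseteq> H'"
    and fin: "finite (out_arcs_avoiding E H v)"
  shows "gap_rep E H' v - gap_rep E H v \<in> J"
proof -
  interpret leavitt_family E "\<lambda>k. cls J (cst k)" "\<lambda>v. cls J (gen (Vertex v))"
    "\<lambda>e. cls J (gen (Edge e))" "\<lambda>e. cls J (gen (Ghost e))"
    using family_of_gen[OF wf J] by (simp add: family_of_def)
  have 0: "cls J (gen (Edge e)) = 0" if "e \<in> out_arcs_avoiding E H v - out_arcs_avoiding E H' v" for e
  proof -
    have e: "e \<in> arcs E" "head E e \<in> H'"
      using that by (auto simp: out_arcs_avoiding_def)
    have "cls J (gen (Vertex (head E e))) = 0"
      using H'[OF e(2)] by (simp add: cls_eq_0_iff[OF J(1)])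
    then show ?thesis
      using A_V[OF e(1)] by simp
  qed
  have "av H v = av H' v"
    unfolding av_def
  proof (rule sum.mono_neutral_right[OF fin])
    show "out_arcs_avoiding E H' v \<subseteq> out_arcs_avoiding E H v"
      using sub by (auto simp: out_arcs_avoiding_def)
  qed (simp add: 0)
  moreover have "cls J (avoiding_rep E H v) = av H v" for H
    by (simp add: avoiding_rep_def av_def cls_sum cls_mult)
  ultimately have "cls J (gap_rep E H' v) = cls J (gap_rep E H v)"
    by (simp add: gap_rep_def cls_diff)
  then show ?thesis
    by (simp add: cls_eq_iff[OF J(1)])
qed

context admissible
begin

lemma pair_ideal_le_iff:
  assumes "admissible E H' S'"
  shows "pair_ideal E H' S' \<subseteq> J \<longleftrightarrow> H' \<subseteq> H \<and> S' \<subseteq> H \<union> S"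
proof -
  interpret P: admissible E K H' S' by fact
  have HV: "gen (Vertex w) \<in> J" if "w \<in> H" for w
    using pair_ideal_mem(2)[OF that] .
  have J2: "two_sided J" "lpa_kernel E \<subseteq> J"
    by (rule two_sided_pair_ideal, rule kernel_pair_ideal)
  show ?thesis
  proof
    assume sub: "pair_ideal E H' S' \<subseteq> J"
    have H'H: "H' \<subseteq> H"
    proof
      fix v assume v: "v \<in> H'"
      then have "v \<in> verts E"
        using P.hereditary by (auto simp: hereditary_def)
      moreover have "gen (Vertex v) \<in> J"
        using subsetD[OF sub pair_ideal_mem(2)[OF v]] .
      ultimately show "v \<in> H"
        by (simp add: vertex_mem_iff)
    qed
    moreover have "v \<in> S" if v: "v \<in> S'" "v \<notin> H" for v
    proof -
      have bv: "v \<in> breaking_vertices E H'"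
        using v(1) P.S_sub by auto
      note bD = breaking_verticesD[OF bv]
      have "gap_rep E H' v \<in> J"
        by (rule subsetD[OF sub pair_ideal_mem(3)[OF v(1)]])
      then have gap: "gap_rep E H v \<in> J"
        using two_sided_mem_cong[OF J2(1) gap_rep_diff[OF wf_digraph_axioms J2 HV H'H bD(5)]] by simp
      have sub': "out_arcs_avoiding E H v \<subseteq> out_arcs_avoiding E H' v"
        using H'H by (auto simp: out_arcs_avoiding_def)
      \<comment> \<open>If no edge from \<open>v\<close> avoided \<open>H\<close>, then v^H would be
        \<open>v\<close>, and \<open>v\<close> would lie in \<open>H\<close>.\<close>
      have "out_arcs_avoiding E H v \<noteq> {}"
        using gap v(2) by (auto simp: gap_rep_def avoiding_rep_def vertex_mem_iff[OF bD(1)])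
      then have "v \<in> breaking_vertices E H"
        using bv v(2) sub' finite_subset by (auto simp: breaking_vertices_def)
      then show "v \<in> S"
        using gap by (simp add: gap_mem_iff)
    qed
    ultimately show "H' \<subseteq> H \<and> S' \<subseteq> H \<union> S"
      by blast
  next
    assume le: "H' \<subseteq> H \<and> S' \<subseteq> H \<union> S"
    have "gap_rep E H' v \<in> J" if "v \<in> S'" for v
    proof -
      have bv: "v \<in> breaking_vertices E H'"
        using that P.S_sub by auto
      note bD = breaking_verticesD[OF bv]
      have diff: "gap_rep E H v - gap_rep E H' v \<in> J"
        by (rule gap_rep_diff[OF wf_digraph_axioms J2 HV _ bD(5)]) (use le in auto)
      moreover have "gap_rep E H v \<in> J"
      \<comment> \<open>For \<open>v\<close> in \<open>H\<close> no edge from \<open>v\<close>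
        avoids \<open>H\<close>, and v^H is \<open>v\<close> itself; this is why \<open>S'\<close>
        is compared with the union of \<open>H\<close> and \<open>S\<close>.\<close>
      proof (cases "v \<in> H")
        case True
        then have "out_arcs_avoiding E H v = {}"
          using hereditary by (auto simp: hereditary_def out_arcs_avoiding_def)
        then show ?thesis
          using HV[OF True] by (simp add: gap_rep_def avoiding_rep_def)
      next
        case False
        then show ?thesis
          using le that by (intro pair_ideal_mem(3)) auto
      qed
      ultimately show ?thesis
        using two_sided_mem_cong[OF J2(1) diff] by simp
    qed
    then show "pair_ideal E H' S' \<subseteq> J"
      using le HV J2 unfolding pair_ideal_def[of E H' S'] by (intro hull_least Un_least) auto
  qed
qed

lemma has_deg_from_quotient: "has_deg (gdeg g) (\<sigma> g)"
proof -
  have v: "has_deg 0 (canon_vertex E H S x)" for x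
    by (cases x) (simp_all add: has_deg_0_avoiding has_deg_0_vertex has_deg_0_gap)
  have gE: "has_deg 1 (gen (Edge e))" and gG: "has_deg (- 1) (gen (Ghost e))" for e
    using has_deg_gen[of "Edge e"] has_deg_gen[of "Ghost e"] by simp_all
  have ev: "has_deg 1 (gen (Edge e) * canon_vertex E H S y)"
    and vg: "has_deg (- 1) (canon_vertex E H S y * gen (Ghost e))" for e y
    using has_deg_mult[OF has_deg_gen[of "Edge e"] v[of y]]
      has_deg_mult[OF v[of y] has_deg_gen[of "Ghost e"]] by simp_all
  have e: "has_deg 1 (canon_edge E H S x)" for x
    by (cases x) (simp_all add: ev gE del: canon_vertex.simps)
  have g: "has_deg (- 1) (canon_ghost E H S x)" for x
    by (cases x) (simp_all add: vg gG del: canon_vertex.simps)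
  show ?thesis
    by (cases g) (simp_all add: from_quotient_def v e g)
qed

lemma from_quotient_augmentation: "\<sigma> g \<in> augmentation_ideal"
proof -
  note aug = two_sided_augmentation two_sided_mult_right[OF two_sided_augmentation] two_sided_zero
    two_sided_mult_left[OF two_sided_augmentation] gen_in_augmentation
  have v: "canon_vertex E H S x \<in> augmentation_ideal" for x
    by (cases x) (simp_all add: augmentation_avoiding augmentation_gap gen_in_augmentation)
  have e: "canon_edge E H S x \<in> augmentation_ideal" for x
    by (cases x) (simp_all add: v aug del: canon_vertex.simps)
  have g: "canon_ghost E H S x \<in> augmentation_ideal" for x
    by (cases x) (simp_all add: v aug del: canon_vertex.simps)
  show ?thesis
    by (cases g) (simp_all add: from_quotient_def v e g two_sided_zero[OF two_sided_augmentation])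
qed

end

theorem homogeneous_is_pair_ideal:
  fixes I :: "(('v, 'e) lpa_gen word \<Rightarrow>\<^sub>0 'k::field) set"
  assumes wf: "wf_digraph E" and countable: "countable (arcs E)"
    and I: "two_sided I" "lpa_kernel E \<subseteq> I" "I \<subseteq> augmentation_ideal" "homogeneous I"
  obtains H S where "hereditary E H" "saturated E H" "S \<subseteq> breaking_vertices E H" "I = pair_ideal E H S"
proof -
  define H where "H = {v \<in> verts E. gen (Vertex v) \<in> I}"
  define S where "S = {v \<in> breaking_vertices E H. gap_rep E H v \<in> I}"
  note I0 = cls_eq_0_iff[OF I(1)]
  interpret EI: leavitt_family E "\<lambda>k. cls I (cst k)" "\<lambda>v. cls I (gen (Vertex v))"
    "\<lambda>e. cls I (gen (Edge e))" "\<lambda>e. cls I (gen (Ghost e))"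
    using family_of_gen[OF wf I(1,2)] by (simp add: family_of_def)
  have VH: "v \<in> verts E \<Longrightarrow> cls I (gen (Vertex v)) = 0 \<longleftrightarrow> v \<in> H" for v
    by (simp add: H_def I0)
  \<comment> \<open>If s(e) is 0, so is e = s(e) e, and with it r(e) = e^* e.\<close>
  have A_out: "cls I (gen (Vertex (tail E e))) = 0 \<Longrightarrow> cls I (gen (Vertex (head E e))) = 0"
    if "e \<in> arcs E" for e
    using EI.V_A[OF that] EI.G_A[OF that that] by simp
  have her: "hereditary E H"
    unfolding hereditary_def
  proof (intro conjI ballI impI)
    fix e assume e: "e \<in> arcs E" "tail E e \<in> H"
    have "tail E e \<in> verts E" "head E e \<in> verts E"
      using e EI.tail_in_verts EI.head_in_verts by blast+
    then show "head E e \<in> H"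
      using e A_out[OF e(1)] by (simp flip: VH)
  qed (auto simp: H_def)
  have sat: "saturated E H"
    unfolding saturated_def
  proof (intro ballI impI)
    fix v assume v: "v \<in> regular_vertices E" "head E ` out_arcs E v \<subseteq> H"
    have "cls I (gen (Edge e)) = 0" if "e \<in> out_arcs E v" for e
    proof -
      have e: "e \<in> arcs E" "head E e \<in> H" using that v by auto
      then have "cls I (gen (Vertex (head E e))) = 0" using VH by (auto simp: H_def)
      then show ?thesis using EI.A_V[OF e(1)] by simp
    qed
    then have "cls I (gen (Vertex v)) = 0"
      using EI.CK[OF v(1)] by simp
    then show "v \<in> H"
      using VH v(1) by (auto simp: regular_vertices_def)
  qed
  interpret admissible E "TYPE('k)" H S
    by (rule admissible.intro[OF wf]) (unfold_locales, use her sat countable in \<open>auto simp: S_def\<close>)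
  have JI: "J \<subseteq> I"
    unfolding pair_ideal_def using I(1,2) by (intro hull_least) (auto simp: H_def S_def)
  \<comment> \<open>The ideal for the quotient graph that corresponds to \<open>I\<close> modulo
    \<open>J\<close>.\<close>
  define I2 where "I2 = {f. ev \<sigma> f \<in> I}"
  have two: "two_sided I2"
    unfolding I2_def by (rule two_sided_vimage_ev[OF I(1)])
  have NI: "N \<subseteq> I2"
    using ev_\<sigma>_kernel JI by (auto simp: I2_def)
  have aug: "I2 \<subseteq> augmentation_ideal"
    using I(3) lookup_ev_0[of \<sigma>, OF from_quotient_augmentation]
    by (auto simp: I2_def augmentation_ideal_def)
  have hom: "homogeneous I2"
    using I(4) by (auto simp: homogeneous_def I2_def simp flip: hpart_ev[OF has_deg_from_quotient])
  have novertex: "gen (Vertex x) \<notin> I2" if x: "x \<in> verts Q" for x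
  proof
    assume "gen (Vertex x) \<in> I2"
    then have cv: "canon_vertex E H S x \<in> I"
      using x by (simp add: I2_def from_quotient_def)
    show False
    proof (cases x)
      case (Inr v)
      then show False
        using x cv by (auto simp: S_def)
    next
      case (Inl v)
      then have v: "v \<in> verts E" "v \<notin> H" using x by auto
      show False
      proof (cases "v \<in> breaking_vertices E H - S")
        case False
        then have "gen (Vertex v) \<in> I"
          using cv by (auto simp: Inl split: if_splits)
        then show False
          using v by (simp add: H_def)
      next
        \<comment> \<open>Multiplying the avoiding sum by one of its edges e gives e back. If the
          sum lay in \<open>I\<close>, so would e and r(e) = e^* e, although r(e) is outside
          \<open>H\<close>.\<close>
        case True
        then have "cls I (avoiding_rep E H v) = 0"
          using cv by (simp add: Inl I0)
        then have av0: "EI.av H v = 0"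
          by (simp add: avoiding_rep_def EI.av_def cls_sum cls_mult)
        obtain e where e: "e \<in> out_arcs_avoiding E H v"
          using True breaking_verticesD(4)[of v E H] by auto
        have e': "e \<in> arcs E" "head E e \<notin> H"
          using e by (auto simp: out_arcs_avoiding_def)
        have "cls I (gen (Edge e)) = 0"
          using EI.av_A[OF e'(1), of H v] av0 e True breaking_verticesD(5)[of v E H] by simp
        then have "cls I (gen (Vertex (head E e))) = 0"
          using EI.G_A[OF e'(1) e'(1)] by simp
        then show False
          using VH[OF EI.head_in_verts[OF e'(1)]] e'(2) by simp
      qed
    qed
  qed
  have "I2 \<subseteq> N"
    using graded_ideal_contains_vertex[OF wf_Q two NI aug hom] novertex by auto
  have "I \<subseteq> J"
  proof
    fix f assume "f \<in> I"
    \<comment> \<open>\<open>\<sigma>\<close> takes \<open>ev \<tau> f\<close> back to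
      \<open>f\<close> modulo \<open>J\<close>, and \<open>J\<close> lies in
      \<open>I\<close>.\<close>
    then have "ev \<tau> f \<in> I2"
      using two_sided_mem_cong[OF I(1) subsetD[OF JI \<sigma>_\<tau>]] by (simp add: I2_def)
    then show "f \<in> J"
      using \<open>I2 \<subseteq> N\<close> by (simp add: subset_iff flip: ev_\<tau>_mem_iff)
  qed
  with JI have "I = J" by blast
  then show thesis
    using that her sat S_sub by blast
qed

section \<open>The restricted graph of a pair inside L_K(E)\<close>

section \<open>The graph of a pair\<close>

lemma pair_graph_simps [simp]:
  "verts (pair_graph E H S) = H \<union> S" "tail (pair_graph E H S) = tail E" "head (pair_graph E H S) = head E"
  "e \<in> arcs (pair_graph E H S) \<longleftrightarrow> e \<in> arcs E \<and> (tail E e \<in> H \<or> tail E e \<in> S \<and> head E e \<in> H)"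
  by (auto simp: pair_graph_def)

lemma wf_pair_graph: "hereditary E H \<Longrightarrow> wf_digraph (pair_graph E H S)"
  by (unfold_locales) (auto simp: hereditary_def)

context leavitt_family
begin

definition pV :: "'v set \<Rightarrow> 'v set \<Rightarrow> 'v \<Rightarrow> 'q" where
  "pV H S v = (if v \<in> S then V v - av H v else V v)"

context
  fixes H S
  assumes her: "hereditary E H" and S: "S \<subseteq> breaking_vertices E H"
begin

private lemma HS: "v \<in> H \<Longrightarrow> v \<in> verts E" "v \<in> S \<Longrightarrow> v \<in> verts E" "v \<in> S \<Longrightarrow> v \<notin> H"
    "v \<in> S \<Longrightarrow> finite (out_arcs_avoiding E H v)" "e \<in> arcs E \<Longrightarrow> tail E e \<in> H \<Longrightarrow> head E e \<in> H"
  using her S by (auto simp: hereditary_def dest: breaking_verticesD)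

text \<open>For \<open>v\<close> in \<open>S\<close>, v^H fixes the edges from \<open>v\<close> into
  \<open>H\<close> and kills those avoiding \<open>H\<close>, which is exactly the selection of
  edges in the restricted graph.\<close>

lemma pV_A:
  assumes "e \<in> arcs E" "v \<in> H \<union> S"
  shows "pV H S v * A e = (if v = tail E e \<and> e \<in> arcs (pair_graph E H S) then A e else 0)"
proof -
  have v: "v \<in> verts E" using assms HS by blast
  show ?thesis
  proof (cases "v \<in> S")
    case True
    then show ?thesis
      using assms(1) v HS(3,4)[OF True]
      by (auto simp: pV_def left_diff_distrib V_A_if av_A out_arcs_avoiding_def)
  next
    case False
    then show ?thesis
      using assms v by (auto simp: pV_def V_A_if)
  qed
qed

lemma G_pV:
  assumes "e \<in> arcs E" "v \<in> H \<union> S"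
  shows "G e * pV H S v = (if v = tail E e \<and> e \<in> arcs (pair_graph E H S) then G e else 0)"
proof -
  have v: "v \<in> verts E" using assms HS by blast
  show ?thesis
  proof (cases "v \<in> S")
    case True
    then show ?thesis
      using assms(1) v HS(3,4)[OF True]
      by (auto simp: pV_def right_diff_distrib G_V_if G_av out_arcs_avoiding_def)
  next
    case False
    then show ?thesis
      using assms v by (auto simp: pV_def G_V_if)
  qed
qed

lemma pair_family: "leavitt_family (pair_graph E H S) c (pV H S) A G"
proof (rule leavitt_family.intro[OF wf_pair_graph[OF her]], unfold_locales)
  let ?P = "pair_graph E H S"
  fix v w assume vw: "v \<in> verts ?P" "w \<in> verts ?P"
  then have "v \<in> verts E" "w \<in> verts E"
    using HS by auto
  then show "pV H S v * pV H S w = (if v = w then pV H S v else 0)"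
    using vw HS(4)
    by (auto simp: pV_def left_diff_distrib right_diff_distrib V_V V_av av_V av_av av_orth)
next
  let ?P = "pair_graph E H S"
  fix e assume e: "e \<in> arcs ?P"
  then have hd1: "head E e \<in> H" and tl: "tail E e \<in> H \<union> S" and e': "e \<in> arcs E"
    using HS(5)[of e] by auto
  have hd2: "head E e \<notin> S"
    using HS(3)[of "head E e"] hd1 by auto
  note hd = hd1 hd2
  show "pV H S (tail ?P e) * A e = A e"
    using pV_A[OF e' tl] e by simp
  show "G e * pV H S (tail ?P e) = G e"
    using G_pV[OF e' tl] e by simp
  show "A e * pV H S (head ?P e) = A e" "pV H S (head ?P e) * G e = G e"
    using hd e' by (simp_all add: pV_def A_V V_G)
  fix f assume "f \<in> arcs ?P"
  then show "G e * A f = (if e = f then pV H S (head ?P e) else 0)"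
    using e' hd by (auto simp: G_A pV_def)
next
  let ?P = "pair_graph E H S"
  fix v assume v: "v \<in> regular_vertices ?P"
  \<comment> \<open>A vertex of \<open>S\<close> emits infinitely many edges, of which only finitely
    many avoid \<open>H\<close>. It stays an infinite emitter in the restricted graph, so no sum
    relation is imposed on v^H.\<close>
  have "v \<in> H"
  proof (rule ccontr)
    assume "v \<notin> H"
    then have vS: "v \<in> S" using v by (auto simp: regular_vertices_def)
    have "out_arcs E v \<subseteq> out_arcs ?P v \<union> out_arcs_avoiding E H v"
      using vS by (auto simp: out_arcs_avoiding_def)
    moreover have "finite (out_arcs ?P v \<union> out_arcs_avoiding E H v)"
      using v HS(4)[OF vS] by (simp add: regular_vertices_def)
    ultimately have "finite (out_arcs E v)"
      by (rule finite_subset)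
    then show False
      using breaking_verticesD(3)[of v E H] vS S by auto
  qed
  then have "out_arcs ?P v = out_arcs E v" "pV H S v = V v"
    using HS(3) by (auto simp: pV_def)
  then show "pV H S v = (\<Sum>e\<in>out_arcs ?P v. A e * G e)"
    using v CK[of v] HS(1)[OF \<open>v \<in> H\<close>] by (simp add: regular_vertices_def)
next
  show "c k * pV H S v = pV H S v * c k" for k v
    by (simp add: pV_def left_diff_distrib right_diff_distrib c_V c_av)
  show "c 1 * pV H S v = pV H S v" for v
    by (simp add: pV_def right_diff_distrib c_one c_one_av)
qed (simp_all add: c_add c_mult c_A c_G)

lemma awalk_pair_graph:
  "awalk w q z \<Longrightarrow> w \<in> H \<Longrightarrow> pre_digraph.awalk (pair_graph E H S) w q z"
proof (induction q arbitrary: w)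
  interpret P: wf_digraph "pair_graph E H S"
    by (rule wf_pair_graph[OF her])
  {
    case Nil
    then show ?case by (simp add: P.awalk_Nil_iff awalk_Nil_iff)
  next
    case (Cons e q)
    then have "e \<in> arcs E" "w = tail E e" "awalk (head E e) q z"
      by (simp_all add: awalk_Cons_iff)
    with Cons.IH[of "head E e"] Cons.prems(2) HS(5)[of e] show ?case
      by (simp add: P.awalk_Cons_iff)
  }
qed

text \<open>Only the first edge can fail to belong to the restricted graph: if it belongs, it ends
  in \<open>H\<close>, and the rest of the path stays there.\<close>

lemma pV_Pa:
  assumes "awalk u p z" "v \<in> H \<union> S"
  shows "pV H S v * Pa u p = (if u = v \<and> pre_digraph.awalk (pair_graph E H S) v p z
    then pV H S v * prod_list (map A p) else 0)"
proof -
  interpret P: wf_digraph "pair_graph E H S"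
    by (rule wf_pair_graph[OF her])
  have v: "v \<in> verts E" and u: "u \<in> verts E" using assms HS awalk_hd_in_verts by blast+
  have pVV: "pV H S v * V u = (if u = v then pV H S v else 0)"
    using v u by (auto simp: pV_def left_diff_distrib V_V av_V)
  show ?thesis
  proof (cases p)
    case Nil
    then have "z = u"
      using assms(1) by (simp add: awalk_Nil_iff)
    have 1: "Pa u p = V u"
      unfolding Nil by (rule Pa_Nil)
    have 2: "P.awalk v p z \<longleftrightarrow> v = u"
      unfolding Nil P.awalk_Nil_iff \<open>z = u\<close> using assms(2) by simp
    have 3: "prod_list (map A p) = 1" "prod_list (map G (rev p)) = 1"
      by (simp_all add: Nil)
    show ?thesis
      unfolding 1 2 3 pVV by (cases "u = v") simp_all
  next
    case (Cons e q)
    then have e: "e \<in> arcs E" "u = tail E e" "awalk (head E e) q z"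
      using assms by (simp_all add: awalk_Cons_iff)
    have walk: "P.awalk v p z \<longleftrightarrow> v = tail E e \<and> e \<in> arcs (pair_graph E H S)"
      unfolding Cons P.awalk_Cons_iff using awalk_pair_graph[OF e(3)] e(1) HS(5)[of e] by auto
    then have aw: "u = v \<and> P.awalk v p z \<longleftrightarrow> u = v \<and> e \<in> arcs (pair_graph E H S)"
      using e(2) by blast
    have "pV H S v * Pa u p = (if u = v then pV H S v * A e * prod_list (map A q) else 0)"
      using pVV by (simp add: Pa_def Cons mult.assoc[symmetric])
    also have "\<dots> = (if u = v \<and> P.awalk v p z then pV H S v * prod_list (map A p) else 0)"
      unfolding aw by (auto simp: Cons e(2) pV_A[OF e(1) assms(2)] mult.assoc[symmetric]
        simp del: pair_graph_simps)
    finally show ?thesis .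
  qed
qed

lemma Pg_pV:
  assumes "awalk u p z" "v \<in> H \<union> S"
  shows "Pg u p * pV H S v = (if u = v \<and> pre_digraph.awalk (pair_graph E H S) v p z
    then prod_list (map G (rev p)) * pV H S v else 0)"
proof -
  interpret P: wf_digraph "pair_graph E H S"
    by (rule wf_pair_graph[OF her])
  have v: "v \<in> verts E" and u: "u \<in> verts E" using assms HS awalk_hd_in_verts by blast+
  have pVV: "V u * pV H S v = (if u = v then pV H S v else 0)"
    using v u by (auto simp: pV_def right_diff_distrib V_V V_av)
  show ?thesis
  proof (cases p)
    case Nil
    then have "z = u"
      using assms(1) by (simp add: awalk_Nil_iff)
    have 1: "Pg u p = V u"
      unfolding Nil by (rule Pg_Nil)
    have 2: "P.awalk v p z \<longleftrightarrow> v = u"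
      unfolding Nil P.awalk_Nil_iff \<open>z = u\<close> using assms(2) by simp
    have 3: "prod_list (map A p) = 1" "prod_list (map G (rev p)) = 1"
      by (simp_all add: Nil)
    show ?thesis
      unfolding 1 2 3 pVV by (cases "u = v") simp_all
  next
    case (Cons e q)
    then have e: "e \<in> arcs E" "u = tail E e" "awalk (head E e) q z"
      using assms by (simp_all add: awalk_Cons_iff)
    have walk: "P.awalk v p z \<longleftrightarrow> v = tail E e \<and> e \<in> arcs (pair_graph E H S)"
      unfolding Cons P.awalk_Cons_iff using awalk_pair_graph[OF e(3)] e(1) HS(5)[of e] by auto
    then have aw: "u = v \<and> P.awalk v p z \<longleftrightarrow> u = v \<and> e \<in> arcs (pair_graph E H S)"
      using e(2) by blast
    have "Pg u p * pV H S v = (if u = v then prod_list (map G (rev q)) * (G e * pV H S v) else 0)"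
      using pVV by (simp add: Pg_def Cons mult.assoc)
    also have "\<dots> = (if u = v \<and> P.awalk v p z then prod_list (map G (rev p)) * pV H S v else 0)"
      unfolding aw by (auto simp: Cons e(2) G_pV[OF e(1) assms(2)] mult.assoc simp del: pair_graph_simps)
    finally show ?thesis .
  qed
qed

end

end

section \<open>From polynomials to the algebra of cosets\<close>

section \<open>Quotients of algebras without unit\<close>

locale nu_algebra = nu_ring A for A :: "('k, 'a, 'm) module_scheme" (structure) +
  assumes smult_closed: "x \<in> carrier A \<Longrightarrow> k \<odot> x \<in> carrier A"
    and smult_r_distr: "\<lbrakk>x \<in> carrier A; y \<in> carrier A\<rbrakk> \<Longrightarrow> k \<odot> (x \<oplus> y) = k \<odot> x \<oplus> k \<odot> y"

context nu_ideal
begin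

lemma is_abelian_subgroup: "abelian_subgroup I R"
  by (rule abelian_subgroupI3[OF additive_subgroup_axioms abelian_group_axioms])

lemma coset_eq_iff:
  assumes "x \<in> carrier R" "y \<in> carrier R"
  shows "I +> x = I +> y \<longleftrightarrow> x \<ominus> y \<in> I"
proof -
  interpret abelian_subgroup I R by (rule is_abelian_subgroup)
  have "I +> x = I +> y \<longleftrightarrow> x \<in> I +> y"
    using a_repr_independence'[of x y] a_rcos_self[of x] assms by auto
  then show ?thesis
    using a_rcos_module[of y x] assms by (simp add: a_minus_def)
qed

lemma coset_mem_eq:
  assumes "x \<in> carrier R" "y \<in> I +> x"
  shows "I +> y = I +> x"
proof -
  interpret abelian_subgroup I R by (rule is_abelian_subgroup)
  show ?thesis
    using a_repr_independence'[of y x] assms by simp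
qed

lemma coset_add:
  assumes "x \<in> carrier R" "y \<in> carrier R"
  shows "(I +> x) <+> (I +> y) = I +> (x \<oplus> y)"
proof -
  interpret abelian_subgroup I R by (rule is_abelian_subgroup)
  show ?thesis using assms by (rule a_rcos_sum)
qed

lemma coset_self: "x \<in> carrier R \<Longrightarrow> x \<in> I +> x"
proof -
  interpret abelian_subgroup I R by (rule is_abelian_subgroup)
  show "x \<in> carrier R \<Longrightarrow> x \<in> I +> x" by (rule a_rcos_self)
qed

text \<open>The product of cosets is a union over all products of representatives; these products
  lie in one coset, and the union is not empty.\<close>

lemma coset_mult:
  assumes x: "x \<in> carrier R" and y: "y \<in> carrier R"
  shows "[mod I:] (I +> x) \<Otimes> (I +> y) = I +> (x \<otimes> y)"
proof -
  have "I +> (a \<otimes> b) = I +> (x \<otimes> y)" if "a \<in> I +> x" "b \<in> I +> y" for a b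
  proof (rule coset_mem_eq)
    obtain i j where i: "i \<in> I" "a = i \<oplus> x" and j: "j \<in> I" "b = j \<oplus> y"
      using \<open>a \<in> I +> x\<close> \<open>b \<in> I +> y\<close> by (auto simp: a_r_coset_def r_coset_def)
    note carr = i(1)[THEN a_Hcarr] j(1)[THEN a_Hcarr] x y
    have "a \<otimes> b = (i \<otimes> b \<oplus> x \<otimes> j) \<oplus> x \<otimes> y"
      using carr by (simp add: i(2) j(2) l_distr r_distr m_closed a_assoc a_lcomm)
    moreover have "i \<otimes> b \<oplus> x \<otimes> j \<in> I"
      using i(1) j carr by (simp add: I_l_closed I_r_closed)
    ultimately show "a \<otimes> b \<in> I +> (x \<otimes> y)"
      by (auto simp: a_r_coset_def r_coset_def)
  qed (simp add: m_closed x y)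
  moreover have "I +> x \<noteq> {}" "I +> y \<noteq> {}"
    using coset_self x y by blast+
  ultimately show ?thesis
    unfolding rcoset_mult_def by (simp cong: SUP_cong_simp)
qed

end

lemma alg_quot_carrier: "carrier (alg_quot A I) = (\<lambda>x. I +>\<^bsub>A\<^esub> x) ` carrier A"
  by (auto simp: alg_quot_def FactRing_def A_RCOSETS_def RCOSETS_def a_r_coset_def)

context
  fixes A :: "('k, 'a, 'm) module_scheme" and I
  assumes A: "nu_algebra A" and I: "alg_ideal I A"
begin

interpretation nu_algebra A by (rule A)

interpretation nu_ideal I A using I by (simp add: alg_ideal_def)

lemma alg_quot_ops:
  assumes "x \<in> carrier A" "y \<in> carrier A"
  shows "(I +>\<^bsub>A\<^esub> x) \<oplus>\<^bsub>alg_quot A I\<^esub> (I +>\<^bsub>A\<^esub> y) = I +>\<^bsub>A\<^esub> (x \<oplus>\<^bsub>A\<^esub> y)"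
    and "(I +>\<^bsub>A\<^esub> x) \<otimes>\<^bsub>alg_quot A I\<^esub> (I +>\<^bsub>A\<^esub> y) = I +>\<^bsub>A\<^esub> (x \<otimes>\<^bsub>A\<^esub> y)"
    and "k \<odot>\<^bsub>alg_quot A I\<^esub> (I +>\<^bsub>A\<^esub> x) = I +>\<^bsub>A\<^esub> (k \<odot>\<^bsub>A\<^esub> x)"
    and "\<zero>\<^bsub>alg_quot A I\<^esub> = I +>\<^bsub>A\<^esub> \<zero>\<^bsub>A\<^esub>"
proof -
  show "(I +>\<^bsub>A\<^esub> x) \<oplus>\<^bsub>alg_quot A I\<^esub> (I +>\<^bsub>A\<^esub> y) = I +>\<^bsub>A\<^esub> (x \<oplus>\<^bsub>A\<^esub> y)"
    using coset_add[OF assms] by (simp add: alg_quot_def FactRing_def)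
  show "(I +>\<^bsub>A\<^esub> x) \<otimes>\<^bsub>alg_quot A I\<^esub> (I +>\<^bsub>A\<^esub> y) = I +>\<^bsub>A\<^esub> (x \<otimes>\<^bsub>A\<^esub> y)"
    using coset_mult[OF assms] by (simp add: alg_quot_def FactRing_def)
  show "\<zero>\<^bsub>alg_quot A I\<^esub> = I +>\<^bsub>A\<^esub> \<zero>\<^bsub>A\<^esub>"
    using a_subset by (simp add: alg_quot_def FactRing_def)
  have "I +>\<^bsub>A\<^esub> (k \<odot>\<^bsub>A\<^esub> a) = I +>\<^bsub>A\<^esub> (k \<odot>\<^bsub>A\<^esub> x)" if a: "a \<in> I +>\<^bsub>A\<^esub> x" for a
  proof (rule coset_mem_eq)
    obtain i where i: "i \<in> I" "a = i \<oplus>\<^bsub>A\<^esub> x"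
      using a by (auto simp: a_r_coset_def r_coset_def)
    then have "k \<odot>\<^bsub>A\<^esub> a = k \<odot>\<^bsub>A\<^esub> i \<oplus>\<^bsub>A\<^esub> k \<odot>\<^bsub>A\<^esub> x" "k \<odot>\<^bsub>A\<^esub> i \<in> I"
      using I assms(1) a_Hcarr by (auto simp: smult_r_distr alg_ideal_def)
    then show "k \<odot>\<^bsub>A\<^esub> a \<in> I +>\<^bsub>A\<^esub> (k \<odot>\<^bsub>A\<^esub> x)"
      by (auto simp: a_r_coset_def r_coset_def)
  qed (simp add: assms smult_closed)
  moreover have "I +>\<^bsub>A\<^esub> x \<noteq> {}"
    using coset_self assms by blast
  ultimately show "k \<odot>\<^bsub>alg_quot A I\<^esub> (I +>\<^bsub>A\<^esub> x) = I +>\<^bsub>A\<^esub> (k \<odot>\<^bsub>A\<^esub> x)"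
    by (simp add: alg_quot_def cong: SUP_cong_simp)
qed

lemma nu_algebra_quot: "nu_algebra (alg_quot A I)"
proof -
  have ag: "abelian_group (alg_quot A I)"
  proof (rule abelian_groupI)
    fix X assume "X \<in> carrier (alg_quot A I)"
    then obtain x where x: "x \<in> carrier A" "X = I +>\<^bsub>A\<^esub> x"
      by (auto simp: alg_quot_carrier)
    then have "\<ominus>\<^bsub>A\<^esub> x \<in> carrier A" "\<ominus>\<^bsub>A\<^esub> x \<oplus>\<^bsub>A\<^esub> x = \<zero>\<^bsub>A\<^esub>"
      by (simp_all add: l_neg)
    then show "\<exists>Y\<in>carrier (alg_quot A I). Y \<oplus>\<^bsub>alg_quot A I\<^esub> X = \<zero>\<^bsub>alg_quot A I\<^esub>"
      using x alg_quot_ops(1)[of "\<ominus>\<^bsub>A\<^esub> x" x] alg_quot_ops(4)[OF x(1) x(1)]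
      unfolding alg_quot_carrier by (intro bexI[of _ "I +>\<^bsub>A\<^esub> (\<ominus>\<^bsub>A\<^esub> x)"] imageI) auto
  qed (auto simp: alg_quot_carrier alg_quot_ops[of "\<zero>\<^bsub>A\<^esub>" "\<zero>\<^bsub>A\<^esub>"] alg_quot_ops a_ac)
  show ?thesis
    by (rule nu_algebra.intro[OF nu_ring.intro[OF ag nu_ring_axioms.intro] nu_algebra_axioms.intro])
      (auto simp: alg_quot_carrier alg_quot_ops m_closed m_assoc l_distr r_distr smult_closed smult_r_distr)
qed

lemma alg_quot_coset_eq_iff:
  "x \<in> carrier A \<Longrightarrow> y \<in> carrier A \<Longrightarrow> I +>\<^bsub>A\<^esub> x = I +>\<^bsub>A\<^esub> y \<longleftrightarrow> x \<ominus>\<^bsub>A\<^esub> y \<in> I"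
  by (rule coset_eq_iff)

end

section \<open>Leavitt path algebras as quotients of the augmentation ideal\<close>

lemma free_alg_simps [simp]:
  "add (free_alg G) = (+)" "mult (free_alg G) = (*)" "\<zero>\<^bsub>free_alg G\<^esub> = 0"
  "k \<odot>\<^bsub>free_alg G\<^esub> f = cst k * f"
  by (simp_all add: free_alg_def mult_map_scale_conv_mult)

lemma free_alg_carrier:
  "f \<in> carrier (free_alg G) \<longleftrightarrow> (\<forall>w\<in>Poly_Mapping.keys f. letters w \<noteq> [] \<and> set (letters w) \<subseteq> G)"
  by (simp add: free_alg_def)

lemma free_alg_zero: "0 \<in> carrier (free_alg G)"
  by (simp add: free_alg_carrier)

lemma free_alg_add: "f \<in> carrier (free_alg G) \<Longrightarrow> g \<in> carrier (free_alg G) \<Longrightarrow> f + g \<in> carrier (free_alg G)"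
  using keys_add[of f g] by (fastforce simp: free_alg_carrier)

lemma free_alg_mult:
  "f \<in> carrier (free_alg G) \<Longrightarrow> g \<in> carrier (free_alg G) \<Longrightarrow> f * g \<in> carrier (free_alg G)"
  using keys_mult[of f g] by (fastforce simp: free_alg_carrier plus_word_def)

lemma free_alg_cst_mult: "f \<in> carrier (free_alg G) \<Longrightarrow> cst k * f \<in> carrier (free_alg G)"
  using keys_mult[of "cst k" f] by (fastforce simp: free_alg_carrier split: if_splits)

lemma free_alg_uminus: "f \<in> carrier (free_alg G) \<Longrightarrow> - f \<in> carrier (free_alg G)"
  by (simp add: free_alg_carrier in_keys_iff)

lemma free_alg_diff: "f \<in> carrier (free_alg G) \<Longrightarrow> g \<in> carrier (free_alg G) \<Longrightarrow> f - g \<in> carrier (free_alg G)"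
  using free_alg_add[of f G "- g"] free_alg_uminus[of g G] by simp

lemma free_alg_sum: "(\<And>i. i \<in> B \<Longrightarrow> f i \<in> carrier (free_alg G)) \<Longrightarrow> sum f B \<in> carrier (free_alg G)"
  by (induction B rule: infinite_finite_induct) (simp_all add: free_alg_zero free_alg_add)

lemma free_alg_gen: "g \<in> G \<Longrightarrow> gen g \<in> carrier (free_alg G)"
  by (simp add: free_alg_carrier)

lemma free_alg_hpart: "f \<in> carrier (free_alg G) \<Longrightarrow> hpart n f \<in> carrier (free_alg G)"
  by (simp add: free_alg_carrier keys_hpart)

lemma free_alg_augmentation: "carrier (free_alg G) \<subseteq> augmentation_ideal"
  by (force simp: free_alg_carrier augmentation_ideal_def zero_word_def in_keys_iff)

lemmas free_alg_closed = free_alg_zero free_alg_add free_alg_mult free_alg_cst_mult free_alg_diff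
  free_alg_sum

lemma free_alg_ev:
  assumes "\<And>g. g \<in> G \<Longrightarrow> \<sigma> g \<in> carrier (free_alg G')" and f: "f \<in> carrier (free_alg G)"
  shows "ev \<sigma> f \<in> carrier (free_alg G')"
proof (induction f rule: free_induct_on)
  case (single ws k)
  then have "ws \<noteq> []" "set ws \<subseteq> G"
    using bspec[OF f[unfolded free_alg_carrier] single] by simp_all
  then have "prod_list (map \<sigma> ws) \<in> carrier (free_alg G')"
    by (induction ws rule: list_nonempty_induct) (auto simp: assms(1) free_alg_mult)
  then show ?case by (simp add: ev_single free_alg_cst_mult)
qed (simp_all add: ev_add free_alg_zero free_alg_add)

lemma nu_algebra_free: "nu_algebra (free_alg G :: ('k::field, _) module)"
proof -
  have ag: "abelian_group (free_alg G :: ('k, _) module)"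
  proof (rule abelian_groupI)
    fix x assume "x \<in> carrier (free_alg G :: ('k, _) module)"
    then show "\<exists>y\<in>carrier (free_alg G). y \<oplus>\<^bsub>free_alg G\<^esub> x = \<zero>\<^bsub>free_alg G :: ('k, _) module\<^esub>"
      by (intro bexI[of _ "- x"]) (simp_all add: free_alg_uminus)
  qed (simp_all add: free_alg_closed add_ac)
  show ?thesis
    by (rule nu_algebra.intro[OF nu_ring.intro[OF ag nu_ring_axioms.intro] nu_algebra_axioms.intro])
      (simp_all add: free_alg_closed mult.assoc distrib_left distrib_right)
qed

lemma free_alg_a_inv: "f \<in> carrier (free_alg G) \<Longrightarrow> \<ominus>\<^bsub>free_alg G\<^esub> f = - f"
proof -
  interpret nu_algebra "free_alg G" by (rule nu_algebra_free)
  show "f \<in> carrier (free_alg G) \<Longrightarrow> \<ominus>\<^bsub>free_alg G\<^esub> f = - f"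
    by (rule minus_equality) (simp_all add: free_alg_uminus)
qed

lemma alg_ideal_two_sided:
  fixes J :: "('g word \<Rightarrow>\<^sub>0 'k::field) set"
  assumes "two_sided J"
  shows "alg_ideal (J \<inter> carrier (free_alg G)) (free_alg G :: ('k, 'g word \<Rightarrow>\<^sub>0 'k) module)"
proof -
  interpret nu_algebra "free_alg G :: ('k, 'g word \<Rightarrow>\<^sub>0 'k) module" by (rule nu_algebra_free)
  have "additive_subgroup (J \<inter> carrier (free_alg G)) (free_alg G :: ('k, 'g word \<Rightarrow>\<^sub>0 'k) module)"
  proof (intro additive_subgroup.intro add.subgroupI)
    show "J \<inter> carrier (free_alg G) \<noteq> {}"
      using two_sided_zero[OF assms] free_alg_zero by blast
  qed (use assms in \<open>auto simp: two_sided_closed free_alg_closed free_alg_a_inv free_alg_uminus two_sided_uminus\<close>)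
  then show ?thesis
    unfolding alg_ideal_def using assms nu_ring_axioms
    by (auto simp: nu_ideal_def nu_ideal_axioms_def two_sided_closed free_alg_closed)
qed

text \<open>A retraction that moves representatives into the free algebra of the definition. It
  drops foreign names, which lie in the kernel, and keeps the constant term, hence the restriction
  to \<open>augmentation_ideal\<close> in \<open>proj_in_free_alg\<close>.\<close>

definition proj :: "'g set \<Rightarrow> ('g word \<Rightarrow>\<^sub>0 'k) \<Rightarrow> 'g word \<Rightarrow>\<^sub>0 'k::field" where
  "proj G = ev (\<lambda>g. if g \<in> G then gen g else 0)"

lemma proj_free_alg:
  fixes f :: "'g word \<Rightarrow>\<^sub>0 'k::field"
  assumes f: "f \<in> carrier (free_alg G)"
  shows "proj G f = f"
proof (induction f rule: free_induct_on)
  case (single ws k)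
  then have "set ws \<subseteq> G"
    using bspec[OF f[unfolded free_alg_carrier] single] by simp_all
  then have "prod_list (map (\<lambda>g. if g \<in> G then gen g else 0 :: 'g word \<Rightarrow>\<^sub>0 'k) ws) = monomial_word ws"
  proof (induction ws)
    case Nil
    then show ?case by (simp flip: single_Word_Nil single_one)
  next
    case (Cons g ws)
    then show ?case by (simp add: single_Word_Cons[of g ws 1])
  qed
  then show ?case
    by (simp add: proj_def ev_single) (simp flip: single_eq_cst_mult)
qed (simp_all add: proj_def ev_add)

lemma proj_in_free_alg:
  fixes f :: "'g word \<Rightarrow>\<^sub>0 'k::field"
  assumes f: "f \<in> augmentation_ideal"
  shows "proj G f \<in> carrier (free_alg G)"
proof (induction f rule: free_induct_on)
  case (single ws k)
  then have "ws \<noteq> []"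
    using f by (auto simp: augmentation_ideal_def in_keys_iff zero_word_def)
  then have "prod_list (map (\<lambda>g. if g \<in> G then gen g else 0 :: 'g word \<Rightarrow>\<^sub>0 'k) ws) \<in> carrier (free_alg G)"
    by (induction ws rule: list_nonempty_induct) (auto simp: free_alg_zero free_alg_gen free_alg_mult)
  then show ?case
    by (simp add: proj_def ev_single free_alg_cst_mult)
qed (simp_all add: proj_def ev_add free_alg_zero free_alg_add)

lemma proj_congruent: "proj (lpa_generators E) f - f \<in> lpa_kernel E"
  unfolding proj_def
  by (rule ev_congruent_id[OF two_sided_kernel])
    (auto simp: ev_simps two_sided_zero[OF two_sided_kernel]
      intro: two_sided_uminus[OF two_sided_kernel] gen_in_kernel)

lemma relations_in_free_alg:
  assumes "wf_digraph E"
  shows "lpa_relations E \<subseteq> carrier (free_alg (lpa_generators E))"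
  using assms unfolding lpa_relations_def Let_def
  by (auto simp: regular_vertices_def intro!: free_alg_diff free_alg_mult free_alg_gen free_alg_sum
    wf_digraph.head_in_verts wf_digraph.tail_in_verts)

definition lcos :: "('v, 'e) pre_digraph \<Rightarrow> (('v, 'e) lpa_gen word \<Rightarrow>\<^sub>0 'k) \<Rightarrow> ('k::field, 'v, 'e) lpa" where
  "lcos E f = lpa_null TYPE('k) E +>\<^bsub>free_alg (lpa_generators E) :: ('k, ('v, 'e) lpa_gen word \<Rightarrow>\<^sub>0 'k) module\<^esub> f"

abbreviation carr :: "('v, 'e) pre_digraph \<Rightarrow> (('v, 'e) lpa_gen word \<Rightarrow>\<^sub>0 'k::field) set" where
  "carr E \<equiv> carrier (free_alg (lpa_generators E))"

lemma lpa_word_lcos: "lpa_word K E ws = lcos E (monomial_word ws)"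
  unfolding lpa_word_def lcos_def lpa_null_def ..

text \<open>Links the ideal generated in the algebra without unit to the kernel in the unital ring.
  For the inclusion of the kernel, an algebra ideal \<open>I\<close> is pulled back along
  \<open>proj\<close>, and the pull-back is two-sided in the whole ring.\<close>

lemma lpa_null_eq:
  fixes K :: "'k::field itself"
  assumes "wf_digraph E"
  shows "lpa_null K E = lpa_kernel E \<inter> carr E"
proof
  have "lpa_relations E \<subseteq> (lpa_kernel E :: (_ \<Rightarrow>\<^sub>0 'k) set)"
    unfolding lpa_kernel_def using hull_incl by (rule subset_trans[rotated]) blast
  then show "lpa_null K E \<subseteq> lpa_kernel E \<inter> carr E"
    unfolding lpa_null_def alg_genideal_def
    using alg_ideal_two_sided[OF two_sided_kernel] relations_in_free_alg[OF assms] by blast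
  show "lpa_kernel E \<inter> carr E \<subseteq> lpa_null K E"
    unfolding lpa_null_def alg_genideal_def
  proof (rule Inter_greatest)
    fix I :: "(_ \<Rightarrow>\<^sub>0 'k) set"
    assume "I \<in> {I. alg_ideal I (free_alg (lpa_generators E)) \<and> lpa_relations E \<subseteq> I}"
    then have I: "alg_ideal I (free_alg (lpa_generators E))" "lpa_relations E \<subseteq> I" by auto
    let ?G = "lpa_generators E" and ?\<pi> = "proj (lpa_generators E) :: (_ \<Rightarrow>\<^sub>0 'k) \<Rightarrow> _"
    interpret nu_ideal I "free_alg ?G" using I(1) by (simp add: alg_ideal_def)
    have I_add: "x + y \<in> I" if "x \<in> I" "y \<in> I" for x y using additive_subgroup.a_closed[OF additive_subgroup_axioms that] by simp
    have I0: "0 \<in> I" using additive_subgroup.zero_closed[OF additive_subgroup_axioms] by simp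
    have I_cst: "cst k * x \<in> I" if "x \<in> I" for k x using I(1) that by (simp add: alg_ideal_def)
    have I_l: "a * x \<in> I" and I_r: "x * a \<in> I" if "x \<in> I" "a \<in> carr E" for a x
      using I_l_closed[OF that] I_r_closed[OF that] by simp_all
    \<comment> \<open>After projection a multiplier is a scalar plus an element of the free algebra,
      and \<open>I\<close> is closed under multiplication by both.\<close>
    have split: "\<exists>k a. a \<in> carr E \<and> ?\<pi> r = cst k + a" for r
    proof -
      let ?k = "Poly_Mapping.lookup r 0"
      have "r - cst ?k \<in> augmentation_ideal"
        by (simp add: augmentation_ideal_def lookup_minus)
      then have "?\<pi> (r - cst ?k) \<in> carr E"
        by (rule proj_in_free_alg)
      moreover have "?\<pi> r = cst ?k + ?\<pi> (r - cst ?k)"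
        by (simp add: proj_def ev_diff)
      ultimately show ?thesis by blast
    qed
    have two: "two_sided {f. ?\<pi> f \<in> I}"
    proof (rule two_sidedI)
      show "0 \<in> {f. ?\<pi> f \<in> I}" using I0 by (simp add: proj_def)
      show "x + y \<in> {f. ?\<pi> f \<in> I}" if "x \<in> {f. ?\<pi> f \<in> I}" "y \<in> {f. ?\<pi> f \<in> I}" for x y
        using that I_add by (simp add: proj_def ev_add)
      fix x r assume x: "x \<in> {f. ?\<pi> f \<in> I}"
      obtain k a where "a \<in> carr E" "?\<pi> r = cst k + a" using split by blast
      then show "r * x \<in> {f. ?\<pi> f \<in> I}" "x * r \<in> {f. ?\<pi> f \<in> I}"
        using x I_add I_cst I_l I_r
        by (simp_all add: proj_def ev_mult distrib_left distrib_right flip: cst_commute)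
    qed
    have "lpa_kernel E \<subseteq> {f. ?\<pi> f \<in> I}"
      unfolding lpa_kernel_def
    proof (rule hull_least[OF two Un_least])
      show "lpa_relations E \<subseteq> {f. ?\<pi> f \<in> I}"
        using I(2) relations_in_free_alg[OF assms] by (auto simp: proj_free_alg subset_iff)
      show "gen ` (- ?G) \<subseteq> {f. ?\<pi> f \<in> I}"
        using I0 by (auto simp: proj_def)
    qed
    then show "lpa_kernel E \<inter> carr E \<subseteq> I"
      by (auto simp: proj_free_alg subset_iff)
  qed
qed

locale graph_algebra = wf_digraph E for E :: "('v, 'e) pre_digraph" +
  fixes K :: "'k::field itself"
begin

abbreviation "N \<equiv> lpa_kernel E :: (('v, 'e) lpa_gen word \<Rightarrow>\<^sub>0 'k) set"
abbreviation "C \<equiv> carr E :: (('v, 'e) lpa_gen word \<Rightarrow>\<^sub>0 'k) set"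
abbreviation "A \<equiv> LPA K E"
abbreviation cos :: "(('v, 'e) lpa_gen word \<Rightarrow>\<^sub>0 'k) \<Rightarrow> ('k, 'v, 'e) lpa" where "cos \<equiv> lcos E"

lemma null_ideal: "alg_ideal (lpa_null K E) (free_alg (lpa_generators E))"
  unfolding lpa_null_eq[OF wf_digraph_axioms] by (rule alg_ideal_two_sided[OF two_sided_kernel])

lemma cos_eq: "cos f = lpa_null K E +>\<^bsub>free_alg (lpa_generators E) :: ('k, ('v, 'e) lpa_gen word \<Rightarrow>\<^sub>0 'k) module\<^esub> f"
  by (simp add: lcos_def lpa_null_def)

lemma carrier_A: "carrier A = cos ` C"
  by (simp add: LPA_def alg_quot_carrier cos_eq image_def)

lemma cos_ops:
  assumes "f \<in> C" "g \<in> C"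
  shows cos_add: "cos f \<oplus>\<^bsub>A\<^esub> cos g = cos (f + g)" and cos_mult: "cos f \<otimes>\<^bsub>A\<^esub> cos g = cos (f * g)"
    and cos_smult: "k \<odot>\<^bsub>A\<^esub> cos f = cos (cst k * f)"
  using alg_quot_ops[OF nu_algebra_free null_ideal assms] by (simp_all add: LPA_def cos_eq)

lemma cos_zero: "\<zero>\<^bsub>A\<^esub> = cos 0"
  using alg_quot_ops(4)[OF nu_algebra_free null_ideal free_alg_zero free_alg_zero]
  by (simp add: LPA_def cos_eq)

lemma nu_algebra_A: "nu_algebra A"
  unfolding LPA_def by (rule nu_algebra_quot[OF nu_algebra_free null_ideal])

sublocale A: nu_algebra A
  by (rule nu_algebra_A)

lemma cos_eq_iff:
  assumes "f \<in> C" "g \<in> C"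
  shows "cos f = cos g \<longleftrightarrow> f - g \<in> N"
  using alg_quot_coset_eq_iff[OF nu_algebra_free null_ideal assms] assms
  by (simp add: cos_eq a_minus_def free_alg_a_inv lpa_null_eq[OF wf_digraph_axioms] free_alg_diff)

lemma cos_closed: "f \<in> C \<Longrightarrow> cos f \<in> carrier A"
  by (simp add: carrier_A)

lemma cos_uminus: "f \<in> C \<Longrightarrow> \<ominus>\<^bsub>A\<^esub> cos f = cos (- f)"
  by (rule A.minus_equality) (simp_all add: cos_closed free_alg_uminus cos_add cos_zero)

lemma cos_minus: "f \<in> C \<Longrightarrow> g \<in> C \<Longrightarrow> cos f \<ominus>\<^bsub>A\<^esub> cos g = cos (f - g)"
  by (simp add: a_minus_def cos_uminus cos_add free_alg_uminus)

lemma cos_finsum: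
  assumes "\<And>i. i \<in> B \<Longrightarrow> f i \<in> C"
  shows "(\<Oplus>\<^bsub>A\<^esub>i\<in>B. cos (f i)) = cos (sum f B)"
  using assms
proof (induction B rule: infinite_finite_induct)
  case (insert i B)
  then show ?case
    by (simp add: A.finsum_insert cos_closed Pi_def cos_add free_alg_sum)
qed (simp_all add: cos_zero)

definition ideal_image :: "(('v, 'e) lpa_gen word \<Rightarrow>\<^sub>0 'k) set \<Rightarrow> ('k, 'v, 'e) lpa set" where
  "ideal_image J = cos ` (J \<inter> C)"

lemma cos_mem_iff:
  assumes "two_sided J" "N \<subseteq> J" "f \<in> C"
  shows "cos f \<in> ideal_image J \<longleftrightarrow> f \<in> J"
proof
  assume "cos f \<in> ideal_image J"
  then obtain g where "g \<in> J" "g \<in> C" "cos f = cos g"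
    by (auto simp: ideal_image_def)
  then show "f \<in> J"
    using assms two_sided_mem_cong[OF assms(1), of f g] by (auto simp: cos_eq_iff)
qed (auto simp: ideal_image_def assms)

lemma ideal_image_ideal:
  assumes "two_sided J"
  shows "nu_ideal (ideal_image J) A"
proof (intro nu_ideal.intro additive_subgroup.intro A.add.subgroupI nu_ideal_axioms.intro)
  show "ideal_image J \<noteq> {}"
    using two_sided_zero[OF assms] free_alg_zero by (auto simp: ideal_image_def)
  show "nu_ring A" by (rule A.nu_ring_axioms)
qed (auto simp: ideal_image_def carrier_A cos_ops cos_uminus free_alg_closed free_alg_uminus
  two_sided_closed[OF assms] two_sided_uminus[OF assms] intro!: imageI)

text \<open>\<open>proj\<close> replaces each element of \<open>J\<close> by a member of
  \<open>C\<close> with the same class modulo \<open>N\<close>, so an ideal inside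
  \<open>augmentation_ideal\<close> can be recovered from its image.\<close>

lemma ideal_image_subset_iff:
  assumes "two_sided J" "N \<subseteq> J" "J \<subseteq> augmentation_ideal"
    and "two_sided J'" "N \<subseteq> J'"
  shows "ideal_image J \<subseteq> ideal_image J' \<longleftrightarrow> J \<subseteq> J'"
proof
  assume sub: "ideal_image J \<subseteq> ideal_image J'"
  show "J \<subseteq> J'"
  proof
    fix f assume f: "f \<in> J"
    let ?g = "proj (lpa_generators E) f"
    have cong: "?g - f \<in> N" by (rule proj_congruent)
    have g: "?g \<in> C" using f assms(3) by (blast intro: proj_in_free_alg)
    have "?g \<in> J"
      using f two_sided_mem_cong[OF assms(1) subsetD[OF assms(2) cong]] by simp
    then have "cos ?g \<in> ideal_image J'"
      using sub g by (auto simp: ideal_image_def)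
    then have "?g \<in> J'"
      using g assms by (simp add: cos_mem_iff)
    then show "f \<in> J'"
      using two_sided_mem_cong[OF assms(4) subsetD[OF assms(5) cong]] by simp
  qed
qed (auto simp: ideal_image_def)

text \<open>The vertices at which the words of \<open>f\<close> begin and end suffice. These finite
  sums replace the missing unit: they give closure under scalars, idempotence of the algebra, and
  the reduction of corners to vertices.\<close>

lemma local_units:
  assumes "f \<in> C"
  obtains U where "finite U" "U \<subseteq> verts E"
    "(\<Sum>v\<in>U. gen (Vertex v)) * f - f \<in> N" "f * (\<Sum>v\<in>U. gen (Vertex v)) - f \<in> N"
proof -
  interpret lf: leavitt_family E "\<lambda>k. cls N (cst k)" "\<lambda>v. cls N (gen (Vertex v))"
    "\<lambda>e. cls N (gen (Edge e))" "\<lambda>e. cls N (gen (Ghost e))"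
    using family_of_gen[OF wf_digraph_axioms two_sided_kernel order_refl] by (simp add: family_of_def)
  let ?u = "\<lambda>U. \<Sum>v\<in>U. cls N (gen (Vertex v))"
  have "\<exists>U. finite U \<and> U \<subseteq> verts E \<and> (\<forall>U'. finite U' \<longrightarrow> U \<subseteq> U' \<longrightarrow> U' \<subseteq> verts E \<longrightarrow>
    ?u U' * cls N f = cls N f \<and> cls N f * ?u U' = cls N f)"
  proof (induction f rule: free_induct_on)
    case zero
    then show ?case by (auto intro!: exI[of _ "{}"])
  next
    case (single ws k)
    then have ws: "ws \<noteq> []" "set ws \<subseteq> lpa_generators E"
      using bspec[OF assms[unfolded free_alg_carrier] single] by simp_all
    obtain g us where g: "ws = g # us" "g \<in> lpa_generators E"
      using ws by (cases ws) auto
    obtain vs g' where g': "ws = vs @ [g']" "g' \<in> lpa_generators E"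
      using ws by (cases ws rule: rev_cases) auto
    define s where "s = (case g of Vertex v \<Rightarrow> v | Edge e \<Rightarrow> tail E e | Ghost e \<Rightarrow> head E e)"
    define t where "t = (case g' of Vertex v \<Rightarrow> v | Edge e \<Rightarrow> head E e | Ghost e \<Rightarrow> tail E e)"
    have st: "s \<in> verts E" "t \<in> verts E"
      using g(2) g'(2) by (cases g; cases g'; auto simp: s_def t_def tail_in_verts head_in_verts)+
    have sg: "cls N (gen (Vertex v)) * cls N (gen g) = (if v = s then cls N (gen g) else 0)"
      if "v \<in> verts E" for v
      using that g(2) by (cases g) (auto simp: s_def lf.V_V lf.V_A_if lf.V_G_if)
    have gt: "cls N (gen g') * cls N (gen (Vertex v)) = (if v = t then cls N (gen g') else 0)"
      if "v \<in> verts E" for v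
      using that g'(2) by (cases g') (auto simp: t_def lf.V_V lf.A_V_if lf.G_V_if)
    have cls_ws: "cls N (Poly_Mapping.single (Word ws) k) = cls N (gen g) * cls N (Poly_Mapping.single (Word us) k)"
      unfolding g(1) single_Word_Cons[of g us k] by (simp add: cls_mult)
    have "Poly_Mapping.single (Word ws) k = cst k * monomial_word ws"
      by (rule single_eq_cst_mult)
    also have "monomial_word ws = (monomial_word vs * gen g' :: ('v, 'e) lpa_gen word \<Rightarrow>\<^sub>0 'k)"
      unfolding g'(1) by (rule single_Word_append)
    finally have cls_ws': "cls N (Poly_Mapping.single (Word ws) k)
        = cls N (cst k * monomial_word vs) * cls N (gen g')"
      by (simp add: cls_mult mult.assoc)
    have "?u U' * cls N (Poly_Mapping.single (Word ws) k) = cls N (Poly_Mapping.single (Word ws) k)"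
      "cls N (Poly_Mapping.single (Word ws) k) * ?u U' = cls N (Poly_Mapping.single (Word ws) k)"
      if U': "finite U'" "{s, t} \<subseteq> U'" "U' \<subseteq> verts E" for U'
    proof -
      have "?u U' * cls N (gen g) = (\<Sum>v\<in>U'. if v = s then cls N (gen g) else 0)"
        unfolding sum_distrib_right using U' sg by (intro sum.cong) auto
      then have "?u U' * cls N (gen g) = cls N (gen g)" using U' by simp
      then show "?u U' * cls N (Poly_Mapping.single (Word ws) k) = cls N (Poly_Mapping.single (Word ws) k)"
        by (simp add: cls_ws mult.assoc[symmetric])
      have "cls N (gen g') * ?u U' = (\<Sum>v\<in>U'. if v = t then cls N (gen g') else 0)"
        unfolding sum_distrib_left using U' gt by (intro sum.cong) auto
      then have "cls N (gen g') * ?u U' = cls N (gen g')" using U' by simp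
      then show "cls N (Poly_Mapping.single (Word ws) k) * ?u U' = cls N (Poly_Mapping.single (Word ws) k)"
        by (simp add: cls_ws' mult.assoc)
    qed
    then show ?case using st by (intro exI[of _ "{s, t}"]) auto
  next
    case (add f g)
    then obtain U1 U2 where "finite U1" "U1 \<subseteq> verts E" "finite U2" "U2 \<subseteq> verts E"
      "\<forall>U'. finite U' \<longrightarrow> U1 \<subseteq> U' \<longrightarrow> U' \<subseteq> verts E \<longrightarrow> ?u U' * cls N f = cls N f \<and> cls N f * ?u U' = cls N f"
      "\<forall>U'. finite U' \<longrightarrow> U2 \<subseteq> U' \<longrightarrow> U' \<subseteq> verts E \<longrightarrow> ?u U' * cls N g = cls N g \<and> cls N g * ?u U' = cls N g"
      by blast
    then show ?case
      by (intro exI[of _ "U1 \<union> U2"]) (auto simp: distrib_left distrib_right cls_add)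
  qed
  then obtain U where "finite U" "U \<subseteq> verts E" "?u U * cls N f = cls N f" "cls N f * ?u U = cls N f"
    by auto
  then show thesis
    by (intro that[of U]) (simp_all add: cls_eq_iff[OF two_sided_kernel, symmetric] cls_mult cls_sum)
qed

lemma local_unit:
  assumes "f \<in> C"
  obtains u where "u \<in> C" "u * f - f \<in> N"
proof -
  obtain U where U: "U \<subseteq> verts E" "(\<Sum>v\<in>U. gen (Vertex v)) * f - f \<in> N"
    by (rule local_units[OF assms])
  have "(\<Sum>v\<in>U. gen (Vertex v)) \<in> C"
    using U(1) by (intro free_alg_sum free_alg_gen) auto
  then show thesis
    using U(2) by (rule that)
qed

text \<open>The given ideal is only a ring ideal. Closure under scalars comes from a local unit u,
  since k g = (k u) g; then the ideal is pulled back along \<open>proj\<close> as in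
  \<open>lpa_null_eq\<close>.\<close>

theorem nu_ideal_is_image:
  assumes I: "nu_ideal I A"
  obtains J where "two_sided J" "N \<subseteq> J" "J \<subseteq> augmentation_ideal" "I = ideal_image J"
proof -
  interpret I: nu_ideal I A by (rule I)
  let ?\<pi> = "proj (lpa_generators E) :: (_ \<Rightarrow>\<^sub>0 'k) \<Rightarrow> _"
  define J where "J = {f \<in> augmentation_ideal. cos (?\<pi> f) \<in> I}"
  have \<pi>C: "?\<pi> f \<in> C" if "f \<in> augmentation_ideal" for f
    using that by (rule proj_in_free_alg)
  note aug = two_sided_closed[OF two_sided_augmentation]
  have I0: "cos 0 \<in> I"
    using additive_subgroup.zero_closed[OF I.additive_subgroup_axioms] by (simp add: cos_zero)
  have Icst: "cos (cst k * g) \<in> I" if g: "g \<in> C" "cos g \<in> I" for k g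
  proof -
    obtain u where u: "u \<in> C" "u * g - g \<in> N" using local_unit[OF g(1)] .
    have "cst k * u * g - cst k * g = cst k * (u * g - g)"
      by (simp add: right_diff_distrib mult.assoc)
    then have "cos (cst k * g) = cos (cst k * u * g)"
      using u g two_sided_mult_left[OF two_sided_kernel u(2)]
      by (intro cos_eq_iff[THEN iffD2, symmetric]) (simp_all add: free_alg_closed)
    also have "\<dots> = cos (cst k * u) \<otimes>\<^bsub>A\<^esub> cos g"
      using u g by (simp add: cos_mult free_alg_closed)
    finally show ?thesis
      using I.I_l_closed[OF g(2), of "cos (cst k * u)"] u by (simp add: cos_closed free_alg_closed)
  qed
  have split: "\<exists>k a. a \<in> C \<and> ?\<pi> r = cst k + a" for r
  proof -
    let ?k = "Poly_Mapping.lookup r 0"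
    have "r - cst ?k \<in> augmentation_ideal"
      by (simp add: augmentation_ideal_def lookup_minus)
    then have "?\<pi> (r - cst ?k) \<in> C" by (rule \<pi>C)
    moreover have "?\<pi> r = cst ?k + ?\<pi> (r - cst ?k)"
      by (simp add: proj_def ev_diff)
    ultimately show ?thesis by blast
  qed
  have two: "two_sided J"
  proof (rule two_sidedI)
    show "0 \<in> J"
      using I0 by (simp add: J_def aug proj_def)
    show "x + y \<in> J" if "x \<in> J" "y \<in> J" for x y
      using that additive_subgroup.a_closed[OF I.additive_subgroup_axioms, of "cos (?\<pi> x)" "cos (?\<pi> y)"]
      by (simp add: J_def aug \<pi>C cos_add) (simp add: proj_def ev_add)
    fix x r assume "x \<in> J"
    then have x: "x \<in> augmentation_ideal" "cos (?\<pi> x) \<in> I" "?\<pi> x \<in> C"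
      by (auto simp: J_def \<pi>C)
    obtain k a where a: "a \<in> C" "?\<pi> r = cst k + a" using split by blast
    have c: "cos (cst k * ?\<pi> x) \<in> I" using x Icst by blast
    have l: "cos (a * ?\<pi> x) \<in> I" and r: "cos (?\<pi> x * a) \<in> I"
      using I.I_l_closed[OF x(2) cos_closed[OF a(1)]] I.I_r_closed[OF x(2) cos_closed[OF a(1)]] a x
      by (simp_all add: cos_mult)
    have "?\<pi> (r * x) = cst k * ?\<pi> x + a * ?\<pi> x" "?\<pi> (x * r) = cst k * ?\<pi> x + ?\<pi> x * a"
      using a(2) by (simp_all add: proj_def ev_mult distrib_left distrib_right cst_commute)
    then have "cos (?\<pi> (r * x)) = cos (cst k * ?\<pi> x) \<oplus>\<^bsub>A\<^esub> cos (a * ?\<pi> x)"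
      "cos (?\<pi> (x * r)) = cos (cst k * ?\<pi> x) \<oplus>\<^bsub>A\<^esub> cos (?\<pi> x * a)"
      using a x by (simp_all add: cos_add free_alg_closed)
    then show "r * x \<in> J" "x * r \<in> J"
      using additive_subgroup.a_closed[OF I.additive_subgroup_axioms c l]
        additive_subgroup.a_closed[OF I.additive_subgroup_axioms c r] x(1) by (simp_all add: J_def aug)
  qed
  have \<pi>N: "?\<pi> f \<in> N" if "f \<in> N" for f
    using that two_sided_mem_cong[OF two_sided_kernel proj_congruent[of E f]] by simp
  have "f \<in> J" if "f \<in> N" for f
  proof -
    have "f \<in> augmentation_ideal"
      using that kernel_augmentation by (rule rev_subsetD)
    moreover have "cos (?\<pi> f) = cos 0"
      using \<pi>N[OF that] cos_eq_iff[OF \<pi>C[OF calculation] free_alg_zero] by simp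
    ultimately show ?thesis
      using I0 by (simp add: J_def)
  qed
  then have "N \<subseteq> J" by (rule subsetI)
  moreover have "I = ideal_image J"
  proof
    show "I \<subseteq> ideal_image J"
    proof
      fix x assume x: "x \<in> I"
      then obtain f where f: "f \<in> C" "x = cos f"
        using I.a_subset by (auto simp: carrier_A)
      then have "f \<in> J"
        using x free_alg_augmentation by (auto simp: J_def proj_free_alg)
      then show "x \<in> ideal_image J" using f by (simp add: ideal_image_def)
    qed
    show "ideal_image J \<subseteq> I"
      by (auto simp: ideal_image_def J_def proj_free_alg)
  qed
  moreover have "J \<subseteq> augmentation_ideal"
    by (auto simp: J_def)
  ultimately show thesis
    using that[OF two] by simp
qed

lemma genideal_image:
  assumes Y: "Y \<subseteq> C"
  shows "nu_genideal A (cos ` Y) = ideal_image (ideal_hull (N \<union> Y))"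
proof
  have "cos ` Y \<subseteq> ideal_image (ideal_hull (N \<union> Y))"
    using hull_incl[of "N \<union> Y"] Y by (auto simp: ideal_image_def)
  then show "nu_genideal A (cos ` Y) \<subseteq> ideal_image (ideal_hull (N \<union> Y))"
    unfolding nu_genideal_def using ideal_image_ideal[OF two_sided_hull] by blast
  show "ideal_image (ideal_hull (N \<union> Y)) \<subseteq> nu_genideal A (cos ` Y)"
    unfolding nu_genideal_def
  proof (rule Inter_greatest)
    fix I assume "I \<in> {I. nu_ideal I A \<and> cos ` Y \<subseteq> I}"
    then have I: "nu_ideal I A" "cos ` Y \<subseteq> I" by auto
    obtain J where J: "two_sided J" "N \<subseteq> J" "J \<subseteq> augmentation_ideal" "I = ideal_image J"
      using nu_ideal_is_image[OF I(1)] .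
    have "Y \<subseteq> J"
      using I(2) Y J by (auto simp: cos_mem_iff subset_iff)
    then have "ideal_hull (N \<union> Y) \<subseteq> J"
      using J by (intro hull_least) auto
    then show "ideal_image (ideal_hull (N \<union> Y)) \<subseteq> I"
      unfolding J(4) by (auto simp: ideal_image_def)
  qed
qed

subsection \<open>The grading\<close>

definition path_rep :: "'v \<Rightarrow> 'e list \<Rightarrow> ('v, 'e) lpa_gen word \<Rightarrow>\<^sub>0 'k" where
  "path_rep u p = (if p = [] then gen (Vertex u) else monomial_word (map Edge p))"

definition star_rep :: "'v \<Rightarrow> 'e list \<Rightarrow> ('v, 'e) lpa_gen word \<Rightarrow>\<^sub>0 'k" where
  "star_rep u p = (if p = [] then gen (Vertex u) else monomial_word (map Ghost (rev p)))"

lemma path_reps: "lpa_path K E u p = cos (path_rep u p)" "lpa_path_star K E u p = cos (star_rep u p)"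
  by (simp_all add: lpa_path_def lpa_path_star_def path_rep_def star_rep_def lpa_word_lcos)

lemma path_rep_C:
  assumes "awalk u p w"
  shows "path_rep u p \<in> C" "star_rep u p \<in> C"
proof -
  have "u \<in> verts E" "set p \<subseteq> arcs E"
    using assms by (simp_all add: awalk_def)
  then show "path_rep u p \<in> C" "star_rep u p \<in> C"
    by (auto simp: path_rep_def star_rep_def free_alg_carrier)
qed

lemma path_rep_deg: "has_deg (int (length p)) (path_rep u p)" "has_deg (- int (length p)) (star_rep u p)"
proof -
  have "sum_list (map (gdeg \<circ> Edge) p) = int (length p)" for p :: "'e list"
    by (induction p) simp_all
  moreover have "sum_list (map (gdeg \<circ> Ghost) (rev p)) = - int (length p)" for p :: "'e list"
    by (induction p) simp_all
  ultimately show "has_deg (int (length p)) (path_rep u p)" "has_deg (- int (length p)) (star_rep u p)"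
    by (auto simp: path_rep_def star_rep_def has_deg_def wdeg_def)
qed

lemma cls_path_rep:
  assumes "awalk u p w"
  shows "cls N (path_rep u p) = cls N (gen (Vertex u)) * prod_list (map (\<lambda>e. cls N (gen (Edge e))) p)"
    and "cls N (star_rep u p) = prod_list (map (\<lambda>e. cls N (gen (Ghost e))) (rev p)) * cls N (gen (Vertex u))"
proof -
  interpret lf: leavitt_family E "\<lambda>k. cls N (cst k)" "\<lambda>v. cls N (gen (Vertex v))"
    "\<lambda>e. cls N (gen (Edge e))" "\<lambda>e. cls N (gen (Ghost e))"
    using family_of_gen[OF wf_digraph_axioms two_sided_kernel order_refl] by (simp add: family_of_def)
  have one: "cls N (cst 1) * (cls N x * y) = cls N x * y" for x y
    by (simp add: mult.assoc[symmetric])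
  show "cls N (path_rep u p) = cls N (gen (Vertex u)) * prod_list (map (\<lambda>e. cls N (gen (Edge e))) p)"
  proof (cases p)
    case (Cons e q)
    then have e: "e \<in> arcs E" "u = tail E e" using assms by (auto simp: awalk_Cons_iff)
    then show ?thesis
      using lf.V_A[OF e(1)] one
      by (simp add: path_rep_def Cons cls_single[of N "Edge e # map Edge q" 1] comp_def mult.assoc[symmetric])
  qed (simp add: path_rep_def)
  show "cls N (star_rep u p) = prod_list (map (\<lambda>e. cls N (gen (Ghost e))) (rev p)) * cls N (gen (Vertex u))"
  proof (cases p)
    case (Cons e q)
    then have e: "e \<in> arcs E" "u = tail E e" using assms by (auto simp: awalk_Cons_iff)
    have one': "cls N 1 * (prod_list (map (\<lambda>e. cls N (gen (Ghost e))) l) * cls N x) =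
        prod_list (map (\<lambda>e. cls N (gen (Ghost e))) l) * cls N x" for l x
      by (cases l) (simp_all add: mult.assoc[symmetric])
    show ?thesis
      using lf.G_V[OF e(1)] one'
      by (simp add: star_rep_def Cons cls_single[of N "map Ghost (rev q) @ [Ghost e]" 1] comp_def mult.assoc e(2))
  qed (simp add: star_rep_def)
qed

text \<open>Modulo the kernel every word is 0 or a product \<alpha>\<beta>^* of the same degree, so
  classes of polynomials of degree \<open>n\<close> lie in the span that defines the
  grading.\<close>

lemma lpa_degree_eq: "lpa_degree K E n = cos ` {f \<in> C. has_deg n f}"
proof
  show "lpa_degree K E n \<subseteq> cos ` {f \<in> C. has_deg n f}"
  proof
    fix x assume "x \<in> lpa_degree K E n"
    then show "x \<in> cos ` {f \<in> C. has_deg n f}"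
      unfolding lpa_degree_def
    proof (induction rule: generate.induct)
      case one
      then show ?case by (auto simp: cos_zero free_alg_zero intro!: imageI)
    next
      case (incl h)
      then obtain k u p w u' p' w' where h: "h = k \<odot>\<^bsub>A\<^esub> (lpa_path K E u p \<otimes>\<^bsub>A\<^esub> lpa_path_star K E u' p')"
        "awalk u p w" "awalk u' p' w'" "int (length p) - int (length p') = n" by blast
      have C: "path_rep u p * star_rep u' p' \<in> C"
        using path_rep_C h(2,3) by (blast intro: free_alg_mult)
      have "h = cos (cst k * (path_rep u p * star_rep u' p'))"
        using path_rep_C(1)[OF h(2)] path_rep_C(2)[OF h(3)] C by (simp add: h(1) path_reps cos_mult cos_smult)
      moreover have "has_deg n (cst k * (path_rep u p * star_rep u' p'))"
        using has_deg_mult[OF has_deg_cst has_deg_mult[OF path_rep_deg(1)[of p u] path_rep_deg(2)[of p' u']]] h(4)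
        by simp
      ultimately show ?case using free_alg_cst_mult[OF C] by blast
    next
      case (inv h)
      then obtain k u p w u' p' w' where h: "h = k \<odot>\<^bsub>A\<^esub> (lpa_path K E u p \<otimes>\<^bsub>A\<^esub> lpa_path_star K E u' p')"
        "awalk u p w" "awalk u' p' w'" "int (length p) - int (length p') = n" by blast
      have C: "path_rep u p * star_rep u' p' \<in> C"
        using path_rep_C h(2,3) by (blast intro: free_alg_mult)
      have "h = cos (cst k * (path_rep u p * star_rep u' p'))"
        using path_rep_C(1)[OF h(2)] path_rep_C(2)[OF h(3)] C by (simp add: h(1) path_reps cos_mult cos_smult)
      then have "inv\<^bsub>add_monoid A\<^esub> h = cos (- (cst k * (path_rep u p * star_rep u' p')))"
        using cos_uminus[OF free_alg_cst_mult[OF C]] by (simp add: a_inv_def)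
      moreover have "has_deg n (0 - cst k * (path_rep u p * star_rep u' p'))"
        using has_deg_mult[OF has_deg_cst has_deg_mult[OF path_rep_deg(1)[of p u] path_rep_deg(2)[of p' u']]] h(4)
        by (intro has_deg_diff) simp_all
      ultimately show ?case using free_alg_uminus[OF free_alg_cst_mult[OF C]] by auto
    next
      case (eng x y)
      then obtain f g where "f \<in> C" "has_deg n f" "x = cos f" "g \<in> C" "has_deg n g" "y = cos g" by blast
      then show ?case
        by (auto simp: cos_add intro!: imageI has_deg_add free_alg_add)
    qed
  qed
  have "cos f \<in> lpa_degree K E n" if f: "f \<in> C" "has_deg n f" for f
  proof -
    have "cos f \<in> lpa_degree K E n \<and> f \<in> C"
    proof (induction f rule: free_induct_on)
      case zero
      then show ?case
        unfolding lpa_degree_def using generate.one[of "add_monoid A"] by (simp add: cos_zero free_alg_zero)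
    next
      case (single ws k)
      then have ws: "ws \<noteq> []" "set ws \<subseteq> lpa_generators E" "wdeg (Word ws) = n"
        using bspec[OF f(1)[unfolded free_alg_carrier] single] bspec[OF f(2)[unfolded has_deg_def] single]
        by simp_all
      let ?m = "Poly_Mapping.single (Word ws) k :: _ \<Rightarrow>\<^sub>0 'k"
      have m: "?m \<in> C" using ws by (simp add: free_alg_carrier)
      have fam: "family_of E gen N"
        by (rule family_of_gen[OF wf_digraph_axioms two_sided_kernel order_refl])
      interpret lf: leavitt_family E "\<lambda>k. cls N (cst k)" "\<lambda>v. cls N (gen (Vertex v))"
        "\<lambda>e. cls N (gen (Edge e))" "\<lambda>e. cls N (gen (Ghost e))"
        using fam by (simp add: family_of_def)
      have "cls N ?m \<in> insert 0 ((*) (cls N (cst k)) ` lf.monomials n)"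
        using word_in_monomials[OF fam two_sided_kernel order_refl ws(1), of k] ws(3) by simp
      then consider "cls N ?m = 0" | u p w u' p' where "awalk u p w" "awalk u' p' w"
          "int (length p) - int (length p') = n" "cls N ?m = cls N (cst k) * (lf.Pa u p * lf.Pg u' p')"
        unfolding lf.monomials_def by blast
      then have "cos ?m \<in> lpa_degree K E n"
      proof cases
        case 1
        then have "cos ?m = cos 0"
          using m by (simp add: cos_eq_iff free_alg_zero cls_eq_0_iff[OF two_sided_kernel])
        then show ?thesis
          unfolding lpa_degree_def using generate.one[of "add_monoid A"] by (simp add: cos_zero)
      next
        case 2
        note C = path_rep_C(1)[OF 2(1)] path_rep_C(2)[OF 2(2)]
        have "cls N ?m = cls N (cst k * (path_rep u p * star_rep u' p'))"
          using 2(4) cls_path_rep(1)[OF 2(1)] cls_path_rep(2)[OF 2(2)]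
          by (simp add: cls_mult lf.Pa_def lf.Pg_def)
        then have "cos ?m = cos (cst k * (path_rep u p * star_rep u' p'))"
          using m C by (simp add: cos_eq_iff free_alg_closed cls_eq_iff[OF two_sided_kernel])
        also have "\<dots> = k \<odot>\<^bsub>A\<^esub> (lpa_path K E u p \<otimes>\<^bsub>A\<^esub> lpa_path_star K E u' p')"
          using C by (simp add: path_reps cos_mult cos_smult free_alg_mult)
        finally show ?thesis
          unfolding lpa_degree_def using 2(1-3) by (intro generate.incl) blast
      qed
      with m show ?case by simp
    next
      case (add f g)
      then show ?case
        unfolding lpa_degree_def
        using generate.eng[of "cos f" "add_monoid A" _ "cos g"] by (auto simp: cos_add free_alg_add)
    qed
    then show ?thesis ..
  qed
  then show "cos ` {f \<in> C. has_deg n f} \<subseteq> lpa_degree K E n" by blast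
qed

text \<open>Lift the components to polynomials of their degrees. The difference between
  \<open>f\<close> and their sum lies in the homogeneous ideal \<open>N\<close>, so degrees can be
  compared one by one.\<close>

lemma decomposition_unique:
  assumes f: "f \<in> C" and d: "\<And>n. d n \<in> lpa_degree K E n" and fin: "finite {n. d n \<noteq> \<zero>\<^bsub>A\<^esub>}"
    and sum: "cos f = (\<Oplus>\<^bsub>A\<^esub>n\<in>{n. d n \<noteq> \<zero>\<^bsub>A\<^esub>}. d n)"
  shows "d n = cos (hpart n f)"
proof -
  obtain g where g: "\<And>n. g n \<in> C" "\<And>n. has_deg n (g n)" "\<And>n. d n = cos (g n)"
    using d unfolding lpa_degree_eq image_iff Bex_def mem_Collect_eq by metis
  have d': "d = (\<lambda>n. cos (g n))"
    by (rule ext) (rule g(3))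
  let ?T = "{n. d n \<noteq> \<zero>\<^bsub>A\<^esub>}"
  have "cos f = cos (\<Sum>n\<in>?T. g n)"
    unfolding sum using cos_finsum[of ?T g] g(1) by (simp add: d')
  then have "f - (\<Sum>n\<in>?T. g n) \<in> N"
    using f g(1) by (simp add: cos_eq_iff free_alg_sum)
  then have "hpart n (f - (\<Sum>n\<in>?T. g n)) \<in> N"
    using homogeneous_kernel by (auto simp: homogeneous_def)
  moreover have "hpart n (\<Sum>n\<in>?T. g n) = (\<Sum>m\<in>?T. if m = n then g n else 0)"
    unfolding hpart_sum by (rule sum.cong) (auto simp: hpart_has_deg[OF g(2)])
  ultimately have diff: "hpart n f - (if n \<in> ?T then g n else 0) \<in> N"
    using fin by (simp add: hpart_diff)
  show ?thesis
  proof (cases "n \<in> ?T")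
    case True
    then have "cos (hpart n f) = cos (g n)"
      using diff f g(1) by (simp add: cos_eq_iff free_alg_hpart)
    then show ?thesis by (simp add: g(3))
  next
    case False
    then have "cos (hpart n f) = cos 0"
      using diff f by (simp add: cos_eq_iff free_alg_hpart free_alg_zero)
    then show ?thesis using False by (simp add: cos_zero)
  qed
qed

text \<open>Uniqueness of decompositions forces the components of an element of a graded ideal to be
  the classes of the polynomials \<open>hpart n f\<close>.\<close>

theorem graded_ideal_image_iff:
  assumes J: "two_sided J" "N \<subseteq> J" "J \<subseteq> augmentation_ideal"
  shows "graded_ideal A (lpa_degree K E) (ideal_image J) \<longleftrightarrow> homogeneous J"
proof
  assume gr: "graded_ideal A (lpa_degree K E) (ideal_image J)"
  have C: "hpart n f \<in> J" if f: "f \<in> J" "f \<in> C" for f n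
  proof -
    have "cos f \<in> ideal_image J" using f by (simp add: ideal_image_def)
    then obtain d where d: "\<forall>n. d n \<in> ideal_image J \<inter> lpa_degree K E n" "finite {n. d n \<noteq> \<zero>\<^bsub>A\<^esub>}"
      "cos f = (\<Oplus>\<^bsub>A\<^esub>n\<in>{n. d n \<noteq> \<zero>\<^bsub>A\<^esub>}. d n)"
      using gr unfolding graded_ideal_def internal_direct_sum_def by metis
    have dn: "d n = cos (hpart n f)"
      using d by (intro decomposition_unique f(2)) auto
    have "d n \<in> ideal_image J"
      using d(1) by blast
    then show ?thesis
      unfolding dn by (simp add: cos_mem_iff[OF J(1,2) free_alg_hpart[OF f(2)]])
  qed
  show "homogeneous J"
    unfolding homogeneous_def
  proof (intro ballI allI)
    fix f n assume f: "f \<in> J"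
    let ?g = "proj (lpa_generators E) f"
    have cong: "?g - f \<in> N" by (rule proj_congruent)
    have g: "?g \<in> C" using f J(3) by (blast intro: proj_in_free_alg)
    have "?g \<in> J"
      using f two_sided_mem_cong[OF J(1) subsetD[OF J(2) cong]] by simp
    then have "hpart n ?g \<in> J" using C g by blast
    moreover have "hpart n ?g - hpart n f \<in> N"
      using homogeneous_kernel cong by (auto simp: homogeneous_def simp flip: hpart_diff)
    ultimately show "hpart n f \<in> J"
      using two_sided_mem_cong[OF J(1)] J(2) by blast
  qed
next
  assume hom: "homogeneous J"
  interpret I: nu_ideal "ideal_image J" A by (rule ideal_image_ideal[OF J(1)])
  have degsub: "subgroup (lpa_degree K E n) (add_monoid A)" for n
  proof -
    have uminus: "has_deg n (- f)" if "has_deg n f" for f :: "('v, 'e) lpa_gen word \<Rightarrow>\<^sub>0 'k"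
      using has_deg_diff[OF has_deg_zero that] by simp
    show ?thesis
      unfolding lpa_degree_eq
    proof (rule A.add.subgroupI)
      show "cos ` {f \<in> C. has_deg n f} \<noteq> {}"
        using free_alg_zero has_deg_zero by blast
    qed (auto simp: carrier_A cos_uminus cos_add free_alg_uminus free_alg_add has_deg_add uminus intro!: imageI)
  qed
  have "\<exists>!d. (\<forall>n. d n \<in> ideal_image J \<inter> lpa_degree K E n) \<and> finite {n. d n \<noteq> \<zero>\<^bsub>A\<^esub>}
      \<and> x = (\<Oplus>\<^bsub>A\<^esub>n\<in>{n. d n \<noteq> \<zero>\<^bsub>A\<^esub>}. d n)" if x: "x \<in> ideal_image J" for x
  proof -
    obtain f where f: "f \<in> J" "f \<in> C" "x = cos f" using x by (auto simp: ideal_image_def)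
    let ?d = "\<lambda>n. cos (hpart n f)" and ?T = "wdeg ` Poly_Mapping.keys f"
    have d0: "{n. ?d n \<noteq> \<zero>\<^bsub>A\<^esub>} \<subseteq> ?T"
      using hpart_eq_0[of _ f] by (auto simp: cos_zero)
    show ?thesis
    proof (rule ex1I[of _ ?d], intro conjI allI)
      show "?d n \<in> ideal_image J \<inter> lpa_degree K E n" for n
        using hom f free_alg_hpart[OF f(2)] has_deg_hpart[of n f]
        by (auto simp: homogeneous_def ideal_image_def lpa_degree_eq)
      show "finite {n. ?d n \<noteq> \<zero>\<^bsub>A\<^esub>}"
        using d0 by (rule finite_subset) simp
      have "x = cos (\<Sum>n\<in>?T. hpart n f)"
        using f(3) hpart_expansion[of f] by simp
      also have "\<dots> = (\<Oplus>\<^bsub>A\<^esub>n\<in>?T. ?d n)"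
        by (rule cos_finsum[symmetric]) (rule free_alg_hpart[OF f(2)])
      also have "\<dots> = (\<Oplus>\<^bsub>A\<^esub>n\<in>{n. ?d n \<noteq> \<zero>\<^bsub>A\<^esub>}. ?d n)"
        using d0 f(2) by (intro A.add.finprod_mono_neutral_cong_right) (auto simp: cos_closed free_alg_hpart)
      finally show "x = (\<Oplus>\<^bsub>A\<^esub>n\<in>{n. ?d n \<noteq> \<zero>\<^bsub>A\<^esub>}. ?d n)" .
    next
      fix d assume "(\<forall>n. d n \<in> ideal_image J \<inter> lpa_degree K E n) \<and> finite {n. d n \<noteq> \<zero>\<^bsub>A\<^esub>}
        \<and> x = (\<Oplus>\<^bsub>A\<^esub>n\<in>{n. d n \<noteq> \<zero>\<^bsub>A\<^esub>}. d n)"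
      then show "d = ?d"
        using decomposition_unique[OF f(2), of d] f(3) by (intro ext) auto
    qed
  qed
  moreover have "additive_subgroup (ideal_image J \<inter> lpa_degree K E n) A" for n
    by (rule additive_subgroup.intro[OF A.add.subgroups_Inter_pair[OF I.a_subgroup degsub]])
  ultimately show "graded_ideal A (lpa_degree K E) (ideal_image J)"
    unfolding graded_ideal_def internal_direct_sum_def using I.nu_ideal_axioms by blast
qed

end

section \<open>The lattice isomorphism\<close>

section \<open>The lattice of graded ideals\<close>

lemma least_Upper_pair:
  assumes "x \<in> carrier L" "y \<in> carrier L"
  shows "least L t (Upper L {x, y}) \<longleftrightarrow> t \<in> carrier L \<and> x \<sqsubseteq>\<^bsub>L\<^esub> t \<and> y \<sqsubseteq>\<^bsub>L\<^esub> t \<and>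
    (\<forall>u\<in>carrier L. x \<sqsubseteq>\<^bsub>L\<^esub> u \<longrightarrow> y \<sqsubseteq>\<^bsub>L\<^esub> u \<longrightarrow> t \<sqsubseteq>\<^bsub>L\<^esub> u)"
  using assms by (auto simp: least_def Upper_def)

lemma greatest_Lower_pair:
  assumes "x \<in> carrier L" "y \<in> carrier L"
  shows "greatest L t (Lower L {x, y}) \<longleftrightarrow> t \<in> carrier L \<and> t \<sqsubseteq>\<^bsub>L\<^esub> x \<and> t \<sqsubseteq>\<^bsub>L\<^esub> y \<and>
    (\<forall>u\<in>carrier L. u \<sqsubseteq>\<^bsub>L\<^esub> x \<longrightarrow> u \<sqsubseteq>\<^bsub>L\<^esub> y \<longrightarrow> u \<sqsubseteq>\<^bsub>L\<^esub> t)"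
  using assms by (auto simp: greatest_def Lower_def)

lemma lattice_inclusion_order:
  assumes "\<And>I J. I \<in> X \<Longrightarrow> J \<in> X \<Longrightarrow> \<exists>S\<in>X. I \<subseteq> S \<and> J \<subseteq> S \<and> (\<forall>U\<in>X. I \<subseteq> U \<longrightarrow> J \<subseteq> U \<longrightarrow> S \<subseteq> U)"
    and "\<And>I J. I \<in> X \<Longrightarrow> J \<in> X \<Longrightarrow> \<exists>S\<in>X. S \<subseteq> I \<and> S \<subseteq> J \<and> (\<forall>U\<in>X. U \<subseteq> I \<longrightarrow> U \<subseteq> J \<longrightarrow> U \<subseteq> S)"
  shows "lattice (inclusion_order X)"
proof unfold_locales
  fix x y assume "x \<in> carrier (inclusion_order X)" "y \<in> carrier (inclusion_order X)"
  then have xy: "x \<in> X" "y \<in> X" by (simp_all add: inclusion_order_def)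
  show "\<exists>s. least (inclusion_order X) s (Upper (inclusion_order X) {x, y})"
    using assms(1)[OF xy] xy by (subst least_Upper_pair) (auto simp: inclusion_order_def)
  show "\<exists>s. greatest (inclusion_order X) s (Lower (inclusion_order X) {x, y})"
    using assms(2)[OF xy] xy by (subst greatest_Lower_pair) (auto simp: inclusion_order_def)
qed (auto simp: inclusion_order_def)

text \<open>Joins and meets in \<open>L\<close> are transported from \<open>M\<close> along the
  order isomorphism, which avoids an explicit formula for joins of admissible pairs.\<close>

lemma lattice_isoI:
  fixes L :: "('a, 'm) gorder_scheme" and M :: "('b, 'n) gorder_scheme"
  assumes M: "lattice M" and eq: "eq L = (=)" and bij: "bij_betw f (carrier L) (carrier M)"
    and le: "\<And>x y. x \<in> carrier L \<Longrightarrow> y \<in> carrier L \<Longrightarrow> x \<sqsubseteq>\<^bsub>L\<^esub> y \<longleftrightarrow> f x \<sqsubseteq>\<^bsub>M\<^esub> f y"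
  shows "lattice_iso L M f"
proof -
  interpret M: lattice M by (rule M)
  have fM: "f x \<in> carrier M" if "x \<in> carrier L" for x
    using bij that by (auto simp: bij_betw_def)
  have inj: "x = y" if "f x = f y" "x \<in> carrier L" "y \<in> carrier L" for x y
    using bij that by (auto simp: bij_betw_def inj_on_def)
  have surj: "\<exists>x\<in>carrier L. u = f x" if "u \<in> carrier M" for u
    using bij that by (auto simp: bij_betw_def)
  have least: "least L t (Upper L {x, y}) \<longleftrightarrow> least M (f t) (Upper M {f x, f y})"
    if "x \<in> carrier L" "y \<in> carrier L" "t \<in> carrier L" for x y t
    using that fM surj by (auto simp: least_Upper_pair le) (metis le)
  have greatest: "greatest L t (Lower L {x, y}) \<longleftrightarrow> greatest M (f t) (Lower M {f x, f y})"
    if "x \<in> carrier L" "y \<in> carrier L" "t \<in> carrier L" for x y t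
    using that fM surj by (auto simp: greatest_Lower_pair le) (metis le)
  interpret L: lattice L
  proof unfold_locales
    fix x y assume xy: "x \<in> carrier L" "y \<in> carrier L"
    obtain s where s: "s \<in> carrier L" "f s = f x \<squnion>\<^bsub>M\<^esub> f y"
      using surj[OF M.join_closed[OF fM fM]] xy by metis
    then show "\<exists>s. least L s (Upper L {x, y})"
      using least[OF xy s(1)] M.sup_of_two_least[OF fM[OF xy(1)] fM[OF xy(2)]]
      by (auto simp: join_def)
    obtain s where s: "s \<in> carrier L" "f s = f x \<sqinter>\<^bsub>M\<^esub> f y"
      using surj[OF M.meet_closed[OF fM fM]] xy by metis
    then show "\<exists>s. greatest L s (Lower L {x, y})"
      using greatest[OF xy s(1)] M.inf_of_two_greatest[OF fM[OF xy(1)] fM[OF xy(2)]]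
      by (auto simp: meet_def)
  next
    fix x y z assume xyz: "x \<sqsubseteq>\<^bsub>L\<^esub> y" "y \<sqsubseteq>\<^bsub>L\<^esub> z" "x \<in> carrier L" "y \<in> carrier L" "z \<in> carrier L"
    then show "x \<sqsubseteq>\<^bsub>L\<^esub> z"
      using M.le_trans[of "f x" "f y" "f z"] fM by (simp add: le)
  next
    fix x y assume "x \<sqsubseteq>\<^bsub>L\<^esub> y" "y \<sqsubseteq>\<^bsub>L\<^esub> x" "x \<in> carrier L" "y \<in> carrier L"
    then show "x .=\<^bsub>L\<^esub> y"
      using M.le_antisym[of "f x" "f y"] fM inj by (simp add: le eq)
  qed (use le fM M.le_refl in \<open>auto simp: eq\<close>)
  have "f (x \<squnion>\<^bsub>L\<^esub> y) = f x \<squnion>\<^bsub>M\<^esub> f y" if xy: "x \<in> carrier L" "y \<in> carrier L" for x y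
  proof -
    have l: "least M (f (x \<squnion>\<^bsub>L\<^esub> y)) (Upper M {f x, f y})"
      using L.sup_of_two_least[OF xy] least[OF xy L.join_closed[OF xy]] by (simp add: join_def)
    then show ?thesis
      using M.sup_of_two_least[OF fM[OF xy(1)] fM[OF xy(2)]] fM xy M.le_antisym
      unfolding join_def by (auto simp: least_Upper_pair)
  qed
  moreover have "f (x \<sqinter>\<^bsub>L\<^esub> y) = f x \<sqinter>\<^bsub>M\<^esub> f y" if xy: "x \<in> carrier L" "y \<in> carrier L" for x y
  proof -
    have l: "greatest M (f (x \<sqinter>\<^bsub>L\<^esub> y)) (Lower M {f x, f y})"
      using L.inf_of_two_greatest[OF xy] greatest[OF xy L.meet_closed[OF xy]] by (simp add: meet_def)
    then show ?thesis
      using M.inf_of_two_greatest[OF fM[OF xy(1)] fM[OF xy(2)]] fM xy M.le_antisym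
      unfolding meet_def by (auto simp: greatest_Lower_pair)
  qed
  ultimately show ?thesis
    using L.lattice_axioms M bij le by (simp add: lattice_iso_def join_pres_def meet_pres_def)
qed

lemma homogeneous_inter: "homogeneous I \<Longrightarrow> homogeneous J \<Longrightarrow> homogeneous (I \<inter> J)"
  by (simp add: homogeneous_def)

lemma homogeneous_plus:
  assumes "homogeneous I" "homogeneous J"
  shows "homogeneous {x + y | x y. x \<in> I \<and> y \<in> J}"
  unfolding homogeneous_def
proof (intro ballI allI)
  fix f n assume "f \<in> {x + y | x y. x \<in> I \<and> y \<in> J}"
  then obtain x y where f: "f = x + y" "x \<in> I" "y \<in> J" by auto
  show "hpart n f \<in> {x + y | x y. x \<in> I \<and> y \<in> J}"
    unfolding f(1) hpart_add using assms f(2,3)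
    by (intro CollectI exI[of _ "hpart n x"] exI[of _ "hpart n y"]) (simp add: homogeneous_def)
qed

lemma admissible_pairs_admissible:
  "wf_digraph E \<Longrightarrow> countable (arcs E) \<Longrightarrow> (H, S) \<in> admissible_pairs E \<longleftrightarrow> admissible E H S"
  by (simp add: admissible_pairs_def admissible_def admissible_axioms_def)

lemma breaking_subset_verts: "S \<subseteq> breaking_vertices E H \<Longrightarrow> S \<subseteq> verts E"
  by (auto simp: breaking_vertices_def)

context graph_algebra
begin

lemma avoiding_rep_C: "avoiding_rep E H v \<in> C"
  unfolding avoiding_rep_def
  by (intro free_alg_sum free_alg_mult free_alg_gen) (auto simp: out_arcs_avoiding_def)

lemma gap_rep_C: "v \<in> verts E \<Longrightarrow> gap_rep E H v \<in> C"
  unfolding gap_rep_def by (intro free_alg_diff free_alg_gen avoiding_rep_C) simp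

lemma gen_C: "v \<in> verts E \<Longrightarrow> gen (Vertex v) \<in> C" "e \<in> arcs E \<Longrightarrow> gen (Edge e) \<in> C"
    "e \<in> arcs E \<Longrightarrow> gen (Ghost e) \<in> C"
  by (simp_all add: free_alg_gen)

lemma avoiding_sum_cos: "avoiding_sum K E H v = cos (avoiding_rep E H v)"
proof -
  have *: "lpa_edge K E e \<otimes>\<^bsub>A\<^esub> lpa_ghost K E e = cos (gen (Edge e) * gen (Ghost e))"
    if "e \<in> out_arcs_avoiding E H v" for e
    using that by (simp add: lpa_word_lcos cos_mult gen_C out_arcs_avoiding_def)
  have C: "gen (Edge e) * gen (Ghost e) \<in> C" if "e \<in> out_arcs_avoiding E H v" for e
    using that by (simp add: free_alg_mult gen_C out_arcs_avoiding_def)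
  have "avoiding_sum K E H v = (\<Oplus>\<^bsub>A\<^esub>e\<in>out_arcs_avoiding E H v. cos (gen (Edge e) * gen (Ghost e)))"
    unfolding avoiding_sum_def by (rule A.finsum_cong'[OF refl]) (auto simp: * C cos_closed)
  then show ?thesis
    unfolding avoiding_rep_def by (simp add: cos_finsum C)
qed

lemma gap_vertex_cos: "v \<in> verts E \<Longrightarrow> gap_vertex K E H v = cos (gap_rep E H v)"
  by (simp add: gap_vertex_def gap_rep_def avoiding_sum_cos lpa_word_lcos cos_minus avoiding_rep_C gen_C)

lemma admissible_ideal_image:
  assumes "H \<subseteq> verts E" "S \<subseteq> verts E"
  shows "admissible_ideal K E (H, S) = ideal_image (pair_ideal E H S)"
proof -
  have *: "lpa_vertex K E ` H \<union> gap_vertex K E H ` S = cos ` ((\<lambda>v. gen (Vertex v)) ` H \<union> gap_rep E H ` S)"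
    unfolding image_Un image_image lpa_word_lcos
    using assms by (intro arg_cong2[of _ _ _ _ "(\<union>)"] image_cong) (auto simp: gap_vertex_cos)
  show ?thesis
    unfolding admissible_ideal_def prod.case * pair_ideal_def
    using assms by (subst genideal_image) (auto simp: gen_C gap_rep_C Un_assoc)
qed

lemma vertex_ideal_image:
  assumes "X \<subseteq> verts E"
  shows "vertex_ideal K E X = ideal_image (pair_ideal E X {})"
  using admissible_ideal_image[OF assms empty_subsetI]
  by (simp add: vertex_ideal_def admissible_ideal_def)

lemma graded_ideal_iff:
  "graded_ideal A (lpa_degree K E) I \<longleftrightarrow> (\<exists>J. two_sided J \<and> N \<subseteq> J \<and> J \<subseteq> augmentation_ideal \<and>
    homogeneous J \<and> I = ideal_image J)"
proof
  assume I: "graded_ideal A (lpa_degree K E) I"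
  then have "nu_ideal I A" by (simp add: graded_ideal_def)
  then obtain J where J: "two_sided J" "N \<subseteq> J" "J \<subseteq> augmentation_ideal" "I = ideal_image J"
    by (rule nu_ideal_is_image)
  then show "\<exists>J. two_sided J \<and> N \<subseteq> J \<and> J \<subseteq> augmentation_ideal \<and> homogeneous J \<and> I = ideal_image J"
    using I graded_ideal_image_iff[OF J(1-3)] by auto
qed (auto simp: graded_ideal_image_iff)

text \<open>The join is the sum of ideals and the meet their intersection, both formed for
  representatives.\<close>

lemma lattice_graded_ideals: "lattice (graded_ideal_lattice K E)"
  unfolding graded_ideal_lattice_def
proof (rule lattice_inclusion_order)
  fix I I' assume "I \<in> {I. graded_ideal A (lpa_degree K E) I}" "I' \<in> {I. graded_ideal A (lpa_degree K E) I}"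
  then obtain J J' where J: "two_sided J" "N \<subseteq> J" "J \<subseteq> augmentation_ideal" "homogeneous J" "I = ideal_image J"
    and J': "two_sided J'" "N \<subseteq> J'" "J' \<subseteq> augmentation_ideal" "homogeneous J'" "I' = ideal_image J'"
    unfolding mem_Collect_eq graded_ideal_iff by metis
  let ?S = "{x + y | x y. x \<in> J \<and> y \<in> J'}"
  have le: "J \<subseteq> ?S" "J' \<subseteq> ?S"
    using two_sided_zero[OF J(1)] two_sided_zero[OF J'(1)] by force+
  have "?S \<subseteq> augmentation_ideal"
    using two_sided_add[OF two_sided_augmentation subsetD[OF J(3)] subsetD[OF J'(3)]] by blast
  then have S: "two_sided ?S" "N \<subseteq> ?S" "?S \<subseteq> augmentation_ideal" "homogeneous ?S"
    using two_sided_plus[OF J(1) J'(1)] homogeneous_plus[OF J(4) J'(4)] le(1) J(2) by simp_all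
  have I: "two_sided (J \<inter> J')" "N \<subseteq> J \<inter> J'" "J \<inter> J' \<subseteq> augmentation_ideal" "homogeneous (J \<inter> J')"
    using two_sided_inter[OF J(1) J'(1)] homogeneous_inter[OF J(4) J'(4)] J(2,3) J'(2) by auto
  show "\<exists>S\<in>{I. graded_ideal A (lpa_degree K E) I}. I \<subseteq> S \<and> I' \<subseteq> S \<and>
      (\<forall>U\<in>{I. graded_ideal A (lpa_degree K E) I}. I \<subseteq> U \<longrightarrow> I' \<subseteq> U \<longrightarrow> S \<subseteq> U)"
  proof (intro bexI[of _ "ideal_image ?S"] conjI ballI impI)
    show "I \<subseteq> ideal_image ?S" "I' \<subseteq> ideal_image ?S"
      using le by (auto simp: J(5) J'(5) ideal_image_def)
    fix U assume "U \<in> {I. graded_ideal A (lpa_degree K E) I}" and U: "I \<subseteq> U" "I' \<subseteq> U"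
    then obtain W where W: "two_sided W" "N \<subseteq> W" "U = ideal_image W"
      unfolding mem_Collect_eq graded_ideal_iff by metis
    have "J \<subseteq> W" "J' \<subseteq> W"
      using U ideal_image_subset_iff[OF J(1-3) W(1,2)] ideal_image_subset_iff[OF J'(1-3) W(1,2)]
      by (simp_all add: J(5) J'(5) W(3))
    then have "?S \<subseteq> W"
      using two_sided_add[OF W(1)] by auto
    then show "ideal_image ?S \<subseteq> U"
      by (auto simp: W(3) ideal_image_def)
  qed (use S graded_ideal_iff in \<open>simp, metis\<close>)
  show "\<exists>S\<in>{I. graded_ideal A (lpa_degree K E) I}. S \<subseteq> I \<and> S \<subseteq> I' \<and>
      (\<forall>U\<in>{I. graded_ideal A (lpa_degree K E) I}. U \<subseteq> I \<longrightarrow> U \<subseteq> I' \<longrightarrow> U \<subseteq> S)"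
  proof (intro bexI[of _ "ideal_image (J \<inter> J')"] conjI ballI impI)
    show "ideal_image (J \<inter> J') \<subseteq> I" "ideal_image (J \<inter> J') \<subseteq> I'"
      by (auto simp: J(5) J'(5) ideal_image_def)
    fix U assume "U \<in> {I. graded_ideal A (lpa_degree K E) I}" and U: "U \<subseteq> I" "U \<subseteq> I'"
    then obtain W where W: "two_sided W" "N \<subseteq> W" "W \<subseteq> augmentation_ideal" "U = ideal_image W"
      unfolding mem_Collect_eq graded_ideal_iff by metis
    have "W \<subseteq> J \<inter> J'"
      using U ideal_image_subset_iff[OF W(1-3) J(1,2)] ideal_image_subset_iff[OF W(1-3) J'(1,2)]
      by (simp add: J(5) J'(5) W(4))
    then show "U \<subseteq> ideal_image (J \<inter> J')"
      by (auto simp: W(4) ideal_image_def)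
  qed (use I graded_ideal_iff in \<open>simp, metis\<close>)
qed

theorem admissible_lattice_iso:
  assumes countable: "countable (arcs E)"
  shows "lattice_iso (admissible_lattice E) (graded_ideal_lattice K E) (admissible_ideal K E)"
proof -
  have car: "carrier (admissible_lattice E) = admissible_pairs E"
    "carrier (graded_ideal_lattice K E) = {I. graded_ideal A (lpa_degree K E) I}"
    by (simp_all add: admissible_lattice_def graded_ideal_lattice_def inclusion_order_def)
  have image: "admissible_ideal K E (H, S) = ideal_image (pair_ideal E H S)" if "(H, S) \<in> admissible_pairs E" for H S
    using that by (intro admissible_ideal_image)
      (auto simp: admissible_pairs_def hereditary_def dest: breaking_subset_verts)
  have le: "admissible_ideal K E (H', S') \<subseteq> admissible_ideal K E (H, S) \<longleftrightarrow> H' \<subseteq> H \<and> S' \<subseteq> H \<union> S"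
    if "(H', S') \<in> admissible_pairs E" "(H, S) \<in> admissible_pairs E" for H S H' S'
    unfolding image[OF that(1)] image[OF that(2)]
      ideal_image_subset_iff[OF two_sided_pair_ideal kernel_pair_ideal pair_ideal_augmentation
        two_sided_pair_ideal kernel_pair_ideal]
    by (rule admissible.pair_ideal_le_iff)
      (use that admissible_pairs_admissible[OF wf_digraph_axioms countable] in simp_all)
  show ?thesis
  proof (rule lattice_isoI[OF lattice_graded_ideals])
    show "bij_betw (admissible_ideal K E) (carrier (admissible_lattice E)) (carrier (graded_ideal_lattice K E))"
      unfolding car bij_betw_def
    proof
      show "inj_on (admissible_ideal K E) (admissible_pairs E)"
      proof (rule inj_onI)
        fix x y assume x: "x \<in> admissible_pairs E" and y: "y \<in> admissible_pairs E"
          and eq: "admissible_ideal K E x = admissible_ideal K E y"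
        obtain H S H' S' where p: "x = (H, S)" "y = (H', S')" by (cases x, cases y)
        have sub: "H \<subseteq> H'" "S \<subseteq> H' \<union> S'" "H' \<subseteq> H" "S' \<subseteq> H \<union> S"
          using le[of H S H' S'] le[of H' S' H S] x y eq by (auto simp: p)
        \<comment> \<open>In an admissible pair the two sets are disjoint, so comparing in both
          directions determines the second set as well as the first.\<close>
        have "S \<inter> H = {}" "S' \<inter> H' = {}"
          using x y by (auto simp: p admissible_pairs_def breaking_vertices_def)
        then show "x = y"
          using sub by (auto simp: p)
      qed
      show "admissible_ideal K E ` admissible_pairs E = {I. graded_ideal A (lpa_degree K E) I}"
      proof (intro equalityI subsetI)
        fix I assume "I \<in> admissible_ideal K E ` admissible_pairs E"
        then obtain H S where "(H, S) \<in> admissible_pairs E" "I = ideal_image (pair_ideal E H S)"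
          using image by (auto simp: image_iff)
        then show "I \<in> {I. graded_ideal A (lpa_degree K E) I}"
          by (simp add: graded_ideal_image_iff[OF two_sided_pair_ideal kernel_pair_ideal pair_ideal_augmentation]
              homogeneous_pair_ideal)
      next
        fix I assume "I \<in> {I. graded_ideal A (lpa_degree K E) I}"
        then obtain J where J: "two_sided J" "N \<subseteq> J" "J \<subseteq> augmentation_ideal" "homogeneous J" "I = ideal_image J"
          unfolding mem_Collect_eq graded_ideal_iff by metis
        obtain H S where HS: "hereditary E H" "saturated E H" "S \<subseteq> breaking_vertices E H" "J = pair_ideal E H S"
          by (rule homogeneous_is_pair_ideal[OF wf_digraph_axioms countable J(1-4)])
        then have "(H, S) \<in> admissible_pairs E" by (simp add: admissible_pairs_def)
        then show "I \<in> admissible_ideal K E ` admissible_pairs E"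
          using image by (intro image_eqI[of _ _ "(H, S)"]) (simp_all add: J(5) HS(4))
      qed
    qed
    show "x \<sqsubseteq>\<^bsub>admissible_lattice E\<^esub> y \<longleftrightarrow> admissible_ideal K E x \<sqsubseteq>\<^bsub>graded_ideal_lattice K E\<^esub> admissible_ideal K E y"
      if "x \<in> carrier (admissible_lattice E)" "y \<in> carrier (admissible_lattice E)" for x y
      using that le unfolding car
      by (cases x, cases y) (simp add: admissible_lattice_def graded_ideal_lattice_def inclusion_order_def)
  qed (simp add: admissible_lattice_def)
qed

end

section \<open>The canonical isomorphism\<close>

section \<open>The canonical isomorphism\<close>

context graph_algebra
begin

lemma ideal_image_alg_ideal:
  assumes "two_sided J"
  shows "alg_ideal (ideal_image J) A"
  unfolding alg_ideal_def
proof (intro conjI allI ballI ideal_image_ideal[OF assms])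
  fix k x assume "x \<in> ideal_image J"
  then obtain f where f: "x = cos f" "f \<in> J" "f \<in> C" by (auto simp: ideal_image_def)
  then show "k \<odot>\<^bsub>A\<^esub> x \<in> ideal_image J"
    using two_sided_mult_left[OF assms f(2)] by (simp add: cos_smult ideal_image_def free_alg_cst_mult)
qed

lemma coset_cos_eq_iff:
  assumes "two_sided J" "N \<subseteq> J" "f \<in> C" "g \<in> C"
  shows "ideal_image J +>\<^bsub>A\<^esub> cos f = ideal_image J +>\<^bsub>A\<^esub> cos g \<longleftrightarrow> f - g \<in> J"
  using assms alg_quot_coset_eq_iff[OF nu_algebra_A ideal_image_alg_ideal[OF assms(1)], of "cos f" "cos g"]
  by (simp add: cos_closed cos_minus cos_mem_iff free_alg_diff)

lemma canon_C:
  assumes "hereditary E H"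
  shows "x \<in> verts (quotient_graph E H S) \<Longrightarrow> canon_vertex E H S x \<in> C"
    and "y \<in> arcs (quotient_graph E H S) \<Longrightarrow> canon_edge E H S y \<in> C"
    and "y \<in> arcs (quotient_graph E H S) \<Longrightarrow> canon_ghost E H S y \<in> C"
proof -
  have brk: "v \<in> verts E" if "v \<in> breaking_vertices E H" for v
    using breaking_verticesD(1)[OF that] .
  have V: "canon_vertex E H S x \<in> C" if "x \<in> verts (quotient_graph E H S)" for x
    using that by (cases x) (simp_all add: avoiding_rep_C gap_rep_C gen_C brk)
  then show "x \<in> verts (quotient_graph E H S) \<Longrightarrow> canon_vertex E H S x \<in> C" .
  assume y: "y \<in> arcs (quotient_graph E H S)"
  show "canon_edge E H S y \<in> C" "canon_ghost E H S y \<in> C"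
    using y by (cases y; simp add: avoiding_rep_C gap_rep_C gen_C brk free_alg_mult)+
qed

lemma canonical_cos:
  shows "x \<in> verts (quotient_graph E H S) \<Longrightarrow> canonical_vertex K E H S x = cos (canon_vertex E H S x)"
    and "y \<in> arcs (quotient_graph E H S) \<Longrightarrow> canonical_edge K E H S y = cos (canon_edge E H S y)"
    and "y \<in> arcs (quotient_graph E H S) \<Longrightarrow> canonical_ghost K E H S y = cos (canon_ghost E H S y)"
proof -
  have brk: "v \<in> verts E" if "v \<in> breaking_vertices E H" for v
    using breaking_verticesD(1)[OF that] .
  show "x \<in> verts (quotient_graph E H S) \<Longrightarrow> canonical_vertex K E H S x = cos (canon_vertex E H S x)"
    by (cases x) (simp_all add: avoiding_sum_cos gap_vertex_cos lpa_word_lcos brk)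
  assume y: "y \<in> arcs (quotient_graph E H S)"
  show "canonical_edge K E H S y = cos (canon_edge E H S y)"
    "canonical_ghost K E H S y = cos (canon_ghost E H S y)"
    using y by (cases y; simp add: avoiding_sum_cos gap_vertex_cos lpa_word_lcos brk
        cos_mult gen_C avoiding_rep_C gap_rep_C)+
qed

end

theorem quotient_canonical_iso:
  fixes K :: "'k::field itself" and E :: "('v, 'e) pre_digraph"
  assumes adm: "admissible E H S"
  shows "\<exists>h. is_canonical_map K E H S h
    \<and> h \<in> alg_iso (LPA K (quotient_graph E H S)) (alg_quot (LPA K E) (admissible_ideal K E (H, S)))"
proof -
  interpret P: admissible E K H S by (rule adm)
  interpret L: graph_algebra E K by (simp add: graph_algebra_def P.wf_digraph_axioms)
  interpret Q: graph_algebra P.Q K by (simp add: graph_algebra_def P.wf_Q)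
  let ?I = "L.ideal_image P.J"
  have I: "admissible_ideal K E (H, S) = ?I"
    using P.hereditary breaking_subset_verts[OF P.S_sub]
    by (intro L.admissible_ideal_image) (simp_all add: hereditary_def)
  have idl: "alg_ideal ?I L.A"
    by (rule L.ideal_image_alg_ideal[OF two_sided_pair_ideal])
  note eq_iff = L.coset_cos_eq_iff[OF two_sided_pair_ideal[of E H S] kernel_pair_ideal]
  note quot_ops = alg_quot_ops[OF L.nu_algebra_A idl]
  have \<sigma>_C: "P.\<sigma> g \<in> L.C" if "g \<in> lpa_generators P.Q" for g
    using that L.canon_C[OF P.hereditary] unfolding from_quotient_def by (cases g) simp_all
  have ev_\<sigma>: "ev P.\<sigma> f \<in> L.C" if "f \<in> Q.C" for f
    using free_alg_ev[OF \<sigma>_C that] .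
  have \<tau>_C: "P.\<tau> g \<in> Q.C" if "g \<in> lpa_generators E" for g
    using that unfolding to_quotient_def vertex_split_def arc_split_def
    by (cases g) (simp_all add: free_alg_add free_alg_zero free_alg_gen)
  \<comment> \<open>\<open>h\<close> picks a representative, and \<open>ev_\<sigma>_kernel\<close>
    makes the result independent of the choice. Injectivity and surjectivity come from
    \<open>ev_\<sigma>_mem_iff\<close> and \<open>\<sigma>_\<tau>\<close>.\<close>
  define h where "h X = ?I +>\<^bsub>L.A\<^esub> L.cos (ev P.\<sigma> (SOME f. f \<in> Q.C \<and> X = Q.cos f))" for X
  have h: "h (Q.cos f) = ?I +>\<^bsub>L.A\<^esub> L.cos (ev P.\<sigma> f)" if f: "f \<in> Q.C" for f
  proof -
    define g where "g = (SOME g. g \<in> Q.C \<and> Q.cos f = Q.cos g)"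
    have g: "g \<in> Q.C \<and> Q.cos f = Q.cos g"
      unfolding g_def by (rule someI[of _ f]) (simp add: f)
    then have "g - f \<in> Q.N"
      using Q.cos_eq_iff[of g f] f by simp
    then have "ev P.\<sigma> g - ev P.\<sigma> f \<in> P.J"
      using P.ev_\<sigma>_kernel[of "g - f"] by (simp add: ev_diff)
    then show ?thesis
      unfolding h_def g_def[symmetric] using g f by (simp add: eq_iff ev_\<sigma>)
  qed
  have hom: "h \<in> alg_hom Q.A (alg_quot L.A ?I)"
    unfolding alg_hom_def mem_Collect_eq
  proof (intro conjI ballI allI funcsetI)
    fix x assume "x \<in> carrier Q.A"
    then obtain f where f: "f \<in> Q.C" "x = Q.cos f" by (auto simp: Q.carrier_A)
    then show "h x \<in> carrier (alg_quot L.A ?I)"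
      by (simp add: h alg_quot_carrier L.cos_closed ev_\<sigma>)
    show "h (k \<odot>\<^bsub>Q.A\<^esub> x) = k \<odot>\<^bsub>alg_quot L.A ?I\<^esub> h x" for k
    proof -
      have e: "ev P.\<sigma> f \<in> L.C" using f(1) by (rule ev_\<sigma>)
      note c = L.cos_closed[OF e]
      show ?thesis
        using f by (simp add: h Q.cos_smult[OF f(1) f(1)] L.cos_smult[OF e e] quot_ops(3)[OF c c] free_alg_cst_mult ev_mult)
    qed
    fix y assume "y \<in> carrier Q.A"
    then obtain g where g: "g \<in> Q.C" "y = Q.cos g" by (auto simp: Q.carrier_A)
    show "h (x \<oplus>\<^bsub>Q.A\<^esub> y) = h x \<oplus>\<^bsub>alg_quot L.A ?I\<^esub> h y"
      using f g by (simp add: h Q.cos_add L.cos_add quot_ops L.cos_closed ev_\<sigma> free_alg_add ev_add)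
    show "h (x \<otimes>\<^bsub>Q.A\<^esub> y) = h x \<otimes>\<^bsub>alg_quot L.A ?I\<^esub> h y"
      using f g by (simp add: h Q.cos_mult L.cos_mult quot_ops L.cos_closed ev_\<sigma> free_alg_mult ev_mult)
  qed
  moreover have "bij_betw h (carrier Q.A) (carrier (alg_quot L.A ?I))"
    unfolding bij_betw_def
  proof
    show "inj_on h (carrier Q.A)"
    proof (rule inj_onI)
      fix x y assume "x \<in> carrier Q.A" "y \<in> carrier Q.A" and eq: "h x = h y"
      then obtain f g where fg: "f \<in> Q.C" "x = Q.cos f" "g \<in> Q.C" "y = Q.cos g"
        by (auto simp: Q.carrier_A)
      then have "ev P.\<sigma> (f - g) \<in> P.J"
        using eq by (simp add: h eq_iff ev_\<sigma> ev_diff)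
      then show "x = y"
        using fg by (simp add: P.ev_\<sigma>_mem_iff Q.cos_eq_iff)
    qed
    show "h ` carrier Q.A = carrier (alg_quot L.A ?I)"
    proof
      show "h ` carrier Q.A \<subseteq> carrier (alg_quot L.A ?I)"
        using hom by (auto simp: alg_hom_def)
      show "carrier (alg_quot L.A ?I) \<subseteq> h ` carrier Q.A"
      proof
        fix z assume "z \<in> carrier (alg_quot L.A ?I)"
        then obtain f where f: "f \<in> L.C" "z = ?I +>\<^bsub>L.A\<^esub> L.cos f"
          by (auto simp: alg_quot_carrier L.carrier_A)
        have \<tau>f: "ev P.\<tau> f \<in> Q.C" by (rule free_alg_ev[OF \<tau>_C f(1)])
        have "h (Q.cos (ev P.\<tau> f)) = z"
          using P.\<sigma>_\<tau>[of f] f by (simp add: h[OF \<tau>f] eq_iff ev_\<sigma>[OF \<tau>f])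
        then show "z \<in> h ` carrier Q.A"
          using Q.cos_closed[OF \<tau>f] by (metis imageI)
      qed
    qed
  qed
  ultimately have iso: "h \<in> alg_iso Q.A (alg_quot L.A ?I)"
    by (simp add: alg_iso_def)
  have h_gen: "h (lpa_word K P.Q [g]) = ?I +>\<^bsub>L.A\<^esub> L.cos (P.\<sigma> g)" if "g \<in> lpa_generators P.Q" for g
    using that by (simp add: lpa_word_lcos h free_alg_gen)
  have "is_canonical_map K E H S h"
    unfolding is_canonical_map_def Let_def I
  proof (intro conjI ballI hom)
    show "h (lpa_vertex K P.Q v) = ?I +>\<^bsub>L.A\<^esub> canonical_vertex K E H S v" if "v \<in> verts P.Q" for v
      using that by (simp add: h_gen L.canonical_cos from_quotient_def)
    show "h (lpa_edge K P.Q e) = ?I +>\<^bsub>L.A\<^esub> canonical_edge K E H S e" if "e \<in> arcs P.Q" for e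
      using that by (simp add: h_gen L.canonical_cos from_quotient_def)
    show "h (lpa_ghost K P.Q e) = ?I +>\<^bsub>L.A\<^esub> canonical_ghost K E H S e" if "e \<in> arcs P.Q" for e
      using that by (simp add: h_gen L.canonical_cos from_quotient_def)
  qed
  then show ?thesis
    using iso by (auto simp: I)
qed

section \<open>Tensor products and Morita contexts of corners\<close>

section \<open>Morita contexts\<close>

subsection \<open>Maps out of a tensor product\<close>

context
  fixes R :: "('r, 'x) ring_scheme" and S :: "('s, 'y) ring_scheme" and T :: "('t, 'z) ring_scheme"
    and M :: "('r, 's, 'm, 'u) bimod_scheme" and N :: "('s, 't, 'n, 'v) bimod_scheme"
  assumes M: "bimodule R S M" and N: "bimodule S T N"
begin

interpretation M: bimodule R S M by (rule M)
interpretation N: bimodule S T N by (rule N)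

abbreviation "FMN \<equiv> tensor_free M N"
abbreviation "ZMN \<equiv> tensor_null S M N"

lemma tensor_free_simps [simp]:
  "x \<in> carrier FMN \<longleftrightarrow> Poly_Mapping.keys x \<subseteq> carrier M \<times> carrier N"
  "x \<otimes>\<^bsub>FMN\<^esub> y = x + y" "\<one>\<^bsub>FMN\<^esub> = 0"
  by (simp_all add: tensor_free_def)

lemma comm_group_tensor_free: "comm_group FMN"
  by (simp add: tensor_free_def abelian_free_Abelian_group)

interpretation F: comm_group FMN by (rule comm_group_tensor_free)

lemma frag_of_mem: "m \<in> carrier M \<Longrightarrow> n \<in> carrier N \<Longrightarrow> frag_of (m, n) \<in> carrier FMN"
  by simp

lemma tensor_free_diff: "x \<in> carrier FMN \<Longrightarrow> y \<in> carrier FMN \<Longrightarrow> x - y \<in> carrier FMN"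
  using keys_diff[of x y] by auto

lemma tensor_relations_cases [consumes 1]:
  assumes "z \<in> tensor_relations S M N"
  obtains (add_l) m m' n where
      "z = frag_of (m \<otimes>\<^bsub>M\<^esub> m', n) - frag_of (m, n) - frag_of (m', n)"
      "m \<in> carrier M" "m' \<in> carrier M" "n \<in> carrier N"
    | (add_r) m n n' where
      "z = frag_of (m, n \<otimes>\<^bsub>N\<^esub> n') - frag_of (m, n) - frag_of (m, n')"
      "m \<in> carrier M" "n \<in> carrier N" "n' \<in> carrier N"
    | (balanced) m s n where "z = frag_of (ract M m s, n) - frag_of (m, lact N s n)"
      "m \<in> carrier M" "s \<in> carrier S" "n \<in> carrier N"
proof -
  from assms show thesis
    unfolding tensor_relations_def Un_iff mem_Collect_eq
    by (elim disjE) (metis add_l, metis add_r, metis balanced)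
qed

lemma tensor_relationsI:
  "m \<in> carrier M \<Longrightarrow> m' \<in> carrier M \<Longrightarrow> n \<in> carrier N \<Longrightarrow>
    frag_of (m \<otimes>\<^bsub>M\<^esub> m', n) - frag_of (m, n) - frag_of (m', n) \<in> tensor_relations S M N"
  "m \<in> carrier M \<Longrightarrow> n \<in> carrier N \<Longrightarrow> n' \<in> carrier N \<Longrightarrow>
    frag_of (m, n \<otimes>\<^bsub>N\<^esub> n') - frag_of (m, n) - frag_of (m, n') \<in> tensor_relations S M N"
  "m \<in> carrier M \<Longrightarrow> s \<in> carrier S \<Longrightarrow> n \<in> carrier N \<Longrightarrow>
    frag_of (ract M m s, n) - frag_of (m, lact N s n) \<in> tensor_relations S M N"
  unfolding tensor_relations_def
  subgoal by (rule UnI1, rule UnI1, intro CollectI exI conjI, rule refl, assumption+)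
  subgoal by (rule UnI1, rule UnI2, intro CollectI exI conjI, rule refl, assumption+)
  subgoal by (rule UnI2, intro CollectI exI conjI, rule refl, assumption+)
  done

lemma tensor_relations_carrier: "tensor_relations S M N \<subseteq> carrier FMN"
  unfolding tensor_relations_def
  by (auto simp del: tensor_free_simps(1)
    intro!: tensor_free_diff frag_of_mem M.M.m_closed N.M.m_closed M.ract_closed N.lact_closed)

lemma subgroup_tensor_null: "subgroup ZMN FMN"
  unfolding tensor_null_def by (rule F.generate_is_subgroup[OF tensor_relations_carrier])

lemma tensor_coset_eq:
  assumes "y \<in> carrier FMN" "x \<in> ZMN #>\<^bsub>FMN\<^esub> y"
  shows "ZMN #>\<^bsub>FMN\<^esub> x = ZMN #>\<^bsub>FMN\<^esub> y"
  using F.repr_independence[OF assms(2,1) subgroup_tensor_null] by simp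

text \<open>The actions on \<open>tensor_bimodule\<close> are unions of cosets over all
  representatives. Since \<open>f\<close> respects the relations, these cosets coincide and the
  union collapses to one of them.\<close>

lemma tensor_act_coset:
  assumes x: "x \<in> carrier FMN" and f: "\<And>m n. m \<in> carrier M \<Longrightarrow> n \<in> carrier N \<Longrightarrow> f (m, n) \<in> carrier FMN"
    and rel: "\<And>z. z \<in> tensor_relations S M N \<Longrightarrow> frag_extend f z \<in> tensor_relations S M N"
  shows "(\<Union>y\<in>ZMN #>\<^bsub>FMN\<^esub> x. ZMN #>\<^bsub>FMN\<^esub> frag_extend f y) = ZMN #>\<^bsub>FMN\<^esub> frag_extend f x"
proof -
  have ext: "frag_extend f y \<in> carrier FMN" if y: "y \<in> carrier FMN" for y
  proof -
    have "(\<Union>x\<in>Poly_Mapping.keys y. Poly_Mapping.keys (f x)) \<subseteq> carrier M \<times> carrier N"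
    proof (rule UN_least)
      fix x assume "x \<in> Poly_Mapping.keys y"
      then obtain m n where "x = (m, n)" "m \<in> carrier M" "n \<in> carrier N"
        using y by (cases x) auto
      then show "Poly_Mapping.keys (f x) \<subseteq> carrier M \<times> carrier N"
        using f[of m n] by simp
    qed
    then show ?thesis
      using keys_frag_extend[of f y] by simp
  qed
  have null: "frag_extend f z \<in> ZMN" if "z \<in> ZMN" for z
    using that unfolding tensor_null_def
  proof induction
    case one
    then show ?case using generate.one[of FMN] by simp
  next
    case (incl z)
    then show ?case by (intro generate.incl rel)
  next
    case (inv z)
    then have "inv\<^bsub>FMN\<^esub> z = - z" "inv\<^bsub>FMN\<^esub> (frag_extend f z) = - frag_extend f z"
      using tensor_relations_carrier rel[OF inv] by (auto simp: tensor_free_def)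
    then show ?case
      using generate.inv[OF rel[OF inv], of FMN] by (simp add: frag_extend_minus)
  next
    case (eng y z)
    then show ?case
      using generate.eng[of "frag_extend f y" FMN _ "frag_extend f z"] by (simp add: frag_extend_add)
  qed
  have "ZMN #>\<^bsub>FMN\<^esub> frag_extend f y = ZMN #>\<^bsub>FMN\<^esub> frag_extend f x" if y: "y \<in> ZMN #>\<^bsub>FMN\<^esub> x" for y
  proof (rule tensor_coset_eq[OF ext[OF x]])
    obtain z where "z \<in> ZMN" "y = z + x"
      using y by (auto simp: r_coset_def)
    then show "frag_extend f y \<in> ZMN #>\<^bsub>FMN\<^esub> frag_extend f x"
      using null[of z] by (auto simp: r_coset_def frag_extend_add)
  qed
  moreover have "ZMN #>\<^bsub>FMN\<^esub> x \<noteq> {}"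
    using F.rcos_self[OF x subgroup_tensor_null] by blast
  ultimately show ?thesis
    by (simp cong: SUP_cong_simp)
qed

lemma tensor_lact:
  assumes x: "x \<in> carrier FMN" and r: "r \<in> carrier R"
  shows "lact (tensor_bimodule S M N) r (ZMN #>\<^bsub>FMN\<^esub> x) =
    ZMN #>\<^bsub>FMN\<^esub> frag_extend (\<lambda>(m, n). frag_of (lact M r m, n)) x"
proof -
  let ?f = "\<lambda>(m, n). frag_of (lact M r m, n)"
  have "frag_extend ?f z \<in> tensor_relations S M N" if "z \<in> tensor_relations S M N" for z
    using that
  proof (cases z rule: tensor_relations_cases)
    case (add_l m m' n)
    then show ?thesis
      using r tensor_relationsI(1)[of "lact M r m" "lact M r m'" n] by (simp add: frag_extend_diff M.lact_add_r M.lact_closed)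
  next
    case (add_r m n n')
    then show ?thesis
      using r tensor_relationsI(2)[of "lact M r m" n n'] by (simp add: frag_extend_diff  M.lact_closed)
  next
    case (balanced m s n)
    then show ?thesis
      using r tensor_relationsI(3)[of "lact M r m" s n] by (simp add: frag_extend_diff M.lact_ract M.lact_closed)
  qed
  then show ?thesis
    using tensor_act_coset[OF x, of ?f] r by (simp add: tensor_bimodule_def Let_def M.lact_closed)
qed

lemma tensor_ract:
  assumes x: "x \<in> carrier FMN" and t: "t \<in> carrier T"
  shows "ract (tensor_bimodule S M N) (ZMN #>\<^bsub>FMN\<^esub> x) t =
    ZMN #>\<^bsub>FMN\<^esub> frag_extend (\<lambda>(m, n). frag_of (m, ract N n t)) x"
proof -
  let ?f = "\<lambda>(m, n). frag_of (m, ract N n t)"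
  have "frag_extend ?f z \<in> tensor_relations S M N" if "z \<in> tensor_relations S M N" for z
    using that
  proof (cases z rule: tensor_relations_cases)
    case (add_l m m' n)
    then show ?thesis
      using t tensor_relationsI(1)[of m m' "ract N n t"] by (simp add: frag_extend_diff  N.ract_closed)
  next
    case (add_r m n n')
    then show ?thesis
      using t tensor_relationsI(2)[of m "ract N n t" "ract N n' t"] by (simp add: frag_extend_diff N.ract_add_l N.ract_closed)
  next
    case (balanced m s n)
    then show ?thesis
      using t tensor_relationsI(3)[of m s "ract N n t"] by (simp add: frag_extend_diff N.lact_ract N.ract_closed)
  qed
  then show ?thesis
    using tensor_act_coset[OF x, of ?f] t by (simp add: tensor_bimodule_def Let_def N.ract_closed)
qed

lemma tensor_bimodule_group:
  "carrier (tensor_bimodule S M N) = (\<lambda>x. ZMN #>\<^bsub>FMN\<^esub> x) ` carrier FMN"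
  "mult (tensor_bimodule S M N) = mult (FMN Mod ZMN)" "one (tensor_bimodule S M N) = ZMN"
  by (simp_all add: tensor_bimodule_def Let_def carrier_FactGroup)

text \<open>The universal property of the tensor product for a balanced pairing \<open>p\<close>:
  extend it to the free abelian group, check that relations go to the neutral element, and pass to
  the quotient. It is onto because the values of \<open>p\<close> generate.\<close>

lemma tensor_lift:
  assumes P: "bimodule R T P"
    and closed: "\<And>m n. m \<in> carrier M \<Longrightarrow> n \<in> carrier N \<Longrightarrow> p m n \<in> carrier P"
    and add_l: "\<And>m m' n. m \<in> carrier M \<Longrightarrow> m' \<in> carrier M \<Longrightarrow> n \<in> carrier N \<Longrightarrow>
      p (m \<otimes>\<^bsub>M\<^esub> m') n = p m n \<otimes>\<^bsub>P\<^esub> p m' n"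
    and add_r: "\<And>m n n'. m \<in> carrier M \<Longrightarrow> n \<in> carrier N \<Longrightarrow> n' \<in> carrier N \<Longrightarrow>
      p m (n \<otimes>\<^bsub>N\<^esub> n') = p m n \<otimes>\<^bsub>P\<^esub> p m n'"
    and balanced: "\<And>m s n. m \<in> carrier M \<Longrightarrow> s \<in> carrier S \<Longrightarrow> n \<in> carrier N \<Longrightarrow>
      p (ract M m s) n = p m (lact N s n)"
    and left: "\<And>r m n. r \<in> carrier R \<Longrightarrow> m \<in> carrier M \<Longrightarrow> n \<in> carrier N \<Longrightarrow>
      p (lact M r m) n = lact P r (p m n)"
    and right: "\<And>t m n. t \<in> carrier T \<Longrightarrow> m \<in> carrier M \<Longrightarrow> n \<in> carrier N \<Longrightarrow>
      p m (ract N n t) = ract P (p m n) t"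
    and gen: "generate P {p m n | m n. m \<in> carrier M \<and> n \<in> carrier N} = carrier P"
  obtains h where "h \<in> bimodule_hom R T (tensor_bimodule S M N) P"
    "h ` carrier (tensor_bimodule S M N) = carrier P"
    "\<And>m n. m \<in> carrier M \<Longrightarrow> n \<in> carrier N \<Longrightarrow> h (pure_tensor S M N m n) = p m n"
proof -
  interpret P: bimodule R T P by (rule P)
  have p_closed: "case_prod p ` (carrier M \<times> carrier N) \<subseteq> carrier P"
    using closed by auto
  have "\<exists>h0. h0 \<in> hom (free_Abelian_group (carrier M \<times> carrier N)) P \<and>
      (\<forall>x\<in>carrier M \<times> carrier N. h0 (frag_of x) = case_prod p x)"
  proof (rule P.M.free_Abelian_group_universal[OF p_closed])
    fix h assume "h \<in> hom (free_Abelian_group (carrier M \<times> carrier N)) P"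
      and "\<And>x. x \<in> carrier M \<times> carrier N \<Longrightarrow> h (frag_of x) = case_prod p x"
    then show ?thesis by metis
  qed
  then obtain h0 where "h0 \<in> hom (free_Abelian_group (carrier M \<times> carrier N)) P"
    and h0_of: "\<And>x. x \<in> carrier M \<times> carrier N \<Longrightarrow> h0 (frag_of x) = case_prod p x"
    by metis
  then have h0: "h0 \<in> hom FMN P"
    by (simp add: tensor_free_def)
  interpret h0: group_hom FMN P h0
    by (simp add: group_hom_def group_hom_axioms_def h0 F.is_group P.M.is_group)
  have h0_p: "h0 (frag_of (m, n)) = p m n" if "m \<in> carrier M" "n \<in> carrier N" for m n
    using h0_of[of "(m, n)"] that by simp
  have h0_diff: "h0 (x - y) = h0 x \<otimes>\<^bsub>P\<^esub> inv\<^bsub>P\<^esub> h0 y" if "x \<in> carrier FMN" "y \<in> carrier FMN" for x y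
  proof -
    have "inv\<^bsub>FMN\<^esub> y = - y"
      using that by (simp add: tensor_free_def)
    then have "x - y = x \<otimes>\<^bsub>FMN\<^esub> inv\<^bsub>FMN\<^esub> y"
      by simp
    then show ?thesis
      using that by (simp only: h0.hom_mult F.inv_closed h0.hom_inv)
  qed
  have rel0: "h0 z = \<one>\<^bsub>P\<^esub>" if z: "z \<in> tensor_relations S M N" for z
  proof -
    have cancel: "a \<otimes>\<^bsub>P\<^esub> b \<otimes>\<^bsub>P\<^esub> inv\<^bsub>P\<^esub> a \<otimes>\<^bsub>P\<^esub> inv\<^bsub>P\<^esub> b = \<one>\<^bsub>P\<^esub>"
      if "a \<in> carrier P" "b \<in> carrier P" for a b
      using that by (simp add: P.M.m_comm[of a b] P.M.m_assoc P.M.r_inv)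
    note simps = h0_diff h0_p tensor_free_diff frag_of_mem closed add_l add_r balanced cancel
      M.ract_closed N.lact_closed P.M.r_inv
    from z show ?thesis
    proof (cases z rule: tensor_relations_cases)
      case (add_l m m' n)
      then show ?thesis by (simp add: simps del: tensor_free_simps(1))
    next
      case (add_r m n n')
      then show ?thesis by (simp add: simps del: tensor_free_simps(1))
    next
      case (balanced m s n)
      then show ?thesis by (simp add: simps del: tensor_free_simps(1))
    qed
  qed
  have "ZMN \<subseteq> kernel FMN P h0"
    unfolding tensor_null_def
    by (rule F.generate_subgroup_incl[OF _ h0.subgroup_kernel])
      (use rel0 tensor_relations_carrier in \<open>auto simp: kernel_def simp del: tensor_free_simps(1)\<close>)
  then have h0_null: "h0 z = \<one>\<^bsub>P\<^esub>" "z \<in> carrier FMN" if "z \<in> ZMN" for z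
    using that by (auto simp: kernel_def)
  have norm: "ZMN \<lhd> FMN"
    by (rule F.subgroup_imp_normal[OF subgroup_tensor_null])
  have "h0 x = h0 y" if "x \<in> carrier FMN" "y \<in> carrier FMN" "ZMN #>\<^bsub>FMN\<^esub> x = ZMN #>\<^bsub>FMN\<^esub> y" for x y
  proof -
    have "x \<in> ZMN #>\<^bsub>FMN\<^esub> y"
      using F.rcos_self[OF that(1) subgroup_tensor_null] that(3) by simp
    then obtain z where "z \<in> ZMN" "x = z \<otimes>\<^bsub>FMN\<^esub> y"
      by (auto simp: r_coset_def)
    then show ?thesis
      using h0_null[of z] that(2) h0.hom_mult[of z y] by simp
  qed
  then obtain h where h: "h \<in> hom (FMN Mod ZMN) P"
    "\<And>x. x \<in> carrier FMN \<Longrightarrow> h (ZMN #>\<^bsub>FMN\<^esub> x) = h0 x"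
    using FactGroup_universal[OF h0 norm] by metis
  let ?T = "tensor_bimodule S M N"
  have hom: "h \<in> hom ?T P"
    using h(1) unfolding hom_def tensor_bimodule_group carrier_FactGroup by simp
  have ext_l: "frag_extend (\<lambda>(m, n). frag_of (lact M r m, n)) x \<in> carrier FMN
      \<and> h0 (frag_extend (\<lambda>(m, n). frag_of (lact M r m, n)) x) = lact P r (h0 x)"
    if r: "r \<in> carrier R" and x: "x \<in> carrier FMN" for r x
  proof -
    interpret a: group_hom P P "lact P r"
      by (simp add: group_hom_def group_hom_axioms_def P.M.is_group hom_def P.lact_closed P.lact_add_r r)
    show ?thesis
    using x[unfolded tensor_free_simps(1)]
  proof (induction x rule: free_Abelian_group_induct[consumes 1])
    case 1
    show ?case
      using h0.hom_one a.hom_one by simp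
  next
    case (2 x y)
    then have xy: "x \<in> carrier FMN" "y \<in> carrier FMN" by simp_all
    show ?case
      using 2(3,4) xy tensor_free_diff h0.hom_closed
      by (simp add: frag_extend_diff h0_diff a.hom_mult a.hom_inv del: tensor_free_simps(1))
  next
    case (3 a)
    then obtain m n where "a = (m, n)" "m \<in> carrier M" "n \<in> carrier N" by auto
    then show ?case
      using r by (simp add: h0_p M.lact_closed left del: tensor_free_simps(1)) (simp add: M.lact_closed left)
  qed
  qed
  have ext_r: "frag_extend (\<lambda>(m, n). frag_of (m, ract N n t)) x \<in> carrier FMN
      \<and> h0 (frag_extend (\<lambda>(m, n). frag_of (m, ract N n t)) x) = ract P (h0 x) t"
    if t: "t \<in> carrier T" and x: "x \<in> carrier FMN" for t x
  proof -
    interpret a: group_hom P P "\<lambda>y. ract P y t"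
      by (simp add: group_hom_def group_hom_axioms_def P.M.is_group hom_def P.ract_closed P.ract_add_l t)
    show ?thesis
    using x[unfolded tensor_free_simps(1)]
  proof (induction x rule: free_Abelian_group_induct[consumes 1])
    case 1
    show ?case
      using h0.hom_one a.hom_one by simp
  next
    case (2 x y)
    then have xy: "x \<in> carrier FMN" "y \<in> carrier FMN" by simp_all
    show ?case
      using 2(3,4) xy tensor_free_diff h0.hom_closed
      by (simp add: frag_extend_diff h0_diff a.hom_mult a.hom_inv del: tensor_free_simps(1))
  next
    case (3 a)
    then obtain m n where "a = (m, n)" "m \<in> carrier M" "n \<in> carrier N" by auto
    then show ?case
      using t by (simp add: h0_p N.ract_closed right del: tensor_free_simps(1)) (simp add: N.ract_closed right)
  qed
  qed
  have "h \<in> bimodule_hom R T ?T P"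
    unfolding bimodule_hom_def tensor_bimodule_group
    using hom ext_l ext_r
    by (auto simp: tensor_lact tensor_ract h(2) simp del: tensor_free_simps(1))
  moreover have "h ` carrier ?T = carrier P"
  proof
    show "h ` carrier ?T \<subseteq> carrier P"
      using hom by (auto simp: hom_def)
    have "h ` carrier ?T = h0 ` carrier FMN"
      by (auto simp: tensor_bimodule_group h(2) image_iff simp del: tensor_free_simps(1))
    moreover have "carrier P \<subseteq> h0 ` carrier FMN"
      unfolding gen[symmetric]
    proof (rule P.M.generate_subgroup_incl[OF _ h0.img_is_subgroup])
      show "{p m n | m n. m \<in> carrier M \<and> n \<in> carrier N} \<subseteq> h0 ` carrier FMN"
      proof
        fix z assume "z \<in> {p m n | m n. m \<in> carrier M \<and> n \<in> carrier N}"
        then obtain m n where "z = h0 (frag_of (m, n))" "frag_of (m, n) \<in> carrier FMN"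
          using h0_p frag_of_mem by force
        then show "z \<in> h0 ` carrier FMN" by (rule image_eqI)
      qed
    qed
    ultimately show "carrier P \<subseteq> h ` carrier ?T"
      by simp
  qed
  moreover have "h (pure_tensor S M N m n) = p m n" if "m \<in> carrier M" "n \<in> carrier N" for m n
    unfolding pure_tensor_def using that h(2)[OF frag_of_mem[OF that]] h0_p by simp
  ultimately show thesis
    by (rule that)
qed

end

subsection \<open>Corners\<close>

text \<open>\<open>generate\<close> takes a whole record; this identifies the subgroups generated in
  \<open>regular_bimodule R\<close> and in \<open>add_monoid R\<close>.\<close>

lemma generate_cong:
  assumes "carrier G = carrier H" "mult G = mult H" "one G = one H"
  shows "generate G K = generate H K"
proof -
  have inv: "inv\<^bsub>G\<^esub> x = inv\<^bsub>H\<^esub> x" for x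
    by (simp add: m_inv_def assms)
  have "x \<in> generate H K" if "x \<in> generate G K" for x
    using that by induction (auto simp: assms inv intro: generate.intros)
  moreover have "x \<in> generate G K" if "x \<in> generate H K" for x
    using that by induction (auto simp: assms(2,3)[symmetric] inv[symmetric] intro: generate.intros)
  ultimately show ?thesis by blast
qed

context nu_ring
begin

abbreviation span :: "'a set \<Rightarrow> 'a set" where
  "span X \<equiv> generate (add_monoid R) X"

lemma l_null: "x \<in> carrier R \<Longrightarrow> \<zero> \<otimes> x = \<zero>"
  using l_distr[of \<zero> \<zero> x] m_closed[of \<zero> x] by (simp add: add.l_cancel_one')

lemma r_null: "x \<in> carrier R \<Longrightarrow> x \<otimes> \<zero> = \<zero>"
  using r_distr[of \<zero> \<zero> x] m_closed[of x \<zero>] by (simp add: add.l_cancel_one')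

lemma l_minus: "x \<in> carrier R \<Longrightarrow> y \<in> carrier R \<Longrightarrow> (\<ominus> x) \<otimes> y = \<ominus> (x \<otimes> y)"
  using l_distr[of "\<ominus> x" x y] by (intro minus_equality[symmetric]) (simp_all add: m_closed l_neg l_null)

lemma r_minus: "x \<in> carrier R \<Longrightarrow> y \<in> carrier R \<Longrightarrow> x \<otimes> (\<ominus> y) = \<ominus> (x \<otimes> y)"
  using r_distr[of "\<ominus> y" y x] by (intro minus_equality[symmetric]) (simp_all add: m_closed l_neg r_null)

lemma span_closed: "X \<subseteq> carrier R \<Longrightarrow> x \<in> span X \<Longrightarrow> x \<in> carrier R"
  using add.generate_in_carrier[of X x] by simp

lemma span_subgroup: "X \<subseteq> carrier R \<Longrightarrow> subgroup (span X) (add_monoid R)"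
  by (rule add.generate_is_subgroup) simp

lemma span_zero: "\<zero> \<in> span X"
  using generate.one[of "add_monoid R"] by simp

lemma span_add: "x \<in> span X \<Longrightarrow> y \<in> span X \<Longrightarrow> x \<oplus> y \<in> span X"
  using generate.eng[of x "add_monoid R" X y] by simp

lemma span_minus: "X \<subseteq> carrier R \<Longrightarrow> x \<in> span X \<Longrightarrow> \<ominus> x \<in> span X"
  using add.generate_m_inv_closed[of X x] by (simp add: a_inv_def)

lemma span_induct [consumes 2, case_names zero incl minus add]:
  assumes "x \<in> span X" and X: "X \<subseteq> carrier R" and "P \<zero>" and "\<And>x. x \<in> X \<Longrightarrow> P x"
    and minus: "\<And>x. x \<in> carrier R \<Longrightarrow> P x \<Longrightarrow> P (\<ominus> x)"
    and "\<And>x y. x \<in> span X \<Longrightarrow> y \<in> span X \<Longrightarrow> P x \<Longrightarrow> P y \<Longrightarrow> P (x \<oplus> y)"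
  shows "P x"
  using assms(1)
proof induction
  case (inv h)
  then have "P (\<ominus> h)" using minus assms(4) X by blast
  then show ?case by (simp add: a_inv_def)
qed (use assms(3,4,6) in auto)

lemma span_mult:
  assumes x: "x \<in> span X" and y: "y \<in> span Y" and X: "X \<subseteq> carrier R" and Y: "Y \<subseteq> carrier R"
    and Z: "Z \<subseteq> carrier R" and XY: "\<And>x y. x \<in> X \<Longrightarrow> y \<in> Y \<Longrightarrow> x \<otimes> y \<in> span Z"
  shows "x \<otimes> y \<in> span Z"
proof -
  have *: "x \<otimes> y \<in> span Z" if "x \<in> X" for x
    using y Y
  proof (induction rule: span_induct)
    case zero
    then show ?case using that X by (auto simp: r_null span_zero)
  next
    case (incl y)
    then show ?case using that XY by blast
  next
    case (minus y)
    then show ?case using that X Z by (auto simp: r_minus span_minus subset_iff)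
  next
    case (add y z)
    then have "y \<in> carrier R" "z \<in> carrier R" "x \<in> carrier R"
      using span_closed[OF Y] that X by auto
    then show ?case using add span_add by (simp add: r_distr)
  qed
  show ?thesis
    using x X
  proof (induction rule: span_induct)
    case zero
    then show ?case using span_closed[OF Y y] by (auto simp: l_null span_zero)
  next
    case (incl x)
    then show ?case by (rule *)
  next
    case (minus x)
    then show ?case using span_closed[OF Y y] Z by (auto simp: l_minus span_minus)
  next
    case (add x z)
    then have "x \<in> carrier R" "z \<in> carrier R" "y \<in> carrier R"
      using span_closed[OF X] span_closed[OF Y y] by auto
    then show ?case using add span_add by (simp add: l_distr)
  qed
qed

text \<open>Products are kept as plain sets and closed under addition only once, by
  \<open>span\<close>. The \<open>span_prods\<close> lemmas drop inner spans, so that associativity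
  is a matter of sets.\<close>

definition prods :: "'a set \<Rightarrow> 'a set \<Rightarrow> 'a set" where
  "prods X Y = {x \<otimes> y | x y. x \<in> X \<and> y \<in> Y}"

lemma prodsI: "x \<in> X \<Longrightarrow> y \<in> Y \<Longrightarrow> x \<otimes> y \<in> prods X Y"
  by (auto simp: prods_def)

lemma prodsE:
  assumes "z \<in> prods X Y"
  obtains x y where "z = x \<otimes> y" "x \<in> X" "y \<in> Y"
  using assms by (auto simp: prods_def)

lemma prods_closed: "X \<subseteq> carrier R \<Longrightarrow> Y \<subseteq> carrier R \<Longrightarrow> prods X Y \<subseteq> carrier R"
  by (auto elim!: prodsE intro!: m_closed)

lemma prods_mono: "X \<subseteq> X' \<Longrightarrow> Y \<subseteq> Y' \<Longrightarrow> prods X Y \<subseteq> prods X' Y'"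
  by (auto simp: prods_def)

lemma prods_assoc:
  assumes "X \<subseteq> carrier R" "Y \<subseteq> carrier R" "Z \<subseteq> carrier R"
  shows "prods (prods X Y) Z = prods X (prods Y Z)"
proof
  show "prods (prods X Y) Z \<subseteq> prods X (prods Y Z)"
  proof
    fix w assume "w \<in> prods (prods X Y) Z"
    then obtain x y z where w: "w = (x \<otimes> y) \<otimes> z" "x \<in> X" "y \<in> Y" "z \<in> Z"
      by (auto elim!: prodsE)
    then have "w = x \<otimes> (y \<otimes> z)"
      using assms by (simp add: m_assoc subset_iff)
    then show "w \<in> prods X (prods Y Z)"
      using w by (simp add: prodsI)
  qed
  show "prods X (prods Y Z) \<subseteq> prods (prods X Y) Z"
  proof
    fix w assume "w \<in> prods X (prods Y Z)"
    then obtain x y z where w: "w = x \<otimes> (y \<otimes> z)" "x \<in> X" "y \<in> Y" "z \<in> Z"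
      by (auto elim!: prodsE)
    then have "w = (x \<otimes> y) \<otimes> z"
      using assms by (simp add: m_assoc subset_iff)
    then show "w \<in> prods (prods X Y) Z"
      using w by (simp add: prodsI)
  qed
qed

lemma span_incl: "X \<subseteq> span X"
  by (auto intro: generate.incl)

lemma span_mono: "X \<subseteq> Y \<Longrightarrow> span X \<subseteq> span Y"
  by (rule add.mono_generate)

lemma span_carrier: "X \<subseteq> carrier R \<Longrightarrow> span X \<subseteq> carrier R"
  using span_closed by blast

lemma span_of_subgroup: "subgroup X (add_monoid R) \<Longrightarrow> span X = X"
  using add.generate_subgroup_incl[of X X] span_incl by blast

lemma span_subset: "X \<subseteq> carrier R \<Longrightarrow> Y \<subseteq> span X \<Longrightarrow> span Y \<subseteq> span X"
  using add.generate_subgroup_incl[OF _ span_subgroup] by blast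

lemma span_prods:
  assumes "X \<subseteq> carrier R" "Y \<subseteq> carrier R"
  shows "span (prods (span X) (span Y)) = span (prods X Y)"
proof
  show "span (prods (span X) (span Y)) \<subseteq> span (prods X Y)"
  proof (rule span_subset[OF prods_closed[OF assms]], rule subsetI)
    fix z assume "z \<in> prods (span X) (span Y)"
    then obtain x y where z: "z = x \<otimes> y" and x: "x \<in> span X" and y: "y \<in> span Y"
      by (rule prodsE)
    show "z \<in> span (prods X Y)"
      unfolding z by (rule span_mult[OF x y assms prods_closed[OF assms]]) (rule generate.incl[OF prodsI])
  qed
  show "span (prods X Y) \<subseteq> span (prods (span X) (span Y))"
    by (intro span_mono prods_mono span_incl)
qed

lemma span_prods_left:
  assumes "X \<subseteq> carrier R" "Y \<subseteq> carrier R"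
  shows "span (prods (span X) Y) = span (prods X Y)"
proof
  show "span (prods (span X) Y) \<subseteq> span (prods X Y)"
    using span_mono[OF prods_mono[OF order_refl span_incl]] span_prods[OF assms] by blast
  show "span (prods X Y) \<subseteq> span (prods (span X) Y)"
    by (intro span_mono prods_mono span_incl order_refl)
qed

lemma span_prods_right:
  assumes "X \<subseteq> carrier R" "Y \<subseteq> carrier R"
  shows "span (prods X (span Y)) = span (prods X Y)"
proof
  show "span (prods X (span Y)) \<subseteq> span (prods X Y)"
    using span_mono[OF prods_mono[OF span_incl order_refl]] span_prods[OF assms] by blast
  show "span (prods X Y) \<subseteq> span (prods X (span Y))"
    by (intro span_mono prods_mono span_incl order_refl)
qed

lemma span_prods_middle:
  assumes "X \<subseteq> carrier R" "Y \<subseteq> carrier R" "Z \<subseteq> carrier R"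
  shows "span (prods X (prods (span Y) Z)) = span (prods X (prods Y Z))"
  using assms span_prods_right[of X "prods (span Y) Z"] span_prods_right[of X "prods Y Z"]
    span_prods_left[of Y Z] by (simp add: prods_closed span_carrier)

lemma nu_ring_sub:
  assumes I: "subgroup I (add_monoid R)" and mult: "\<And>x y. x \<in> I \<Longrightarrow> y \<in> I \<Longrightarrow> x \<otimes> y \<in> I"
  shows "nu_ring (R\<lparr>carrier := I\<rparr>)"
proof -
  interpret I: additive_subgroup I R by (rule additive_subgroup.intro[OF I])
  have "abelian_group (R\<lparr>carrier := I\<rparr>)"
  proof (rule abelian_groupI)
    fix x assume "x \<in> carrier (R\<lparr>carrier := I\<rparr>)"
    then show "\<exists>y\<in>carrier (R\<lparr>carrier := I\<rparr>). y \<oplus>\<^bsub>R\<lparr>carrier := I\<rparr>\<^esub> x = \<zero>\<^bsub>R\<lparr>carrier := I\<rparr>\<^esub>"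
      by (intro bexI[of _ "\<ominus> x"]) (auto simp: l_neg)
  qed (auto simp: a_ac)
  then show ?thesis
    by (intro nu_ring.intro nu_ring_axioms.intro) (auto simp: mult m_assoc l_distr r_distr)
qed

text \<open>\<open>morita_equivalent\<close> asks for bimodules whose elements are lists over the
  sum of both ring types; ring elements enter as lists of length one.\<close>

definition enc :: "'a \<Rightarrow> ('a + 's) list" where
  "enc x = [Inl x]"

definition dec :: "('a + 's) list \<Rightarrow> 'a" where
  "dec l = projl (hd l)"

lemma dec_enc [simp]: "dec (enc x) = x"
  by (simp add: enc_def dec_def)

lemma enc_eq_iff [simp]: "enc x = enc y \<longleftrightarrow> x = y"
  by (simp add: enc_def)

definition enc_bimod :: "'a set \<Rightarrow> ('p \<Rightarrow> 'a \<Rightarrow> 'a) \<Rightarrow> ('a \<Rightarrow> 'q \<Rightarrow> 'a) \<Rightarrow> ('p, 'q, ('a + 's) list) bimod" where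
  "enc_bimod M l r = \<lparr>carrier = enc ` M, mult = (\<lambda>x y. enc (dec x \<oplus> dec y)), one = enc \<zero>,
     lact = (\<lambda>a m. enc (l a (dec m))), ract = (\<lambda>m a. enc (r (dec m) a))\<rparr>"

lemma enc_bimod_simps [simp]:
  "carrier (enc_bimod M l r) = enc ` M" "mult (enc_bimod M l r) = (\<lambda>x y. enc (dec x \<oplus> dec y))"
  "one (enc_bimod M l r) = enc \<zero>" "lact (enc_bimod M l r) = (\<lambda>a m. enc (l a (dec m)))"
  "ract (enc_bimod M l r) = (\<lambda>m a. enc (r (dec m) a))"
  by (simp_all add: enc_bimod_def)

lemma enc_collect:
  "{enc (f a (dec m)) | a m. a \<in> X \<and> m \<in> enc ` M} = enc ` {f a m | a m. a \<in> X \<and> m \<in> M}"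
  "{enc (g (dec m) b) | m b. m \<in> enc ` M \<and> b \<in> Y} = enc ` {g m b | m b. m \<in> M \<and> b \<in> Y}"
  by (force, force)

lemma comm_group_enc:
  assumes "subgroup M (add_monoid R)"
  shows "comm_group (enc_bimod M l r :: ('p, 'q, ('a + 's) list) bimod)"
proof -
  interpret M: additive_subgroup M R by (rule additive_subgroup.intro[OF assms])
  show ?thesis
  proof (rule comm_groupI)
    fix x assume "x \<in> carrier (enc_bimod M l r :: ('p, 'q, ('a + 's) list) bimod)"
    then obtain m where m: "m \<in> M" "x = enc m" by auto
    then show "\<exists>y\<in>carrier (enc_bimod M l r). y \<otimes>\<^bsub>enc_bimod M l r\<^esub> x
        = \<one>\<^bsub>enc_bimod M l r :: ('p, 'q, ('a + 's) list) bimod\<^esub>"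
      by (intro bexI[of _ "enc (\<ominus> m)"]) (auto simp: l_neg)
  qed (auto simp: a_ac)
qed

lemma generate_enc:
  assumes M: "subgroup M (add_monoid R)" and X: "X \<subseteq> M"
  shows "generate (enc_bimod M l r :: ('p, 'q, ('a + 's) list) bimod) (enc ` X) = enc ` span X"
proof -
  let ?G = "(add_monoid R)\<lparr>carrier := M\<rparr>" and ?M = "enc_bimod M l r :: ('p, 'q, ('a + 's) list) bimod"
  interpret h: group_hom ?G ?M enc
    using add.subgroup_imp_group[OF M] comm_group_enc[OF M]
    by (auto simp: group_hom_def group_hom_axioms_def hom_def comm_group_def)
  show ?thesis
    using h.generate_img[of X] add.generate_consistent[OF X M] X by simp
qed

lemma bimodule_enc:
  assumes P: "nu_ring P" and Q: "nu_ring Q" and M: "subgroup M (add_monoid R)"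
    and l: "\<And>p m. p \<in> carrier P \<Longrightarrow> m \<in> M \<Longrightarrow> l p m \<in> M"
    and r: "\<And>q m. q \<in> carrier Q \<Longrightarrow> m \<in> M \<Longrightarrow> r m q \<in> M"
    and "\<And>p m m'. p \<in> carrier P \<Longrightarrow> m \<in> M \<Longrightarrow> m' \<in> M \<Longrightarrow> l p (m \<oplus> m') = l p m \<oplus> l p m'"
    and "\<And>p p' m. p \<in> carrier P \<Longrightarrow> p' \<in> carrier P \<Longrightarrow> m \<in> M \<Longrightarrow> l (p \<oplus>\<^bsub>P\<^esub> p') m = l p m \<oplus> l p' m"
    and "\<And>p p' m. p \<in> carrier P \<Longrightarrow> p' \<in> carrier P \<Longrightarrow> m \<in> M \<Longrightarrow> l (p \<otimes>\<^bsub>P\<^esub> p') m = l p (l p' m)"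
    and "\<And>q m m'. q \<in> carrier Q \<Longrightarrow> m \<in> M \<Longrightarrow> m' \<in> M \<Longrightarrow> r (m \<oplus> m') q = r m q \<oplus> r m' q"
    and "\<And>q q' m. q \<in> carrier Q \<Longrightarrow> q' \<in> carrier Q \<Longrightarrow> m \<in> M \<Longrightarrow> r m (q \<oplus>\<^bsub>Q\<^esub> q') = r m q \<oplus> r m q'"
    and "\<And>q q' m. q \<in> carrier Q \<Longrightarrow> q' \<in> carrier Q \<Longrightarrow> m \<in> M \<Longrightarrow> r m (q \<otimes>\<^bsub>Q\<^esub> q') = r (r m q) q'"
    and "\<And>p q m. p \<in> carrier P \<Longrightarrow> q \<in> carrier Q \<Longrightarrow> m \<in> M \<Longrightarrow> r (l p m) q = l p (r m q)"
  shows "bimodule P Q (enc_bimod M l r :: ('p, 'q, ('a + 's) list) bimod)"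
  by (intro bimodule.intro P Q comm_group_enc[OF M] bimodule_axioms.intro) (auto simp: assms)

end

lemma bimodule_regular:
  assumes "nu_ring R"
  shows "bimodule R R (regular_bimodule R)"
proof -
  interpret nu_ring R by fact
  have "comm_group (regular_bimodule R)"
  proof (rule comm_groupI)
    fix x assume "x \<in> carrier (regular_bimodule R)"
    then show "\<exists>y\<in>carrier (regular_bimodule R). y \<otimes>\<^bsub>regular_bimodule R\<^esub> x = \<one>\<^bsub>regular_bimodule R\<^esub>"
      by (intro bexI[of _ "\<ominus>\<^bsub>R\<^esub> x"]) (simp_all add: regular_bimodule_def l_neg)
  qed (simp_all add: regular_bimodule_def a_ac)
  then show ?thesis
    by (intro bimodule.intro assms bimodule_axioms.intro)
      (simp_all add: regular_bimodule_def m_closed l_distr r_distr m_assoc)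
qed

text \<open>
  For a subring \<open>A\<close> with \<open>A B A \<subseteq> A\<close> and \<open>A A = A\<close> the ring \<open>B A B\<close> is Morita equivalent to \<open>A\<close>
  through the bimodules \<open>B A\<close> and \<open>A B\<close>.
\<close>

locale corner = B: nu_ring B + S: nu_ring S
  for B :: "('r, 'x) ring_scheme" (structure) and S :: "('s, 'y) ring_scheme" +
  fixes \<theta> :: "'s \<Rightarrow> 'r"
  assumes \<theta>_closed: "s \<in> carrier S \<Longrightarrow> \<theta> s \<in> carrier B"
    and \<theta>_add: "s \<in> carrier S \<Longrightarrow> t \<in> carrier S \<Longrightarrow> \<theta> (s \<oplus>\<^bsub>S\<^esub> t) = \<theta> s \<oplus> \<theta> t"
    and \<theta>_mult: "s \<in> carrier S \<Longrightarrow> t \<in> carrier S \<Longrightarrow> \<theta> (s \<otimes>\<^bsub>S\<^esub> t) = \<theta> s \<otimes> \<theta> t"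
    and \<theta>_inj: "inj_on \<theta> (carrier S)"
    and S_idem: "idempotent_ring S"
    and corner: "a \<in> \<theta> ` carrier S \<Longrightarrow> b \<in> carrier B \<Longrightarrow> a' \<in> \<theta> ` carrier S \<Longrightarrow>
      a \<otimes> b \<otimes> a' \<in> \<theta> ` carrier S"
begin

definition "A = \<theta> ` carrier S"
definition "I = B.span (B.prods (carrier B) (B.prods A (carrier B)))"
definition "M = B.span (B.prods (carrier B) A)"
definition "N = B.span (B.prods A (carrier B))"

lemma A_carr: "A \<subseteq> carrier B"
  using \<theta>_closed by (auto simp: A_def)

lemma \<theta>_A: "s \<in> carrier S \<Longrightarrow> \<theta> s \<in> A"
  by (simp add: A_def)

lemma AA: "B.prods A A \<subseteq> A"
proof
  fix x assume "x \<in> B.prods A A"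
  then obtain s t where "x = \<theta> s \<otimes> \<theta> t" "s \<in> carrier S" "t \<in> carrier S"
    by (auto elim!: B.prodsE simp: A_def)
  then have "x = \<theta> (s \<otimes>\<^bsub>S\<^esub> t)" "s \<otimes>\<^bsub>S\<^esub> t \<in> carrier S"
    by (simp_all add: \<theta>_mult S.m_closed)
  then show "x \<in> A" by (simp add: A_def)
qed

lemma A_hom: "group_hom (add_monoid S) (add_monoid B) \<theta>"
  using \<theta>_closed \<theta>_add S.add.is_group B.add.is_group
  by (auto simp: group_hom_def group_hom_axioms_def hom_def)

lemma A_subgroup: "subgroup A (add_monoid B)"
  using group_hom.img_is_subgroup[OF A_hom] by (simp add: A_def)

lemma span_A: "B.span A = A"
  by (rule B.span_of_subgroup[OF A_subgroup])

lemma span_AA: "B.span (B.prods A A) = A"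
proof
  show "B.span (B.prods A A) \<subseteq> A"
    using B.span_mono[OF AA] span_A by simp
  let ?X = "{x \<otimes>\<^bsub>S\<^esub> y | x y. x \<in> carrier S \<and> y \<in> carrier S}"
  have "?X \<subseteq> carrier S"
    by (auto intro: S.m_closed)
  then have "A = B.span (\<theta> ` ?X)"
    using S_idem group_hom.generate_img[OF A_hom, of ?X] by (simp add: idempotent_ring_def A_def)
  also have "\<dots> \<subseteq> B.span (B.prods A A)"
    by (rule B.span_mono) (auto simp: \<theta>_mult A_def intro!: B.prodsI)
  finally show "A \<subseteq> B.span (B.prods A A)" .
qed

text \<open>As \<open>A\<close> is idempotent, it is spanned by products of four of its elements.
  This supplies the inner factors that a unit would supply, for instance in rewriting B A B as (B A
  B)(B A B).\<close>

abbreviation "A2 \<equiv> B.prods A A"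
abbreviation "A4 \<equiv> B.prods A2 A2"
abbreviation "c \<equiv> carrier B"

lemma A2_carr: "A2 \<subseteq> c"
  by (intro B.prods_closed A_carr)

lemma A4_carr: "A4 \<subseteq> c"
  by (intro B.prods_closed A2_carr)

lemma span_A4: "B.span A4 = A"
  using B.span_prods[OF A2_carr A2_carr] by (simp add: span_AA)

lemma cX: "X \<subseteq> c \<Longrightarrow> B.prods c X \<subseteq> c" "X \<subseteq> c \<Longrightarrow> B.prods X c \<subseteq> c"
  by (intro B.prods_closed; simp)+

lemmas closed = B.prods_closed cX A_carr A2_carr A4_carr order_refl

text \<open>These are the idempotence of \<open>I\<close>, the unitality of both bimodules and the
  surjectivity of both pairings.\<close>

lemma generated:
  "B.span (B.prods I I) = I" "B.span (B.prods I M) = M" "B.span (B.prods M A) = M"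
  "B.span (B.prods A N) = N" "B.span (B.prods N I) = N" "B.span (B.prods M N) = I"
  "B.span (B.prods N M) = A"
proof -
  let ?P = "B.prods"
  have I4: "I = B.span (?P c (?P A4 c))"
    using B.span_prods_middle[of c A4 c] by (simp add: closed span_A4 I_def)
  have M4: "M = B.span (?P c A4)"
    using B.span_prods_right[of c A4] by (simp add: closed span_A4 M_def)
  have N4: "N = B.span (?P A4 c)"
    using B.span_prods_left[of A4 c] by (simp add: closed span_A4 N_def)
  show "B.span (?P I I) = I"
  proof
    have "B.span (?P I I) = B.span (?P (?P c (?P A c)) (?P c (?P A c)))"
      unfolding I_def by (rule B.span_prods) (intro closed)+
    also have "?P (?P c (?P A c)) (?P c (?P A c)) = ?P c (?P A (?P c (?P c (?P A c))))"
      by (simp add: B.prods_assoc closed)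
    also have "B.span \<dots> \<subseteq> I"
      unfolding I_def by (intro B.span_mono B.prods_mono closed)
    finally show "B.span (?P I I) \<subseteq> I" .
    \<comment> \<open>Of the four factors from \<open>A\<close>, two go to each side, and the two
      innermost ones are enlarged to the whole ring.\<close>
    have "?P c (?P A4 c) = ?P (?P c (?P A A)) (?P A (?P A c))"
      by (simp add: B.prods_assoc closed)
    also have "\<dots> \<subseteq> ?P (?P c (?P A c)) (?P c (?P A c))"
      by (intro B.prods_mono A_carr order_refl)
    also have "\<dots> \<subseteq> ?P I I"
      unfolding I_def by (intro B.prods_mono B.span_incl)
    finally show "I \<subseteq> B.span (?P I I)"
      unfolding I4 by (rule B.span_mono)
  qed
  show "B.span (?P I M) = M"
  proof
    have "B.span (?P I M) = B.span (?P (?P c (?P A c)) (?P c A))"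
      unfolding I_def M_def by (rule B.span_prods) (intro closed)+
    also have "?P (?P c (?P A c)) (?P c A) = ?P (?P c (?P A (?P c c))) A"
      by (simp add: B.prods_assoc closed)
    also have "B.span \<dots> \<subseteq> M"
      unfolding M_def by (intro B.span_mono B.prods_mono closed)
    finally show "B.span (?P I M) \<subseteq> M" .
    have "?P c A4 = ?P (?P c (?P A A)) (?P A A)"
      by (simp add: B.prods_assoc closed)
    also have "\<dots> \<subseteq> ?P (?P c (?P A c)) (?P c A)"
      by (intro B.prods_mono A_carr order_refl)
    also have "\<dots> \<subseteq> ?P I M"
      unfolding I_def M_def by (intro B.prods_mono B.span_incl)
    finally show "M \<subseteq> B.span (?P I M)"
      unfolding M4 by (rule B.span_mono)
  qed
  have "B.span (?P M A) = B.span (?P (?P c A) A)"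
    unfolding M_def by (rule B.span_prods_left) (intro closed)+
  also have "?P (?P c A) A = ?P c (?P A A)"
    by (intro B.prods_assoc closed)
  also have "B.span \<dots> = M"
    using B.span_prods_right[of c A2] by (simp add: closed span_AA M_def)
  finally show "B.span (?P M A) = M" .
  have "B.span (?P A N) = B.span (?P A (?P A c))"
    unfolding N_def by (rule B.span_prods_right) (intro closed)+
  also have "?P A (?P A c) = ?P (?P A A) c"
    by (intro B.prods_assoc[symmetric] closed)
  also have "B.span \<dots> = N"
    using B.span_prods_left[of A2 c] by (simp add: closed span_AA N_def)
  finally show "B.span (?P A N) = N" .
  show "B.span (?P N I) = N"
  proof
    have "B.span (?P N I) = B.span (?P (?P A c) (?P c (?P A c)))"
      unfolding I_def N_def by (rule B.span_prods) (intro closed)+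
    also have "?P (?P A c) (?P c (?P A c)) = ?P A (?P c (?P c (?P A c)))"
      by (simp add: B.prods_assoc closed)
    also have "B.span \<dots> \<subseteq> N"
      unfolding N_def by (intro B.span_mono B.prods_mono closed)
    finally show "B.span (?P N I) \<subseteq> N" .
    have "?P A4 c = ?P (?P A A) (?P A (?P A c))"
      by (simp add: B.prods_assoc closed)
    also have "\<dots> \<subseteq> ?P (?P A c) (?P c (?P A c))"
      by (intro B.prods_mono A_carr order_refl)
    also have "\<dots> \<subseteq> ?P N I"
      unfolding I_def N_def by (intro B.prods_mono B.span_incl)
    finally show "N \<subseteq> B.span (?P N I)"
      unfolding N4 by (rule B.span_mono)
  qed
  have "B.span (?P M N) = B.span (?P (?P c A) (?P A c))"
    unfolding M_def N_def by (rule B.span_prods) (intro closed)+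
  also have "?P (?P c A) (?P A c) = ?P c (?P (?P A A) c)"
    by (simp add: B.prods_assoc closed)
  also have "B.span \<dots> = I"
    using B.span_prods_middle[of c A2 c] by (simp add: closed span_AA I_def)
  finally show "B.span (?P M N) = I" .
  show "B.span (?P N M) = A"
  proof
    have "B.span (?P N M) = B.span (?P (?P A c) (?P c A))"
      unfolding M_def N_def by (rule B.span_prods) (intro closed)+
    also have "?P (?P A c) (?P c A) = ?P (?P A (?P c c)) A"
      by (simp add: B.prods_assoc closed)
    also have "\<dots> \<subseteq> A"
    proof
      fix x assume "x \<in> ?P (?P A (?P c c)) A"
      then obtain a b a' where "x = a \<otimes> b \<otimes> a'" "a \<in> A" "b \<in> ?P c c" "a' \<in> A"
        by (auto elim!: B.prodsE intro: B.prodsI)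
      then show "x \<in> A"
        using corner[of a b a'] cX(1)[OF order_refl] by (auto simp: A_def)
    qed
    finally have "B.span (?P N M) \<subseteq> B.span A"
      by (simp add: B.span_mono)
    then show "B.span (?P N M) \<subseteq> A"
      by (simp add: span_A)
    have "A4 \<subseteq> ?P (?P A c) (?P c A)"
      by (intro B.prods_mono A_carr order_refl)
    also have "\<dots> \<subseteq> ?P N M"
      unfolding M_def N_def by (intro B.prods_mono B.span_incl)
    finally show "A \<subseteq> B.span (?P N M)"
      using B.span_mono span_A4 by blast
  qed
qed

lemma mult_closed:
  "x \<in> I \<Longrightarrow> y \<in> I \<Longrightarrow> x \<otimes> y \<in> I" "x \<in> I \<Longrightarrow> m \<in> M \<Longrightarrow> x \<otimes> m \<in> M"
  "m \<in> M \<Longrightarrow> a \<in> A \<Longrightarrow> m \<otimes> a \<in> M" "a \<in> A \<Longrightarrow> n \<in> N \<Longrightarrow> a \<otimes> n \<in> N"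
  "n \<in> N \<Longrightarrow> x \<in> I \<Longrightarrow> n \<otimes> x \<in> N" "m \<in> M \<Longrightarrow> n \<in> N \<Longrightarrow> m \<otimes> n \<in> I"
  "n \<in> N \<Longrightarrow> m \<in> M \<Longrightarrow> n \<otimes> m \<in> A"
proof -
  have "x \<otimes> y \<in> Z" if "B.span (B.prods X Y) = Z" "x \<in> X" "y \<in> Y" for x y X Y Z
    using generate.incl[OF B.prodsI[OF that(2,3)]] that(1) by blast
  note * = generated[THEN this]
  show "x \<in> I \<Longrightarrow> y \<in> I \<Longrightarrow> x \<otimes> y \<in> I" by (rule *(1))
  show "x \<in> I \<Longrightarrow> m \<in> M \<Longrightarrow> x \<otimes> m \<in> M" by (rule *(2))
  show "m \<in> M \<Longrightarrow> a \<in> A \<Longrightarrow> m \<otimes> a \<in> M" by (rule *(3))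
  show "a \<in> A \<Longrightarrow> n \<in> N \<Longrightarrow> a \<otimes> n \<in> N" by (rule *(4))
  show "n \<in> N \<Longrightarrow> x \<in> I \<Longrightarrow> n \<otimes> x \<in> N" by (rule *(5))
  show "m \<in> M \<Longrightarrow> n \<in> N \<Longrightarrow> m \<otimes> n \<in> I" by (rule *(6))
  show "n \<in> N \<Longrightarrow> m \<in> M \<Longrightarrow> n \<otimes> m \<in> A" by (rule *(7))
qed

lemma subgroups: "subgroup I (add_monoid B)" "subgroup M (add_monoid B)" "subgroup N (add_monoid B)"
  unfolding I_def M_def N_def by (intro B.span_subgroup closed)+

lemma in_B: "x \<in> I \<Longrightarrow> x \<in> c" "x \<in> M \<Longrightarrow> x \<in> c" "x \<in> N \<Longrightarrow> x \<in> c" "x \<in> A \<Longrightarrow> x \<in> c"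
  using subgroup.subset[OF subgroups(1)] subgroup.subset[OF subgroups(2)]
    subgroup.subset[OF subgroups(3)] A_carr by auto

definition IR :: "('r, 'x) ring_scheme" where
  "IR = B\<lparr>carrier := I\<rparr>"

definition MB :: "('r, 's, ('r + 's) list) bimod" where
  "MB = B.enc_bimod M (\<lambda>x m. x \<otimes> m) (\<lambda>m s. m \<otimes> \<theta> s)"

definition NB :: "('s, 'r, ('r + 's) list) bimod" where
  "NB = B.enc_bimod N (\<lambda>s n. \<theta> s \<otimes> n) (\<lambda>n x. n \<otimes> x)"

lemma IR_simps [simp]:
  "carrier IR = I" "mult IR = mult B" "add IR = add B" "\<zero>\<^bsub>IR\<^esub> = \<zero>"
  by (simp_all add: IR_def)

lemma nu_ring_IR: "nu_ring IR"
  unfolding IR_def by (rule B.nu_ring_sub[OF subgroups(1)]) (rule mult_closed)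

lemma generate_IR: "X \<subseteq> I \<Longrightarrow> generate (add_monoid IR) X = B.span X"
  using B.add.generate_consistent[OF _ subgroups(1), of X] by (simp add: IR_def)

lemma bimodules: "bimodule IR S MB" "bimodule S IR NB"
proof -
  note simps = mult_closed \<theta>_A in_B \<theta>_add \<theta>_mult B.l_distr B.r_distr B.m_assoc
  show "bimodule IR S MB"
    unfolding MB_def
    by (rule B.bimodule_enc[OF nu_ring_IR S.nu_ring_axioms subgroups(2)]) (simp_all add: simps)
  show "bimodule S IR NB"
    unfolding NB_def
    by (rule B.bimodule_enc[OF S.nu_ring_axioms nu_ring_IR subgroups(3)]) (simp_all add: simps)
qed

lemma prods_subset: "B.prods I I \<subseteq> I" "B.prods I M \<subseteq> M" "B.prods M A \<subseteq> M" "B.prods A N \<subseteq> N"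
    "B.prods N I \<subseteq> N" "B.prods M N \<subseteq> I" "B.prods N M \<subseteq> A"
  by (auto elim!: B.prodsE intro: mult_closed)

lemma unital: "unital_bimodule IR S MB" "unital_bimodule S IR NB"
proof -
  have MA: "B.prods M A = {m \<otimes> \<theta> s | m s. m \<in> M \<and> s \<in> carrier S}"
    and AN: "B.prods A N = {\<theta> s \<otimes> n | s n. s \<in> carrier S \<and> n \<in> N}"
    by (auto simp: B.prods_def A_def)
  have lM: "{lact MB r m | r m. r \<in> carrier IR \<and> m \<in> carrier MB} = B.enc ` B.prods I M"
    by (simp add: MB_def B.prods_def B.enc_collect)
  have rM: "{ract MB m s | m s. m \<in> carrier MB \<and> s \<in> carrier S} = B.enc ` B.prods M A"
    by (simp add: MB_def MA B.enc_collect(2)[where g = "\<lambda>m s. m \<otimes> \<theta> s"])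
  have lN: "{lact NB s n | s n. s \<in> carrier S \<and> n \<in> carrier NB} = B.enc ` B.prods A N"
    by (simp add: NB_def AN B.enc_collect(1)[where f = "\<lambda>s n. \<theta> s \<otimes> n"])
  have rN: "{ract NB n r | n r. n \<in> carrier NB \<and> r \<in> carrier IR} = B.enc ` B.prods N I"
    by (simp add: NB_def B.prods_def B.enc_collect)
  show "unital_bimodule IR S MB"
    unfolding unital_bimodule_def lM rM using bimodules(1)
    by (simp add: MB_def B.generate_enc[OF subgroups(2) prods_subset(2)]
      B.generate_enc[OF subgroups(2) prods_subset(3)] generated)
  show "unital_bimodule S IR NB"
    unfolding unital_bimodule_def lN rN using bimodules(2)
    by (simp add: NB_def B.generate_enc[OF subgroups(3) prods_subset(4)]
      B.generate_enc[OF subgroups(3) prods_subset(5)] generated)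
qed

lemma idempotent_IR: "idempotent_ring IR"
  using nu_ring_IR generate_IR[OF prods_subset(1)] generated(1)
  by (simp add: idempotent_ring_def B.prods_def)

theorem morita_equivalent_corner: "morita_equivalent IR S"
proof -
  \<comment> \<open>The product of \<open>N\<close> and \<open>M\<close> lands in \<open>A\<close>,
    while the context needs values in \<open>S\<close>.\<close>
  define pull where "pull = inv_into (carrier S) \<theta>"
  have pull: "pull a \<in> carrier S" "\<theta> (pull a) = a" if "a \<in> A" for a
    using that unfolding pull_def A_def by (simp_all add: inv_into_into f_inv_into_f)
  have pull_\<theta>: "pull (\<theta> s) = s" if "s \<in> carrier S" for s
    using that \<theta>_inj by (simp add: pull_def)
  have pull_eq: "pull a = s" if "s \<in> carrier S" "a = \<theta> s" for a s
    using that pull_\<theta> by simp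
  have A_add: "a \<oplus> b \<in> A" if "a \<in> A" "b \<in> A" for a b
    using subgroup.m_closed[OF A_subgroup that] by simp
  have pull_add: "pull (a \<oplus> b) = pull a \<oplus>\<^bsub>S\<^esub> pull b" if "a \<in> A" "b \<in> A" for a b
    using that by (intro pull_eq) (simp_all add: pull \<theta>_add)
  have pull_l: "pull (\<theta> s \<otimes> a) = s \<otimes>\<^bsub>S\<^esub> pull a" if "s \<in> carrier S" "a \<in> A" for s a
    using that by (intro pull_eq) (simp_all add: pull \<theta>_mult S.m_closed)
  have pull_r: "pull (a \<otimes> \<theta> s) = pull a \<otimes>\<^bsub>S\<^esub> s" if "s \<in> carrier S" "a \<in> A" for s a
    using that by (intro pull_eq) (simp_all add: pull \<theta>_mult S.m_closed)
  let ?d = "B.dec :: ('r + 's) list \<Rightarrow> 'r"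
  have memM: "?d m \<in> M" if "m \<in> carrier MB" for m using that by (auto simp: MB_def)
  have memN: "?d n \<in> N" if "n \<in> carrier NB" for n using that by (auto simp: NB_def)
  have M_ops: "?d (m \<otimes>\<^bsub>MB\<^esub> m') = ?d m \<oplus> ?d m'" "?d (lact MB x m) = x \<otimes> ?d m"
    "?d (ract MB m s) = ?d m \<otimes> \<theta> s" for m m' x s
    by (simp_all add: MB_def)
  have N_ops: "?d (n \<otimes>\<^bsub>NB\<^esub> n') = ?d n \<oplus> ?d n'" "?d (lact NB s n) = \<theta> s \<otimes> ?d n"
    "?d (ract NB n x) = ?d n \<otimes> x" for n n' x s
    by (simp_all add: NB_def)
  note ops = memM memN M_ops N_ops mult_closed \<theta>_A in_B \<theta>_closed B.l_distr B.r_distr B.m_assoc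
  have pull_lN: "pull (\<theta> s \<otimes> n \<otimes> m) = s \<otimes>\<^bsub>S\<^esub> pull (n \<otimes> m)"
    if "s \<in> carrier S" "n \<in> N" "m \<in> M" for s n m
    using that pull_l[OF that(1) mult_closed(7)[OF that(2,3)]] by (simp add: B.m_assoc in_B \<theta>_closed)
  have dM: "?d ` carrier MB = M" and dN: "?d ` carrier NB = N"
    by (simp_all add: MB_def NB_def image_image)
  have prodsMN: "{?d m \<otimes> ?d n | m n. m \<in> carrier MB \<and> n \<in> carrier NB} = B.prods M N"
    unfolding B.prods_def dM[symmetric] dN[symmetric] by blast
  have prodsNM: "{pull (?d n \<otimes> ?d m) | n m. n \<in> carrier NB \<and> m \<in> carrier MB} = pull ` B.prods N M"
    unfolding B.prods_def dM[symmetric] dN[symmetric] by blast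
  have regI: "generate (regular_bimodule IR) X = generate (add_monoid IR) X" for X
    by (rule generate_cong) (simp_all add: regular_bimodule_def)
  have regS: "generate (regular_bimodule S) X = generate (add_monoid S) X" for X
    by (rule generate_cong) (simp_all add: regular_bimodule_def)
  have genI: "generate (regular_bimodule IR) {?d m \<otimes> ?d n | m n. m \<in> carrier MB \<and> n \<in> carrier NB}
      = carrier (regular_bimodule IR)"
    unfolding prodsMN regI generate_IR[OF prods_subset(6)] generated(6)
    by (simp add: regular_bimodule_def)
  have genS: "generate (regular_bimodule S) {pull (?d n \<otimes> ?d m) | n m. n \<in> carrier NB \<and> m \<in> carrier MB}
      = carrier (regular_bimodule S)"
  proof -
    let ?X = "pull ` B.prods N M"
    have X: "?X \<subseteq> carrier S"
      using prods_subset(7) pull(1) by blast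
    have "\<theta> ` ?X = B.prods N M"
      using prods_subset(7) pull(2) by (force simp: image_image)
    then have "\<theta> ` generate (add_monoid S) ?X = A"
      using group_hom.generate_img[OF A_hom, of ?X] X generated(7) by simp
    moreover have "generate (add_monoid S) ?X \<subseteq> carrier S"
      using S.span_carrier[OF X] .
    ultimately have "generate (add_monoid S) ?X = carrier S"
      using \<theta>_inj unfolding A_def by (metis inj_on_image_eq_iff order_refl)
    then show ?thesis
      unfolding prodsNM regS by (simp add: regular_bimodule_def)
  qed
  obtain \<psi> where \<psi>: "\<psi> \<in> bimodule_hom IR IR (tensor_bimodule S MB NB) (regular_bimodule IR)"
    "\<psi> ` carrier (tensor_bimodule S MB NB) = carrier (regular_bimodule IR)"
    "\<And>m n. m \<in> carrier MB \<Longrightarrow> n \<in> carrier NB \<Longrightarrow> \<psi> (pure_tensor S MB NB m n) = ?d m \<otimes> ?d n"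
    by (rule tensor_lift[OF bimodules(1,2) bimodule_regular[OF nu_ring_IR] _ _ _ _ _ _ genI])
      (simp_all add: ops regular_bimodule_def)
  obtain \<phi> where \<phi>: "\<phi> \<in> bimodule_hom S S (tensor_bimodule IR NB MB) (regular_bimodule S)"
    "\<phi> ` carrier (tensor_bimodule IR NB MB) = carrier (regular_bimodule S)"
    "\<And>n m. n \<in> carrier NB \<Longrightarrow> m \<in> carrier MB \<Longrightarrow> \<phi> (pure_tensor IR NB MB n m) = pull (?d n \<otimes> ?d m)"
    by (rule tensor_lift[OF bimodules(2,1) bimodule_regular[OF S.nu_ring_axioms] _ _ _ _ _ _ genS])
      (simp_all add: ops regular_bimodule_def pull pull_add pull_lN pull_r flip: B.m_assoc)
  have "surjective_morita_context IR S MB NB \<psi> \<phi>"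
    unfolding surjective_morita_context_def
  proof (intro conjI ballI unital \<psi>(1) \<phi>(1))
    show "\<psi> ` carrier (tensor_bimodule S MB NB) = carrier IR"
      "\<phi> ` carrier (tensor_bimodule IR NB MB) = carrier S"
      using \<psi>(2) \<phi>(2) by (simp_all add: regular_bimodule_def)
    \<comment> \<open>Up to \<open>pull\<close>, both pairings are multiplication in
      \<open>B\<close>, so the compatibility conditions are instances of associativity.\<close>
    fix m n assume m: "m \<in> carrier MB" and n: "n \<in> carrier NB"
    show "lact NB (\<phi> (pure_tensor IR NB MB n m)) n' = ract NB n (\<psi> (pure_tensor S MB NB m n'))"
      if n': "n' \<in> carrier NB" for n'
    proof -
      have "\<theta> (pull (?d n \<otimes> ?d m)) \<otimes> ?d n' = ?d n \<otimes> (?d m \<otimes> ?d n')"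
        using m n n' by (simp add: ops pull)
      then show ?thesis
        unfolding \<phi>(3)[OF n m] \<psi>(3)[OF m n'] by (simp add: NB_def)
    qed
    show "ract MB m' (\<phi> (pure_tensor IR NB MB n m)) = lact MB (\<psi> (pure_tensor S MB NB m' n)) m"
      if m': "m' \<in> carrier MB" for m'
    proof -
      have "?d m' \<otimes> \<theta> (pull (?d n \<otimes> ?d m)) = ?d m' \<otimes> ?d n \<otimes> ?d m"
        using m n m' by (simp add: ops pull)
      then show ?thesis
        unfolding \<phi>(3)[OF n m] \<psi>(3)[OF m' n] by (simp add: MB_def)
    qed
  qed
  then show ?thesis
    unfolding morita_equivalent_def using idempotent_IR S_idem by blast
qed

lemma I_ideal: "nu_ideal I B"
proof (intro nu_ideal.intro additive_subgroup.intro subgroups(1) nu_ideal_axioms.intro B.nu_ring_axioms)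
  let ?X = "B.prods c (B.prods A c)"
  have X: "?X \<subseteq> c" by (intro closed)
  fix a x assume a: "a \<in> I" and x: "x \<in> c"
  have a': "a \<in> B.span ?X" using a by (simp add: I_def)
  have x': "x \<in> B.span c" using B.span_incl x by blast
  show "x \<otimes> a \<in> I"
    unfolding I_def
  proof (rule B.span_mult[OF x' a' order_refl X X])
    fix x y assume "x \<in> c" "y \<in> ?X"
    then have "x \<otimes> y \<in> B.prods c ?X" by (intro B.prodsI)
    also have "\<dots> = B.prods (B.prods c c) (B.prods A c)" by (simp add: B.prods_assoc closed)
    also have "\<dots> \<subseteq> ?X" by (intro B.prods_mono closed)
    finally show "x \<otimes> y \<in> B.span ?X" using B.span_incl by blast
  qed
  show "a \<otimes> x \<in> I"
    unfolding I_def
  proof (rule B.span_mult[OF a' x' X order_refl X])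
    fix y x assume "y \<in> ?X" "x \<in> c"
    then have "y \<otimes> x \<in> B.prods ?X c" by (intro B.prodsI)
    also have "\<dots> = B.prods c (B.prods A (B.prods c c))" by (simp add: B.prods_assoc closed)
    also have "\<dots> \<subseteq> ?X" by (intro B.prods_mono closed)
    finally show "y \<otimes> x \<in> B.span ?X" using B.span_incl by blast
  qed
qed

text \<open>Without a unit in \<open>B\<close> this rests on the idempotence of \<open>A\<close>.
  With \<open>I_ideal\<close> and \<open>I_least\<close> it identifies \<open>I\<close> as the ideal
  generated by \<open>A\<close>.\<close>

lemma A_subset_I: "A \<subseteq> I"
proof -
  have "A4 = B.prods A (B.prods A A2)"
    by (simp add: B.prods_assoc closed)
  also have "\<dots> \<subseteq> B.prods c (B.prods A c)"
    by (intro B.prods_mono A_carr A2_carr order_refl)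
  finally show ?thesis
    using B.span_mono span_A4 by (simp add: I_def) blast
qed

lemma I_least:
  assumes "nu_ideal J B" "A \<subseteq> J"
  shows "I \<subseteq> J"
proof -
  interpret J: nu_ideal J B by fact
  have "B.prods c (B.prods A c) \<subseteq> J"
  proof
    fix z assume "z \<in> B.prods c (B.prods A c)"
    then obtain x a y where "z = x \<otimes> (a \<otimes> y)" "x \<in> c" "a \<in> A" "y \<in> c"
      by (metis B.prodsE)
    then show "z \<in> J"
      using J.I_l_closed[OF J.I_r_closed] assms(2) by auto
  qed
  then show ?thesis
    unfolding I_def using B.span_mono B.span_of_subgroup[OF J.a_subgroup] by blast
qed

end

section \<open>The ideal of a pair and the algebra of its graph\<close>

section \<open>The algebra of the graph of a pair as a corner\<close>

context graph_algebra
begin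

lemma idempotent_A: "idempotent_ring A"
  unfolding idempotent_ring_def
proof (intro conjI A.nu_ring_axioms equalityI subsetI)
  let ?X = "{x \<otimes>\<^bsub>A\<^esub> y | x y. x \<in> carrier A \<and> y \<in> carrier A}"
  show "x \<in> carrier A" if "x \<in> generate (add_monoid A) ?X" for x
    using A.span_closed[OF _ that] A.m_closed by auto
  fix x assume "x \<in> carrier A"
  then obtain f where f: "f \<in> C" "x = cos f" by (auto simp: carrier_A)
  then obtain u where u: "u \<in> C" "u * f - f \<in> N" using local_unit by blast
  then have "x = cos u \<otimes>\<^bsub>A\<^esub> cos f"
    using f cos_eq_iff[of "u * f" f] by (simp add: cos_mult free_alg_mult)
  then show "x \<in> generate (add_monoid A) ?X"
    using cos_closed u f by (intro generate.incl) auto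
qed

end

definition pair_rep :: "('v, 'e) pre_digraph \<Rightarrow> 'v set \<Rightarrow> 'v set \<Rightarrow> ('v, 'e) lpa_gen
    \<Rightarrow> ('v, 'e) lpa_gen word \<Rightarrow>\<^sub>0 'k::field" where
  "pair_rep E H S g = (if g \<in> lpa_generators (pair_graph E H S) then
     (case g of Vertex v \<Rightarrow> if v \<in> S then gap_rep E H v else gen (Vertex v) | _ \<Rightarrow> gen g) else 0)"

text \<open>\<open>H\<close> is only hereditary, so that the pair of an arbitrary hereditary
  \<open>X\<close> with the empty set is covered as well.\<close>

locale pair_subalgebra = graph_algebra E K for E :: "('v, 'e) pre_digraph" and K :: "'k::field itself" +
  fixes H S :: "'v set"
  assumes hereditary: "hereditary E H" and S_sub: "S \<subseteq> breaking_vertices E H"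
    and countable_arcs: "countable (arcs E)"
begin

abbreviation "P \<equiv> pair_graph E H S"
abbreviation \<rho> :: "('v, 'e) lpa_gen \<Rightarrow> ('v, 'e) lpa_gen word \<Rightarrow>\<^sub>0 'k" where "\<rho> \<equiv> pair_rep E H S"
abbreviation J :: "(('v, 'e) lpa_gen word \<Rightarrow>\<^sub>0 'k) set" where "J \<equiv> pair_ideal E H S"
abbreviation NP :: "(('v, 'e) lpa_gen word \<Rightarrow>\<^sub>0 'k) set" where "NP \<equiv> lpa_kernel P"
abbreviation CP :: "(('v, 'e) lpa_gen word \<Rightarrow>\<^sub>0 'k) set" where "CP \<equiv> carr P"

lemma wf_P: "wf_digraph P"
  by (rule wf_pair_graph[OF hereditary])

lemma verts_sub: "H \<subseteq> verts E" "S \<subseteq> verts E"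
  using hereditary breaking_subset_verts[OF S_sub] by (simp_all add: hereditary_def)

sublocale P: graph_algebra P K
  by (simp add: graph_algebra_def wf_P)

sublocale lf: leavitt_family E "\<lambda>k. cls N (cst k)" "\<lambda>v. cls N (gen (Vertex v))"
    "\<lambda>e. cls N (gen (Edge e))" "\<lambda>e. cls N (gen (Ghost e))"
  using family_of_gen[OF wf_digraph_axioms two_sided_kernel order_refl] by (simp add: family_of_def)

lemma cls_gap: "cls N (gap_rep E H v) = cls N (gen (Vertex v)) - lf.av H v"
  by (simp add: gap_rep_def avoiding_rep_def cls_diff cls_sum cls_mult lf.av_def)

lemma cls_\<rho>:
  "v \<in> verts P \<Longrightarrow> cls N (\<rho> (Vertex v)) = lf.pV H S v"
  "e \<in> arcs P \<Longrightarrow> \<rho> (Edge e) = gen (Edge e)" "e \<in> arcs P \<Longrightarrow> \<rho> (Ghost e) = gen (Ghost e)"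
  by (simp_all add: pair_rep_def lf.pV_def cls_gap)

lemma family_\<rho>: "family_of P \<rho> N"
  by (rule family_of_restrict[OF lf.pair_family[OF hereditary S_sub]]) (simp_all only: cls_\<rho>)

lemma \<rho>_bad: "g \<notin> lpa_generators P \<Longrightarrow> \<rho> g = 0"
  by (simp add: pair_rep_def)

lemma \<rho>_C: "g \<in> lpa_generators P \<Longrightarrow> \<rho> g \<in> C"
  using verts_sub by (cases g) (auto simp: pair_rep_def gap_rep_C gen_C)

lemma ev_\<rho>_C: "f \<in> CP \<Longrightarrow> ev \<rho> f \<in> C"
  by (rule free_alg_ev[OF \<rho>_C])

lemma has_deg_\<rho>: "has_deg (gdeg g) (\<rho> g)"
proof -
  have "has_deg (gdeg g) (gen g :: ('v, 'e) lpa_gen word \<Rightarrow>\<^sub>0 'k)"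
    by (rule has_deg_gen)
  then show ?thesis
    by (cases g) (simp_all add: pair_rep_def has_deg_0_gap)
qed

lemma \<rho>_augmentation: "\<rho> g \<in> augmentation_ideal"
proof -
  have "(0 :: ('v, 'e) lpa_gen word \<Rightarrow>\<^sub>0 'k) \<in> augmentation_ideal"
    by (rule two_sided_zero[OF two_sided_augmentation])
  then show ?thesis
    by (cases g) (simp_all add: pair_rep_def augmentation_gap gen_in_augmentation)
qed

text \<open>For \<open>v\<close> in \<open>S\<close> some edge e leads from \<open>v\<close> into
  \<open>H\<close>, because only finitely many of its infinitely many edges avoid \<open>H\<close>.
  Then v^H e = e, and e^* e is a nonzero vertex.\<close>

lemma \<rho>_vertex_nonzero:
  assumes v: "v \<in> verts P"
  shows "\<rho> (Vertex v) \<notin> N"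
proof
  assume "\<rho> (Vertex v) \<in> N"
  then have "cls N (\<rho> (Vertex v)) = 0"
    by (simp add: cls_eq_0_iff[OF two_sided_kernel])
  then have zero: "lf.pV H S v = 0"
    using cls_\<rho>(1)[OF v] by simp
  have V: "cls N (gen (Vertex w)) \<noteq> 0" if "w \<in> verts E" for w
    using vertex_notin_kernel[OF wf_digraph_axioms countable_arcs that]
    by (simp add: cls_eq_0_iff[OF two_sided_kernel])
  show False
  proof (cases "v \<in> S")
    case False
    then show False
      using zero V[of v] v verts_sub by (auto simp: lf.pV_def)
  next
    case True
    then have br: "v \<in> breaking_vertices E H" using S_sub by auto
    have "out_arcs E v - out_arcs_avoiding E H v \<noteq> {}"
    proof
      assume "out_arcs E v - out_arcs_avoiding E H v = {}"
      then have "finite (out_arcs E v)"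
        by (intro finite_subset[OF _ breaking_verticesD(5)[OF br]]) simp
      then show False
        using breaking_verticesD(3)[OF br] by simp
    qed
    then obtain e where "e \<in> out_arcs E v" "e \<notin> out_arcs_avoiding E H v"
      by (metis Diff_iff ex_in_conv)
    then have e: "e \<in> arcs E" "tail E e = v" "head E e \<in> H"
      by (simp_all add: out_arcs_avoiding_def)
    have "lf.pV H S v * cls N (gen (Edge e)) = cls N (gen (Edge e))"
      using lf.pV_A[OF hereditary S_sub e(1), of v] e True by simp
    then have "cls N (gen (Vertex (head E e))) = 0"
      using zero lf.G_A[OF e(1) e(1)] by simp
    then show False
      using V[of "head E e"] e(1) by simp
  qed
qed

text \<open>The elements sent into \<open>N\<close> form a homogeneous ideal without vertices, so
  \<open>graded_ideal_contains_vertex\<close> leaves only the kernel. This makes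
  \<open>\<theta>\<close> in \<open>morita_pair\<close> injective.\<close>

lemma ev_\<rho>_mem_iff: "ev \<rho> f \<in> N \<longleftrightarrow> f \<in> NP"
proof
  show "f \<in> NP \<Longrightarrow> ev \<rho> f \<in> N"
    by (rule ev_kernel[OF two_sided_kernel family_\<rho>]) (simp_all add: \<rho>_bad two_sided_zero[OF two_sided_kernel])
  let ?M = "{f. ev \<rho> f \<in> N}"
  assume f: "ev \<rho> f \<in> N"
  show "f \<in> NP"
  proof (rule ccontr)
    assume nf: "f \<notin> NP"
    have "\<exists>v\<in>verts P. gen (Vertex v) \<in> ?M"
    proof (rule graded_ideal_contains_vertex[OF wf_P])
      show "two_sided ?M" by (rule two_sided_vimage_ev[OF two_sided_kernel])
      show "NP \<subseteq> ?M"
        by (intro subsetI CollectI ev_kernel[OF two_sided_kernel family_\<rho>])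
          (simp_all add: \<rho>_bad two_sided_zero[OF two_sided_kernel])
      show "?M \<subseteq> augmentation_ideal"
        using kernel_augmentation[of E] lookup_ev_0[of \<rho>, OF \<rho>_augmentation]
        by (auto simp: augmentation_ideal_def)
      show "homogeneous ?M"
      proof -
        have "homogeneous N" by (rule homogeneous_kernel)
        then show ?thesis
          by (simp add: homogeneous_def hpart_ev[of \<rho>, OF has_deg_\<rho>, symmetric])
      qed
    qed (use f nf in auto)
    then obtain v where "v \<in> verts P" "\<rho> (Vertex v) \<in> N" by auto
    then show False
      using \<rho>_vertex_nonzero[of v] by simp
  qed
qed

text \<open>Every edge of the restricted graph starts or ends in \<open>H\<close>, so a vertex of
  \<open>H\<close> can be split off.\<close>

lemma \<rho>_in_J: "\<rho> g \<in> J"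
proof (cases "g \<in> lpa_generators P")
  case True
  have V: "gen (Vertex v) \<in> J" if "v \<in> H" for v
    using that by (rule pair_ideal_mem(2))
  have rel: "z \<in> J" if "cls N x * cls N y = cls N z" "x \<in> J \<or> y \<in> J"
    for x y z :: "('v, 'e) lpa_gen word \<Rightarrow>\<^sub>0 'k"
  proof -
    have "x * y - z \<in> N"
      using that(1) by (simp add: cls_mult[symmetric] cls_eq_iff[OF two_sided_kernel])
    then have "x * y - z \<in> J"
      by (rule subsetD[OF kernel_pair_ideal])
    moreover have "x * y \<in> J"
      using that(2) by (elim disjE)
        (simp_all add: two_sided_mult_left[OF two_sided_pair_ideal] two_sided_mult_right[OF two_sided_pair_ideal])
    ultimately show ?thesis
      using two_sided_mem_cong[OF two_sided_pair_ideal, of "x * y" z] by simp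
  qed
  show ?thesis
  proof (cases g)
    case (Vertex v)
    then show ?thesis using True V pair_ideal_mem(3) by (auto simp: pair_rep_def)
  next
    case (Edge e)
    then have e: "e \<in> arcs E" "tail E e \<in> H \<or> head E e \<in> H" using True by auto
    have "gen (Edge e) \<in> J"
      using e(2)
    proof
      assume "tail E e \<in> H"
      then show ?thesis by (intro rel[OF lf.V_A[OF e(1)]] disjI1 V)
    next
      assume "head E e \<in> H"
      then show ?thesis by (intro rel[OF lf.A_V[OF e(1)]] disjI2 V)
    qed
    then show ?thesis using True Edge by (simp add: cls_\<rho>)
  next
    case (Ghost e)
    then have e: "e \<in> arcs E" "tail E e \<in> H \<or> head E e \<in> H" using True by auto
    have "gen (Ghost e) \<in> J"
      using e(2)
    proof
      assume "tail E e \<in> H"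
      then show ?thesis by (intro rel[OF lf.G_V[OF e(1)]] disjI2 V)
    next
      assume "head E e \<in> H"
      then show ?thesis by (intro rel[OF lf.V_G[OF e(1)]] disjI1 V)
    qed
    then show ?thesis using True Ghost by (simp add: cls_\<rho>)
  qed
qed (simp add: \<rho>_bad two_sided_zero[OF two_sided_pair_ideal])

lemma ev_\<rho>_J:
  assumes "f \<in> CP"
  shows "ev \<rho> f \<in> J"
proof (induction f rule: free_induct_on)
  case (single ws k)
  then have "ws \<noteq> []"
    using bspec[OF assms[unfolded free_alg_carrier] single] by simp
  then obtain g us where "ws = g # us" by (cases ws) auto
  then show ?case
    by (simp add: ev_single two_sided_mult_left[OF two_sided_pair_ideal]
        two_sided_mult_right[OF two_sided_pair_ideal] \<rho>_in_J)
qed (simp_all add: ev_add two_sided_zero[OF two_sided_pair_ideal] two_sided_add[OF two_sided_pair_ideal])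

text \<open>\<open>g\<close> reduces to products \<alpha>\<beta>^*. Multiplying by the images of
  \<open>v\<close> and \<open>w\<close> gives 0 unless \<alpha> and \<beta> are paths of the
  restricted graph that start at \<open>v\<close> and \<open>w\<close>.\<close>

lemma corner_vertices:
  assumes v: "v \<in> verts P" and w: "w \<in> verts P" and g: "g \<in> C"
  shows "\<exists>q\<in>CP. cls N (\<rho> (Vertex v) * g * \<rho> (Vertex w)) = cls N (ev \<rho> q)"
proof (induction g rule: free_induct_on)
  case zero
  then show ?case by (auto intro!: bexI[of _ 0] free_alg_zero)
next
  case (single ws k)
  then have ws: "ws \<noteq> []"
    using bspec[OF g[unfolded free_alg_carrier] single] by simp
  have vw: "v \<in> H \<union> S" "w \<in> H \<union> S" using v w by simp_all
  let ?x = "cls N (Poly_Mapping.single (Word ws) k)"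
  have comm: "cls N (cst k) * y = y * cls N (cst k)" if "y = cls N z" for y z
    unfolding that cls_mult[symmetric] by (simp add: cst_commute)
  have "?x \<in> insert 0 ((*) (cls N (cst k)) ` lf.monomials (wdeg (Word ws)))"
    using word_in_monomials[OF family_of_gen[OF wf_digraph_axioms two_sided_kernel order_refl]
      two_sided_kernel order_refl ws] .
  then have "?x = 0 \<or> (\<exists>m\<in>lf.monomials (wdeg (Word ws)). ?x = cls N (cst k) * m)"
    by (simp only: insert_iff image_iff)
  then show ?case
  proof (elim disjE bexE)
    assume zero: "?x = 0"
    have "cls N (\<rho> (Vertex v) * Poly_Mapping.single (Word ws) k * \<rho> (Vertex w)) = cls N (ev \<rho> 0)"
      by (simp only: cls_mult zero mult_zero_right mult_zero_left ev_zero cls_zero)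
    then show ?thesis by (rule bexI[OF _ free_alg_zero])
  next
    fix m assume m: "m \<in> lf.monomials (wdeg (Word ws))" "?x = cls N (cst k) * m"
    obtain u p z u' p' where mono: "awalk u p z" "awalk u' p' z" "m = lf.Pa u p * lf.Pg u' p'"
      using m(1) unfolding lf.monomials_def by (elim CollectE exE conjE) (rule that)
    have "cls N (\<rho> (Vertex v) * Poly_Mapping.single (Word ws) k * \<rho> (Vertex w))
        = (lf.pV H S v * cls N (cst k)) * (lf.Pa u p * lf.Pg u' p') * lf.pV H S w"
      by (simp only: cls_mult m(2) mono(3) cls_\<rho>(1)[OF v] cls_\<rho>(1)[OF w] mult.assoc)
    also have "lf.pV H S v * cls N (cst k) = cls N (cst k) * lf.pV H S v"
      by (rule comm[OF cls_\<rho>(1)[OF v, symmetric], symmetric])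
    also have "cls N (cst k) * lf.pV H S v * (lf.Pa u p * lf.Pg u' p') * lf.pV H S w
        = cls N (cst k) * ((lf.pV H S v * lf.Pa u p) * (lf.Pg u' p' * lf.pV H S w))"
      by (simp only: mult.assoc)
    finally have x: "cls N (\<rho> (Vertex v) * Poly_Mapping.single (Word ws) k * \<rho> (Vertex w))
        = cls N (cst k) * ((lf.pV H S v * lf.Pa u p) * (lf.Pg u' p' * lf.pV H S w))" .
    note left = lf.pV_Pa[OF hereditary S_sub mono(1) vw(1)]
      and right = lf.Pg_pV[OF hereditary S_sub mono(2) vw(2)]
    show ?thesis
    proof (cases "u = v \<and> P.awalk v p z \<and> u' = w \<and> P.awalk w p' z")
      case False
      then have "lf.pV H S v * lf.Pa u p = 0 \<or> lf.Pg u' p' * lf.pV H S w = 0"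
        unfolding left right by presburger
      then have "cls N (\<rho> (Vertex v) * Poly_Mapping.single (Word ws) k * \<rho> (Vertex w)) = cls N (ev \<rho> 0)"
        unfolding x by (elim disjE) (simp_all only: mult_zero_right mult_zero_left ev_zero cls_zero)
      then show ?thesis by (rule bexI[OF _ free_alg_zero])
    next
      case True
      \<comment> \<open>With the end vertices included the word is nonempty even for trivial paths,
        and each letter is sent to the matching factor.\<close>
      let ?ws = "Vertex v # map Edge p @ map Ghost (rev p') @ [Vertex w]"
      have arcs: "set p \<subseteq> arcs P" "set p' \<subseteq> arcs P"
        using True by (auto simp: P.awalk_def)
      have "Poly_Mapping.single (Word ?ws) k \<in> CP"
        using arcs v w unfolding free_alg_carrier by (auto simp: image_subset_iff subset_iff)
      moreover have "map (\<lambda>g. cls N (\<rho> g)) (map Edge p) = map (\<lambda>e. cls N (gen (Edge e))) p"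
        "map (\<lambda>g. cls N (\<rho> g)) (map Ghost (rev p')) = map (\<lambda>e. cls N (gen (Ghost e))) (rev p')"
        using arcs by (auto simp: cls_\<rho> subset_iff)
      then have "cls N (ev \<rho> (Poly_Mapping.single (Word ?ws) k)) = cls N (cst k) * (lf.pV H S v
          * prod_list (map (\<lambda>e. cls N (gen (Edge e))) p)
          * (prod_list (map (\<lambda>e. cls N (gen (Ghost e))) (rev p')) * lf.pV H S w))"
        unfolding cls_ev_single list.map(2) map_append prod_list.append prod_list.Cons
        by (simp add: cls_\<rho>(1)[OF v] cls_\<rho>(1)[OF w] mult.assoc del: map_map)
      then have "cls N (\<rho> (Vertex v) * Poly_Mapping.single (Word ws) k * \<rho> (Vertex w))
          = cls N (ev \<rho> (Poly_Mapping.single (Word ?ws) k))"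
        unfolding x left right using True by simp
      ultimately show ?thesis by (intro bexI)
    qed
  qed
next
  case (add f g)
  then obtain q q' where "q \<in> CP" "q' \<in> CP" "cls N (\<rho> (Vertex v) * f * \<rho> (Vertex w)) = cls N (ev \<rho> q)"
    "cls N (\<rho> (Vertex v) * g * \<rho> (Vertex w)) = cls N (ev \<rho> q')" by blast
  then show ?case
    by (intro bexI[of _ "q + q'"]) (simp_all add: distrib_left distrib_right cls_add ev_add free_alg_add)
qed

text \<open>Local units of the algebra of \<open>P\<close> insert vertices on both sides of
  \<open>g\<close>, which reduces the claim to \<open>corner_vertices\<close>.\<close>

lemma corner:
  assumes p: "p \<in> CP" and g: "g \<in> C" and p': "p' \<in> CP"
  obtains q where "q \<in> CP" "ev \<rho> p * g * ev \<rho> p' - ev \<rho> q \<in> N"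
proof -
  obtain U where U: "U \<subseteq> verts P" "p * (\<Sum>v\<in>U. gen (Vertex v)) - p \<in> NP"
    by (rule P.local_units[OF p])
  obtain W where W: "W \<subseteq> verts P" "(\<Sum>w\<in>W. gen (Vertex w)) * p' - p' \<in> NP"
    by (rule P.local_units[OF p'])
  have left: "cls N (ev \<rho> p) * (\<Sum>v\<in>U. cls N (\<rho> (Vertex v))) = cls N (ev \<rho> p)"
    using iffD2[OF ev_\<rho>_mem_iff U(2)]
    by (simp add: ev_simps cls_eq_iff[OF two_sided_kernel, symmetric] cls_mult cls_sum)
  have right: "(\<Sum>w\<in>W. cls N (\<rho> (Vertex w))) * cls N (ev \<rho> p') = cls N (ev \<rho> p')"
    using iffD2[OF ev_\<rho>_mem_iff W(2)]
    by (simp add: ev_simps cls_eq_iff[OF two_sided_kernel, symmetric] cls_mult cls_sum)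
  have "\<forall>v w. \<exists>q. v \<in> verts P \<longrightarrow> w \<in> verts P \<longrightarrow>
      q \<in> CP \<and> cls N (\<rho> (Vertex v) * g * \<rho> (Vertex w)) = cls N (ev \<rho> q)"
    using corner_vertices[OF _ _ g] by blast
  then obtain q where q: "\<And>v w. v \<in> verts P \<Longrightarrow> w \<in> verts P \<Longrightarrow>
      q v w \<in> CP \<and> cls N (\<rho> (Vertex v) * g * \<rho> (Vertex w)) = cls N (ev \<rho> (q v w))"
    by metis
  let ?q = "p * (\<Sum>v\<in>U. \<Sum>w\<in>W. q v w) * p'"
  have "cls N (ev \<rho> p * g * ev \<rho> p') = (cls N (ev \<rho> p) * (\<Sum>v\<in>U. cls N (\<rho> (Vertex v))))
      * cls N g * ((\<Sum>w\<in>W. cls N (\<rho> (Vertex w))) * cls N (ev \<rho> p'))"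
    unfolding left right cls_mult ..
  also have "\<dots> = cls N (ev \<rho> p) * ((\<Sum>v\<in>U. cls N (\<rho> (Vertex v))) * cls N g
      * (\<Sum>w\<in>W. cls N (\<rho> (Vertex w)))) * cls N (ev \<rho> p')"
    by (simp add: mult.assoc)
  also have "(\<Sum>v\<in>U. cls N (\<rho> (Vertex v))) * cls N g * (\<Sum>w\<in>W. cls N (\<rho> (Vertex w)))
      = (\<Sum>v\<in>U. \<Sum>w\<in>W. cls N (\<rho> (Vertex v) * g * \<rho> (Vertex w)))"
    unfolding sum_distrib_right[of _ _ "cls N g"] sum_product cls_mult ..
  also have "\<dots> = (\<Sum>v\<in>U. \<Sum>w\<in>W. cls N (ev \<rho> (q v w)))"
    using U(1) W(1) q by (intro sum.cong) auto
  finally have "cls N (ev \<rho> p * g * ev \<rho> p') = cls N (ev \<rho> ?q)"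
    by (simp add: ev_simps cls_mult cls_sum)
  moreover have "?q \<in> CP"
    using U(1) W(1) q p p' by (intro free_alg_mult free_alg_sum) auto
  ultimately show thesis
    using that by (simp add: cls_eq_iff[OF two_sided_kernel])
qed

theorem morita_pair: "morita_equivalent (A\<lparr>carrier := ideal_image J\<rparr>) (LPA K P)"
proof -
  define \<theta> where "\<theta> X = cos (ev \<rho> (SOME f. f \<in> CP \<and> X = P.cos f))" for X
  have \<theta>: "\<theta> (P.cos f) = cos (ev \<rho> f)" if f: "f \<in> CP" for f
  proof -
    define g where "g = (SOME g. g \<in> CP \<and> P.cos f = P.cos g)"
    have g: "g \<in> CP \<and> P.cos f = P.cos g"
      unfolding g_def by (rule someI[of _ f]) (simp add: f)
    then have "g - f \<in> NP"
      using P.cos_eq_iff[of g f] f by simp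
    then have "ev \<rho> g - ev \<rho> f \<in> N"
      using ev_\<rho>_mem_iff[of "g - f"] by (simp add: ev_diff)
    then show ?thesis
      unfolding \<theta>_def g_def[symmetric] using g f by (simp add: cos_eq_iff ev_\<rho>_C)
  qed
  have image: "\<theta> ` carrier P.A = (\<lambda>f. cos (ev \<rho> f)) ` CP"
    unfolding P.carrier_A image_image by (rule image_cong[OF refl]) (rule \<theta>)
  interpret c: corner A P.A \<theta>
  proof (intro corner.intro corner_axioms.intro A.nu_ring_axioms P.A.nu_ring_axioms P.idempotent_A)
    fix s assume "s \<in> carrier P.A"
    then obtain f where f: "f \<in> CP" "s = P.cos f" by (auto simp: P.carrier_A)
    then show "\<theta> s \<in> carrier A" by (simp add: \<theta> cos_closed ev_\<rho>_C)
    fix t assume "t \<in> carrier P.A"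
    then obtain g where g: "g \<in> CP" "t = P.cos g" by (auto simp: P.carrier_A)
    show "\<theta> (s \<oplus>\<^bsub>P.A\<^esub> t) = \<theta> s \<oplus>\<^bsub>A\<^esub> \<theta> t"
      using f g by (simp add: \<theta> P.cos_add cos_add ev_\<rho>_C ev_add free_alg_add)
    show "\<theta> (s \<otimes>\<^bsub>P.A\<^esub> t) = \<theta> s \<otimes>\<^bsub>A\<^esub> \<theta> t"
      using f g by (simp add: \<theta> P.cos_mult cos_mult ev_\<rho>_C ev_mult free_alg_mult)
  next
    show "inj_on \<theta> (carrier P.A)"
    proof (rule inj_onI)
      fix x y assume "x \<in> carrier P.A" "y \<in> carrier P.A" and eq: "\<theta> x = \<theta> y"
      then obtain f g where fg: "f \<in> CP" "x = P.cos f" "g \<in> CP" "y = P.cos g"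
        by (auto simp: P.carrier_A)
      then have "ev \<rho> (f - g) \<in> N"
        using eq by (simp add: \<theta> cos_eq_iff ev_\<rho>_C ev_diff)
      then show "x = y"
        using fg by (simp add: ev_\<rho>_mem_iff P.cos_eq_iff)
    qed
  next
    fix a b a' assume "a \<in> \<theta> ` carrier P.A" "b \<in> carrier A" "a' \<in> \<theta> ` carrier P.A"
    then obtain p g p' where x: "p \<in> CP" "g \<in> C" "p' \<in> CP" "a = cos (ev \<rho> p)" "b = cos g" "a' = cos (ev \<rho> p')"
      unfolding image by (auto simp: carrier_A)
    obtain q where q: "q \<in> CP" "ev \<rho> p * g * ev \<rho> p' - ev \<rho> q \<in> N"
      by (rule corner[OF x(1-3)])
    then have "a \<otimes>\<^bsub>A\<^esub> b \<otimes>\<^bsub>A\<^esub> a' = cos (ev \<rho> q)"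
      using x by (simp add: cos_mult ev_\<rho>_C free_alg_mult cos_eq_iff)
    then show "a \<otimes>\<^bsub>A\<^esub> b \<otimes>\<^bsub>A\<^esub> a' \<in> \<theta> ` carrier P.A"
      unfolding image using q(1) by blast
  qed
  \<comment> \<open>The image of the algebra of \<open>P\<close> lies in the ideal and contains the
    generators v and v^H, so it generates the whole ideal.\<close>
  have "c.I = ideal_image J"
  proof
    have "c.A \<subseteq> ideal_image J"
      unfolding c.A_def image using ev_\<rho>_C ev_\<rho>_J by (auto simp: ideal_image_def)
    then show "c.I \<subseteq> ideal_image J"
      by (rule c.I_least[OF ideal_image_ideal[OF two_sided_pair_ideal]])
    let ?Y = "(\<lambda>v. gen (Vertex v)) ` H \<union> gap_rep E H ` S"
    have Y: "?Y \<subseteq> C"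
      using verts_sub by (auto simp: gen_C gap_rep_C)
    have "\<rho> (Vertex v) = gen (Vertex v)" if "v \<in> H" for v
      using that S_sub by (auto simp: pair_rep_def breaking_vertices_def)
    moreover have "\<rho> (Vertex v) = gap_rep E H v" if "v \<in> S" for v
      using that by (simp add: pair_rep_def)
    ultimately have Y_eq: "?Y = (\<lambda>v. \<rho> (Vertex v)) ` verts P"
      by (simp add: image_Un)
    have "cos (\<rho> (Vertex v)) \<in> c.A" if "v \<in> verts P" for v
      unfolding c.A_def image
      by (rule image_eqI[of _ _ "gen (Vertex v)"]) (use that in \<open>simp_all add: free_alg_gen\<close>)
    then have "cos ` ?Y \<subseteq> c.A"
      unfolding Y_eq by blast
    then have "nu_genideal A (cos ` ?Y) \<subseteq> c.I"
      unfolding nu_genideal_def using c.I_ideal c.A_subset_I by blast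
    then show "ideal_image J \<subseteq> c.I"
      unfolding genideal_image[OF Y] pair_ideal_def by (simp add: Un_assoc)
  qed
  then show ?thesis
    using c.morita_equivalent_corner by (simp add: c.IR_def)
qed

end

text \<open>The ideal of \<open>X\<close> is homogeneous, hence the ideal of some pair (H,S). As
  \<open>H\<close> consists of the vertices in it, \<open>H\<close> contains \<open>X\<close>, and
  being hereditary and saturated it contains the saturation. This replaces a step-by-step
  construction of the saturation.\<close>

lemma pair_ideal_saturation:
  assumes wf: "wf_digraph E" and countable: "countable (arcs E)" and X: "hereditary E X"
  shows "(pair_ideal E X {} :: (('v, 'e) lpa_gen word \<Rightarrow>\<^sub>0 'k::field) set) = pair_ideal E (saturation E X) {}"
proof
  let ?I = "pair_ideal E X {} :: (('v, 'e) lpa_gen word \<Rightarrow>\<^sub>0 'k) set"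
  have "X \<subseteq> saturation E X"
    by (auto simp: saturation_def)
  then show "?I \<subseteq> pair_ideal E (saturation E X) {}"
    unfolding pair_ideal_def by (intro hull_mono) auto
  obtain H S where H: "hereditary E H" "saturated E H" "S \<subseteq> breaking_vertices E H" "?I = pair_ideal E H S"
    by (rule homogeneous_is_pair_ideal[OF wf countable two_sided_pair_ideal kernel_pair_ideal
      pair_ideal_augmentation homogeneous_pair_ideal])
  have adm: "admissible E H S"
    using H wf countable by (simp add: admissible_def admissible_axioms_def)
  have "X \<subseteq> H"
  proof
    fix v assume v: "v \<in> X"
    then have "gen (Vertex v) \<in> ?I" by (rule pair_ideal_mem(2))
    moreover have "v \<in> verts E" using v X by (auto simp: hereditary_def)
    moreover have "gen (Vertex v) \<in> (pair_ideal E H S :: (('v, 'e) lpa_gen word \<Rightarrow>\<^sub>0 'k) set) \<longleftrightarrow> v \<in> H"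
      if "v \<in> verts E"
      by (rule admissible.vertex_mem_iff[OF adm that])
    ultimately show "v \<in> H"
      by (simp add: H(4))
  qed
  then have "saturation E X \<subseteq> H"
    using H by (auto simp: saturation_def)
  then have "(\<lambda>v. gen (Vertex v)) ` saturation E X \<subseteq> ?I"
    unfolding H(4) by (auto intro: pair_ideal_mem(2))
  then show "pair_ideal E (saturation E X) {} \<subseteq> ?I"
    unfolding pair_ideal_def[of E "saturation E X"]
    by (intro hull_least two_sided_pair_ideal) (simp add: kernel_pair_ideal)
qed

theorem theorem5p7:
  fixes K :: "'k::field itself" and E :: "('v, 'e) pre_digraph"
  assumes "wf_digraph E" and "countable (verts E)" and "countable (arcs E)"
  shows "lattice_iso (admissible_lattice E) (graded_ideal_lattice K E) (admissible_ideal K E)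
    \<and> (\<forall>(H, S)\<in>admissible_pairs E.
        \<exists>h. is_canonical_map K E H S h
          \<and> h \<in> alg_iso (LPA K (quotient_graph E H S))
                         (alg_quot (LPA K E) (admissible_ideal K E (H, S))))
    \<and> (\<forall>(H, S)\<in>admissible_pairs E.
        morita_equivalent ((LPA K E)\<lparr>carrier := admissible_ideal K E (H, S)\<rparr>)
                          (LPA K (pair_graph E H S)))
    \<and> (\<forall>X. hereditary E X \<longrightarrow>
        vertex_ideal K E X = admissible_ideal K E (saturation E X, {})
        \<and> morita_equivalent ((LPA K E)\<lparr>carrier := vertex_ideal K E X\<rparr>)
                            (LPA K (pair_graph E X {})))"
proof (intro conjI ballI allI impI)
  have E: "graph_algebra E"
    using assms(1) by (simp only: graph_algebra_def)
  have sub: "pair_subalgebra E H S" if "hereditary E H" "S \<subseteq> breaking_vertices E H" for H S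
    unfolding pair_subalgebra_def pair_subalgebra_axioms_def by (intro conjI E that assms(3))
  have image: "admissible_ideal K E (H, S) = graph_algebra.ideal_image E (pair_ideal E H S)"
    if "hereditary E H" "S \<subseteq> breaking_vertices E H" for H S
    using that(1) breaking_subset_verts[OF that(2)]
    by (intro graph_algebra.admissible_ideal_image[OF E]) (simp_all add: hereditary_def)
  show "lattice_iso (admissible_lattice E) (graded_ideal_lattice K E) (admissible_ideal K E)"
    by (rule graph_algebra.admissible_lattice_iso[OF E assms(3)])
  fix p assume "p \<in> admissible_pairs E"
  then obtain H S where p: "p = (H, S)" and pair: "(H, S) \<in> admissible_pairs E"
    by (cases p) simp
  have H: "hereditary E H" "S \<subseteq> breaking_vertices E H"
    using pair by (simp_all add: admissible_pairs_def)
  have adm: "admissible E H S"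
    using pair by (simp only: admissible_pairs_admissible[OF assms(1,3)])
  show "case p of (H, S) \<Rightarrow> \<exists>h. is_canonical_map K E H S h
      \<and> h \<in> alg_iso (LPA K (quotient_graph E H S)) (alg_quot (LPA K E) (admissible_ideal K E (H, S)))"
    unfolding p prod.case by (rule quotient_canonical_iso[OF adm])
  show "case p of (H, S) \<Rightarrow>
      morita_equivalent ((LPA K E)\<lparr>carrier := admissible_ideal K E (H, S)\<rparr>) (LPA K (pair_graph E H S))"
    unfolding p prod.case image[OF H] by (rule pair_subalgebra.morita_pair[OF sub[OF H]])
next
  have E: "graph_algebra E"
    using assms(1) by (simp only: graph_algebra_def)
  fix X assume X: "hereditary E X"
  have sub: "pair_subalgebra E X {}"
    unfolding pair_subalgebra_def pair_subalgebra_axioms_def by (intro conjI E X empty_subsetI assms(3))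
  have X_verts: "X \<subseteq> verts E"
    using X by (simp add: hereditary_def)
  have "hereditary E (verts E)" "saturated E (verts E)"
    using wf_digraph.head_in_verts[OF assms(1)]
    by (simp_all add: hereditary_def saturated_def regular_vertices_def)
  then have sat: "saturation E X \<subseteq> verts E"
    unfolding saturation_def using X_verts by (intro Inter_lower) simp
  note image = graph_algebra.vertex_ideal_image[OF E X_verts]
  show "vertex_ideal K E X = admissible_ideal K E (saturation E X, {})"
    unfolding image graph_algebra.admissible_ideal_image[OF E sat empty_subsetI]
    by (simp only: pair_ideal_saturation[OF assms(1,3) X])
  show "morita_equivalent ((LPA K E)\<lparr>carrier := vertex_ideal K E X\<rparr>) (LPA K (pair_graph E X {}))"
    unfolding image by (rule pair_subalgebra.morita_pair[OF sub])
qed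

end
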